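(* Let $R=\bigoplus_{n\ge 0}R_n$ be a graded commutative Noetherian ring, where $R_0$ is a Noetherian local ring with maximal ideal $\mathfrak{m}_0$ and $R$ is generated as an $R_0$-algebra by finitely many elements of $R_1$. Let $R_+=\bigoplus_{n>0}R_n$, let $\mathfrak{a}_0$ be a proper ideal of $R_0$, let $\mathfrak{a}=\mathfrak{a}_0+R_+$ (that is, the ideal $\mathfrak{a}_0R+R_+$ of $R$), and let $M$ be a non-zero finitely generated graded $R$-module. Suppose that $f^{R_+}_{\mathfrak{a}}(M)<\infty$ and that $f:=f_{R_+}(M)=\mathrm{cd}(R_+,M)$. Then $$\mathrm{grade}\bigl(\mathfrak{a}_0,\,H^{f}_{R_+}(M)_n\bigr)=f^{R_+}_{\mathfrak{a}}(M)-f\qquad\text{for all } n\ll 0.$$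
   Context: For a graded ideal $\mathfrak{b}$ of $R$, $H^i_{\mathfrak{b}}(M)$ denotes the $i$-th local cohomology module of $M$ with respect to $\mathfrak{b}$, with its natural grading, and $H^i_{\mathfrak{b}}(M)_n$ is its $n$-th graded component ($n\in\mathbb{Z}$). Each $H^i_{R_+}(M)_n$ is a finitely generated $R_0$-module. The finiteness dimension $f_{R_+}(M)$ is the least non-negative integer $i$ such that $H^i_{R_+}(M)$ is not finitely generated ($\infty$ if there is no such $i$). The cohomological dimension $\mathrm{cd}(R_+,M)$ is the largest non-negative integer $i$ such that $H^i_{R_+}(M)\neq 0$. The $\mathfrak{a}$-finiteness dimension $f^{R_+}_{\mathfrak{a}}(M)$ of $M$ relative to $R_+$ is the least non-negative integer $i$ such that $R_+$ is not contained in the radical of the ideal $(0:_R H^i_{\mathfrak{a}}(M))$ (the annihilator of $H^i_{\mathfrak{a}}(M)$), and is $\infty$ if no such $i$ exists. For a finitely generated $R_0$-module $X$ with $\mathfrak{a}_0X\neq X$, $\mathrm{grade}(\mathfrak{a}_0,X)$ is the least integer $i$ such that $H^i_{\mathfrak{a}_0}(X)\neq 0$. "For all $n\ll 0$" means: there is $n_0\in\mathbb{Z}$ such that the assertion holds for all integers $n\le n_0$. *)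

theory Defs
  imports "HOL-Algebra.Module" "HOL-Algebra.Ideal_Product" "HOL-Algebra.Ring_Divisibility" "HOL-Algebra.Generated_Rings" "HOL-Library.Extended_Real"
begin

section \<open>Graded rings and modules\<close>

record 'a graded_ring = "'a ring" +
  ring_part :: "nat \<Rightarrow> 'a set"

record ('a, 'm) graded_module = "('a, 'm) module" +
  module_part :: "int \<Rightarrow> 'm set"

definition internal_direct_sum :: "('m, 'z) ring_scheme \<Rightarrow> ('i \<Rightarrow> 'm set) \<Rightarrow> bool" where
  "internal_direct_sum M C \<longleftrightarrow>
     (\<forall>i. additive_subgroup (C i) M) \<and>
     (\<forall>x\<in>carrier M. \<exists>!c. (\<forall>i. c i \<in> C i) \<and> finite {i. c i \<noteq> \<zero>\<^bsub>M\<^esub>} \<and>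
        x = finsum M c {i. c i \<noteq> \<zero>\<^bsub>M\<^esub>})"

definition is_graded_ring :: "'a graded_ring \<Rightarrow> bool" where
  "is_graded_ring R \<longleftrightarrow>
     cring R \<and> internal_direct_sum R (ring_part R) \<and> \<one>\<^bsub>R\<^esub> \<in> ring_part R 0 \<and>
     (\<forall>i j. \<forall>a\<in>ring_part R i. \<forall>b\<in>ring_part R j. a \<otimes>\<^bsub>R\<^esub> b \<in> ring_part R (i + j))"

definition is_graded_module :: "'a graded_ring \<Rightarrow> ('a, 'm) graded_module \<Rightarrow> bool" where
  "is_graded_module R M \<longleftrightarrow>
     module R M \<and> internal_direct_sum M (module_part M) \<and>
     (\<forall>i j. \<forall>a\<in>ring_part R i. \<forall>x\<in>module_part M j. a \<odot>\<^bsub>M\<^esub> x \<in> module_part M (int i + j))"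

definition degree_zero_ring :: "'a graded_ring \<Rightarrow> 'a graded_ring" where
  "degree_zero_ring R = R\<lparr>carrier := ring_part R 0\<rparr>"

definition irrelevant_ideal :: "'a graded_ring \<Rightarrow> 'a set" where
  "irrelevant_ideal R =
     {finsum R c F | c F. finite F \<and> F \<subseteq> {0<..} \<and> (\<forall>n\<in>F. c n \<in> ring_part R n)}"

definition finitely_generated_in_degree_one :: "'a graded_ring \<Rightarrow> bool" where
  "finitely_generated_in_degree_one R \<longleftrightarrow>
     (\<exists>S. finite S \<and> S \<subseteq> ring_part R 1 \<and> carrier R = generate_ring R (ring_part R 0 \<union> S))"

definition local_ring :: "('a, 'r) ring_scheme \<Rightarrow> 'a set \<Rightarrow> bool" where
  "local_ring R m \<longleftrightarrow> cring R \<and> (\<forall>J. maximalideal J R \<longleftrightarrow> J = m)"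

definition radical_of :: "('a, 'r) ring_scheme \<Rightarrow> 'a set \<Rightarrow> 'a set" where
  "radical_of R J = {a \<in> carrier R. \<exists>k::nat. a [^]\<^bsub>R\<^esub> k \<in> J}"

definition ideal_power :: "('a, 'r) ring_scheme \<Rightarrow> 'a set \<Rightarrow> nat \<Rightarrow> 'a set" where
  "ideal_power R J k = (ideal_prod R J ^^ k) (carrier R)"


section \<open>Modules and homomorphisms\<close>

definition zero_module :: "('a, 'm, 'z) module_scheme \<Rightarrow> bool" where
  "zero_module M \<longleftrightarrow> carrier M = {\<zero>\<^bsub>M\<^esub>}"

definition finitely_generated_module ::
  "('a, 'r) ring_scheme \<Rightarrow> ('a, 'm, 'z) module_scheme \<Rightarrow> bool" where
  "finitely_generated_module R M \<longleftrightarrow>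
     (\<exists>S. finite S \<and> S \<subseteq> carrier M \<and> (\<forall>N. submodule N R M \<and> S \<subseteq> N \<longrightarrow> N = carrier M))"

definition annihilator :: "('a, 'r) ring_scheme \<Rightarrow> ('a, 'm, 'z) module_scheme \<Rightarrow> 'a set" where
  "annihilator R M = {a \<in> carrier R. \<forall>x\<in>carrier M. a \<odot>\<^bsub>M\<^esub> x = \<zero>\<^bsub>M\<^esub>}"

definition is_module_hom ::
  "('a, 'r) ring_scheme \<Rightarrow> ('a, 'm, 'y) module_scheme \<Rightarrow> ('a, 'n, 'z) module_scheme \<Rightarrow>
     ('m \<Rightarrow> 'n) \<Rightarrow> bool" where
  "is_module_hom R M N f \<longleftrightarrow>
     f \<in> carrier M \<rightarrow> carrier N \<and>
     (\<forall>x\<in>carrier M. \<forall>y\<in>carrier M. f (x \<oplus>\<^bsub>M\<^esub> y) = f x \<oplus>\<^bsub>N\<^esub> f y) \<and>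
     (\<forall>a\<in>carrier R. \<forall>x\<in>carrier M. f (a \<odot>\<^bsub>M\<^esub> x) = a \<odot>\<^bsub>N\<^esub> f x)"

text \<open>Morphisms of graded modules are the homomorphisms that are homogeneous of degree 0.\<close>

definition is_graded_hom ::
  "'a graded_ring \<Rightarrow> ('a, 'm) graded_module \<Rightarrow> ('a, 'n) graded_module \<Rightarrow> ('m \<Rightarrow> 'n) \<Rightarrow> bool" where
  "is_graded_hom R M N f \<longleftrightarrow>
     is_module_hom R M N f \<and> (\<forall>n. f ` module_part M n \<subseteq> module_part N n)"

text \<open>The quotient \<open>Z/B\<close> of two submodules \<open>B \<subseteq> Z\<close> of \<open>M\<close>, built from cosets as in
  \<open>FactRing\<close>. The ring multiplication and unit of the record play no role for modules.\<close>

definition subquotient_module ::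
  "('a, 'm, 'z) module_scheme \<Rightarrow> 'm set \<Rightarrow> 'm set \<Rightarrow> ('a, 'm set) module" where
  "subquotient_module M Z B =
     \<lparr>carrier = (\<lambda>x. B +>\<^bsub>M\<^esub> x) ` Z, monoid.mult = undefined, one = undefined, zero = B,
      add = set_add M, smult = (\<lambda>a c. \<Union>x\<in>c. B +>\<^bsub>M\<^esub> (a \<odot>\<^bsub>M\<^esub> x))\<rparr>"


section \<open>Injective resolutions\<close>

text \<open>Injectivity is the extension property along monomorphisms \<open>A \<rightarrow> B\<close>. HOL cannot quantify over
  all types inside a formula; here \<open>A\<close> and \<open>B\<close> range over the modules with underlying set in the
  type of the ring elements. These include the inclusions of ideals into the ring (with all
  degree shifts in the graded case), so by Baer's criterion, in its ungraded and graded forms,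
  the extension property for arbitrary \<open>A\<close> and \<open>B\<close> follows.\<close>

definition injective_module ::
  "('a, 'r) ring_scheme \<Rightarrow> ('a, 'e, 'z) module_scheme \<Rightarrow> bool" where
  "injective_module R E \<longleftrightarrow> module R E \<and>
     (\<forall>(A :: ('a, 'a) module) (B :: ('a, 'a) module) j g.
        module R A \<and> module R B \<and> is_module_hom R A B j \<and> inj_on j (carrier A) \<and>
        is_module_hom R A E g \<longrightarrow>
        (\<exists>h. is_module_hom R B E h \<and> (\<forall>x\<in>carrier A. h (j x) = g x)))"

definition graded_injective_module ::
  "'a graded_ring \<Rightarrow> ('a, 'e) graded_module \<Rightarrow> bool" where
  "graded_injective_module R E \<longleftrightarrow> is_graded_module R E \<and>
     (\<forall>(A :: ('a, 'a) graded_module) (B :: ('a, 'a) graded_module) j g.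
        is_graded_module R A \<and> is_graded_module R B \<and> is_graded_hom R A B j \<and>
        inj_on j (carrier A) \<and> is_graded_hom R A E g \<longrightarrow>
        (\<exists>h. is_graded_hom R B E h \<and> (\<forall>x\<in>carrier A. h (j x) = g x)))"

text \<open>Exactness of \<open>0 \<rightarrow> M \<rightarrow> E 0 \<rightarrow> E 1 \<rightarrow> \<dots>\<close> with maps \<open>\<epsilon>, d 0, d 1, \<dots>\<close>.\<close>

definition exact_coresolution ::
  "('a, 'm, 'y) module_scheme \<Rightarrow> ('m \<Rightarrow> 'e) \<Rightarrow> (nat \<Rightarrow> ('a, 'e, 'z) module_scheme) \<Rightarrow>
     (nat \<Rightarrow> 'e \<Rightarrow> 'e) \<Rightarrow> bool" where
  "exact_coresolution M \<epsilon> E d \<longleftrightarrow>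
     inj_on \<epsilon> (carrier M) \<and>
     \<epsilon> ` carrier M = {x \<in> carrier (E 0). d 0 x = \<zero>\<^bsub>E 1\<^esub>} \<and>
     (\<forall>i. d i ` carrier (E i) =
        {x \<in> carrier (E (Suc i)). d (Suc i) x = \<zero>\<^bsub>E (Suc (Suc i))\<^esub>})"

definition injective_resolution ::
  "('a, 'r) ring_scheme \<Rightarrow> ('a, 'm, 'y) module_scheme \<Rightarrow> ('m \<Rightarrow> 'e) \<Rightarrow>
     (nat \<Rightarrow> ('a, 'e, 'z) module_scheme) \<Rightarrow> (nat \<Rightarrow> 'e \<Rightarrow> 'e) \<Rightarrow> bool" where
  "injective_resolution R M \<epsilon> E d \<longleftrightarrow>
     module R M \<and> (\<forall>i. injective_module R (E i)) \<and>
     is_module_hom R M (E 0) \<epsilon> \<and> (\<forall>i. is_module_hom R (E i) (E (Suc i)) (d i)) \<and>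
     exact_coresolution M \<epsilon> E d"

definition graded_injective_resolution ::
  "'a graded_ring \<Rightarrow> ('a, 'm) graded_module \<Rightarrow> ('m \<Rightarrow> 'e) \<Rightarrow>
     (nat \<Rightarrow> ('a, 'e) graded_module) \<Rightarrow> (nat \<Rightarrow> 'e \<Rightarrow> 'e) \<Rightarrow> bool" where
  "graded_injective_resolution R M \<epsilon> E d \<longleftrightarrow>
     is_graded_module R M \<and> (\<forall>i. graded_injective_module R (E i)) \<and>
     is_graded_hom R M (E 0) \<epsilon> \<and> (\<forall>i. is_graded_hom R (E i) (E (Suc i)) (d i)) \<and>
     exact_coresolution M \<epsilon> E d"


section \<open>Local cohomology\<close>

text \<open>Local cohomology is the right derived functor of the torsion functor
  \<open>\<Gamma>\<^sub>b(M) = {x. b\<^sup>k x = 0 for some k}\<close>: given an injective resolution \<open>(E, d)\<close> of \<open>M\<close>, the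
  module \<open>H\<^sup>i\<^sub>b(M)\<close> is the \<open>i\<close>-th cohomology module of the complex \<open>\<Gamma>\<^sub>b(E)\<close>. As usual this depends
  on the resolution only up to isomorphism, and the constants below take the resolution as their
  argument. For a graded ideal and a graded module, a graded injective resolution
  (consisting of injective objects of the category of graded modules) computes the same module
  together with its natural grading.\<close>

definition torsion_part ::
  "('a, 'r) ring_scheme \<Rightarrow> 'a set \<Rightarrow> ('a, 'e, 'z) module_scheme \<Rightarrow> 'e set" where
  "torsion_part R b E =
     {x \<in> carrier E. \<exists>k. \<forall>a\<in>ideal_power R b k. a \<odot>\<^bsub>E\<^esub> x = \<zero>\<^bsub>E\<^esub>}"

definition torsion_cocycles ::
  "('a, 'r) ring_scheme \<Rightarrow> 'a set \<Rightarrow> (nat \<Rightarrow> ('a, 'e, 'z) module_scheme) \<Rightarrow>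
     (nat \<Rightarrow> 'e \<Rightarrow> 'e) \<Rightarrow> nat \<Rightarrow> 'e set" where
  "torsion_cocycles R b E d i = {x \<in> torsion_part R b (E i). d i x = \<zero>\<^bsub>E (Suc i)\<^esub>}"

definition torsion_coboundaries ::
  "('a, 'r) ring_scheme \<Rightarrow> 'a set \<Rightarrow> (nat \<Rightarrow> ('a, 'e, 'z) module_scheme) \<Rightarrow>
     (nat \<Rightarrow> 'e \<Rightarrow> 'e) \<Rightarrow> nat \<Rightarrow> 'e set" where
  "torsion_coboundaries R b E d i =
     (case i of 0 \<Rightarrow> {\<zero>\<^bsub>E 0\<^esub>} | Suc j \<Rightarrow> d j ` torsion_part R b (E j))"

definition local_cohomology ::
  "('a, 'r) ring_scheme \<Rightarrow> 'a set \<Rightarrow> (nat \<Rightarrow> ('a, 'e, 'z) module_scheme) \<Rightarrow>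
     (nat \<Rightarrow> 'e \<Rightarrow> 'e) \<Rightarrow> nat \<Rightarrow> ('a, 'e set) module" where
  "local_cohomology R b E d i =
     subquotient_module (E i) (torsion_cocycles R b E d i) (torsion_coboundaries R b E d i)"

text \<open>The degree \<open>n\<close> component \<open>H\<^sup>i\<^sub>b(M)\<^sub>n\<close>, consisting of the classes of the cocycles of degree
  \<open>n\<close>. It is a module over the degree zero ring.\<close>

definition local_cohomology_component ::
  "'a graded_ring \<Rightarrow> 'a set \<Rightarrow> (nat \<Rightarrow> ('a, 'e) graded_module) \<Rightarrow>
     (nat \<Rightarrow> 'e \<Rightarrow> 'e) \<Rightarrow> nat \<Rightarrow> int \<Rightarrow> ('a, 'e set) module" where
  "local_cohomology_component R b E d i n =
     (local_cohomology R b E d i)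
       \<lparr>carrier := (\<lambda>x. torsion_coboundaries R b E d i +>\<^bsub>E i\<^esub> x) `
                     (torsion_cocycles R b E d i \<inter> module_part (E i) n)\<rparr>"


section \<open>Finiteness dimensions, cohomological dimension, grade\<close>

text \<open>All invariants of a module are computed from an injective resolution of it. The values are
  extended reals, so that the infimum of the empty set is \<open>\<infinity>\<close>, its supremum is \<open>-\<infinity>\<close>, and
  the subtraction of finite values is not truncated.\<close>

definition finiteness_dimension ::
  "('a, 'r) ring_scheme \<Rightarrow> 'a set \<Rightarrow> (nat \<Rightarrow> ('a, 'e, 'z) module_scheme) \<Rightarrow>
     (nat \<Rightarrow> 'e \<Rightarrow> 'e) \<Rightarrow> ereal" where
  "finiteness_dimension R b E d =
     (INF i\<in>{i. \<not> finitely_generated_module R (local_cohomology R b E d i)}. ereal (real i))"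

definition relative_finiteness_dimension ::
  "('a, 'r) ring_scheme \<Rightarrow> 'a set \<Rightarrow> 'a set \<Rightarrow> (nat \<Rightarrow> ('a, 'e, 'z) module_scheme) \<Rightarrow>
     (nat \<Rightarrow> 'e \<Rightarrow> 'e) \<Rightarrow> ereal" where
  "relative_finiteness_dimension R a b E d =
     (INF i\<in>{i. \<not> b \<subseteq> radical_of R (annihilator R (local_cohomology R a E d i))}. ereal (real i))"

definition cohomological_dimension ::
  "('a, 'r) ring_scheme \<Rightarrow> 'a set \<Rightarrow> (nat \<Rightarrow> ('a, 'e, 'z) module_scheme) \<Rightarrow>
     (nat \<Rightarrow> 'e \<Rightarrow> 'e) \<Rightarrow> ereal" where
  "cohomological_dimension R b E d =
     (SUP i\<in>{i. \<not> zero_module (local_cohomology R b E d i)}. ereal (real i))"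

definition grade ::
  "('a, 'r) ring_scheme \<Rightarrow> 'a set \<Rightarrow> (nat \<Rightarrow> ('a, 'e, 'z) module_scheme) \<Rightarrow>
     (nat \<Rightarrow> 'e \<Rightarrow> 'e) \<Rightarrow> ereal" where
  "grade R b E d =
     (INF i\<in>{i. \<not> zero_module (local_cohomology R b E d i)}. ereal (real i))"

end

theory Submission
  imports Defs
begin

text \<open>Put \<open>T\<^sup>i = H\<^sup>i\<^sub>a(M)\<close> and let \<open>t\<close> be the least \<open>i\<close> such that no power of \<open>R\<^sub>+\<close> annihilates \<open>T\<^sup>i\<close>.
  The components \<open>T\<^sup>i\<^sub>n\<close> vanish for \<open>n\<close> large. Moreover, if \<open>T\<^sup>j\<^sub>n = 0\<close> for all \<open>n \<lless> 0\<close> and \<open>j < i\<close>, and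
  either \<open>R\<^sub>+\<close> is nilpotent on \<open>T\<^sup>i\<close> or \<open>T\<^sup>i\<^sub>n = 0\<close> for arbitrarily small \<open>n\<close>, then \<open>T\<^sup>i\<^sub>n = 0\<close> for all
  \<open>n \<lless> 0\<close>. Both claims are proved by induction on \<open>i\<close>, passing from a resolution to the cone of the
  multiplication by an almost regular homogeneous element. Two such elements, of degrees \<open>s\<close> and
  \<open>s + 1\<close>, carry the vanishing from one degree to all sufficiently smaller ones. Hence, for
  \<open>n \<lless> 0\<close>, \<open>t\<close> is the least \<open>i\<close> with \<open>T\<^sup>i\<^sub>n \<noteq> 0\<close>.

  For \<open>n \<lless> 0\<close> the degree \<open>n\<close> part of the \<open>R\<^sub>+\<close>-torsion of the resolution has cohomology only in
  position \<open>f\<close>, namely \<open>H\<^sup>f\<^sub>R\<^sub>+(M)\<^sub>n\<close>. A chain map from it to an injective resolution of this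
  \<open>R\<^sub>0\<close>-module has an exact cone, which remains exact after taking \<open>a\<^sub>0\<close>-torsion. So
  \<open>H\<^sup>j\<^sub>a\<^sub>0(H\<^sup>f\<^sub>R\<^sub>+(M)\<^sub>n)\<close> vanishes if and only if \<open>T\<^sup>f\<^sup>+\<^sup>j\<^sub>n\<close> does, and the least \<open>j\<close> with nonzero value is \<open>t - f\<close>.\<close>


section \<open>Torsion in graded complexes\<close>

text \<open>The cone of multiplication by an almost regular \<open>y\<close> on a resolution of
  \<open>M\<close> is not a resolution of \<open>M/yM\<close>, as \<open>y\<close> may have a kernel
  in finitely many degrees. The induction therefore runs over complexes rather than modules:
  \<open>admissible_complex\<close> asks for exactness above position 0, for exactness below it in
  degrees of large absolute value, and for a finitely generated H^0. Taking torsion preserves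
  exactness only if the terms behave like injective modules, and neither torsion submodules nor
  graded components over R_0 come with injectivity. What is kept of it is a division property: each
  \<open>x\<close> equals \<open>r z\<close> up to an element killed by a power of \<open>r\<close>,
  with a \<open>z\<close> killed by every homogeneous scalar that kills \<open>x\<close>. The first
  clause allows a preimage to be corrected until it is torsion, the second keeps the correction
  inside the torsion already achieved. Since H^f is the only cohomology of the R_+-torsion in small
  degrees, the spectral sequence of the two torsion functors would have a single row; a comparison
  of complexes takes its place.\<close>

definition tors ::
  "('a, 'r) ring_scheme \<Rightarrow> ('a, 'w, 'z) module_scheme \<Rightarrow> 'a set \<Rightarrow> 'w set \<Rightarrow> 'w set" where
  "tors R M S A = {x \<in> A. \<forall>s\<in>S. \<exists>k::nat. (s [^]\<^bsub>R\<^esub> k) \<odot>\<^bsub>M\<^esub> x = \<zero>\<^bsub>M\<^esub>}"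

text \<open>Vanishing in degree \<open>n\<close> of the \<open>i\<close>-th cohomology of the
  \<open>S\<close>-torsion subcomplex. With \<open>S = {}\<close> this is plain exactness, so
  resolutions and local cohomology share one predicate. Positions and degrees are integers because
  cones and shifts lower both.\<close>

definition exact_at ::
  "('a, 'r) ring_scheme \<Rightarrow> (int \<Rightarrow> ('a, 'w, 'z) module_scheme) \<Rightarrow> (int \<Rightarrow> int \<Rightarrow> 'w set) \<Rightarrow>
     (int \<Rightarrow> 'w \<Rightarrow> 'w) \<Rightarrow> 'a set \<Rightarrow> int \<Rightarrow> int \<Rightarrow> bool" where
  "exact_at R K X d S i n \<longleftrightarrow>
     (\<forall>u\<in>tors R (K i) S (X i n). d i u = \<zero>\<^bsub>K (i + 1)\<^esub> \<longrightarrow>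
        u \<in> d (i - 1) ` tors R (K (i - 1)) S (X (i - 1) n))"

lemma tors_empty [simp]: "tors R M {} A = A"
  by (simp add: tors_def)

lemma torsD: "u \<in> tors R M S A \<Longrightarrow> u \<in> A"
  by (simp add: tors_def)

lemma tors_insert:
  "u \<in> tors R M (insert y S) A \<longleftrightarrow>
     u \<in> tors R M S A \<and> (\<exists>k::nat. (y [^]\<^bsub>R\<^esub> k) \<odot>\<^bsub>M\<^esub> u = \<zero>\<^bsub>M\<^esub>)"
  by (auto simp: tors_def)

lemma torsE:
  assumes "u \<in> tors R M S A" "s \<in> S"
  obtains k :: nat where "(s [^]\<^bsub>R\<^esub> k) \<odot>\<^bsub>M\<^esub> u = \<zero>\<^bsub>M\<^esub>"
  using assms by (auto simp: tors_def)

text \<open>Torsion can be taken in stages: torsion by generators of a_0 inside the R_+-torsion is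
  torsion by generators of their sum.\<close>

lemma tors_tors: "tors R M Y (tors R M X A) = tors R M (X \<union> Y) A"
  by (auto simp: tors_def)

section \<open>Torsion by powers of ring elements in a single module\<close>

context module
begin

lemma smult_pow_zero_mono:
  assumes "s \<in> carrier R" "x \<in> carrier M" "(s [^] (k::nat)) \<odot>\<^bsub>M\<^esub> x = \<zero>\<^bsub>M\<^esub>" "k \<le> l"
  shows "(s [^] l) \<odot>\<^bsub>M\<^esub> x = \<zero>\<^bsub>M\<^esub>"
proof -
  have "s [^] l = s [^] (l - k) \<otimes> s [^] k"
    using assms by (simp add: R.nat_pow_mult)
  then show ?thesis using assms by (simp add: smult_assoc1)
qed

lemma smult_commute:
  assumes "r \<in> carrier R" "s \<in> carrier R" "x \<in> carrier M"
  shows "r \<odot>\<^bsub>M\<^esub> (s \<odot>\<^bsub>M\<^esub> x) = s \<odot>\<^bsub>M\<^esub> (r \<odot>\<^bsub>M\<^esub> x)"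
  using assms by (metis R.m_comm smult_assoc1)

lemma smult_minus_distr:
  assumes "r \<in> carrier R" "x \<in> carrier M" "y \<in> carrier M"
  shows "r \<odot>\<^bsub>M\<^esub> (x \<ominus>\<^bsub>M\<^esub> y) = r \<odot>\<^bsub>M\<^esub> x \<ominus>\<^bsub>M\<^esub> r \<odot>\<^bsub>M\<^esub> y"
  using assms by (simp add: a_minus_def smult_r_distr smult_r_minus)

lemma minus_eq_zero_imp_eq:
  assumes "x \<in> carrier M" "y \<in> carrier M" "x \<ominus>\<^bsub>M\<^esub> y = \<zero>\<^bsub>M\<^esub>"
  shows "x = y"
  using assms by (metis M.add.inv_equality M.add.inv_inv M.add.inv_closed M.minus_eq)

lemma tors_zero:
  assumes "S \<subseteq> carrier R" "\<zero>\<^bsub>M\<^esub> \<in> A"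
  shows "\<zero>\<^bsub>M\<^esub> \<in> tors R M S A"
  using assms by (auto simp: tors_def)

lemma tors_add:
  assumes "S \<subseteq> carrier R" "A \<subseteq> carrier M" "x \<in> tors R M S A" "y \<in> tors R M S A" "x \<oplus>\<^bsub>M\<^esub> y \<in> A"
  shows "x \<oplus>\<^bsub>M\<^esub> y \<in> tors R M S A"
  unfolding tors_def
proof (intro CollectI conjI ballI)
  show "x \<oplus>\<^bsub>M\<^esub> y \<in> A" by fact
  fix s assume s: "s \<in> S"
  obtain k :: nat where k: "(s [^] k) \<odot>\<^bsub>M\<^esub> x = \<zero>\<^bsub>M\<^esub>" using assms(3) s by (rule torsE)
  obtain l :: nat where l: "(s [^] l) \<odot>\<^bsub>M\<^esub> y = \<zero>\<^bsub>M\<^esub>" using assms(4) s by (rule torsE)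
  have c: "s \<in> carrier R" "x \<in> carrier M" "y \<in> carrier M" using assms s by (auto simp: tors_def)
  have "(s [^] (k + l)) \<odot>\<^bsub>M\<^esub> x = \<zero>\<^bsub>M\<^esub>" "(s [^] (k + l)) \<odot>\<^bsub>M\<^esub> y = \<zero>\<^bsub>M\<^esub>"
    using smult_pow_zero_mono k l c by auto
  then show "\<exists>k::nat. (s [^] k) \<odot>\<^bsub>M\<^esub> (x \<oplus>\<^bsub>M\<^esub> y) = \<zero>\<^bsub>M\<^esub>"
    using c by (intro exI[of _ "k + l"]) (simp add: smult_r_distr)
qed

lemma tors_neg:
  assumes "S \<subseteq> carrier R" "A \<subseteq> carrier M" "x \<in> tors R M S A" "\<ominus>\<^bsub>M\<^esub> x \<in> A"
  shows "\<ominus>\<^bsub>M\<^esub> x \<in> tors R M S A"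
  unfolding tors_def
proof (intro CollectI conjI ballI assms(4))
  have x: "x \<in> carrier M" using assms by (auto simp: tors_def)
  fix s assume s: "s \<in> S"
  obtain k :: nat where k: "(s [^] k) \<odot>\<^bsub>M\<^esub> x = \<zero>\<^bsub>M\<^esub>" using assms(3) s by (rule torsE)
  have "(s [^] k) \<odot>\<^bsub>M\<^esub> (\<ominus>\<^bsub>M\<^esub> x) = \<zero>\<^bsub>M\<^esub>"
    using k x s assms(1) by (subst smult_r_minus) auto
  then show "\<exists>k::nat. (s [^] k) \<odot>\<^bsub>M\<^esub> (\<ominus>\<^bsub>M\<^esub> x) = \<zero>\<^bsub>M\<^esub>" by blast
qed

lemma tors_smult:
  assumes "S \<subseteq> carrier R" "A \<subseteq> carrier M" "x \<in> tors R M S A" "r \<in> carrier R" "r \<odot>\<^bsub>M\<^esub> x \<in> B"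
  shows "r \<odot>\<^bsub>M\<^esub> x \<in> tors R M S B"
  unfolding tors_def
proof (intro CollectI conjI ballI)
  show "r \<odot>\<^bsub>M\<^esub> x \<in> B" by fact
  fix s assume s: "s \<in> S"
  obtain k :: nat where k: "(s [^] k) \<odot>\<^bsub>M\<^esub> x = \<zero>\<^bsub>M\<^esub>"
    using assms s by (auto simp: tors_def)
  have c: "s \<in> carrier R" "x \<in> carrier M" using assms s by (auto simp: tors_def)
  have "(s [^] k) \<odot>\<^bsub>M\<^esub> (r \<odot>\<^bsub>M\<^esub> x) = r \<odot>\<^bsub>M\<^esub> ((s [^] k) \<odot>\<^bsub>M\<^esub> x)"
    using c assms by (intro smult_commute) auto
  then show "\<exists>k::nat. (s [^] k) \<odot>\<^bsub>M\<^esub> (r \<odot>\<^bsub>M\<^esub> x) = \<zero>\<^bsub>M\<^esub>"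
    using k assms by (intro exI[of _ k]) simp
qed

end

text \<open>Deliberately weak: \<open>P\<close> may be the grading of \<open>R\<close>, but also the
  scalars of degree 0 with empty sets in the other degrees. The latter instance describes a fixed
  graded component as a complex over the degree zero ring.\<close>

locale graded_scalars = cring R for R :: "('a, 'r) ring_scheme" (structure) +
  fixes P :: "int \<Rightarrow> 'a set"
  assumes P_sub: "P e \<subseteq> carrier R"
    and P_mult: "r \<in> P e \<Longrightarrow> s \<in> P e' \<Longrightarrow> r \<otimes> s \<in> P (e + e')"
    and P_one: "\<one> \<in> P 0"
begin

lemma P_carrier: "r \<in> P e \<Longrightarrow> r \<in> carrier R"
  using P_sub by blast

lemma P_pow: "r \<in> P e \<Longrightarrow> r [^] (k::nat) \<in> P (int k * e)"
proof (induction k)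
  case 0
  then show ?case using P_one by simp
next
  case (Suc k)
  then have "r [^] Suc k \<in> P (int k * e + e)" by (simp add: P_mult)
  then show ?case by (simp add: algebra_simps)
qed

end

text \<open>The axiom \<open>good\<close> is all that is needed of the injectivity of the modules over a noetherian
  ring. In contrast to injectivity it passes to torsion subcomplexes and to cones, and it is
  what keeps exactness when torsion is taken.\<close>

locale graded_complex = graded_scalars R P
  for R :: "('a, 'r) ring_scheme" (structure) and P +
  fixes K :: "int \<Rightarrow> ('a, 'w, 'z) module_scheme" and X :: "int \<Rightarrow> int \<Rightarrow> 'w set"
    and d :: "int \<Rightarrow> 'w \<Rightarrow> 'w"
  assumes module_K: "module R (K i)"
    and X_sub: "X i n \<subseteq> carrier (K i)"
    and X_zero: "\<zero>\<^bsub>K i\<^esub> \<in> X i n"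
    and X_add: "x \<in> X i n \<Longrightarrow> y \<in> X i n \<Longrightarrow> x \<oplus>\<^bsub>K i\<^esub> y \<in> X i n"
    and X_neg: "x \<in> X i n \<Longrightarrow> \<ominus>\<^bsub>K i\<^esub> x \<in> X i n"
    and X_smult: "r \<in> P e \<Longrightarrow> x \<in> X i n \<Longrightarrow> r \<odot>\<^bsub>K i\<^esub> x \<in> X i (n + e)"
    and d_closed: "x \<in> X i n \<Longrightarrow> d i x \<in> X (i + 1) n"
    and d_add: "x \<in> X i n \<Longrightarrow> y \<in> X i n \<Longrightarrow> d i (x \<oplus>\<^bsub>K i\<^esub> y) = d i x \<oplus>\<^bsub>K (i + 1)\<^esub> d i y"
    and d_smult: "r \<in> P e \<Longrightarrow> x \<in> X i n \<Longrightarrow> d i (r \<odot>\<^bsub>K i\<^esub> x) = r \<odot>\<^bsub>K (i + 1)\<^esub> d i x"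
    and d_d: "x \<in> X i n \<Longrightarrow> d (i + 1) (d i x) = \<zero>\<^bsub>K (i + 1 + 1)\<^esub>"
    and good: "x \<in> X i n \<Longrightarrow> r \<in> P e \<Longrightarrow>
      \<exists>z\<in>X i (n - e). (\<exists>l::nat. (r [^] l) \<odot>\<^bsub>K i\<^esub> (x \<ominus>\<^bsub>K i\<^esub> r \<odot>\<^bsub>K i\<^esub> z) = \<zero>\<^bsub>K i\<^esub>) \<and>
        (\<forall>e'. \<forall>s\<in>P e'. s \<odot>\<^bsub>K i\<^esub> x = \<zero>\<^bsub>K i\<^esub> \<longrightarrow> s \<odot>\<^bsub>K i\<^esub> z = \<zero>\<^bsub>K i\<^esub>)"
begin

lemma X_carrier: "x \<in> X i n \<Longrightarrow> x \<in> carrier (K i)"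
  using X_sub by blast

lemma ab_K: "abelian_group (K i)"
  using module_K module.axioms by blast

lemma X_minus: "x \<in> X i n \<Longrightarrow> y \<in> X i n \<Longrightarrow> x \<ominus>\<^bsub>K i\<^esub> y \<in> X i n"
  by (simp add: a_minus_def X_add X_neg)

lemma d_zero: "d i \<zero>\<^bsub>K i\<^esub> = \<zero>\<^bsub>K (i + 1)\<^esub>"
proof -
  interpret A: abelian_group "K i" by (rule ab_K)
  interpret B: abelian_group "K (i + 1)" by (rule ab_K)
  have z: "\<zero>\<^bsub>K i\<^esub> \<in> X i 0" by (rule X_zero)
  have "d i \<zero>\<^bsub>K i\<^esub> \<oplus>\<^bsub>K (i + 1)\<^esub> d i \<zero>\<^bsub>K i\<^esub> = d i \<zero>\<^bsub>K i\<^esub>"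
    using d_add[OF z z] by simp
  moreover have "d i \<zero>\<^bsub>K i\<^esub> \<in> carrier (K (i + 1))" using d_closed[OF z] X_carrier by blast
  ultimately show ?thesis by (metis B.add.r_cancel_one')
qed

lemma d_neg: assumes "x \<in> X i n" shows "d i (\<ominus>\<^bsub>K i\<^esub> x) = \<ominus>\<^bsub>K (i + 1)\<^esub> d i x"
proof -
  interpret A: abelian_group "K i" by (rule ab_K)
  interpret B: abelian_group "K (i + 1)" by (rule ab_K)
  have "d i (\<ominus>\<^bsub>K i\<^esub> x) \<oplus>\<^bsub>K (i + 1)\<^esub> d i x = d i (\<ominus>\<^bsub>K i\<^esub> x \<oplus>\<^bsub>K i\<^esub> x)"
    using d_add[OF X_neg[OF assms] assms] by simp
  also have "\<dots> = \<zero>\<^bsub>K (i + 1)\<^esub>" using X_carrier[OF assms] d_zero by (simp add: A.l_neg)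
  finally show ?thesis
    using d_closed[OF assms] d_closed[OF X_neg[OF assms]] X_carrier by (metis B.minus_equality)
qed

lemma d_minus:
  assumes "x \<in> X i n" "y \<in> X i n"
  shows "d i (x \<ominus>\<^bsub>K i\<^esub> y) = d i x \<ominus>\<^bsub>K (i + 1)\<^esub> d i y"
  using assms by (simp add: a_minus_def d_add d_neg X_neg)

lemma tors_X_zero: "S \<subseteq> carrier R \<Longrightarrow> \<zero>\<^bsub>K i\<^esub> \<in> tors R (K i) S (X i n)"
  by (simp add: X_zero module.tors_zero module_K)

lemma tors_X_add:
  "S \<subseteq> carrier R \<Longrightarrow> x \<in> tors R (K i) S (X i n) \<Longrightarrow> y \<in> tors R (K i) S (X i n) \<Longrightarrow>
    x \<oplus>\<^bsub>K i\<^esub> y \<in> tors R (K i) S (X i n)"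
  by (rule module.tors_add[OF module_K _ X_sub]) (auto simp: tors_def X_add)

lemma tors_X_neg:
  "S \<subseteq> carrier R \<Longrightarrow> x \<in> tors R (K i) S (X i n) \<Longrightarrow> \<ominus>\<^bsub>K i\<^esub> x \<in> tors R (K i) S (X i n)"
  by (rule module.tors_neg[OF module_K _ X_sub]) (auto simp: tors_def X_neg)

lemma tors_X_minus:
  "S \<subseteq> carrier R \<Longrightarrow> x \<in> tors R (K i) S (X i n) \<Longrightarrow> y \<in> tors R (K i) S (X i n) \<Longrightarrow>
    x \<ominus>\<^bsub>K i\<^esub> y \<in> tors R (K i) S (X i n)"
  by (simp add: a_minus_def tors_X_add tors_X_neg)

lemma tors_X_smult:
  "S \<subseteq> carrier R \<Longrightarrow> x \<in> tors R (K i) S (X i n) \<Longrightarrow> r \<in> P e \<Longrightarrow>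
    r \<odot>\<^bsub>K i\<^esub> x \<in> tors R (K i) S (X i (n + e))"
  by (rule module.tors_smult[OF module_K _ X_sub]) (auto simp: tors_def X_smult P_carrier)

lemma d_tors:
  assumes "S \<subseteq> (\<Union>e. P e)" "x \<in> tors R (K i) S (X i n)"
  shows "d i x \<in> tors R (K (i + 1)) S (X (i + 1) n)"
  unfolding tors_def
proof (intro CollectI conjI ballI)
  have x: "x \<in> X i n" using assms by (simp add: tors_def)
  then show "d i x \<in> X (i + 1) n" by (rule d_closed)
  fix s assume s: "s \<in> S"
  then obtain e where e: "s \<in> P e" using assms by auto
  from s assms obtain k :: nat where k: "(s [^] k) \<odot>\<^bsub>K i\<^esub> x = \<zero>\<^bsub>K i\<^esub>" by (auto simp: tors_def)
  have "(s [^] k) \<odot>\<^bsub>K (i + 1)\<^esub> d i x = \<zero>\<^bsub>K (i + 1)\<^esub>"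
    using d_smult[OF P_pow[OF e] x, of k] k d_zero by simp
  then show "\<exists>k::nat. (s [^] k) \<odot>\<^bsub>K (i + 1)\<^esub> d i x = \<zero>\<^bsub>K (i + 1)\<^esub>" by blast
qed

text \<open>The divisor \<open>z\<close> inherits the torsion of \<open>x\<close>: powers of members
  of \<open>S\<close> are homogeneous, and those that kill \<open>x\<close> kill
  \<open>z\<close>.\<close>

lemma good_tors:
  assumes "S \<subseteq> (\<Union>e. P e)" "x \<in> tors R (K i) S (X i n)" "y \<in> P e"
  shows "\<exists>z\<in>tors R (K i) S (X i (n - e)).
    \<exists>l::nat. (y [^] l) \<odot>\<^bsub>K i\<^esub> (x \<ominus>\<^bsub>K i\<^esub> y \<odot>\<^bsub>K i\<^esub> z) = \<zero>\<^bsub>K i\<^esub>"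
proof -
  have x: "x \<in> X i n" using assms by (simp add: tors_def)
  obtain z where z: "z \<in> X i (n - e)" "\<exists>l::nat. (y [^] l) \<odot>\<^bsub>K i\<^esub> (x \<ominus>\<^bsub>K i\<^esub> y \<odot>\<^bsub>K i\<^esub> z) = \<zero>\<^bsub>K i\<^esub>"
    "\<And>e' r. r \<in> P e' \<Longrightarrow> r \<odot>\<^bsub>K i\<^esub> x = \<zero>\<^bsub>K i\<^esub> \<Longrightarrow> r \<odot>\<^bsub>K i\<^esub> z = \<zero>\<^bsub>K i\<^esub>"
    using good[OF x assms(3)] by blast
  have "z \<in> tors R (K i) S (X i (n - e))" unfolding tors_def
  proof (intro CollectI conjI ballI z(1))
    fix s assume s: "s \<in> S"
    then obtain e where e: "s \<in> P e" using assms by auto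
    from s assms obtain k :: nat where k: "(s [^] k) \<odot>\<^bsub>K i\<^esub> x = \<zero>\<^bsub>K i\<^esub>" by (auto simp: tors_def)
    then show "\<exists>k::nat. (s [^] k) \<odot>\<^bsub>K i\<^esub> z = \<zero>\<^bsub>K i\<^esub>" using z(3)[OF P_pow[OF e]] by blast
  qed
  then show ?thesis using z(2) by blast
qed

text \<open>This is how \<open>good\<close> keeps exactness. The third assumption says that powers
  of every member of \<open>S\<close> kill each cohomology class in a position below
  \<open>i\<close>; exactness there is a special case. The induction adds one element
  \<open>y\<close> to \<open>S\<close>: a preimage \<open>w\<close> that is already
  \<open>S\<close>-torsion is changed by a coboundary \<open>d v'\<close>, with \<open>v'\<close>
  obtained by division, until a power of \<open>y\<close> kills it. The induction hypothesis is used
  one position lower as well, so \<open>j\<close> varies.\<close>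

lemma tors_boundary_lift:
  fixes g :: "'a \<Rightarrow> int"
  assumes "finite S" "\<And>s. s \<in> S \<Longrightarrow> s \<in> P (g s)"
    and "\<And>j n u s. j < i \<Longrightarrow> u \<in> X j n \<Longrightarrow> d j u = \<zero>\<^bsub>K (j + 1)\<^esub> \<Longrightarrow> s \<in> S \<Longrightarrow>
      \<exists>k::nat. (s [^] k) \<odot>\<^bsub>K j\<^esub> u \<in> d (j - 1) ` X (j - 1) (n + int k * g s)"
  shows "j \<le> i \<Longrightarrow> u \<in> tors R (K j) S (X j n) \<Longrightarrow> u \<in> d (j - 1) ` X (j - 1) n \<Longrightarrow>
    u \<in> d (j - 1) ` tors R (K (j - 1)) S (X (j - 1) n)"
  using assms
proof (induction S arbitrary: j u n)
  case empty
  then show ?case by simp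
next
  case (insert y S)
  have IH: "u \<in> d (j - 1) ` tors R (K (j - 1)) S (X (j - 1) n)"
    if "j \<le> i" "u \<in> tors R (K j) S (X j n)" "u \<in> d (j - 1) ` X (j - 1) n" for j u n
    by (rule insert.IH[OF that]) (use insert.prems in auto)
  have hom: "S \<subseteq> (\<Union>e. P e)" using insert.prems by blast
  have hc: "S \<subseteq> carrier R" using hom P_carrier by blast
  define e where "e = g y"
  have y: "y \<in> P e" using insert.prems by (simp add: e_def)
  have yc: "y \<in> carrier R" using P_carrier y by blast
  from insert.prems(2) obtain k :: nat where u: "u \<in> tors R (K j) S (X j n)"
    and k: "(y [^] k) \<odot>\<^bsub>K j\<^esub> u = \<zero>\<^bsub>K j\<^esub>" by (auto simp: tors_insert)
  from IH[OF insert.prems(1) u insert.prems(3)]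
  obtain w where w: "w \<in> tors R (K (j - 1)) S (X (j - 1) n)" "d (j - 1) w = u" by blast
  have wX: "w \<in> X (j - 1) n" using w(1) by (rule torsD)
  \<comment> \<open>As \<open>y^k\<close> kills \<open>u\<close>, this multiple of \<open>w\<close>
    is a cocycle. Its position is below \<open>i\<close>, so the assumption on cohomology classes
    applies to it.\<close>
  define w1 where "w1 = (y [^] k) \<odot>\<^bsub>K (j - 1)\<^esub> w"
  have w1: "w1 \<in> tors R (K (j - 1)) S (X (j - 1) (n + int k * e))"
    unfolding w1_def by (rule tors_X_smult[OF hc w(1) P_pow[OF y]])
  have w1X: "w1 \<in> X (j - 1) (n + int k * e)" using w1 by (rule torsD)
  have "d (j - 1) w1 = (y [^] k) \<odot>\<^bsub>K (j - 1 + 1)\<^esub> d (j - 1) w"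
    unfolding w1_def by (rule d_smult[OF P_pow[OF y] wX])
  then have dw1: "d (j - 1) w1 = \<zero>\<^bsub>K (j - 1 + 1)\<^esub>" using k w by simp
  obtain k' :: nat where k': "(y [^] k') \<odot>\<^bsub>K (j - 1)\<^esub> w1 \<in> d (j - 1 - 1) ` X (j - 1 - 1) (n + int k * e + int k' * e)"
    using insert.prems(5)[of "j - 1" w1 "n + int k * e" y] insert.prems(1) w1X dw1
    by (auto simp: e_def)
  have "(y [^] k') \<odot>\<^bsub>K (j - 1)\<^esub> w1 \<in> tors R (K (j - 1)) S (X (j - 1) (n + int k * e + int k' * e))"
    by (rule tors_X_smult[OF hc w1 P_pow[OF y]])
  from IH[OF _ this k'] insert.prems(1)
  obtain v where v: "v \<in> tors R (K (j - 1 - 1)) S (X (j - 1 - 1) (n + int k * e + int k' * e))"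
    "d (j - 1 - 1) v = (y [^] k') \<odot>\<^bsub>K (j - 1)\<^esub> w1" by auto
  interpret A: module R "K (j - 1 - 1)" by (rule module_K)
  interpret B: module R "K (j - 1)" by (rule module_K)
  interpret C: module R "K j" by (rule module_K)
  \<comment> \<open>With this power, \<open>z w = d v\<close> for an \<open>S\<close>-torsion
    element \<open>v\<close>, and \<open>v\<close> is now divided by \<open>z\<close>.\<close>
  define z where "z = y [^] (k + k')"
  have z: "z \<in> P (int (k + k') * e)" unfolding z_def by (rule P_pow[OF y])
  have zc: "z \<in> carrier R" using P_carrier z by blast
  have deg: "n + int k * e + int k' * e - int (k + k') * e = n" by (simp add: algebra_simps)
  have wc: "w \<in> carrier (K (j - 1))" using wX X_carrier by blast
  have dv: "d (j - 1 - 1) v = z \<odot>\<^bsub>K (j - 1)\<^esub> w"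
    using v(2) wc yc unfolding w1_def z_def
    by (simp add: B.smult_assoc1[symmetric] nat_pow_mult add.commute)
  from good_tors[OF hom v(1) z]
  obtain v' l where v': "v' \<in> tors R (K (j - 1 - 1)) S (X (j - 1 - 1) n)"
    and l: "(z [^] (l::nat)) \<odot>\<^bsub>K (j - 1 - 1)\<^esub> (v \<ominus>\<^bsub>K (j - 1 - 1)\<^esub> z \<odot>\<^bsub>K (j - 1 - 1)\<^esub> v') = \<zero>\<^bsub>K (j - 1 - 1)\<^esub>"
    unfolding deg by blast
  have vX: "v \<in> X (j - 1 - 1) (n + int k * e + int k' * e)" using v(1) by (rule torsD)
  have v'X: "v' \<in> X (j - 1 - 1) n" using v' by (rule torsD)
  have zv'X: "z \<odot>\<^bsub>K (j - 1 - 1)\<^esub> v' \<in> X (j - 1 - 1) (n + int k * e + int k' * e)"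
    using X_smult[OF z v'X] by (simp add: algebra_simps)
  \<comment> \<open>Still \<open>d w' = u\<close>, but now \<open>z w' = d (v - z v')\<close> is
    killed by a power of \<open>z\<close>.\<close>
  define w' where "w' = w \<ominus>\<^bsub>K (j - 1)\<^esub> d (j - 1 - 1) v'"
  have dv': "d (j - 1 - 1) v' \<in> tors R (K (j - 1)) S (X (j - 1) n)"
    using d_tors[OF hom v'] by simp
  have w': "w' \<in> tors R (K (j - 1)) S (X (j - 1) n)"
    unfolding w'_def by (rule tors_X_minus[OF hc w(1) dv'])
  have dv'X: "d (j - 1 - 1) v' \<in> X (j - 1) n" using dv' by (rule torsD)
  have uc: "u \<in> carrier (K j)" using torsD[OF u] by (rule X_carrier)
  have dv'c: "d (j - 1 - 1) v' \<in> carrier (K (j - 1))" using dv'X X_carrier by blast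
  have "d (j - 1) w' = u \<ominus>\<^bsub>K j\<^esub> d (j - 1) (d (j - 1 - 1) v')"
    unfolding w'_def using d_minus[OF wX dv'X] w(2) by simp
  also have "d (j - 1) (d (j - 1 - 1) v') = \<zero>\<^bsub>K j\<^esub>" using d_d[OF v'X] by simp
  also have "u \<ominus>\<^bsub>K j\<^esub> \<zero>\<^bsub>K j\<^esub> = u" using uc by (simp add: a_minus_def)
  finally have dw': "d (j - 1) w' = u" .
  have "z \<odot>\<^bsub>K (j - 1)\<^esub> w' = d (j - 1 - 1) v \<ominus>\<^bsub>K (j - 1)\<^esub> z \<odot>\<^bsub>K (j - 1)\<^esub> d (j - 1 - 1) v'"
    unfolding w'_def dv by (rule B.smult_minus_distr[OF zc wc dv'c])
  also have "z \<odot>\<^bsub>K (j - 1)\<^esub> d (j - 1 - 1) v' = d (j - 1 - 1) (z \<odot>\<^bsub>K (j - 1 - 1)\<^esub> v')"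
    using d_smult[OF z v'X] by simp
  also have "d (j - 1 - 1) v \<ominus>\<^bsub>K (j - 1)\<^esub> d (j - 1 - 1) (z \<odot>\<^bsub>K (j - 1 - 1)\<^esub> v')
      = d (j - 1 - 1) (v \<ominus>\<^bsub>K (j - 1 - 1)\<^esub> z \<odot>\<^bsub>K (j - 1 - 1)\<^esub> v')"
    using d_minus[OF vX zv'X] by simp
  finally have zw': "z \<odot>\<^bsub>K (j - 1)\<^esub> w' = d (j - 1 - 1) (v \<ominus>\<^bsub>K (j - 1 - 1)\<^esub> z \<odot>\<^bsub>K (j - 1 - 1)\<^esub> v')" .
  have w'c: "w' \<in> carrier (K (j - 1))" using torsD[OF w'] by (rule X_carrier)
  have "(z [^] l) \<odot>\<^bsub>K (j - 1)\<^esub> (z \<odot>\<^bsub>K (j - 1)\<^esub> w')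
      = d (j - 1 - 1) ((z [^] l) \<odot>\<^bsub>K (j - 1 - 1)\<^esub> (v \<ominus>\<^bsub>K (j - 1 - 1)\<^esub> z \<odot>\<^bsub>K (j - 1 - 1)\<^esub> v'))"
    unfolding zw' using d_smult[OF P_pow[OF z] X_minus[OF vX zv'X]] by simp
  also have "\<dots> = \<zero>\<^bsub>K (j - 1)\<^esub>" unfolding l using d_zero[of "j - 1 - 1"] by simp
  finally have "(z [^] l \<otimes> z) \<odot>\<^bsub>K (j - 1)\<^esub> w' = \<zero>\<^bsub>K (j - 1)\<^esub>"
    using zc w'c by (simp add: B.smult_assoc1)
  moreover have "z [^] l \<otimes> z = y [^] ((k + k') * Suc l)"
    unfolding z_def nat_pow_pow[OF yc] nat_pow_mult[OF yc] by (simp only: mult_Suc_right add.commute)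
  ultimately have "w' \<in> tors R (K (j - 1)) (insert y S) (X (j - 1) n)"
    using w' by (auto simp: tors_insert)
  then show ?case using dw' by blast
qed

end


section \<open>Mapping cones\<close>

lemma (in abelian_group) a_inv_zero: "\<ominus> \<zero> = \<zero>"
  by (rule minus_equality) auto

definition pair_module ::
  "('v \<Rightarrow> 'w \<Rightarrow> 'p) \<Rightarrow> ('p \<Rightarrow> 'v) \<Rightarrow> ('p \<Rightarrow> 'w) \<Rightarrow> ('a, 'v, 'y) module_scheme \<Rightarrow>
     ('a, 'w, 'z) module_scheme \<Rightarrow> ('a, 'p) module" where
  "pair_module pr p1 p2 A B =
     \<lparr>carrier = {pr a b | a b. a \<in> carrier A \<and> b \<in> carrier B},
      monoid.mult = undefined, one = undefined, zero = pr \<zero>\<^bsub>A\<^esub> \<zero>\<^bsub>B\<^esub>,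
      add = (\<lambda>u v. pr (p1 u \<oplus>\<^bsub>A\<^esub> p1 v) (p2 u \<oplus>\<^bsub>B\<^esub> p2 v)),
      smult = (\<lambda>r u. pr (r \<odot>\<^bsub>A\<^esub> p1 u) (r \<odot>\<^bsub>B\<^esub> p2 u))\<rparr>"

text \<open>The type of pairs is a parameter, so that the same cone construction yields ordinary
  pairs as well as trees.\<close>

locale pairing =
  fixes pr :: "'v \<Rightarrow> 'w \<Rightarrow> 'p" and p1 :: "'p \<Rightarrow> 'v" and p2 :: "'p \<Rightarrow> 'w"
  assumes p1_pr [simp]: "p1 (pr a b) = a" and p2_pr [simp]: "p2 (pr a b) = b"
begin

lemma pr_eq_iff [simp]: "pr a b = pr a' b' \<longleftrightarrow> a = a' \<and> b = b'"
  by (metis p1_pr p2_pr)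

lemma pair_carrier: "u \<in> carrier (pair_module pr p1 p2 A B) \<longleftrightarrow>
    (\<exists>a b. u = pr a b \<and> a \<in> carrier A \<and> b \<in> carrier B)"
  by (auto simp: pair_module_def)

lemma pair_in_carrier [simp]: "pr a b \<in> carrier (pair_module pr p1 p2 A B) \<longleftrightarrow>
    a \<in> carrier A \<and> b \<in> carrier B"
  by (simp add: pair_carrier)

lemma pair_zero: "\<zero>\<^bsub>pair_module pr p1 p2 A B\<^esub> = pr \<zero>\<^bsub>A\<^esub> \<zero>\<^bsub>B\<^esub>"
  by (simp add: pair_module_def)

lemma pair_add: "pr a b \<oplus>\<^bsub>pair_module pr p1 p2 A B\<^esub> pr a' b' = pr (a \<oplus>\<^bsub>A\<^esub> a') (b \<oplus>\<^bsub>B\<^esub> b')"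
  by (simp add: pair_module_def)

lemma pair_smult: "r \<odot>\<^bsub>pair_module pr p1 p2 A B\<^esub> pr a b = pr (r \<odot>\<^bsub>A\<^esub> a) (r \<odot>\<^bsub>B\<^esub> b)"
  by (simp add: pair_module_def)

lemma module_pair:
  assumes "module R A" "module R B"
  shows "module R (pair_module pr p1 p2 A B)"
proof -
  interpret A: module R A by fact
  interpret B: module R B by fact
  have ab: "abelian_group (pair_module pr p1 p2 A B)"
  proof (rule abelian_groupI)
    fix x assume "x \<in> carrier (pair_module pr p1 p2 A B)"
    then obtain a b where x: "x = pr a b" "a \<in> carrier A" "b \<in> carrier B" by (auto simp: pair_carrier)
    show "\<exists>y\<in>carrier (pair_module pr p1 p2 A B).
        y \<oplus>\<^bsub>pair_module pr p1 p2 A B\<^esub> x = \<zero>\<^bsub>pair_module pr p1 p2 A B\<^esub>"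
      using x by (intro bexI[of _ "pr (\<ominus>\<^bsub>A\<^esub> a) (\<ominus>\<^bsub>B\<^esub> b)"])
        (auto simp: pair_add pair_zero A.M.l_neg B.M.l_neg)
  qed (auto simp: pair_carrier pair_add pair_zero A.M.a_ac B.M.a_ac)
  show ?thesis
    by (rule moduleI[OF A.R.is_cring ab])
      (auto simp: pair_carrier pair_add pair_smult A.smult_l_distr B.smult_l_distr A.smult_r_distr
        B.smult_r_distr A.smult_assoc1 B.smult_assoc1)
qed

lemma pair_neg:
  assumes "module R A" "module R B" "a \<in> carrier A" "b \<in> carrier B"
  shows "\<ominus>\<^bsub>pair_module pr p1 p2 A B\<^esub> pr a b = pr (\<ominus>\<^bsub>A\<^esub> a) (\<ominus>\<^bsub>B\<^esub> b)"
proof -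
  interpret A: module R A by fact
  interpret B: module R B by fact
  interpret C: module R "pair_module pr p1 p2 A B" by (rule module_pair) fact+
  show ?thesis
    by (rule C.M.minus_equality) (use assms in \<open>auto simp: pair_add pair_zero A.M.l_neg B.M.l_neg\<close>)
qed

lemma pair_minus:
  assumes "module R A" "module R B" "a' \<in> carrier A" "b' \<in> carrier B"
  shows "pr a b \<ominus>\<^bsub>pair_module pr p1 p2 A B\<^esub> pr a' b' = pr (a \<ominus>\<^bsub>A\<^esub> a') (b \<ominus>\<^bsub>B\<^esub> b')"
  by (simp add: a_minus_def pair_neg[OF assms] pair_add)

end

section \<open>Cones of homogeneous chain maps\<close>

definition cone_module where
  "cone_module pr p1 p2 K1 K2 i = pair_module pr p1 p2 (K1 (i + 1)) (K2 i)" for i :: int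

text \<open>The first summand is shifted by \<open>s\<close>, so that a map raising degrees by
  \<open>s\<close> becomes part of a differential of degree 0.\<close>

definition cone_part where
  "cone_part pr s X1 X2 i n = {pr a b | a b. a \<in> X1 (i + 1) (n - s) \<and> b \<in> X2 i n}" for i n s :: int

definition cone_diff where
  "cone_diff pr p1 p2 K1 K2 d1 d2 \<phi> i u =
     pr (\<ominus>\<^bsub>K1 (i + 1 + 1)\<^esub> d1 (i + 1) (p1 u)) (\<phi> (i + 1) (p1 u) \<oplus>\<^bsub>K2 (i + 1)\<^esub> d2 i (p2 u))"
  for i :: int

locale mapping_cone = pairing pr p1 p2 + A: graded_complex R P K1 X1 d1 + B: graded_complex R P K2 X2 d2
  for pr :: "'v \<Rightarrow> 'w \<Rightarrow> 'p" and p1 :: "'p \<Rightarrow> 'v" and p2 :: "'p \<Rightarrow> 'w"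
    and R :: "('a, 'r) ring_scheme" (structure) and P
    and K1 :: "int \<Rightarrow> ('a, 'v, 'y) module_scheme" and X1 d1
    and K2 :: "int \<Rightarrow> ('a, 'w, 'z) module_scheme" and X2 d2 +
  fixes s :: int and \<phi> :: "int \<Rightarrow> 'v \<Rightarrow> 'w"
  assumes map_closed: "a \<in> X1 i n \<Longrightarrow> \<phi> i a \<in> X2 i (n + s)"
    and map_add: "a \<in> X1 i n \<Longrightarrow> a' \<in> X1 i n \<Longrightarrow> \<phi> i (a \<oplus>\<^bsub>K1 i\<^esub> a') = \<phi> i a \<oplus>\<^bsub>K2 i\<^esub> \<phi> i a'"
    and map_smult: "r \<in> P e \<Longrightarrow> a \<in> X1 i n \<Longrightarrow> \<phi> i (r \<odot>\<^bsub>K1 i\<^esub> a) = r \<odot>\<^bsub>K2 i\<^esub> \<phi> i a"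
    and map_d: "a \<in> X1 i n \<Longrightarrow> \<phi> (i + 1) (d1 i a) = d2 i (\<phi> i a)"
begin

abbreviation "CK \<equiv> cone_module pr p1 p2 K1 K2"
abbreviation "CX \<equiv> cone_part pr s X1 X2"
abbreviation "Cd \<equiv> cone_diff pr p1 p2 K1 K2 d1 d2 \<phi>"

lemma CX_iff: "pr a b \<in> CX i n \<longleftrightarrow> a \<in> X1 (i + 1) (n - s) \<and> b \<in> X2 i n"
  by (auto simp: cone_part_def)

lemma CXE:
  assumes "u \<in> CX i n"
  obtains a b where "u = pr a b" "a \<in> X1 (i + 1) (n - s)" "b \<in> X2 i n"
  using assms by (auto simp: cone_part_def)

lemma Cd_pr: "Cd i (pr a b) =
    pr (\<ominus>\<^bsub>K1 (i + 1 + 1)\<^esub> d1 (i + 1) a) (\<phi> (i + 1) a \<oplus>\<^bsub>K2 (i + 1)\<^esub> d2 i b)"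
  by (simp add: cone_diff_def)

lemma map_closed': "a \<in> X1 i (n - s) \<Longrightarrow> \<phi> i a \<in> X2 i n"
  using map_closed[of a i "n - s"] by simp

lemma map_zero: "\<phi> i \<zero>\<^bsub>K1 i\<^esub> = \<zero>\<^bsub>K2 i\<^esub>"
proof -
  interpret A': abelian_group "K1 i" by (rule A.ab_K)
  interpret B': abelian_group "K2 i" by (rule B.ab_K)
  have z: "\<zero>\<^bsub>K1 i\<^esub> \<in> X1 i 0" by (rule A.X_zero)
  have "\<phi> i \<zero>\<^bsub>K1 i\<^esub> \<oplus>\<^bsub>K2 i\<^esub> \<phi> i \<zero>\<^bsub>K1 i\<^esub> = \<phi> i \<zero>\<^bsub>K1 i\<^esub>"
    using map_add[OF z z] by simp
  moreover have "\<phi> i \<zero>\<^bsub>K1 i\<^esub> \<in> carrier (K2 i)" using map_closed[OF z] B.X_carrier by blast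
  ultimately show ?thesis by (metis B'.add.r_cancel_one')
qed

lemma map_neg: assumes "a \<in> X1 i n" shows "\<phi> i (\<ominus>\<^bsub>K1 i\<^esub> a) = \<ominus>\<^bsub>K2 i\<^esub> \<phi> i a"
proof -
  interpret A': abelian_group "K1 i" by (rule A.ab_K)
  interpret B': abelian_group "K2 i" by (rule B.ab_K)
  have "\<phi> i (\<ominus>\<^bsub>K1 i\<^esub> a) \<oplus>\<^bsub>K2 i\<^esub> \<phi> i a = \<phi> i (\<ominus>\<^bsub>K1 i\<^esub> a \<oplus>\<^bsub>K1 i\<^esub> a)"
    using map_add[OF A.X_neg[OF assms] assms] by simp
  also have "\<dots> = \<zero>\<^bsub>K2 i\<^esub>" using A.X_carrier[OF assms] map_zero by (simp add: A'.l_neg)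
  finally show ?thesis
    using map_closed[OF assms] map_closed[OF A.X_neg[OF assms]] B.X_carrier
    by (metis B'.minus_equality)
qed

lemma map_tors:
  assumes "S \<subseteq> (\<Union>e. P e)" "x \<in> tors R (K1 i) S (X1 i (n - s))"
  shows "\<phi> i x \<in> tors R (K2 i) S (X2 i n)"
  unfolding tors_def
proof (intro CollectI conjI ballI)
  have x: "x \<in> X1 i (n - s)" using assms(2) by (rule torsD)
  then show "\<phi> i x \<in> X2 i n" by (rule map_closed')
  fix t assume t: "t \<in> S"
  then obtain e where e: "t \<in> P e" using assms by auto
  obtain k :: nat where k: "(t [^] k) \<odot>\<^bsub>K1 i\<^esub> x = \<zero>\<^bsub>K1 i\<^esub>" using assms(2) t by (rule torsE)
  have "(t [^] k) \<odot>\<^bsub>K2 i\<^esub> \<phi> i x = \<zero>\<^bsub>K2 i\<^esub>"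
    using map_smult[OF A.P_pow[OF e] x, of k] k map_zero by simp
  then show "\<exists>k::nat. (t [^] k) \<odot>\<^bsub>K2 i\<^esub> \<phi> i x = \<zero>\<^bsub>K2 i\<^esub>" by blast
qed

lemmas CK_simps = cone_module_def pair_add pair_zero pair_smult
  pair_neg[OF A.module_K B.module_K] pair_minus[OF A.module_K B.module_K]

text \<open>The two entries are divided separately. A scalar that kills the pair kills both entries,
  so the annihilator clause survives; the sum of the two exponents serves both.\<close>

lemma C_good:
  assumes "u \<in> CX i n" "r \<in> P e"
  shows "\<exists>w\<in>CX i (n - e). (\<exists>l::nat. (r [^] l) \<odot>\<^bsub>CK i\<^esub> (u \<ominus>\<^bsub>CK i\<^esub> r \<odot>\<^bsub>CK i\<^esub> w) = \<zero>\<^bsub>CK i\<^esub>) \<and>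
        (\<forall>e'. \<forall>s\<in>P e'. s \<odot>\<^bsub>CK i\<^esub> u = \<zero>\<^bsub>CK i\<^esub> \<longrightarrow> s \<odot>\<^bsub>CK i\<^esub> w = \<zero>\<^bsub>CK i\<^esub>)"
proof -
  interpret A': module R "K1 (i + 1)" by (rule A.module_K)
  interpret B': module R "K2 i" by (rule B.module_K)
  from assms(1) obtain a b where u: "u = pr a b" "a \<in> X1 (i + 1) (n - s)" "b \<in> X2 i n" by (rule CXE)
  have rc: "r \<in> carrier R" using A.P_carrier assms by blast
  obtain a' l where a': "a' \<in> X1 (i + 1) (n - s - e)"
    "(r [^] (l::nat)) \<odot>\<^bsub>K1 (i + 1)\<^esub> (a \<ominus>\<^bsub>K1 (i + 1)\<^esub> r \<odot>\<^bsub>K1 (i + 1)\<^esub> a') = \<zero>\<^bsub>K1 (i + 1)\<^esub>"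
    "\<And>e' t. t \<in> P e' \<Longrightarrow> t \<odot>\<^bsub>K1 (i + 1)\<^esub> a = \<zero>\<^bsub>K1 (i + 1)\<^esub> \<Longrightarrow> t \<odot>\<^bsub>K1 (i + 1)\<^esub> a' = \<zero>\<^bsub>K1 (i + 1)\<^esub>"
    using A.good[OF u(2) assms(2)] by blast
  obtain b' m where b': "b' \<in> X2 i (n - e)"
    "(r [^] (m::nat)) \<odot>\<^bsub>K2 i\<^esub> (b \<ominus>\<^bsub>K2 i\<^esub> r \<odot>\<^bsub>K2 i\<^esub> b') = \<zero>\<^bsub>K2 i\<^esub>"
    "\<And>e' t. t \<in> P e' \<Longrightarrow> t \<odot>\<^bsub>K2 i\<^esub> b = \<zero>\<^bsub>K2 i\<^esub> \<Longrightarrow> t \<odot>\<^bsub>K2 i\<^esub> b' = \<zero>\<^bsub>K2 i\<^esub>"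
    using B.good[OF u(3) assms(2)] by blast
  have c: "a \<in> carrier (K1 (i + 1))" "a' \<in> carrier (K1 (i + 1))" "b \<in> carrier (K2 i)" "b' \<in> carrier (K2 i)"
    using u a' b' A.X_carrier B.X_carrier by blast+
  have "n - e - s = n - s - e" by simp
  then have w: "pr a' b' \<in> CX i (n - e)" using a'(1) b'(1) by (simp only: CX_iff)
  have 1: "(r [^] (l + m)) \<odot>\<^bsub>K1 (i + 1)\<^esub> (a \<ominus>\<^bsub>K1 (i + 1)\<^esub> r \<odot>\<^bsub>K1 (i + 1)\<^esub> a') = \<zero>\<^bsub>K1 (i + 1)\<^esub>"
    by (rule A'.smult_pow_zero_mono[OF rc _ a'(2)]) (use c rc in auto)
  have 2: "(r [^] (l + m)) \<odot>\<^bsub>K2 i\<^esub> (b \<ominus>\<^bsub>K2 i\<^esub> r \<odot>\<^bsub>K2 i\<^esub> b') = \<zero>\<^bsub>K2 i\<^esub>"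
    by (rule B'.smult_pow_zero_mono[OF rc _ b'(2)]) (use c rc in auto)
  have 3: "(r [^] (l + m)) \<odot>\<^bsub>CK i\<^esub> (u \<ominus>\<^bsub>CK i\<^esub> r \<odot>\<^bsub>CK i\<^esub> pr a' b') = \<zero>\<^bsub>CK i\<^esub>"
    using 1 2 c rc by (simp add: CK_simps u)
  have 4: "t \<odot>\<^bsub>CK i\<^esub> pr a' b' = \<zero>\<^bsub>CK i\<^esub>" if "t \<in> P e'" "t \<odot>\<^bsub>CK i\<^esub> u = \<zero>\<^bsub>CK i\<^esub>" for t e'
    using that a'(3) b'(3) by (simp add: CK_simps u)
  show ?thesis using w 3 4 by blast
qed

lemma module_CK: "module R (CK i)"
  unfolding cone_module_def by (rule module_pair[OF A.module_K B.module_K])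

lemma C_complex: "graded_complex R P CK CX Cd"
proof (intro graded_complex.intro graded_complex_axioms.intro A.graded_scalars_axioms, goal_cases)
  case (1 i)
  show ?case by (rule module_CK)
next
  case (2 i n)
  show ?case using A.X_carrier B.X_carrier by (auto simp: cone_part_def cone_module_def)
next
  case (3 i n)
  show ?case by (simp add: CK_simps CX_iff A.X_zero B.X_zero)
next
  case (4 x i n y)
  then show ?case by (auto elim!: CXE simp: CK_simps CX_iff A.X_add B.X_add)
next
  case (5 x i n)
  then show ?case
    by (auto elim!: CXE simp: CK_simps CX_iff A.X_neg B.X_neg A.X_carrier B.X_carrier)
next
  case (6 r e x i n)
  have eq: "n + e - s = n - s + e" by simp
  from 6 obtain a b where x: "x = pr a b" "a \<in> X1 (i + 1) (n - s)" "b \<in> X2 i n" by (metis CXE)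
  show ?case
    using A.X_smult[OF 6(1) x(2)] B.X_smult[OF 6(1) x(3)]
    by (simp only: x(1) CK_simps CX_iff eq)
next
  case (7 x i n)
  then obtain a b where x: "x = pr a b" "a \<in> X1 (i + 1) (n - s)" "b \<in> X2 i n" by (metis CXE)
  show ?case unfolding x Cd_pr CX_iff
    using x by (intro conjI A.X_neg B.X_add A.d_closed B.d_closed map_closed')
next
  case (8 x i n y)
  interpret A': module R "K1 (i + 1 + 1)" by (rule A.module_K)
  interpret B': module R "K2 (i + 1)" by (rule B.module_K)
  from 8 obtain a b a' b' where x: "x = pr a b" "a \<in> X1 (i + 1) (n - s)" "b \<in> X2 i n"
    and y: "y = pr a' b'" "a' \<in> X1 (i + 1) (n - s)" "b' \<in> X2 i n" by (metis CXE)
  have c: "d1 (i + 1) a \<in> carrier (K1 (i + 1 + 1))" "d1 (i + 1) a' \<in> carrier (K1 (i + 1 + 1))"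
    "\<phi> (i + 1) a \<in> carrier (K2 (i + 1))" "\<phi> (i + 1) a' \<in> carrier (K2 (i + 1))"
    "d2 i b \<in> carrier (K2 (i + 1))" "d2 i b' \<in> carrier (K2 (i + 1))"
    using x y A.X_carrier B.X_carrier A.d_closed B.d_closed map_closed by blast+
  show ?case
    unfolding x(1) y(1) CK_simps Cd_pr p1_pr p2_pr A.d_add[OF x(2) y(2)] B.d_add[OF x(3) y(3)]
      map_add[OF x(2) y(2)] A'.M.minus_add[OF c(1,2)]
    using c by (simp add: B'.M.a_ac)
next
  case (9 r e x i n)
  interpret A': module R "K1 (i + 1 + 1)" by (rule A.module_K)
  interpret B': module R "K2 (i + 1)" by (rule B.module_K)
  from 9 obtain a b where x: "x = pr a b" "a \<in> X1 (i + 1) (n - s)" "b \<in> X2 i n" by (metis CXE)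
  have c: "d1 (i + 1) a \<in> carrier (K1 (i + 1 + 1))"
    "\<phi> (i + 1) a \<in> carrier (K2 (i + 1))"  "d2 i b \<in> carrier (K2 (i + 1))" "r \<in> carrier R"
    using x A.X_carrier B.X_carrier A.d_closed B.d_closed map_closed A.P_carrier 9 by blast+
  show ?case
    unfolding x(1) CK_simps Cd_pr A.d_smult[OF 9(1) x(2)] B.d_smult[OF 9(1) x(3)]
      map_smult[OF 9(1) x(2)] A'.smult_r_minus[OF c(4,1)] B'.smult_r_distr[OF c(4,2,3)] by simp
next
  case (10 x i n)
  interpret A': module R "K1 (i + 1 + 1 + 1)" by (rule A.module_K)
  interpret B': module R "K2 (i + 1 + 1)" by (rule B.module_K)
  from 10 obtain a b where x: "x = pr a b" "a \<in> X1 (i + 1) (n - s)" "b \<in> X2 i n" by (metis CXE)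
  have dX: "d1 (i + 1) a \<in> X1 (i + 1 + 1) (n - s)" "\<phi> (i + 1) a \<in> X2 (i + 1) n" "d2 i b \<in> X2 (i + 1) n"
    using x A.d_closed B.d_closed map_closed' by blast+
  have c: "d2 (i + 1) (\<phi> (i + 1) a) \<in> carrier (K2 (i + 1 + 1))"
    using dX B.d_closed B.X_carrier by blast
  show ?case
    unfolding x(1) CK_simps Cd_pr A.d_neg[OF dX(1)] A.d_d[OF x(2)] B.d_add[OF dX(2,3)] B.d_d[OF x(3)]
      map_neg[OF dX(1)] map_d[OF x(2)] B'.M.r_zero[OF c] B'.M.l_neg[OF c] A'.M.a_inv_zero by simp
next
  case (11 x i n r e)
  then show ?case by (rule C_good)
qed

lemma C_tors_iff:
  assumes "S \<subseteq> carrier R"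
  shows "pr a b \<in> tors R (CK i) S (CX i n) \<longleftrightarrow>
    a \<in> tors R (K1 (i + 1)) S (X1 (i + 1) (n - s)) \<and> b \<in> tors R (K2 i) S (X2 i n)" (is "?L \<longleftrightarrow> ?R")
proof
  assume ?L
  then show ?R by (auto simp: tors_def CX_iff CK_simps)
next
  assume ab: ?R
  interpret A': module R "K1 (i + 1)" by (rule A.module_K)
  interpret B': module R "K2 i" by (rule B.module_K)
  have X: "a \<in> X1 (i + 1) (n - s)" "b \<in> X2 i n" using ab by (auto dest: torsD)
  have "\<exists>k::nat. (t [^] k) \<odot>\<^bsub>CK i\<^esub> pr a b = \<zero>\<^bsub>CK i\<^esub>" if t: "t \<in> S" for t
  proof -
    from ab t obtain k :: nat where k: "(t [^] k) \<odot>\<^bsub>K1 (i + 1)\<^esub> a = \<zero>\<^bsub>K1 (i + 1)\<^esub>" by (metis torsE)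
    from ab t obtain l :: nat where l: "(t [^] l) \<odot>\<^bsub>K2 i\<^esub> b = \<zero>\<^bsub>K2 i\<^esub>" by (metis torsE)
    have "t \<in> carrier R" using assms t by blast
    then have "(t [^] (k + l)) \<odot>\<^bsub>K1 (i + 1)\<^esub> a = \<zero>\<^bsub>K1 (i + 1)\<^esub>" "(t [^] (k + l)) \<odot>\<^bsub>K2 i\<^esub> b = \<zero>\<^bsub>K2 i\<^esub>"
      using A'.smult_pow_zero_mono[OF _ A.X_carrier[OF X(1)] k, of "k + l"]
        B'.smult_pow_zero_mono[OF _ B.X_carrier[OF X(2)] l, of "k + l"] by auto
    then show ?thesis by (intro exI[of _ "k + l"]) (simp add: CK_simps)
  qed
  then show ?L using X by (simp add: tors_def CX_iff)
qed

lemma C_torsE: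
  assumes "S \<subseteq> carrier R" "u \<in> tors R (CK i) S (CX i n)"
  obtains a b where "u = pr a b" "a \<in> tors R (K1 (i + 1)) S (X1 (i + 1) (n - s))"
    "b \<in> tors R (K2 i) S (X2 i n)"
  using assms(2) torsD[OF assms(2)] C_tors_iff[OF assms(1)] by (metis CXE)

text \<open>The following lemmas are fragments of the long exact cohomology sequence of the cone.\<close>

lemma cone_cocycle:
  assumes S: "S \<subseteq> (\<Union>e. P e)"
    and u: "pr a b \<in> tors R (CK i) S (CX i n)" "Cd i (pr a b) = \<zero>\<^bsub>CK (i + 1)\<^esub>"
    and a': "a' \<in> tors R (K1 i) S (X1 i (n - s))" "a = d1 i a'"
  shows "b \<oplus>\<^bsub>K2 i\<^esub> \<phi> i a' \<in> tors R (K2 i) S (X2 i n)"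
    "d2 i (b \<oplus>\<^bsub>K2 i\<^esub> \<phi> i a') = \<zero>\<^bsub>K2 (i + 1)\<^esub>"
proof -
  have Sc: "S \<subseteq> carrier R" using S A.P_carrier by blast
  interpret B'': module R "K2 (i + 1)" by (rule B.module_K)
  have b: "b \<in> tors R (K2 i) S (X2 i n)" using u(1) C_tors_iff[OF Sc] by auto
  have fa: "\<phi> i a' \<in> tors R (K2 i) S (X2 i n)" by (rule map_tors[OF S a'(1)])
  show "b \<oplus>\<^bsub>K2 i\<^esub> \<phi> i a' \<in> tors R (K2 i) S (X2 i n)" by (rule B.tors_X_add[OF Sc b fa])
  have c: "d2 i b \<in> carrier (K2 (i + 1))" "d2 i (\<phi> i a') \<in> carrier (K2 (i + 1))"
    using torsD[OF b] torsD[OF fa] by (blast intro: B.X_carrier B.d_closed)+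
  have "\<phi> (i + 1) a \<oplus>\<^bsub>K2 (i + 1)\<^esub> d2 i b = \<zero>\<^bsub>K2 (i + 1)\<^esub>"
    using u(2) by (simp add: Cd_pr CK_simps)
  then show "d2 i (b \<oplus>\<^bsub>K2 i\<^esub> \<phi> i a') = \<zero>\<^bsub>K2 (i + 1)\<^esub>"
    unfolding B.d_add[OF torsD[OF b] torsD[OF fa]] a'(2) map_d[OF torsD[OF a'(1)]]
    using c by (simp add: B''.M.a_comm)
qed

text \<open>\<open>(a, b)\<close> and \<open>(0, b + \<phi> a')\<close> differ by the coboundary of
  \<open>(- a', 0)\<close>.\<close>

lemma cone_boundaryI:
  assumes S: "S \<subseteq> (\<Union>e. P e)" and b: "b \<in> carrier (K2 i)"
    and a': "a' \<in> tors R (K1 i) S (X1 i (n - s))" "a = d1 i a'"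
    and b1: "b \<oplus>\<^bsub>K2 i\<^esub> \<phi> i a' \<in> d2 (i - 1) ` tors R (K2 (i - 1)) S (X2 (i - 1) n)"
  shows "pr a b \<in> Cd (i - 1) ` tors R (CK (i - 1)) S (CX (i - 1) n)"
proof -
  have Sc: "S \<subseteq> carrier R" using S A.P_carrier by blast
  interpret A': module R "K1 (i + 1)" by (rule A.module_K)
  interpret B': module R "K2 i" by (rule B.module_K)
  have X: "a' \<in> X1 i (n - s)" "\<phi> i a' \<in> X2 i n"
    using torsD[OF a'(1)] map_closed' by auto
  have c: "\<phi> i a' \<in> carrier (K2 i)" "d1 i a' \<in> carrier (K1 (i + 1))"
    using X A.X_carrier B.X_carrier A.d_closed by blast+
  from b1 obtain b2 where b2: "b2 \<in> tors R (K2 (i - 1)) S (X2 (i - 1) n)"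
    "d2 (i - 1) b2 = b \<oplus>\<^bsub>K2 i\<^esub> \<phi> i a'" by (metis imageE)
  have na: "\<ominus>\<^bsub>K1 i\<^esub> a' \<in> tors R (K1 i) S (X1 i (n - s))" by (rule A.tors_X_neg[OF Sc a'(1)])
  have "pr (\<ominus>\<^bsub>K1 i\<^esub> a') b2 \<in> tors R (CK (i - 1)) S (CX (i - 1) n)"
    using na b2(1) C_tors_iff[OF Sc, of _ _ "i - 1"] by simp
  moreover have "Cd (i - 1) (pr (\<ominus>\<^bsub>K1 i\<^esub> a') b2) = pr a b"
  proof -
    have "\<ominus>\<^bsub>K2 i\<^esub> \<phi> i a' \<oplus>\<^bsub>K2 i\<^esub> (b \<oplus>\<^bsub>K2 i\<^esub> \<phi> i a') = b"
      using c b by (simp add: B'.M.a_lcomm B'.M.l_neg)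
    then show ?thesis using c
      by (simp add: Cd_pr A.d_neg[OF X(1)] map_neg[OF X(1)] b2(2) a'(2))
  qed
  ultimately show ?thesis by (metis imageI)
qed

lemma cone_boundary:
  assumes S: "S \<subseteq> (\<Union>e. P e)" and ex: "exact_at R K2 X2 d2 S i n"
    and u: "pr a b \<in> tors R (CK i) S (CX i n)" "Cd i (pr a b) = \<zero>\<^bsub>CK (i + 1)\<^esub>"
    and a': "a' \<in> tors R (K1 i) S (X1 i (n - s))" "a = d1 i a'"
  shows "pr a b \<in> Cd (i - 1) ` tors R (CK (i - 1)) S (CX (i - 1) n)"
proof (rule cone_boundaryI[OF S _ a'])
  show "b \<in> carrier (K2 i)" using torsD[OF u(1)] B.X_carrier by (auto simp: CX_iff)
  show "b \<oplus>\<^bsub>K2 i\<^esub> \<phi> i a' \<in> d2 (i - 1) ` tors R (K2 (i - 1)) S (X2 (i - 1) n)"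
    using ex cone_cocycle[OF S u a'] unfolding exact_at_def by blast
qed

lemma cone_cocycle_fst:
  assumes "pr a b \<in> CX i n" "Cd i (pr a b) = \<zero>\<^bsub>CK (i + 1)\<^esub>"
  shows "d1 (i + 1) a = \<zero>\<^bsub>K1 (i + 1 + 1)\<^esub>"
proof -
  interpret A': module R "K1 (i + 1 + 1)" by (rule A.module_K)
  have "\<ominus>\<^bsub>K1 (i + 1 + 1)\<^esub> d1 (i + 1) a = \<zero>\<^bsub>K1 (i + 1 + 1)\<^esub>"
    using assms(2) by (simp add: Cd_pr CK_simps)
  moreover have "d1 (i + 1) a \<in> carrier (K1 (i + 1 + 1))"
    using assms(1) unfolding CX_iff by (blast intro: A.X_carrier A.d_closed)
  ultimately show ?thesis by (metis A'.M.add.inv_eq_1_iff)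
qed

text \<open>Middle term of H^i(K2)_n \<rightarrow> H^i(C)_n \<rightarrow> H^{i+1}(K1)_{n-s}, all
  taken for the \<open>S\<close>-torsion.\<close>

lemma exact_cone:
  assumes S: "S \<subseteq> (\<Union>e. P e)" and "exact_at R K1 X1 d1 S (i + 1) (n - s)" "exact_at R K2 X2 d2 S i n"
  shows "exact_at R CK CX Cd S i n"
  unfolding exact_at_def
proof (intro ballI impI)
  have Sc: "S \<subseteq> carrier R" using S A.P_carrier by blast
  fix u assume u: "u \<in> tors R (CK i) S (CX i n)" "Cd i u = \<zero>\<^bsub>CK (i + 1)\<^esub>"
  from C_torsE[OF Sc u(1)] obtain a b where ab: "u = pr a b"
    "a \<in> tors R (K1 (i + 1)) S (X1 (i + 1) (n - s))" "b \<in> tors R (K2 i) S (X2 i n)" .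
  have "d1 (i + 1) a = \<zero>\<^bsub>K1 (i + 1 + 1)\<^esub>"
    using cone_cocycle_fst u(2) torsD[OF u(1)] unfolding ab(1) by blast
  with assms(2) ab(2) obtain a' where "a' \<in> tors R (K1 i) S (X1 i (n - s))" "a = d1 i a'"
    unfolding exact_at_def by auto
  with cone_boundary[OF S assms(3)] u show "u \<in> Cd (i - 1) ` tors R (CK (i - 1)) S (CX (i - 1) n)"
    unfolding ab(1) by blast
qed

text \<open>If H^{i-1}(C)_n is zero, the map H^i(K1)_{n-s} \<rightarrow> H^i(K2)_n induced by
  \<open>\<phi>\<close> is injective. For the cone of a multiplication this is the cancellation of
  \<open>y\<close> on cohomology classes, the form in which the induction on the position is
  exploited.\<close>

lemma boundary_of_exact_cone:
  assumes S: "S \<subseteq> (\<Union>e. P e)" and ex: "exact_at R CK CX Cd S (i - 1) n"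
    and u: "u \<in> tors R (K1 i) S (X1 i (n - s))" "d1 i u = \<zero>\<^bsub>K1 (i + 1)\<^esub>"
    and "\<phi> i u \<in> d2 (i - 1) ` tors R (K2 (i - 1)) S (X2 (i - 1) n)"
  shows "u \<in> d1 (i - 1) ` tors R (K1 (i - 1)) S (X1 (i - 1) (n - s))"
proof -
  have Sc: "S \<subseteq> carrier R" using S A.P_carrier by blast
  interpret A': module R "K1 (i + 1)" by (rule A.module_K)
  interpret A'': module R "K1 i" by (rule A.module_K)
  interpret B': module R "K2 i" by (rule B.module_K)
  obtain b where b: "b \<in> tors R (K2 (i - 1)) S (X2 (i - 1) n)" "\<phi> i u = d2 (i - 1) b" using assms by blast
  have nb: "\<ominus>\<^bsub>K2 (i - 1)\<^esub> b \<in> tors R (K2 (i - 1)) S (X2 (i - 1) n)" by (rule B.tors_X_neg[OF Sc b(1)])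
  have "pr u (\<ominus>\<^bsub>K2 (i - 1)\<^esub> b) \<in> tors R (CK (i - 1)) S (CX (i - 1) n)"
    using nb u C_tors_iff[OF Sc, of _ _ "i - 1"] by simp
  moreover have "Cd (i - 1) (pr u (\<ominus>\<^bsub>K2 (i - 1)\<^esub> b)) = \<zero>\<^bsub>CK (i - 1 + 1)\<^esub>"
  proof -
    have "d2 (i - 1) b \<in> carrier (K2 i)" using B.d_closed[OF torsD[OF b(1)]] B.X_carrier by force
    then show ?thesis using u(2) B.d_neg[OF torsD[OF b(1)]]
      by (simp add: Cd_pr CK_simps b(2) B'.M.r_neg)
  qed
  ultimately have "pr u (\<ominus>\<^bsub>K2 (i - 1)\<^esub> b) \<in> Cd (i - 1 - 1) ` tors R (CK (i - 1 - 1)) S (CX (i - 1 - 1) n)"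
    using ex unfolding exact_at_def by blast
  then obtain a' b' where a': "a' \<in> tors R (K1 (i - 1)) S (X1 (i - 1) (n - s))"
    "pr u (\<ominus>\<^bsub>K2 (i - 1)\<^esub> b) = Cd (i - 1 - 1) (pr a' b')"
    using C_tors_iff[OF Sc, of _ _ "i - 1 - 1"] by (auto elim!: C_torsE[OF Sc])
  have "u = \<ominus>\<^bsub>K1 i\<^esub> d1 (i - 1) a'" using a'(2) by (simp add: Cd_pr)
  also have "\<dots> = d1 (i - 1) (\<ominus>\<^bsub>K1 (i - 1)\<^esub> a')" using A.d_neg[OF torsD[OF a'(1)]] by simp
  finally show ?thesis using A.tors_X_neg[OF Sc a'(1)] by blast
qed

lemma exact_source:
  assumes "S \<subseteq> (\<Union>e. P e)" "exact_at R CK CX Cd S (i - 1) n" "exact_at R K2 X2 d2 S i n"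
  shows "exact_at R K1 X1 d1 S i (n - s)"
  unfolding exact_at_def
proof (intro ballI impI)
  fix u assume u: "u \<in> tors R (K1 i) S (X1 i (n - s))" "d1 i u = \<zero>\<^bsub>K1 (i + 1)\<^esub>"
  have "d2 i (\<phi> i u) = \<zero>\<^bsub>K2 (i + 1)\<^esub>" using map_d[OF torsD[OF u(1)]] u(2) map_zero by simp
  with assms(3) map_tors[OF assms(1) u(1)]
  have "\<phi> i u \<in> d2 (i - 1) ` tors R (K2 (i - 1)) S (X2 (i - 1) n)" unfolding exact_at_def by blast
  then show "u \<in> d1 (i - 1) ` tors R (K1 (i - 1)) S (X1 (i - 1) (n - s))"
    by (rule boundary_of_exact_cone[OF assms(1,2) u])
qed

text \<open>Middle term of H^i(K1)_{n-s} \<rightarrow> H^i(K2)_n \<rightarrow> H^i(C)_n; the cocycle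
  \<open>b\<close> is seen in the cone as \<open>(0, b)\<close>.\<close>

lemma exact_target:
  assumes S: "S \<subseteq> (\<Union>e. P e)" and ex: "exact_at R CK CX Cd S i n" "exact_at R K1 X1 d1 S i (n - s)"
  shows "exact_at R K2 X2 d2 S i n"
  unfolding exact_at_def
proof (intro ballI impI)
  fix b assume b: "b \<in> tors R (K2 i) S (X2 i n)" "d2 i b = \<zero>\<^bsub>K2 (i + 1)\<^esub>"
  have Sc: "S \<subseteq> carrier R" using S A.P_carrier by blast
  interpret A0: module R "K1 (i + 1 + 1)" by (rule A.module_K)
  interpret A': module R "K1 (i + 1)" by (rule A.module_K)
  interpret A'': module R "K1 i" by (rule A.module_K)
  interpret B': module R "K2 i" by (rule B.module_K)
  interpret B'': module R "K2 (i + 1)" by (rule B.module_K)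
  have "pr \<zero>\<^bsub>K1 (i + 1)\<^esub> b \<in> tors R (CK i) S (CX i n)"
    using b A.tors_X_zero[OF Sc] C_tors_iff[OF Sc] by simp
  moreover have "Cd i (pr \<zero>\<^bsub>K1 (i + 1)\<^esub> b) = \<zero>\<^bsub>CK (i + 1)\<^esub>"
    unfolding Cd_pr CK_simps A.d_zero map_zero b(2) A0.M.a_inv_zero by simp
  ultimately have "pr \<zero>\<^bsub>K1 (i + 1)\<^esub> b \<in> Cd (i - 1) ` tors R (CK (i - 1)) S (CX (i - 1) n)"
    using ex(1) unfolding exact_at_def by blast
  then obtain a' b' where a': "a' \<in> tors R (K1 i) S (X1 i (n - s))" "b' \<in> tors R (K2 (i - 1)) S (X2 (i - 1) n)"
    "pr \<zero>\<^bsub>K1 (i + 1)\<^esub> b = Cd (i - 1) (pr a' b')"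
    using C_tors_iff[OF Sc, of _ _ "i - 1"] by (auto elim!: C_torsE[OF Sc])
  have 1: "\<ominus>\<^bsub>K1 (i + 1)\<^esub> d1 i a' = \<zero>\<^bsub>K1 (i + 1)\<^esub>" and 2: "b = \<phi> i a' \<oplus>\<^bsub>K2 i\<^esub> d2 (i - 1) b'"
    using a'(3) by (simp_all add: Cd_pr)
  have "d1 i a' \<in> carrier (K1 (i + 1))"
    using A.d_closed[OF torsD[OF a'(1)]] A.X_carrier by blast
  with 1 have "d1 i a' = \<zero>\<^bsub>K1 (i + 1)\<^esub>"
    by (metis A'.M.add.inv_eq_1_iff)
  with ex(2) a'(1) obtain a'' where a'': "a'' \<in> tors R (K1 (i - 1)) S (X1 (i - 1) (n - s))" "a' = d1 (i - 1) a''"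
    unfolding exact_at_def by auto
  have f: "\<phi> (i - 1) a'' \<in> tors R (K2 (i - 1)) S (X2 (i - 1) n)" by (rule map_tors[OF S a''(1)])
  have "b = d2 (i - 1) (\<phi> (i - 1) a'' \<oplus>\<^bsub>K2 (i - 1)\<^esub> b')"
    using 2 map_d[OF torsD[OF a''(1)]] B.d_add[OF torsD[OF f] torsD[OF a'(2)]] by (simp add: a''(2))
  then show "b \<in> d2 (i - 1) ` tors R (K2 (i - 1)) S (X2 (i - 1) n)"
    using B.tors_X_add[OF Sc f a'(2)] by blast
qed

end


section \<open>Homogeneous primes and almost regular elements\<close>

text \<open>Degree \<open>n\<close> part of \<open>N + R u\<close> for \<open>u\<close> of degree
  \<open>m\<close>, where \<open>mu = (m, u)\<close>. Folding it over a list expresses generation by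
  finitely many homogeneous elements within each degree, without sums over the list.\<close>

definition adjoin_element ::
  "(int \<Rightarrow> 'a set) \<Rightarrow> ('a, 'w, 'z) module_scheme \<Rightarrow> (int \<Rightarrow> 'w set) \<Rightarrow> int \<times> 'w \<Rightarrow> int \<Rightarrow> 'w set" where
  "adjoin_element P V N mu n = {v \<oplus>\<^bsub>V\<^esub> r \<odot>\<^bsub>V\<^esub> snd mu | v r. v \<in> N n \<and> r \<in> P (n - fst mu)}"

text \<open>A homogeneous ideal as the family of its graded pieces; the order on functions is then
  inclusion of ideals.\<close>

definition (in graded_scalars) hom_ideal :: "(int \<Rightarrow> 'a set) \<Rightarrow> bool" where
  "hom_ideal p \<longleftrightarrow> (\<forall>e. p e \<subseteq> P e \<and> \<zero> \<in> p e \<and> (\<forall>a\<in>p e. \<forall>b\<in>p e. a \<oplus> b \<in> p e)) \<and>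
     (\<forall>e e'. \<forall>a\<in>p e. \<forall>r\<in>P e'. r \<otimes> a \<in> p (e + e'))"

definition (in graded_scalars) hom_prime :: "(int \<Rightarrow> 'a set) \<Rightarrow> bool" where
  "hom_prime p \<longleftrightarrow> hom_ideal p \<and> \<one> \<notin> p 0 \<and>
     (\<forall>e e'. \<forall>r\<in>P e. \<forall>s\<in>P e'. r \<otimes> s \<in> p (e + e') \<longrightarrow> r \<in> p e \<or> s \<in> p e')"

text \<open>\<open>G_generates\<close> states R_{e+1} = G R_e as an induction rule: a set closed
  under sums that contains the products contains R_{e+1}. \<open>hom_ideal_wf\<close> is the
  ascending chain condition for homogeneous ideals, oriented so that well-founded induction passes
  to larger ideals.\<close>

locale graded_noetherian = graded_scalars R P
  for R :: "('a, 'r) ring_scheme" (structure) and P +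
  fixes G :: "'a set"
  assumes P_zero: "\<zero> \<in> P e"
    and P_add: "a \<in> P e \<Longrightarrow> b \<in> P e \<Longrightarrow> a \<oplus> b \<in> P e"
    and P_neg: "a \<in> P e \<Longrightarrow> \<ominus> a \<in> P e"
    and P_negative: "e < 0 \<Longrightarrow> P e = {\<zero>}"
    and G_finite: "finite G"
    and G_sub: "G \<subseteq> P 1"
    and G_generates: "0 \<le> e \<Longrightarrow> r \<in> P (e + 1) \<Longrightarrow> \<zero> \<in> Q \<Longrightarrow>
      (\<And>a b. a \<in> Q \<Longrightarrow> b \<in> Q \<Longrightarrow> a \<oplus> b \<in> Q) \<Longrightarrow>
      (\<And>g t. g \<in> G \<Longrightarrow> t \<in> P e \<Longrightarrow> g \<otimes> t \<in> Q) \<Longrightarrow> r \<in> Q"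
    and hom_ideal_wf: "wf {(q, p). hom_ideal p \<and> hom_ideal q \<and> p \<le> q \<and> p \<noteq> q}"
begin

section \<open>Homogeneous prime avoidance\<close>

lemma hom_prime_ideal: "hom_prime p \<Longrightarrow> hom_ideal p"
  by (simp add: hom_prime_def)

lemma hom_idealD:
  assumes "hom_ideal p"
  shows "a \<in> p e \<Longrightarrow> a \<in> P e" "\<zero> \<in> p e" "a \<in> p e \<Longrightarrow> b \<in> p e \<Longrightarrow> a \<oplus> b \<in> p e"
    "a \<in> p e \<Longrightarrow> r \<in> P e' \<Longrightarrow> r \<otimes> a \<in> p (e + e')"
    "a \<in> p e \<Longrightarrow> r \<in> P e' \<Longrightarrow> a \<otimes> r \<in> p (e + e')"
proof -
  show *: "a \<in> P e" if "a \<in> p e" for a using assms that unfolding hom_ideal_def by blast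
  show "\<zero> \<in> p e" "a \<in> p e \<Longrightarrow> b \<in> p e \<Longrightarrow> a \<oplus> b \<in> p e"
    "a \<in> p e \<Longrightarrow> r \<in> P e' \<Longrightarrow> r \<otimes> a \<in> p (e + e')"
    using assms unfolding hom_ideal_def by blast+
  then show "a \<in> p e \<Longrightarrow> r \<in> P e' \<Longrightarrow> a \<otimes> r \<in> p (e + e')"
    using * P_carrier by (metis m_comm)
qed

lemma hom_ideal_neg: "hom_ideal p \<Longrightarrow> a \<in> p e \<Longrightarrow> \<ominus> a \<in> p e"
  using hom_idealD(4)[of p a e "\<ominus> \<one>" 0] hom_idealD(1)[of p a e] P_neg[OF P_one] P_carrier
  by (simp add: l_minus)

lemma hom_ideal_add_cancel:
  assumes "hom_ideal p" "a \<in> p e" "b \<in> P e" "b \<oplus> a \<in> p e"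
  shows "b \<in> p e"
proof -
  have "(b \<oplus> a) \<oplus> (\<ominus> a) \<in> p e"
    using assms hom_ideal_neg hom_idealD(3) by blast
  moreover have "(b \<oplus> a) \<oplus> (\<ominus> a) = b"
    using assms hom_idealD(1) P_carrier by (metis add.inv_solve_right' add.m_closed)
  ultimately show ?thesis by simp
qed

lemma hom_prime_not: "hom_prime p \<Longrightarrow> r \<in> P e \<Longrightarrow> s \<in> P e' \<Longrightarrow> r \<notin> p e \<Longrightarrow> s \<notin> p e' \<Longrightarrow>
    r \<otimes> s \<notin> p (e + e')"
  unfolding hom_prime_def by blast

lemma hom_prime_pow:
  assumes "hom_prime p" "r \<in> P e" "r \<notin> p e"
  shows "r [^] (k::nat) \<notin> p (int k * e)"
proof (induction k)
  case 0
  then show ?case using assms by (simp add: hom_prime_def)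
next
  case (Suc k)
  have "r [^] k \<otimes> r \<notin> p (int k * e + e)"
    by (rule hom_prime_not[OF assms(1) P_pow[OF assms(2)] assms(2) Suc assms(3)])
  then show ?case by (simp add: algebra_simps)
qed

lemma hom_ideal_positive:
  assumes p: "hom_ideal p" and G: "G \<subseteq> p 1" and "e > 0" "r \<in> P e"
  shows "r \<in> p e"
proof (rule G_generates[of "e - 1"])
  show "0 \<le> e - 1" "r \<in> P (e - 1 + 1)" using assms by auto
  show "\<zero> \<in> p e" "\<And>a b. a \<in> p e \<Longrightarrow> b \<in> p e \<Longrightarrow> a \<oplus> b \<in> p e" using hom_idealD[OF p] by blast+
  fix g t assume "g \<in> G" "t \<in> P (e - 1)"
  then show "g \<otimes> t \<in> p e" using hom_idealD(5)[OF p, of g 1 t "e - 1"] G by auto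
qed

text \<open>Powers of \<open>z\<close> give an element outside \<open>p\<close> in every degree from
  0 on. For each \<open>q\<close> a factor from \<open>q\<close> outside \<open>p\<close> is
  multiplied in, which raises the bound by the absolute value of its degree. Because
  \<open>z\<close> has degree one, every large degree is reached, not only multiples of some
  number.\<close>

lemma prime_separation:
  assumes p: "hom_prime p" "z \<in> P 1" "z \<notin> p 1"
    and "finite Q" "\<And>q. q \<in> Q \<Longrightarrow> hom_ideal q \<and> (\<exists>e. \<not> q e \<subseteq> p e)"
  shows "\<exists>s0\<ge>0. \<forall>s\<ge>s0. \<exists>c\<in>P s. c \<notin> p s \<and> (\<forall>q\<in>Q. c \<in> q s)"
  using assms(4,5)
proof (induction Q)
  case empty
  have "\<exists>c\<in>P s. c \<notin> p s" if "s \<ge> 0" for s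
    using hom_prime_pow[OF p, of "nat s"] P_pow[OF p(2), of "nat s"] that by auto
  then show ?case by auto
next
  case (insert q Q)
  have "\<exists>s0\<ge>0. \<forall>s\<ge>s0. \<exists>c\<in>P s. c \<notin> p s \<and> (\<forall>q\<in>Q. c \<in> q s)"
    by (rule insert.IH) (use insert.prems in simp)
  then obtain s0 where s0: "s0 \<ge> 0" "\<And>s. s \<ge> s0 \<Longrightarrow> \<exists>c\<in>P s. c \<notin> p s \<and> (\<forall>q\<in>Q. c \<in> q s)"
    by blast
  from insert.prems(1)[of q] obtain e c0 where c0: "c0 \<in> q e" "c0 \<notin> p e" and q: "hom_ideal q"
    by auto
  have c0P: "c0 \<in> P e" using hom_idealD(1)[OF q c0(1)] .
  have "\<exists>c\<in>P s. c \<notin> p s \<and> (\<forall>q\<in>insert q Q. c \<in> q s)" if s: "s \<ge> s0 + \<bar>e\<bar>" for s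
  proof -
    have "s - e \<ge> s0" using s by linarith
    then obtain c where c: "c \<in> P (s - e)" "c \<notin> p (s - e)" "\<And>q. q \<in> Q \<Longrightarrow> c \<in> q (s - e)"
      using s0 by blast
    have "c \<otimes> c0 \<in> P s" using P_mult[OF c(1) c0P] by simp
    moreover have "c \<otimes> c0 \<notin> p s" using hom_prime_not[OF p(1) c(1) c0P c(2) c0(2)] by simp
    moreover have "c \<otimes> c0 \<in> q s" using hom_idealD(4)[OF q c0(1) c(1)] by simp
    moreover have "c \<otimes> c0 \<in> q' s" if "q' \<in> Q" for q'
      using hom_idealD(5)[of q' c "s - e" c0 e] c(3)[OF that] c0P insert.prems that by simp
    ultimately show ?thesis by blast
  qed
  then show ?case using s0(1) by (intro exI[of _ "s0 + \<bar>e\<bar>"]) auto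
qed

text \<open>The usual proof adds auxiliary elements, which here must share a common degree.
  Separation provides them in every large degree; in particular avoiding elements exist in two
  consecutive degrees.\<close>

lemma prime_avoidance:
  assumes "finite Ps" "\<And>p. p \<in> Ps \<Longrightarrow> hom_prime p \<and> \<not> G \<subseteq> p 1"
  shows "\<exists>s0\<ge>0. \<forall>s\<ge>s0. \<exists>x\<in>P s. \<forall>p\<in>Ps. x \<notin> p s"
  using assms
proof (induction "card Ps" arbitrary: Ps rule: less_induct)
  case less
  show ?case
  proof (cases "\<exists>p\<in>Ps. \<exists>q\<in>Ps. p \<noteq> q \<and> (\<forall>e. p e \<subseteq> q e)")
    case True
    then obtain p q where pq: "p \<in> Ps" "q \<in> Ps" "p \<noteq> q" "\<And>e. p e \<subseteq> q e" by blast
    have "card (Ps - {p}) < card Ps" using pq less.prems by (metis card_Diff1_less)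
    with less obtain s0 where s0: "s0 \<ge> 0" "\<And>s. s \<ge> s0 \<Longrightarrow> \<exists>x\<in>P s. \<forall>p\<in>Ps - {p}. x \<notin> p s"
      by (metis DiffE finite_Diff)
    have "\<exists>x\<in>P s. \<forall>p\<in>Ps. x \<notin> p s" if "s \<ge> s0" for s
    proof -
      from s0(2)[OF that] obtain x where x: "x \<in> P s" "\<forall>p\<in>Ps - {p}. x \<notin> p s" by blast
      then have "x \<notin> p s" using pq by blast
      with x show ?thesis by blast
    qed
    with s0(1) show ?thesis by blast
  next
    case False
    have "\<exists>s0\<ge>0. \<forall>s\<ge>s0. \<exists>c\<in>P s. c \<notin> p s \<and> (\<forall>q\<in>Ps - {p}. c \<in> q s)" if p: "p \<in> Ps" for p
    proof -
      obtain z where "z \<in> G" "z \<notin> p 1" using less.prems p by blast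
      then show ?thesis
        using less.prems p False G_sub
        by (intro prime_separation[of p z]) (auto simp: hom_prime_ideal)
    qed
    then obtain s1 where s1: "\<And>p s. p \<in> Ps \<Longrightarrow> s \<ge> s1 p \<Longrightarrow>
        \<exists>c\<in>P s. c \<notin> p s \<and> (\<forall>q\<in>Ps - {p}. c \<in> q s)"
      by metis
    obtain s0 where s0: "s0 \<ge> 0" "\<And>p. p \<in> Ps \<Longrightarrow> s1 p \<le> s0"
    proof -
      have fin: "finite (insert 0 (s1 ` Ps))" using less.prems by simp
      show thesis
        by (rule that[of "Max (insert 0 (s1 ` Ps))"]) (use fin in auto)
    qed
    \<comment> \<open>The sum is built one prime at a time: \<open>x\<close> avoids the primes in
      \<open>Q\<close> and lies in all others. The element for the next prime \<open>p\<close> lies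
      in every prime but \<open>p\<close>, so adding it spoils nothing and moves the sum out of
      \<open>p\<close>.\<close>
    have "\<exists>x\<in>P s. (\<forall>p\<in>Q. x \<notin> p s) \<and> (\<forall>p\<in>Ps - Q. x \<in> p s)" if s: "s \<ge> s0" and "finite Q" "Q \<subseteq> Ps" for s Q
      using that(2,3)
    proof (induction Q)
      case empty
      have "\<forall>p\<in>Ps. \<zero> \<in> p s" using less.prems(2) by (simp add: hom_prime_ideal hom_idealD(2))
      then show ?case using P_zero by (intro bexI[of _ \<zero>]) auto
    next
      case (insert p Q)
      then obtain x where x: "x \<in> P s" "\<And>q. q \<in> Q \<Longrightarrow> x \<notin> q s" "\<And>q. q \<in> Ps - Q \<Longrightarrow> x \<in> q s" by blast
      have pPs: "p \<in> Ps" using insert.prems by simp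
      have "s1 p \<le> s" using s0(2)[OF pPs] s by linarith
      from s1[OF pPs this] obtain c where c: "c \<in> P s" "c \<notin> p s" "\<forall>q\<in>Ps - {p}. c \<in> q s"
        by (elim bexE conjE)
      have id: "hom_ideal q" if "q \<in> Ps" for q
        using less.prems(2)[OF that] by (simp add: hom_prime_ideal)
      have comm: "x \<oplus> c = c \<oplus> x" by (rule a_comm[OF P_carrier[OF x(1)] P_carrier[OF c(1)]])
      have "x \<oplus> c \<in> P s" by (rule P_add[OF x(1) c(1)])
      moreover have "x \<oplus> c \<notin> q s" if q: "q \<in> insert p Q" for q
      proof (cases "q = p")
        case True
        have "x \<in> p s" using x(3)[of p] pPs insert.hyps by simp
        then show ?thesis
          using hom_ideal_add_cancel[OF id[OF pPs] _ c(1)] c(2) comm True by auto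
      next
        case False
        then have "q \<in> Q" "q \<in> Ps" using q insert.prems by auto
        then have "x \<notin> q s" "c \<in> q s" using x(2) c(3) False by auto
        then show ?thesis
          using hom_ideal_add_cancel[OF id[OF \<open>q \<in> Ps\<close>] _ x(1)] by blast
      qed
      moreover have "x \<oplus> c \<in> q s" if q: "q \<in> Ps - insert p Q" for q
        using q by (intro hom_idealD(3)[OF id] x(3) bspec[OF c(3)]) auto
      ultimately show ?case by blast
    qed
    from this[OF _ less.prems(1)] show ?thesis using s0(1) by blast
  qed
qed

end

section \<open>Prime filtrations of finitely generated graded modules\<close>

locale graded_noetherian_module = graded_noetherian R P G + V?: module R V
  for R :: "('a, 'r) ring_scheme" (structure) and P G
    and V :: "('a, 'w, 'z) module_scheme" +
  fixes X :: "int \<Rightarrow> 'w set"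
  assumes X_sub: "X n \<subseteq> carrier V"
    and X_zero: "\<zero>\<^bsub>V\<^esub> \<in> X n"
    and X_add: "x \<in> X n \<Longrightarrow> y \<in> X n \<Longrightarrow> x \<oplus>\<^bsub>V\<^esub> y \<in> X n"
    and X_smult: "r \<in> P e \<Longrightarrow> x \<in> X n \<Longrightarrow> r \<odot>\<^bsub>V\<^esub> x \<in> X (n + e)"
begin

definition hom_submodule :: "(int \<Rightarrow> 'w set) \<Rightarrow> bool" where
  "hom_submodule N \<longleftrightarrow> (\<forall>n. N n \<subseteq> X n \<and> \<zero>\<^bsub>V\<^esub> \<in> N n \<and> (\<forall>x\<in>N n. \<forall>y\<in>N n. x \<oplus>\<^bsub>V\<^esub> y \<in> N n)) \<and>
     (\<forall>n e. \<forall>x\<in>N n. \<forall>r\<in>P e. r \<odot>\<^bsub>V\<^esub> x \<in> N (n + e))"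

abbreviation "adjoin \<equiv> adjoin_element P V"

definition colon :: "(int \<Rightarrow> 'w set) \<Rightarrow> int \<times> 'w \<Rightarrow> int \<Rightarrow> 'a set" where
  "colon N mu e = {r \<in> P e. r \<odot>\<^bsub>V\<^esub> snd mu \<in> N (fst mu + e)}"

text \<open>What a finite filtration between \<open>N\<close> and \<open>L\<close> with shifted quotients \<open>R/p\<close> by homogeneous
  primes yields: \<open>Ps\<close> consists of the occurring primes that do not contain the irrelevant ideal,
  \<open>A\<close> of the degrees of the generators of the other quotients.\<close>

definition controlled :: "(int \<Rightarrow> 'w set) \<Rightarrow> (int \<Rightarrow> 'w set) \<Rightarrow> bool" where
  "controlled N L \<longleftrightarrow> (\<exists>A Ps. finite A \<and> finite Ps \<and> (\<forall>p\<in>Ps. hom_prime p \<and> \<not> G \<subseteq> p 1) \<and>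
     (\<forall>n u. u \<in> L n \<and> n \<notin> A \<and> u \<notin> N n \<longrightarrow>
        (\<forall>s. \<forall>x\<in>P s. (\<forall>p\<in>Ps. x \<notin> p s) \<longrightarrow> x \<odot>\<^bsub>V\<^esub> u \<notin> N (n + s)) \<and>
        (\<exists>z\<in>G. \<forall>k::nat. (z [^] k) \<odot>\<^bsub>V\<^esub> u \<notin> N (n + int k))))"

lemma hom_submoduleD:
  assumes "hom_submodule N"
  shows "x \<in> N n \<Longrightarrow> x \<in> X n" "\<zero>\<^bsub>V\<^esub> \<in> N n" "x \<in> N n \<Longrightarrow> y \<in> N n \<Longrightarrow> x \<oplus>\<^bsub>V\<^esub> y \<in> N n"
    "x \<in> N n \<Longrightarrow> r \<in> P e \<Longrightarrow> r \<odot>\<^bsub>V\<^esub> x \<in> N (n + e)" "x \<in> N n \<Longrightarrow> x \<in> carrier V"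
  using assms X_sub unfolding hom_submodule_def by blast+

lemma hom_submodule_neg: "hom_submodule N \<Longrightarrow> x \<in> N n \<Longrightarrow> \<ominus>\<^bsub>V\<^esub> x \<in> N n"
  using hom_submoduleD(4)[of N x n "\<ominus> \<one>" 0] hom_submoduleD(5)[of N x n] P_neg[OF P_one]
  by (simp add: smult_l_minus)

lemma hom_submodule_add_cancel:
  assumes "hom_submodule N" "v \<in> N n" "x \<in> carrier V" "v \<oplus>\<^bsub>V\<^esub> x \<in> N n"
  shows "x \<in> N n"
proof -
  have "\<ominus>\<^bsub>V\<^esub> v \<oplus>\<^bsub>V\<^esub> (v \<oplus>\<^bsub>V\<^esub> x) \<in> N n"
    using assms hom_submodule_neg hom_submoduleD(3) by blast
  moreover have "\<ominus>\<^bsub>V\<^esub> v \<oplus>\<^bsub>V\<^esub> (v \<oplus>\<^bsub>V\<^esub> x) = x"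
    using assms hom_submoduleD(5) by (simp add: V.M.r_neg1)
  ultimately show ?thesis by simp
qed

lemma hom_submodule_colon:
  assumes "hom_submodule N" "u \<in> X m"
  shows "hom_ideal (colon N (m, u))"
proof -
  have u: "u \<in> carrier V" using assms X_sub by blast
  have "r \<otimes> a \<in> colon N (m, u) (e + e')" if a: "a \<in> colon N (m, u) e" and r: "r \<in> P e'" for a r e e'
  proof -
    have aP: "a \<in> P e" "a \<odot>\<^bsub>V\<^esub> u \<in> N (m + e)" using a by (auto simp: colon_def)
    have "r \<odot>\<^bsub>V\<^esub> (a \<odot>\<^bsub>V\<^esub> u) \<in> N (m + e + e')" by (rule hom_submoduleD(4)[OF assms(1) aP(2) r])
    then have "(r \<otimes> a) \<odot>\<^bsub>V\<^esub> u \<in> N (m + (e + e'))"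
      using aP r u P_carrier by (simp add: smult_assoc1 add.assoc)
    moreover have "r \<otimes> a \<in> P (e + e')" using P_mult[OF r aP(1)] by (simp add: add.commute)
    ultimately show ?thesis by (simp add: colon_def)
  qed
  moreover have "\<zero> \<in> colon N (m, u) e" for e
    using u hom_submoduleD(2)[OF assms(1)] P_zero by (simp add: colon_def)
  moreover have "a \<oplus> b \<in> colon N (m, u) e" if "a \<in> colon N (m, u) e" "b \<in> colon N (m, u) e" for a b e
    using that u P_carrier hom_submoduleD(3)[OF assms(1)] P_add by (auto simp: colon_def smult_l_distr)
  moreover have "colon N (m, u) e \<subseteq> P e" for e by (auto simp: colon_def)
  ultimately show ?thesis unfolding hom_ideal_def by blast
qed

lemma adjoinI: "v \<in> N n \<Longrightarrow> r \<in> P (n - m) \<Longrightarrow> v \<oplus>\<^bsub>V\<^esub> r \<odot>\<^bsub>V\<^esub> u \<in> adjoin N (m, u) n"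
  by (auto simp: adjoin_element_def)

lemma hom_submodule_adjoin:
  assumes N: "hom_submodule N" and u: "u \<in> X m"
  shows "hom_submodule (adjoin N (m, u))" "N n \<subseteq> adjoin N (m, u) n"
proof -
  have uc: "u \<in> carrier V" using assms X_sub by blast
  have "adjoin N (m, u) n \<subseteq> X n" for n
  proof -
    have "r \<odot>\<^bsub>V\<^esub> u \<in> X n" if "r \<in> P (n - m)" for r using X_smult[OF that u] by simp
    then show ?thesis using X_add[OF hom_submoduleD(1)[OF N]] by (auto simp: adjoin_element_def)
  qed
  moreover have NN: "N n \<subseteq> adjoin N (m, u) n" for n
  proof
    fix v assume v: "v \<in> N n"
    then have "v = v \<oplus>\<^bsub>V\<^esub> \<zero> \<odot>\<^bsub>V\<^esub> u" using uc hom_submoduleD(5)[OF N] by simp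
    then show "v \<in> adjoin N (m, u) n" using adjoinI[of v N n \<zero> m u] v P_zero by simp
  qed
  moreover have "\<zero>\<^bsub>V\<^esub> \<in> adjoin N (m, u) n" for n using NN hom_submoduleD(2)[OF N] by blast
  moreover have "x \<oplus>\<^bsub>V\<^esub> y \<in> adjoin N (m, u) n" if "x \<in> adjoin N (m, u) n" "y \<in> adjoin N (m, u) n" for x y n
  proof -
    from that obtain v r v' r' where *: "x = v \<oplus>\<^bsub>V\<^esub> r \<odot>\<^bsub>V\<^esub> u" "y = v' \<oplus>\<^bsub>V\<^esub> r' \<odot>\<^bsub>V\<^esub> u"
      "v \<in> N n" "v' \<in> N n" "r \<in> P (n - m)" "r' \<in> P (n - m)" by (auto simp: adjoin_element_def)
    then have "x \<oplus>\<^bsub>V\<^esub> y = (v \<oplus>\<^bsub>V\<^esub> v') \<oplus>\<^bsub>V\<^esub> (r \<oplus> r') \<odot>\<^bsub>V\<^esub> u"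
      using uc hom_submoduleD(5)[OF N] P_carrier by (simp add: smult_l_distr V.M.a_ac)
    then show ?thesis
      by (simp only:) (intro adjoinI hom_submoduleD(3)[OF N] P_add *(3-6))
  qed
  moreover have "r \<odot>\<^bsub>V\<^esub> x \<in> adjoin N (m, u) (n + e)" if x: "x \<in> adjoin N (m, u) n" and r: "r \<in> P e" for x r n e
  proof -
    from x obtain v t where *: "x = v \<oplus>\<^bsub>V\<^esub> t \<odot>\<^bsub>V\<^esub> u" "v \<in> N n" "t \<in> P (n - m)"
      by (auto simp: adjoin_element_def)
    then have "r \<odot>\<^bsub>V\<^esub> x = r \<odot>\<^bsub>V\<^esub> v \<oplus>\<^bsub>V\<^esub> (r \<otimes> t) \<odot>\<^bsub>V\<^esub> u"
      using uc hom_submoduleD(5)[OF N] P_carrier r by (simp add: smult_r_distr smult_assoc1)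
    moreover have "r \<otimes> t \<in> P (n + e - m)" using P_mult[OF r *(3)] by (simp add: algebra_simps)
    ultimately show ?thesis using hom_submoduleD(4)[OF N *(2) r]
      by (simp only:) (intro adjoinI)
  qed
  ultimately show "hom_submodule (adjoin N (m, u))" unfolding hom_submodule_def by blast
  show "N n \<subseteq> adjoin N (m, u) n" by (rule NN)
qed

lemma hom_submodule_foldl:
  assumes "hom_submodule N" "\<And>m u. (m, u) \<in> set us \<Longrightarrow> u \<in> X m"
  shows "hom_submodule (foldl adjoin N us) \<and> (\<forall>n. N n \<subseteq> foldl adjoin N us n)"
  using assms
proof (induction us arbitrary: N)
  case (Cons mu us)
  obtain m u where mu: "mu = (m, u)" by force
  have u: "u \<in> X m" using Cons.prems(2) mu by simp
  have "hom_submodule (foldl adjoin (adjoin N mu) us) \<and>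
      (\<forall>n. adjoin N mu n \<subseteq> foldl adjoin (adjoin N mu) us n)"
    using hom_submodule_adjoin(1)[OF Cons.prems(1) u] Cons.prems(2) mu by (intro Cons.IH) auto
  then show ?case using hom_submodule_adjoin(2)[OF Cons.prems(1) u] unfolding mu foldl_Cons
    by (metis subset_trans)
qed simp

text \<open>An element of \<open>L\<close> is handled by the first filtration. For one outside
  \<open>L\<close> the second keeps its multiples outside \<open>L\<close>, hence outside
  \<open>N\<close>.\<close>

lemma controlled_trans:
  assumes "controlled N L" "controlled L L'" "\<And>n. N n \<subseteq> L n"
  shows "controlled N L'"
proof -
  obtain A Ps where 1: "finite A" "finite Ps" "\<forall>p\<in>Ps. hom_prime p \<and> \<not> G \<subseteq> p 1"
     "\<And>n u. u \<in> L n \<Longrightarrow> n \<notin> A \<Longrightarrow> u \<notin> N n \<Longrightarrow>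
        (\<forall>s. \<forall>x\<in>P s. (\<forall>p\<in>Ps. x \<notin> p s) \<longrightarrow> x \<odot>\<^bsub>V\<^esub> u \<notin> N (n + s)) \<and>
        (\<exists>z\<in>G. \<forall>k::nat. (z [^] k) \<odot>\<^bsub>V\<^esub> u \<notin> N (n + int k))"
    using assms(1) unfolding controlled_def by metis
  obtain A' Ps' where 2: "finite A'" "finite Ps'" "\<forall>p\<in>Ps'. hom_prime p \<and> \<not> G \<subseteq> p 1"
     "\<And>n u. u \<in> L' n \<Longrightarrow> n \<notin> A' \<Longrightarrow> u \<notin> L n \<Longrightarrow>
        (\<forall>s. \<forall>x\<in>P s. (\<forall>p\<in>Ps'. x \<notin> p s) \<longrightarrow> x \<odot>\<^bsub>V\<^esub> u \<notin> L (n + s)) \<and>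
        (\<exists>z\<in>G. \<forall>k::nat. (z [^] k) \<odot>\<^bsub>V\<^esub> u \<notin> L (n + int k))"
    using assms(2) unfolding controlled_def by metis
  have key: "(\<forall>s. \<forall>x\<in>P s. (\<forall>p\<in>Ps \<union> Ps'. x \<notin> p s) \<longrightarrow> x \<odot>\<^bsub>V\<^esub> u \<notin> N (n + s)) \<and>
        (\<exists>z\<in>G. \<forall>k::nat. (z [^] k) \<odot>\<^bsub>V\<^esub> u \<notin> N (n + int k))"
    if u: "u \<in> L' n \<and> n \<notin> A \<union> A' \<and> u \<notin> N n" for n u
  proof (cases "u \<in> L n")
    case True
    have "n \<notin> A" "u \<notin> N n" using u by auto
    from 1(4)[OF True this] show ?thesis by (meson UnI1)
  next
    case False
    have "u \<in> L' n" "n \<notin> A'" using u by auto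
    from 2(4)[OF this False] show ?thesis using subsetD[OF assms(3)] by (meson UnI2)
  qed
  have "\<forall>p\<in>Ps \<union> Ps'. hom_prime p \<and> \<not> G \<subseteq> p 1" using 1(3) 2(3) by blast
  then show ?thesis unfolding controlled_def
    using 1(1,2) 2(1,2) key by (intro exI[of _ "A \<union> A'"] exI[of _ "Ps \<union> Ps'"] conjI allI) auto
qed

lemma controlled_mono:
  assumes "controlled N L" "\<And>n. L' n \<subseteq> L n"
  shows "controlled N L'"
proof -
  from assms(1) obtain A Ps where "finite A" "finite Ps" "\<forall>p\<in>Ps. hom_prime p \<and> \<not> G \<subseteq> p 1"
     "\<forall>n u. u \<in> L n \<and> n \<notin> A \<and> u \<notin> N n \<longrightarrow>
        (\<forall>s. \<forall>x\<in>P s. (\<forall>p\<in>Ps. x \<notin> p s) \<longrightarrow> x \<odot>\<^bsub>V\<^esub> u \<notin> N (n + s)) \<and>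
        (\<exists>z\<in>G. \<forall>k::nat. (z [^] k) \<odot>\<^bsub>V\<^esub> u \<notin> N (n + int k))"
    unfolding controlled_def by (elim exE conjE)
  then show ?thesis
    unfolding controlled_def using subsetD[OF assms(2)]
    by (intro exI[of _ A] exI[of _ Ps]) simp
qed

lemma controlled_refl: "(\<And>n. L n \<subseteq> N n) \<Longrightarrow> controlled N L"
  unfolding controlled_def by (intro exI[of _ "{}"]) auto

text \<open>The quotient of \<open>N + R u\<close> by \<open>N\<close> is a shifted copy of
  \<open>R/p\<close>, on which every homogeneous element outside \<open>p\<close> acts
  injectively.\<close>

lemma controlled_prime:
  assumes N: "hom_submodule N" and u: "u \<in> X m" and p: "hom_prime (colon N (m, u))"
  shows "controlled N (adjoin N (m, u))"
proof -
  define p where "p = colon N (m, u)"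
  have pp: "hom_prime p" and pi: "hom_ideal p" using p hom_prime_ideal by (auto simp: p_def)
  have uc: "u \<in> carrier V" using assms X_sub by blast
  have key: "x \<otimes> r \<in> p (s + (n - m))" if "v \<in> N n" "r \<in> P (n - m)" "x \<in> P s"
    "x \<odot>\<^bsub>V\<^esub> (v \<oplus>\<^bsub>V\<^esub> r \<odot>\<^bsub>V\<^esub> u) \<in> N (n + s)" for v r n x s
  proof -
    have vc: "v \<in> carrier V" "r \<in> carrier R" "x \<in> carrier R"
      using that hom_submoduleD(5)[OF N] P_carrier by blast+
    have "x \<odot>\<^bsub>V\<^esub> (v \<oplus>\<^bsub>V\<^esub> r \<odot>\<^bsub>V\<^esub> u) = x \<odot>\<^bsub>V\<^esub> v \<oplus>\<^bsub>V\<^esub> (x \<otimes> r) \<odot>\<^bsub>V\<^esub> u"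
      using vc uc by (simp add: smult_r_distr smult_assoc1)
    with hom_submodule_add_cancel[OF N hom_submoduleD(4)[OF N that(1,3)], of "(x \<otimes> r) \<odot>\<^bsub>V\<^esub> u"]
    have "(x \<otimes> r) \<odot>\<^bsub>V\<^esub> u \<in> N (n + s)" using that(4) vc uc by simp
    then show ?thesis using P_mult[OF that(3,2)] by (simp add: p_def colon_def add.commute)
  qed
  have notp: "r \<notin> p (n - m)" if "v \<in> N n" "r \<in> P (n - m)" "v \<oplus>\<^bsub>V\<^esub> r \<odot>\<^bsub>V\<^esub> u \<notin> N n" for v r n
    using that hom_submoduleD(3)[OF N] by (auto simp: p_def colon_def)
  show ?thesis
  proof (cases "G \<subseteq> p 1")
    \<comment> \<open>Then \<open>p\<close> contains every homogeneous element of positive degree.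
      So the quotient lives in the single degree \<open>m\<close>, which becomes the exceptional
      one.\<close>
    case True
    have "x \<in> N n" if x: "x \<in> adjoin N (m, u) n" and n: "n \<noteq> m" for x n
    proof -
      from x obtain v r where *: "x = v \<oplus>\<^bsub>V\<^esub> r \<odot>\<^bsub>V\<^esub> u" "v \<in> N n" "r \<in> P (n - m)"
        by (auto simp: adjoin_element_def)
      have "r \<in> p (n - m)"
      proof (cases "n - m > 0")
        case pos: True
        then show ?thesis using hom_ideal_positive[OF pi True] * by blast
      next
        case False
        then have "r = \<zero>" using * P_negative[of "n - m"] n by simp
        then show ?thesis using hom_idealD(2)[OF pi] by simp
      qed
      then show ?thesis using notp * by blast
    qed
    then show ?thesis unfolding controlled_def by (intro exI[of _ "{m}"] exI[of _ "{}"]) auto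
  next
    case False
    then obtain z where z: "z \<in> G" "z \<notin> p 1" by blast
    have "(\<forall>s. \<forall>t\<in>P s. t \<notin> p s \<longrightarrow> t \<odot>\<^bsub>V\<^esub> x \<notin> N (n + s)) \<and>
        (\<exists>z\<in>G. \<forall>k::nat. (z [^] k) \<odot>\<^bsub>V\<^esub> x \<notin> N (n + int k))"
      if x: "x \<in> adjoin N (m, u) n" and xN: "x \<notin> N n" for n x
    proof -
      from x obtain v r where *: "x = v \<oplus>\<^bsub>V\<^esub> r \<odot>\<^bsub>V\<^esub> u" "v \<in> N n" "r \<in> P (n - m)"
        by (auto simp: adjoin_element_def)
      have r: "r \<notin> p (n - m)" using notp * xN by blast
      have not: "t \<odot>\<^bsub>V\<^esub> x \<notin> N (n + s)" if t: "t \<in> P s" "t \<notin> p s" for t s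
        using key[OF *(2,3) t(1)] hom_prime_not[OF pp t(1) *(3) t(2) r] unfolding *(1) by blast
      have zP: "z \<in> P 1" using z G_sub by blast
      have "z [^] k \<notin> p (int k)" "z [^] k \<in> P (int k)" for k :: nat
        using hom_prime_pow[OF pp zP z(2), of k] P_pow[OF zP, of k] by auto
      then have "\<forall>k::nat. (z [^] k) \<odot>\<^bsub>V\<^esub> x \<notin> N (n + int k)" using not by blast
      then show ?thesis using not z(1) by blast
    qed
    then show ?thesis unfolding controlled_def using pp False
      by (intro exI[of _ "{}"] exI[of _ "{p}"]) simp
  qed
qed

text \<open>Noetherian induction on the annihilator \<open>p\<close> of \<open>u\<close> modulo
  \<open>N\<close>. If \<open>r s\<close> lies in \<open>p\<close> but neither factor does,
  \<open>N + R r u\<close> is inserted in between: the annihilator of \<open>r u\<close> modulo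
  \<open>N\<close> gains \<open>s\<close>, that of \<open>u\<close> modulo the inserted module gains
  \<open>r\<close>. In this way the filtration arises without a search for associated
  primes.\<close>

lemma controlled_adjoin:
  assumes "hom_submodule N" "u \<in> X m"
  shows "controlled N (adjoin N (m, u))"
  using assms
proof (induction "colon N (m, u)" arbitrary: N m u rule: wf_induct_rule[OF hom_ideal_wf])
  case (1 N m u)
  note N = 1(2) and u = 1(3)
  define p where "p = colon N (m, u)"
  have pi: "hom_ideal p" unfolding p_def by (rule hom_submodule_colon[OF N u])
  have uc: "u \<in> carrier V" using u X_sub by blast
  consider "\<one> \<in> p 0" | "hom_prime p"
    | r s e e' where "r \<in> P e" "s \<in> P e'" "r \<otimes> s \<in> p (e + e')" "r \<notin> p e" "s \<notin> p e'"
    using pi unfolding hom_prime_def by blast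
  then show ?case
  proof cases
    case 1
    have "adjoin N (m, u) n \<subseteq> N n" for n
    proof
      fix x assume "x \<in> adjoin N (m, u) n"
      then obtain v r where *: "x = v \<oplus>\<^bsub>V\<^esub> r \<odot>\<^bsub>V\<^esub> u" "v \<in> N n" "r \<in> P (n - m)"
        by (auto simp: adjoin_element_def)
      have "u \<in> N m" using 1 uc by (simp add: p_def colon_def)
      then have "r \<odot>\<^bsub>V\<^esub> u \<in> N n" using hom_submoduleD(4)[OF N _ *(3)] by force
      then show "x \<in> N n" using * hom_submoduleD(3)[OF N] by blast
    qed
    then show ?thesis by (rule controlled_refl)
  next
    case 2
    then show ?thesis using controlled_prime[OF N u] by (simp add: p_def)
  next
    case (3 r s e e')
    have rc: "r \<in> carrier R" "s \<in> carrier R" using 3 P_carrier by blast+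
    define v where "v = r \<odot>\<^bsub>V\<^esub> u"
    have v: "v \<in> X (m + e)" unfolding v_def by (rule X_smult[OF 3(1) u])
    have vc: "v \<in> carrier V" using v X_sub by blast
    define N1 where "N1 = adjoin N (m + e, v)"
    have N1: "hom_submodule N1" "\<And>n. N n \<subseteq> N1 n"
      unfolding N1_def by (rule hom_submodule_adjoin[OF N v])+
    have le1: "p \<le> colon N (m + e, v)"
    proof (rule le_funI, rule subsetI)
      fix f t assume t: "t \<in> p f"
      then have tP: "t \<in> P f" by (rule hom_idealD(1)[OF pi])
      have "r \<otimes> t \<in> p (f + e)" by (rule hom_idealD(4)[OF pi t 3(1)])
      then have "(r \<otimes> t) \<odot>\<^bsub>V\<^esub> u \<in> N (m + (f + e))" by (simp add: p_def colon_def)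
      moreover have "(r \<otimes> t) \<odot>\<^bsub>V\<^esub> u = t \<odot>\<^bsub>V\<^esub> v"
        unfolding v_def using rc P_carrier[OF tP] uc by (metis m_comm smult_assoc1)
      ultimately show "t \<in> colon N (m + e, v) f" using tP by (simp add: colon_def algebra_simps)
    qed
    have "s \<in> colon N (m + e, v) e'"
    proof -
      have "(r \<otimes> s) \<odot>\<^bsub>V\<^esub> u \<in> N (m + (e + e'))" using 3 by (simp add: p_def colon_def)
      moreover have "(r \<otimes> s) \<odot>\<^bsub>V\<^esub> u = s \<odot>\<^bsub>V\<^esub> v"
        unfolding v_def using rc uc by (metis m_comm smult_assoc1)
      ultimately show ?thesis using 3(2) by (simp add: colon_def algebra_simps)
    qed
    then have ne1: "p \<noteq> colon N (m + e, v)" using 3(5) by metis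
    have c1: "controlled N N1"
      unfolding N1_def
      by (rule 1(1)[OF _ N v]) (use pi le1 ne1 hom_submodule_colon[OF N v] in \<open>auto simp: p_def\<close>)
    have le2: "p \<le> colon N1 (m, u)"
      using N1(2) by (auto simp: le_fun_def p_def colon_def)
    have "v = \<zero>\<^bsub>V\<^esub> \<oplus>\<^bsub>V\<^esub> \<one> \<odot>\<^bsub>V\<^esub> v" using vc by simp
    then have "v \<in> N1 (m + e)"
      unfolding N1_def adjoin_element_def using hom_submoduleD(2)[OF N] P_one by fastforce
    then have "r \<in> colon N1 (m, u) e" using 3(1) by (simp add: colon_def v_def)
    then have ne2: "p \<noteq> colon N1 (m, u)" using 3(4) by metis
    have c2: "controlled N1 (adjoin N1 (m, u))"
      by (rule 1(1)[OF _ N1(1) u]) (use pi le2 ne2 hom_submodule_colon[OF N1(1) u] in \<open>auto simp: p_def\<close>)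
    have "controlled N (adjoin N1 (m, u))" by (rule controlled_trans[OF c1 c2 N1(2)])
    then show ?thesis
      by (rule controlled_mono) (use N1(2) in \<open>auto simp: adjoin_element_def\<close>)
  qed
qed

lemma controlled_foldl:
  assumes "hom_submodule N" "\<And>m u. (m, u) \<in> set us \<Longrightarrow> u \<in> X m"
  shows "controlled N (foldl adjoin N us)"
  using assms
proof (induction us arbitrary: N)
  case Nil
  then show ?case by (simp add: controlled_refl)
next
  case (Cons mu us)
  obtain m u where mu: "mu = (m, u)" by force
  have u: "u \<in> X m" using Cons.prems(2) mu by simp
  have "controlled N (adjoin N mu)" unfolding mu by (rule controlled_adjoin[OF Cons.prems(1) u])
  moreover have "controlled (adjoin N mu) (foldl adjoin (adjoin N mu) us)"
    using Cons hom_submodule_adjoin(1)[OF Cons.prems(1) u] mu by simp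
  ultimately show ?case
    using controlled_trans hom_submodule_adjoin(2)[OF Cons.prems(1) u] unfolding mu
    by (metis foldl_Cons)
qed

text \<open>Elements outside the finitely many recorded primes act injectively on \<open>Z\<close>
  modulo \<open>N\<close> away from the degrees in \<open>A\<close>. The last clause says that
  classes killed by powers of all members of \<open>G\<close> occur only in degrees from
  \<open>A\<close>.\<close>

lemma filter_regular_elements:
  assumes N: "hom_submodule N" and us: "\<And>m u. (m, u) \<in> set us \<Longrightarrow> u \<in> X m"
    and Z: "\<And>n. Z n \<subseteq> foldl adjoin N us n"
  obtains A s0 where "finite A"
    "\<And>s. s \<ge> s0 \<Longrightarrow> \<exists>x\<in>P s. \<forall>n u. n \<notin> A \<longrightarrow> u \<in> Z n \<longrightarrow> x \<odot>\<^bsub>V\<^esub> u \<in> N (n + s) \<longrightarrow> u \<in> N n"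
    "\<And>n u. n \<notin> A \<Longrightarrow> u \<in> Z n \<Longrightarrow> (\<And>z. z \<in> G \<Longrightarrow> \<exists>k::nat. (z [^] k) \<odot>\<^bsub>V\<^esub> u \<in> N (n + int k)) \<Longrightarrow> u \<in> N n"
proof -
  have "controlled N Z" using controlled_mono[OF controlled_foldl[OF N us] Z] by blast
  then obtain A Ps where A: "finite A" "finite Ps" "\<forall>p\<in>Ps. hom_prime p \<and> \<not> G \<subseteq> p 1"
     "\<And>n u. u \<in> Z n \<Longrightarrow> n \<notin> A \<Longrightarrow> u \<notin> N n \<Longrightarrow>
        (\<forall>s. \<forall>x\<in>P s. (\<forall>p\<in>Ps. x \<notin> p s) \<longrightarrow> x \<odot>\<^bsub>V\<^esub> u \<notin> N (n + s)) \<and>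
        (\<exists>z\<in>G. \<forall>k::nat. (z [^] k) \<odot>\<^bsub>V\<^esub> u \<notin> N (n + int k))"
    unfolding controlled_def by metis
  obtain s0 where s0: "\<And>s. s \<ge> s0 \<Longrightarrow> \<exists>x\<in>P s. \<forall>p\<in>Ps. x \<notin> p s"
    using prime_avoidance[OF A(2)] A(3) by blast
  show thesis
  proof (rule that[OF A(1)])
    fix s assume "s0 \<le> s"
    then obtain x where "x \<in> P s" "\<forall>p\<in>Ps. x \<notin> p s" using s0 by blast
    then show "\<exists>x\<in>P s. \<forall>n u. n \<notin> A \<longrightarrow> u \<in> Z n \<longrightarrow> x \<odot>\<^bsub>V\<^esub> u \<in> N (n + s) \<longrightarrow> u \<in> N n"
      using A(4) by blast
  next
    fix n u assume "n \<notin> A" "u \<in> Z n" "\<And>z. z \<in> G \<Longrightarrow> \<exists>k::nat. (z [^] k) \<odot>\<^bsub>V\<^esub> u \<in> N (n + int k)"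
    then show "u \<in> N n" using A(4) by blast
  qed
qed

end


section \<open>Admissible complexes\<close>

context graded_complex
begin

text \<open>In a fixed degree \<open>n\<close> the torsion subcomplex is a complex over the scalars
  of degree 0. It satisfies \<open>good\<close> because division by such a scalar keeps the degree
  and the divisor inherits torsion. This permits a second torsion inside the first.\<close>

lemma restrict_torsion:
  assumes S: "S \<subseteq> (\<Union>e. P e)"
  shows "graded_complex R (\<lambda>e. if e = 0 then P 0 else {}) K (\<lambda>i m. tors R (K i) S (X i n)) d"
proof (intro graded_complex.intro graded_complex_axioms.intro module_K, goal_cases)
  case 1
  show ?case using P_sub P_mult[of _ 0 _ 0] P_one by unfold_locales (auto split: if_splits)
next
  case (2 i m)
  show ?case by (auto dest!: torsD X_carrier)
next
  case (3 i m)
  have "S \<subseteq> carrier R" using S P_carrier by blast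
  then show ?case by (rule tors_X_zero)
next
  case (4 x i m y)
  then show ?case using S P_carrier by (intro tors_X_add) auto
next
  case (5 x i m)
  then show ?case using S P_carrier by (intro tors_X_neg) auto
next
  case (6 r e x i m)
  then have "r \<in> P 0" "e = 0" by (auto split: if_splits)
  moreover have "S \<subseteq> carrier R" using S P_carrier by auto
  ultimately show ?case using tors_X_smult[of S x i n r 0] 6 by simp
next
  case (7 x i m)
  then show ?case by (intro d_tors[OF S])
next
  case (8 x i m y)
  then show ?case by (intro d_add) (auto dest: torsD)
next
  case (9 r e x i m)
  then show ?case by (auto dest!: torsD intro!: d_smult split: if_splits)
next
  case (10 x i m)
  then show ?case by (intro d_d) (auto dest: torsD)
next
  case (11 x i m r e)
  then have r: "r \<in> P 0" "e = 0" by (auto split: if_splits)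
  have x: "x \<in> X i n" using 11 by (blast dest: torsD)
  obtain z where z: "z \<in> X i n" "\<exists>l::nat. (r [^] l) \<odot>\<^bsub>K i\<^esub> (x \<ominus>\<^bsub>K i\<^esub> r \<odot>\<^bsub>K i\<^esub> z) = \<zero>\<^bsub>K i\<^esub>"
    "\<And>e' s. s \<in> P e' \<Longrightarrow> s \<odot>\<^bsub>K i\<^esub> x = \<zero>\<^bsub>K i\<^esub> \<Longrightarrow> s \<odot>\<^bsub>K i\<^esub> z = \<zero>\<^bsub>K i\<^esub>"
    using good[OF x r(1)] by auto
  have "z \<in> tors R (K i) S (X i n)" unfolding tors_def
  proof (intro CollectI conjI ballI z(1))
    fix s assume s: "s \<in> S"
    then obtain e where e: "s \<in> P e" using S by auto
    obtain k :: nat where k: "(s [^] k) \<odot>\<^bsub>K i\<^esub> x = \<zero>\<^bsub>K i\<^esub>" using 11(1) s by (rule torsE)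
    then show "\<exists>k::nat. (s [^] k) \<odot>\<^bsub>K i\<^esub> z = \<zero>\<^bsub>K i\<^esub>" using z(3)[OF P_pow[OF e]] by blast
  qed
  then show ?case using z(2,3) r by (intro bexI[of _ z]) auto
qed

lemma mapping_cone_smult:
  assumes "pairing pr p1 p2" "y \<in> P s"
  shows "mapping_cone pr p1 p2 R P K X d K X d s (\<lambda>i x. y \<odot>\<^bsub>K i\<^esub> x)"
proof (intro mapping_cone.intro mapping_cone_axioms.intro assms graded_complex_axioms, goal_cases)
  case (2 a i n a')
  then show ?case using X_carrier P_carrier[OF assms(2)] module.smult_r_distr[OF module_K] by blast
next
  case (3 r e a i n)
  then show ?case
    using X_carrier P_carrier assms(2) module.smult_commute[OF module_K] by blast
qed (use X_smult[OF assms(2)] d_smult[OF assms(2)] in auto)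

lemma pow_boundary:
  assumes "u \<in> d (i - 1) ` tors R (K (i - 1)) S (X (i - 1) n)" "S \<subseteq> carrier R" "y \<in> P e"
  shows "y \<odot>\<^bsub>K i\<^esub> u \<in> d (i - 1) ` tors R (K (i - 1)) S (X (i - 1) (n + e))"
proof -
  obtain w where w: "w \<in> tors R (K (i - 1)) S (X (i - 1) n)" "u = d (i - 1) w" using assms by blast
  have "y \<odot>\<^bsub>K i\<^esub> u = d (i - 1) (y \<odot>\<^bsub>K (i - 1)\<^esub> w)"
    using d_smult[OF assms(3) torsD[OF w(1)]] w(2) by simp
  then show ?thesis using tors_X_smult[OF assms(2) w(1) assms(3)] by blast
qed

end

text \<open>The scalars with a power killing \<open>u\<close> are closed under addition, and a
  product is among them as soon as one factor is. So they contain G R_{e-1} and its span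
  R_e.\<close>

lemma (in graded_noetherian) positive_nilpotent:
  assumes "module R V" "u \<in> carrier V" "\<And>z. z \<in> G \<Longrightarrow> \<exists>k::nat. (z [^] k) \<odot>\<^bsub>V\<^esub> u = \<zero>\<^bsub>V\<^esub>"
    and "1 \<le> e" "y \<in> P e"
  shows "\<exists>k::nat. (y [^] k) \<odot>\<^bsub>V\<^esub> u = \<zero>\<^bsub>V\<^esub>"
proof -
  interpret V: module R V by fact
  define Q where "Q = {a \<in> carrier R. \<exists>k::nat. (a [^] k) \<odot>\<^bsub>V\<^esub> u = \<zero>\<^bsub>V\<^esub>}"
  \<comment> \<open>The binomial argument by induction on \<open>n + m\<close>:
    \<open>(a + b)^(l+1) x\<close> is the sum of \<open>(a + b)^l\<close> applied to
    \<open>a x\<close> and to \<open>b x\<close>, and for each of these one of the two exponents has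
    dropped.\<close>
  have sum: "((a \<oplus> b) [^] (n + m)) \<odot>\<^bsub>V\<^esub> x = \<zero>\<^bsub>V\<^esub>"
    if "a \<in> carrier R" "b \<in> carrier R" "x \<in> carrier V"
      "(a [^] n) \<odot>\<^bsub>V\<^esub> x = \<zero>\<^bsub>V\<^esub>" "(b [^] m) \<odot>\<^bsub>V\<^esub> x = \<zero>\<^bsub>V\<^esub>" for a b x and n m :: nat
    using that
  proof (induction "n + m" arbitrary: n m x)
    case 0
    then show ?case by simp
  next
    case (Suc l)
    show ?case
    proof (cases "n = 0 \<or> m = 0")
      case True
      then have "x = \<zero>\<^bsub>V\<^esub>" using Suc.prems by auto
      then show ?thesis using Suc.prems by simp
    next
      case False
      then obtain n' m' where nm: "n = Suc n'" "m = Suc m'" by (meson not0_implies_Suc)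
      have l: "l = n' + m" "l = n + m'" using Suc.hyps(2) nm by auto
      have 1: "((a \<oplus> b) [^] l) \<odot>\<^bsub>V\<^esub> (a \<odot>\<^bsub>V\<^esub> x) = \<zero>\<^bsub>V\<^esub>"
        unfolding l(1)
      proof (rule Suc.hyps(1)[OF l(1)])
        show "(a [^] n') \<odot>\<^bsub>V\<^esub> (a \<odot>\<^bsub>V\<^esub> x) = \<zero>\<^bsub>V\<^esub>"
          using Suc.prems nm by (simp add: V.smult_assoc1[symmetric])
        have "(b [^] m) \<odot>\<^bsub>V\<^esub> (a \<odot>\<^bsub>V\<^esub> x) = a \<odot>\<^bsub>V\<^esub> ((b [^] m) \<odot>\<^bsub>V\<^esub> x)"
          using Suc.prems by (intro V.smult_commute) auto
        then show "(b [^] m) \<odot>\<^bsub>V\<^esub> (a \<odot>\<^bsub>V\<^esub> x) = \<zero>\<^bsub>V\<^esub>" using Suc.prems by simp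
      qed (use Suc.prems in auto)
      have 2: "((a \<oplus> b) [^] l) \<odot>\<^bsub>V\<^esub> (b \<odot>\<^bsub>V\<^esub> x) = \<zero>\<^bsub>V\<^esub>"
        unfolding l(2)
      proof (rule Suc.hyps(1)[OF l(2)])
        show "(b [^] m') \<odot>\<^bsub>V\<^esub> (b \<odot>\<^bsub>V\<^esub> x) = \<zero>\<^bsub>V\<^esub>"
          using Suc.prems nm by (simp add: V.smult_assoc1[symmetric])
        have "(a [^] n) \<odot>\<^bsub>V\<^esub> (b \<odot>\<^bsub>V\<^esub> x) = b \<odot>\<^bsub>V\<^esub> ((a [^] n) \<odot>\<^bsub>V\<^esub> x)"
          using Suc.prems by (intro V.smult_commute) auto
        then show "(a [^] n) \<odot>\<^bsub>V\<^esub> (b \<odot>\<^bsub>V\<^esub> x) = \<zero>\<^bsub>V\<^esub>" using Suc.prems by simp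
      qed (use Suc.prems in auto)
      have "((a \<oplus> b) [^] Suc l) \<odot>\<^bsub>V\<^esub> x = ((a \<oplus> b) [^] l) \<odot>\<^bsub>V\<^esub> ((a \<oplus> b) \<odot>\<^bsub>V\<^esub> x)"
        using Suc.prems by (simp add: V.smult_assoc1)
      also have "(a \<oplus> b) \<odot>\<^bsub>V\<^esub> x = a \<odot>\<^bsub>V\<^esub> x \<oplus>\<^bsub>V\<^esub> b \<odot>\<^bsub>V\<^esub> x"
        using Suc.prems by (simp add: V.smult_l_distr)
      also have "((a \<oplus> b) [^] l) \<odot>\<^bsub>V\<^esub> (a \<odot>\<^bsub>V\<^esub> x \<oplus>\<^bsub>V\<^esub> b \<odot>\<^bsub>V\<^esub> x) = \<zero>\<^bsub>V\<^esub>"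
        using Suc.prems 1 2 by (simp add: V.smult_r_distr)
      finally show ?thesis using Suc.hyps(2) by simp
    qed
  qed
  have "y \<in> Q"
  proof (rule G_generates[of "e - 1" y])
    show "\<zero> \<in> Q" using assms(2) by (auto simp: Q_def intro!: exI[of _ 1])
    show "a \<oplus> b \<in> Q" if "a \<in> Q" "b \<in> Q" for a b
      using that sum[OF _ _ assms(2)] unfolding Q_def by blast
    show "g \<otimes> t \<in> Q" if g: "g \<in> G" and t: "t \<in> P (e - 1)" for g t
    proof -
      obtain k :: nat where k: "(g [^] k) \<odot>\<^bsub>V\<^esub> u = \<zero>\<^bsub>V\<^esub>" using assms(3)[OF g] by blast
      have c: "g \<in> carrier R" "t \<in> carrier R" using g t G_sub P_carrier by blast+
      have "((g \<otimes> t) [^] k) \<odot>\<^bsub>V\<^esub> u = (t [^] k) \<odot>\<^bsub>V\<^esub> ((g [^] k) \<odot>\<^bsub>V\<^esub> u)"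
        using c assms(2) by (simp add: nat_pow_distrib V.smult_assoc1[symmetric] m_comm)
      then show ?thesis using k c unfolding Q_def by auto
    qed
  qed (use assms in auto)
  then show ?thesis by (simp add: Q_def)
qed

locale graded_noetherian_complex = graded_noetherian R P G + graded_complex R P K X d
  for R :: "('a, 'r) ring_scheme" (structure) and P G
    and K :: "int \<Rightarrow> ('a, 'w, 'z) module_scheme" and X d
begin

lemma graded_noetherian_module_0: "graded_noetherian_module R P G (K 0) (X 0)"
  by (intro graded_noetherian_module.intro graded_noetherian_module_axioms.intro
      graded_noetherian_axioms module_K X_sub X_zero X_add X_smult)

lemma hom_submodule_boundaries:
  "graded_noetherian_module.hom_submodule P (K 0) (X 0) (\<lambda>n. d (- 1) ` X (- 1) n)"
proof -
  interpret V: graded_noetherian_module R P G "K 0" "X 0" by (rule graded_noetherian_module_0)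
  have 1: "d (- 1) ` X (- 1) n \<subseteq> X 0 n" for n using d_closed[of _ "-1"] by auto
  have 2: "\<zero>\<^bsub>K 0\<^esub> \<in> d (- 1) ` X (- 1) n" for n
    using d_zero[of "-1"] X_zero[of "-1"] by (metis add.left_inverse imageI)
  have 3: "x \<oplus>\<^bsub>K 0\<^esub> y \<in> d (- 1) ` X (- 1) n"
    if xy: "x \<in> d (- 1) ` X (- 1) n" "y \<in> d (- 1) ` X (- 1) n" for x y n
  proof -
    obtain v w where vw: "v \<in> X (- 1) n" "w \<in> X (- 1) n" "x = d (- 1) v" "y = d (- 1) w"
      using xy by blast
    then have "x \<oplus>\<^bsub>K 0\<^esub> y = d (- 1) (v \<oplus>\<^bsub>K (- 1)\<^esub> w)" using d_add[OF vw(1,2)] by simp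
    then show ?thesis using X_add[OF vw(1,2)] by blast
  qed
  have 4: "r \<odot>\<^bsub>K 0\<^esub> x \<in> d (- 1) ` X (- 1) (n + e)"
    if "x \<in> d (- 1) ` X (- 1) n" "r \<in> P e" for x r n e
    using pow_boundary[of x 0 "{}"] that by simp
  show ?thesis unfolding V.hom_submodule_def
    by (intro conjI allI ballI; (rule 1 2 3 4; assumption?))
qed

end

text \<open>The complexes to which the induction applies. Up to finitely many degrees they behave like
  graded injective resolutions of finitely generated graded modules, but this class is also stable
  under the cones of almost regular homogeneous elements.\<close>

locale admissible_complex = graded_noetherian_complex R P G K X d
  for R :: "('a, 'r) ring_scheme" (structure) and P G
    and K :: "int \<Rightarrow> ('a, 'w, 'z) module_scheme" and X d +
  assumes exact_above: "j > 0 \<Longrightarrow> exact_at R K X d {} j n"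
    and exact_below: "\<exists>N. \<forall>j<0. \<forall>n. \<bar>n\<bar> > N \<longrightarrow> exact_at R K X d {} j n"
    and finitely_generated: "\<exists>us. (\<forall>(m, u)\<in>set us. u \<in> X 0 m \<and> d 0 u = \<zero>\<^bsub>K 1\<^esub>) \<and>
      (\<forall>n. {u \<in> X 0 n. d 0 u = \<zero>\<^bsub>K 1\<^esub>} \<subseteq> foldl (adjoin_element P (K 0)) (\<lambda>n. d (- 1) ` X (- 1) n) us n)"
begin

lemma almost_regular_elements:
  obtains A s0 where "finite A"
    "\<And>s. s \<ge> s0 \<Longrightarrow> \<exists>y\<in>P s. \<forall>n u. n \<notin> A \<longrightarrow> u \<in> X 0 n \<longrightarrow> d 0 u = \<zero>\<^bsub>K 1\<^esub> \<longrightarrow>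
        y \<odot>\<^bsub>K 0\<^esub> u \<in> d (- 1) ` X (- 1) (n + s) \<longrightarrow> u \<in> d (- 1) ` X (- 1) n"
    "\<And>n u. n \<notin> A \<Longrightarrow> u \<in> X 0 n \<Longrightarrow> d 0 u = \<zero>\<^bsub>K 1\<^esub> \<Longrightarrow>
        (\<And>z. z \<in> G \<Longrightarrow> \<exists>k::nat. (z [^] k) \<odot>\<^bsub>K 0\<^esub> u \<in> d (- 1) ` X (- 1) (n + int k)) \<Longrightarrow>
        u \<in> d (- 1) ` X (- 1) n"
proof -
  interpret V: graded_noetherian_module R P G "K 0" "X 0" by (rule graded_noetherian_module_0)
  obtain us where us: "\<And>m u. (m, u) \<in> set us \<Longrightarrow> u \<in> X 0 m"
    "\<And>n. {u \<in> X 0 n. d 0 u = \<zero>\<^bsub>K 1\<^esub>} \<subseteq> foldl (adjoin_element P (K 0)) (\<lambda>n. d (- 1) ` X (- 1) n) us n"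
    using finitely_generated by blast
  obtain A s0 where A: "finite A"
    "\<And>s. s \<ge> s0 \<Longrightarrow> \<exists>x\<in>P s. \<forall>n u. n \<notin> A \<longrightarrow> u \<in> {u \<in> X 0 n. d 0 u = \<zero>\<^bsub>K 1\<^esub>} \<longrightarrow>
        x \<odot>\<^bsub>K 0\<^esub> u \<in> d (- 1) ` X (- 1) (n + s) \<longrightarrow> u \<in> d (- 1) ` X (- 1) n"
    "\<And>n u. n \<notin> A \<Longrightarrow> u \<in> {u \<in> X 0 n. d 0 u = \<zero>\<^bsub>K 1\<^esub>} \<Longrightarrow>
        (\<And>z. z \<in> G \<Longrightarrow> \<exists>k::nat. (z [^] k) \<odot>\<^bsub>K 0\<^esub> u \<in> d (- 1) ` X (- 1) (n + int k)) \<Longrightarrow>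
        u \<in> d (- 1) ` X (- 1) n"
    using V.filter_regular_elements[OF hom_submodule_boundaries us] by blast
  show thesis
  proof (rule that[OF A(1)])
    show "\<exists>y\<in>P s. \<forall>n u. n \<notin> A \<longrightarrow> u \<in> X 0 n \<longrightarrow> d 0 u = \<zero>\<^bsub>K 1\<^esub> \<longrightarrow>
        y \<odot>\<^bsub>K 0\<^esub> u \<in> d (- 1) ` X (- 1) (n + s) \<longrightarrow> u \<in> d (- 1) ` X (- 1) n" if "s0 \<le> s" for s
      using A(2)[OF that] by (simp only: mem_Collect_eq) blast
    show "u \<in> d (- 1) ` X (- 1) n" if "n \<notin> A" "u \<in> X 0 n" "d 0 u = \<zero>\<^bsub>K 1\<^esub>"
      "\<And>z. z \<in> G \<Longrightarrow> \<exists>k::nat. (z [^] k) \<odot>\<^bsub>K 0\<^esub> u \<in> d (- 1) ` X (- 1) (n + int k)" for n u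
      by (rule A(3)) (use that in auto)
  qed
qed

text \<open>Start of both inductions on the position. Outside a bounded range of degrees, cohomology
  below position 0 is zero, and a class in position 0 that is killed by powers of all of
  \<open>G\<close> is zero; \<open>tors_boundary_lift\<close> turns this into exactness of the
  torsion subcomplex.\<close>

lemma exact_low:
  assumes Y: "finite Y" "Y \<subseteq> P 0"
  shows "\<exists>N. \<forall>j\<le>0. \<forall>n. \<bar>n\<bar> > N \<longrightarrow> exact_at R K X d (G \<union> Y) j n"
proof -
  obtain A s0 where A: "finite A"
    "\<And>n u. n \<notin> A \<Longrightarrow> u \<in> X 0 n \<Longrightarrow> d 0 u = \<zero>\<^bsub>K 1\<^esub> \<Longrightarrow>
        (\<And>z. z \<in> G \<Longrightarrow> \<exists>k::nat. (z [^] k) \<odot>\<^bsub>K 0\<^esub> u \<in> d (- 1) ` X (- 1) (n + int k)) \<Longrightarrow>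
        u \<in> d (- 1) ` X (- 1) n"
    by (rule almost_regular_elements) blast
  obtain N0 where N0: "\<And>j n. j < 0 \<Longrightarrow> \<bar>n\<bar> > N0 \<Longrightarrow> exact_at R K X d {} j n"
    using exact_below by blast
  define N where "N = Max (insert \<bar>N0\<bar> (abs ` A))"
  have N: "\<bar>N0\<bar> \<le> N" "a \<in> A \<Longrightarrow> \<bar>a\<bar> \<le> N" for a using A(1) by (auto simp: N_def)
  have Gh: "G \<subseteq> (\<Union>e. P e)" using G_sub by blast
  have Gexact: "exact_at R K X d G j n" if j: "j \<le> 0" and n: "\<bar>n\<bar> > N" for j n
    unfolding exact_at_def
  proof (intro ballI impI)
    fix u assume u: "u \<in> tors R (K j) G (X j n)" "d j u = \<zero>\<^bsub>K (j + 1)\<^esub>"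
    have uX: "u \<in> X j n" using u(1) by (rule torsD)
    have "u \<in> d (j - 1) ` X (j - 1) n"
    proof (cases "j = 0")
      case False
      then have "exact_at R K X d {} j n" using N0 N(1) j n by simp
      then show ?thesis using uX u(2) by (simp add: exact_at_def)
    next
      case True
      have "u \<in> d (- 1) ` X (- 1) n"
      proof (rule A(2))
        show "n \<notin> A" using N(2)[of n] n by auto
        fix z assume "z \<in> G"
        then obtain k :: nat where k: "(z [^] k) \<odot>\<^bsub>K j\<^esub> u = \<zero>\<^bsub>K j\<^esub>" using u(1) by (metis torsE)
        have "\<zero>\<^bsub>K 0\<^esub> \<in> d (- 1) ` X (- 1) (n + int k)"
          using d_zero[of "-1"] X_zero[of "-1"] by (metis add.left_inverse imageI)
        then show "\<exists>k::nat. (z [^] k) \<odot>\<^bsub>K 0\<^esub> u \<in> d (- 1) ` X (- 1) (n + int k)"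
          using k True by (intro exI[of _ k]) simp
      qed (use uX u(2) True in auto)
      then show ?thesis using True by simp
    qed
    from j u(1) this show "u \<in> d (j - 1) ` tors R (K (j - 1)) G (X (j - 1) n)"
    proof (rule tors_boundary_lift[where g = "\<lambda>_. 1", OF G_finite, rotated 2])
      show "\<And>s. s \<in> G \<Longrightarrow> s \<in> P 1" using G_sub by auto
      fix j' n' u' s assume *: "j' < 0" "u' \<in> X j' n'" "d j' u' = \<zero>\<^bsub>K (j' + 1)\<^esub>" "s \<in> G"
      \<comment> \<open>Cohomology below position 0 may be nonzero in degree \<open>n'\<close>, but
        \<open>s\<close> has degree 1, so a large power of it moves any class beyond the bound
        \<open>N0\<close>.\<close>
      define k where "k = nat (\<bar>N0\<bar> + \<bar>n'\<bar> + 1)"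
      have s: "s \<in> P 1" using * G_sub by blast
      have sk: "s [^] k \<in> P (int k)" using P_pow[OF s, of k] by simp
      have "exact_at R K X d {} j' (n' + int k)" by (rule N0) (use * in \<open>auto simp: k_def\<close>)
      moreover have "(s [^] k) \<odot>\<^bsub>K j'\<^esub> u' \<in> X j' (n' + int k)" by (rule X_smult[OF sk *(2)])
      moreover have "d j' ((s [^] k) \<odot>\<^bsub>K j'\<^esub> u') = \<zero>\<^bsub>K (j' + 1)\<^esub>"
        using d_smult[OF sk *(2)] *(3) P_carrier[OF sk] module.smult_r_null[OF module_K] by simp
      ultimately show "\<exists>k::nat. (s [^] k) \<odot>\<^bsub>K j'\<^esub> u' \<in> d (j' - 1) ` X (j' - 1) (n' + int k * 1)"
        unfolding exact_at_def by (intro exI[of _ k]) simp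
    qed
  qed
  have "exact_at R K X d (G \<union> Y) j n" if j: "j \<le> 0" and n: "\<bar>n\<bar> > N" for j n
    unfolding exact_at_def
  proof (intro ballI impI)
    fix u assume u: "u \<in> tors R (K j) (G \<union> Y) (X j n)" "d j u = \<zero>\<^bsub>K (j + 1)\<^esub>"
    \<comment> \<open>Members of \<open>Y\<close> have degree 0 and cannot move a class to a better
      degree. Their torsion is therefore taken inside the \<open>G\<close>-torsion of the fixed
      degree \<open>n\<close>, which is already exact in positions up to 0.\<close>
    interpret T: graded_complex R "\<lambda>e. if e = 0 then P 0 else {}" K "\<lambda>i m. tors R (K i) G (X i n)" d
      by (rule restrict_torsion[OF Gh])
    have u': "u \<in> tors R (K j) Y (tors R (K j) G (X j n))" using u(1) by (simp add: tors_tors)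
    then have "u \<in> d (j - 1) ` tors R (K (j - 1)) G (X (j - 1) n)"
      using Gexact[OF j n] u(2) torsD[OF u'] by (simp add: exact_at_def)
    from j u' this
    have "u \<in> d (j - 1) ` tors R (K (j - 1)) Y (tors R (K (j - 1)) G (X (j - 1) n))"
    proof (rule T.tors_boundary_lift[where g = "\<lambda>_. 0", OF Y(1), rotated 2])
      show "s \<in> (if (0::int) = 0 then P 0 else {})" if "s \<in> Y" for s using that Y by auto
      fix j' n' u' s assume *: "j' < 0" "u' \<in> tors R (K j') G (X j' n)" "d j' u' = \<zero>\<^bsub>K (j' + 1)\<^esub>" "s \<in> Y"
      have "u' \<in> carrier (K j')" using torsD[OF *(2)] by (rule X_carrier)
      then have "\<one> \<odot>\<^bsub>K j'\<^esub> u' = u'" using module.smult_one[OF module_K] by blast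
      then show "\<exists>k::nat. (s [^] k) \<odot>\<^bsub>K j'\<^esub> u' \<in> d (j' - 1) ` tors R (K (j' - 1)) G (X (j' - 1) n)"
        using * Gexact[of j' n] n by (intro exI[of _ 0]) (simp add: exact_at_def)
    qed
    then show "u \<in> d (j - 1) ` tors R (K (j - 1)) (G \<union> Y) (X (j - 1) n)" by (simp add: tors_tors)
  qed
  then show ?thesis by blast
qed

end

text \<open>Carries generators of H^0 of a complex into the second summand of a cone.\<close>

lemma (in pairing) foldl_adjoin_pr:
  assumes "module R A" "module R B" "\<And>e. P e \<subseteq> carrier R"
    and "\<And>n. N n \<subseteq> carrier B" "\<And>m u. (m, u) \<in> set us \<Longrightarrow> u \<in> carrier B"
    and "\<And>n x. x \<in> N n \<Longrightarrow> pr \<zero>\<^bsub>A\<^esub> x \<in> N' n"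
    and "x \<in> foldl (adjoin_element P B) N us n"
  shows "pr \<zero>\<^bsub>A\<^esub> x \<in> foldl (adjoin_element P (pair_module pr p1 p2 A B)) N'
           (map (\<lambda>(m, u). (m, pr \<zero>\<^bsub>A\<^esub> u)) us) n"
  using assms
proof (induction us arbitrary: N N')
  case Nil
  then show ?case by simp
next
  case (Cons mu us)
  interpret A: module R A by fact
  interpret B: module R B by fact
  obtain m u where mu: "mu = (m, u)" by force
  have u: "u \<in> carrier B" using Cons.prems(5)[of m u] mu by simp
  have "pr \<zero>\<^bsub>A\<^esub> x \<in> foldl (adjoin_element P (pair_module pr p1 p2 A B))
          (adjoin_element P (pair_module pr p1 p2 A B) N' (m, pr \<zero>\<^bsub>A\<^esub> u))
           (map (\<lambda>(m, u). (m, pr \<zero>\<^bsub>A\<^esub> u)) us) n"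
  proof (rule Cons.IH[OF Cons.prems(1-3)])
    show "x \<in> foldl (adjoin_element P B) (adjoin_element P B N mu) us n" using Cons.prems(7) by simp
    show "u \<in> carrier B" if "(m, u) \<in> set us" for m u using that Cons.prems(5)[of m u] by simp
    show "adjoin_element P B N mu n \<subseteq> carrier B" for n
      using Cons.prems(3,4) u by (fastforce simp: adjoin_element_def mu)
    show "pr \<zero>\<^bsub>A\<^esub> x \<in> adjoin_element P (pair_module pr p1 p2 A B) N' (m, pr \<zero>\<^bsub>A\<^esub> u) n"
      if x: "x \<in> adjoin_element P B N mu n" for x n
    proof -
      obtain v r where *: "x = v \<oplus>\<^bsub>B\<^esub> r \<odot>\<^bsub>B\<^esub> u" "v \<in> N n" "r \<in> P (n - m)"
        using x by (auto simp: adjoin_element_def mu)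
      have "r \<in> carrier R" using *(3) Cons.prems(3) by blast
      then have "pr \<zero>\<^bsub>A\<^esub> x = pr \<zero>\<^bsub>A\<^esub> v \<oplus>\<^bsub>pair_module pr p1 p2 A B\<^esub> r \<odot>\<^bsub>pair_module pr p1 p2 A B\<^esub> pr \<zero>\<^bsub>A\<^esub> u"
        by (simp add: pair_add pair_smult *(1))
      then show ?thesis using * Cons.prems(6)[OF *(2)] by (auto simp: adjoin_element_def)
    qed
  qed
  then show ?case by (simp add: mu)
qed

context admissible_complex
begin

text \<open>The new point is position -1 of the cone. Its cohomology is built from H^{-1} and the
  kernel of \<open>y\<close> on H^0, so it vanishes in degrees of large absolute value. As H^1 is
  zero, H^0 of the cone is a quotient of H^0, generated by the images of the old generators.\<close>

lemma cone_admissible: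
  assumes pair: "pairing pr p1 p2" and y: "y \<in> P s" and A: "finite A"
    and reg: "\<And>n u. n \<notin> A \<Longrightarrow> u \<in> X 0 n \<Longrightarrow> d 0 u = \<zero>\<^bsub>K 1\<^esub> \<Longrightarrow>
        y \<odot>\<^bsub>K 0\<^esub> u \<in> d (- 1) ` X (- 1) (n + s) \<Longrightarrow> u \<in> d (- 1) ` X (- 1) n"
  shows "admissible_complex R P G (cone_module pr p1 p2 K K) (cone_part pr s X X)
    (cone_diff pr p1 p2 K K d d (\<lambda>i x. y \<odot>\<^bsub>K i\<^esub> x))"
proof -
  interpret C: mapping_cone pr p1 p2 R P K X d K X d s "\<lambda>i x. y \<odot>\<^bsub>K i\<^esub> x"
    by (rule mapping_cone_smult[OF pair y])
  have CK: "C.CK 0 = pair_module pr p1 p2 (K 1) (K 0)" by (simp add: cone_module_def)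
  interpret D: graded_noetherian_complex R P G C.CK C.CX C.Cd
    by (intro graded_noetherian_complex.intro graded_noetherian_axioms C.C_complex)
  interpret V: graded_noetherian_module R P G "C.CK 0" "C.CX 0"
    by (rule D.graded_noetherian_module_0)
  show ?thesis
  proof (unfold_locales, goal_cases)
    case (1 j n)
    then show ?case by (intro C.exact_cone exact_above) auto
  next
    case 2
    obtain N0 where N0: "\<And>j n. j < 0 \<Longrightarrow> \<bar>n\<bar> > N0 \<Longrightarrow> exact_at R K X d {} j n"
      using exact_below by blast
    \<comment> \<open>A degree beyond this bound stays beyond \<open>N0\<close> and outside
      \<open>A\<close> after \<open>s\<close> is subtracted.\<close>
    define N where "N = Max (insert \<bar>N0\<bar> (abs ` A)) + \<bar>s\<bar>"
    have N: "\<bar>N0\<bar> + \<bar>s\<bar> \<le> N" "a \<in> A \<Longrightarrow> \<bar>a\<bar> + \<bar>s\<bar> \<le> N" for a using A by (auto simp: N_def)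
    have "exact_at R C.CK C.CX C.Cd {} j n" if j: "j < 0" and n: "\<bar>n\<bar> > N" for j n
    proof (cases "j = -1")
      case False
      then show ?thesis using j n N by (intro C.exact_cone N0) auto
    next
      case True
      show ?thesis unfolding exact_at_def tors_empty
      proof (intro ballI impI)
        fix u assume u: "u \<in> C.CX j n" "C.Cd j u = \<zero>\<^bsub>C.CK (j + 1)\<^esub>"
        then obtain a b where ab: "u = pr a b" "a \<in> X (j + 1) (n - s)" "b \<in> X j n" by (metis C.CXE)
        have da: "d (j + 1) a = \<zero>\<^bsub>K (j + 1 + 1)\<^esub>"
          using u unfolding ab(1) by (rule C.cone_cocycle_fst)
        \<comment> \<open>The second entry of the cocycle condition shows that \<open>y a\<close> is
          a boundary, so \<open>reg\<close> applies to \<open>a\<close>.\<close>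
        have "y \<odot>\<^bsub>K (j + 1)\<^esub> a \<oplus>\<^bsub>K (j + 1)\<^esub> d j b = \<zero>\<^bsub>K (j + 1)\<^esub>"
          using u(2) by (simp add: ab(1) C.Cd_pr C.CK_simps)
        moreover have "y \<odot>\<^bsub>K (j + 1)\<^esub> a \<in> carrier (K (j + 1))" "d j b \<in> carrier (K (j + 1))"
          using X_carrier[OF C.map_closed'[OF ab(2)]] X_carrier[OF d_closed[OF ab(3)]] by auto
        ultimately have "y \<odot>\<^bsub>K (j + 1)\<^esub> a = \<ominus>\<^bsub>K (j + 1)\<^esub> d j b"
          using abelian_group.minus_equality[OF ab_K] by metis
        also have "\<dots> = d j (\<ominus>\<^bsub>K j\<^esub> b)" using d_neg[OF ab(3)] by simp
        finally have "y \<odot>\<^bsub>K 0\<^esub> a \<in> d (- 1) ` X (- 1) (n - s + s)"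
          using X_neg[OF ab(3)] True by simp
        moreover have "n - s \<notin> A" using N(2)[of "n - s"] n by auto
        ultimately have "a \<in> d (- 1) ` X (- 1) (n - s)"
          using reg ab(2) da True by simp
        then obtain a' where a': "a' \<in> X j (n - s)" "a = d j a'" using True by blast
        have "\<bar>N0\<bar> < \<bar>n\<bar>" using N(1) n by auto
        then have "exact_at R K X d {} j n" using N0 j by simp
        from C.cone_boundary[OF _ this, of a b a'] show "u \<in> C.Cd (j - 1) ` C.CX (j - 1) n"
          using u a' unfolding ab(1) tors_empty by blast
      qed
    qed
    then show ?case by blast
  next
    case 3
    obtain us where us: "\<And>m u. (m, u) \<in> set us \<Longrightarrow> u \<in> X 0 m \<and> d 0 u = \<zero>\<^bsub>K 1\<^esub>"
      "\<And>n. {u \<in> X 0 n. d 0 u = \<zero>\<^bsub>K 1\<^esub>} \<subseteq> foldl (adjoin_element P (K 0)) (\<lambda>n. d (- 1) ` X (- 1) n) us n"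
      using finitely_generated by blast
    define us' where "us' = map (\<lambda>(m, u). (m, pr \<zero>\<^bsub>K 1\<^esub> u)) us"
    define B' where "B' = (\<lambda>n. C.Cd (- 1) ` C.CX (- 1) n)"
    interpret A0: module R "K 1" by (rule module_K)
    interpret A1: module R "K 0" by (rule module_K)
    interpret A2: module R "K 2" by (rule module_K)
    have d1: "d 1 \<zero>\<^bsub>K 1\<^esub> = \<zero>\<^bsub>K 2\<^esub>" using d_zero[of 1] by simp
    have yc: "y \<in> carrier R" using P_carrier y by blast
    have us'X: "u \<in> C.CX 0 m \<and> C.Cd 0 u = \<zero>\<^bsub>C.CK 1\<^esub>" if mu: "(m, u) \<in> set us'" for m u
    proof -
      obtain v where v: "(m, v) \<in> set us" "u = pr \<zero>\<^bsub>K 1\<^esub> v" using mu by (auto simp: us'_def)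
      have "v \<in> X 0 m" "d 0 v = \<zero>\<^bsub>K 1\<^esub>" using us(1) v by auto
      then show ?thesis using X_zero[of 1]
        by (simp add: v(2) C.CX_iff C.Cd_pr C.CK_simps d1 yc A2.M.a_inv_zero)
    qed
    have B': "V.hom_submodule B'" unfolding B'_def by (rule D.hom_submodule_boundaries)
    have L: "V.hom_submodule (foldl V.adjoin B' us')" "B' n \<subseteq> foldl V.adjoin B' us' n" for n
      using V.hom_submodule_foldl[OF B', of us'] us'X by blast+
    have B'I: "C.Cd (- 1) (pr a b) \<in> B' n" if "a \<in> X 0 (n - s)" "b \<in> X (- 1) n" for a b n
      using that unfolding B'_def by (intro imageI) (simp add: C.CX_iff)
    have "{u \<in> C.CX 0 n. C.Cd 0 u = \<zero>\<^bsub>C.CK 1\<^esub>} \<subseteq> foldl V.adjoin B' us' n" for n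
    proof safe
      fix u assume u: "u \<in> C.CX 0 n" "C.Cd 0 u = \<zero>\<^bsub>C.CK 1\<^esub>"
      then obtain a b where ab: "u = pr a b" "a \<in> X 1 (n - s)" "b \<in> X 0 n" by (auto elim: C.CXE)
      have u': "pr a b \<in> tors R (C.CK 0) {} (C.CX 0 n)" "C.Cd 0 (pr a b) = \<zero>\<^bsub>C.CK (0 + 1)\<^esub>"
        using u ab(1) by simp_all
      have "d 1 a = \<zero>\<^bsub>K 2\<^esub>" using C.cone_cocycle_fst[OF torsD[OF u'(1)] u'(2)] by simp
      then obtain a' where a': "a' \<in> X 0 (n - s)" "a = d 0 a'"
        using exact_above[of 1 "n - s"] ab(2) by (auto simp: exact_at_def)
      define b1 where "b1 = b \<oplus>\<^bsub>K 0\<^esub> y \<odot>\<^bsub>K 0\<^esub> a'"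
      have "b1 \<in> X 0 n" "d 0 b1 = \<zero>\<^bsub>K 1\<^esub>"
        using C.cone_cocycle[OF _ u', of a'] a' unfolding b1_def by auto
      then have "b1 \<in> foldl (adjoin_element P (K 0)) (\<lambda>n. d (- 1) ` X (- 1) n) us n"
        using us(2) by blast
      then have pb1: "pr \<zero>\<^bsub>K 1\<^esub> b1 \<in> foldl V.adjoin B' us' n"
        unfolding us'_def CK
      proof (rule C.foldl_adjoin_pr[rotated -1, OF _ module_K module_K P_sub])
        show "d (- 1) ` X (- 1) n \<subseteq> carrier (K 0)" for n
          using d_closed[of _ "-1"] X_carrier[of _ 0] by auto
        show "u \<in> carrier (K 0)" if "(m, u) \<in> set us" for m u using us(1)[OF that] X_carrier by blast
        show "pr \<zero>\<^bsub>K 1\<^esub> x \<in> B' n" if x: "x \<in> d (- 1) ` X (- 1) n" for x n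
        proof -
          obtain w where w: "w \<in> X (- 1) n" "x = d (- 1) w" using x by blast
          have "x \<in> carrier (K 0)" using d_closed[OF w(1)] X_carrier w(2) by force
          then have "C.Cd (- 1) (pr \<zero>\<^bsub>K 0\<^esub> w) = pr \<zero>\<^bsub>K 1\<^esub> x"
            using d_zero[of 0] yc by (simp add: C.Cd_pr w(2) A0.M.a_inv_zero)
          then show ?thesis using B'I[OF X_zero w(1)] by simp
        qed
      qed
      have c: "a \<in> carrier (K 1)" "b \<in> carrier (K 0)" "a' \<in> carrier (K 0)" "y \<odot>\<^bsub>K 0\<^esub> a' \<in> carrier (K 0)"
        using ab a' X_carrier yc by auto
      \<comment> \<open>With \<open>a = d a'\<close> the cocycle \<open>(a, b)\<close> splits into a
        coboundary and \<open>(0, b1)\<close>, where \<open>b1\<close> is a cocycle of the old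
        complex.\<close>
      have "C.Cd (- 1) (pr (\<ominus>\<^bsub>K 0\<^esub> a') \<zero>\<^bsub>K (- 1)\<^esub>) = pr a (\<ominus>\<^bsub>K 0\<^esub> (y \<odot>\<^bsub>K 0\<^esub> a'))"
        using c d_zero[of "-1"] d_neg[OF a'(1)] yc by (simp add: C.Cd_pr a'(2) A1.smult_r_minus)
      then have "pr a (\<ominus>\<^bsub>K 0\<^esub> (y \<odot>\<^bsub>K 0\<^esub> a')) \<in> foldl V.adjoin B' us' n"
        using B'I[OF X_neg[OF a'(1)] X_zero] L(2) by (metis subsetD)
      then have "pr a (\<ominus>\<^bsub>K 0\<^esub> (y \<odot>\<^bsub>K 0\<^esub> a')) \<oplus>\<^bsub>C.CK 0\<^esub> pr \<zero>\<^bsub>K 1\<^esub> b1 \<in> foldl V.adjoin B' us' n"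
        using pb1 V.hom_submoduleD(3)[OF L(1)] by blast
      moreover have "pr a (\<ominus>\<^bsub>K 0\<^esub> (y \<odot>\<^bsub>K 0\<^esub> a')) \<oplus>\<^bsub>C.CK 0\<^esub> pr \<zero>\<^bsub>K 1\<^esub> b1 = pr a b"
        unfolding CK b1_def using c by (simp add: C.pair_add A1.M.a_lcomm A1.M.l_neg)
      ultimately show "u \<in> foldl V.adjoin B' us' n" by (simp add: ab(1))
    qed
    then show ?case using us'X unfolding B'_def by (intro exI[of _ us']) auto
  qed
qed

end


section \<open>Tameness\<close>

definition exact_below_some ::
  "('a, 'r) ring_scheme \<Rightarrow> (int \<Rightarrow> ('a, 'w, 'z) module_scheme) \<Rightarrow> (int \<Rightarrow> int \<Rightarrow> 'w set) \<Rightarrow>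
     (int \<Rightarrow> 'w \<Rightarrow> 'w) \<Rightarrow> 'a set \<Rightarrow> int \<Rightarrow> bool" where
  "exact_below_some R K X d S i \<longleftrightarrow> (\<exists>n0. \<forall>n\<le>n0. exact_at R K X d S i n)"

definition exact_above_some ::
  "('a, 'r) ring_scheme \<Rightarrow> (int \<Rightarrow> ('a, 'w, 'z) module_scheme) \<Rightarrow> (int \<Rightarrow> int \<Rightarrow> 'w set) \<Rightarrow>
     (int \<Rightarrow> 'w \<Rightarrow> 'w) \<Rightarrow> 'a set \<Rightarrow> int \<Rightarrow> bool" where
  "exact_above_some R K X d S i \<longleftrightarrow> (\<exists>n0. \<forall>n\<ge>n0. exact_at R K X d S i n)"

definition exact_cofinally ::
  "('a, 'r) ring_scheme \<Rightarrow> (int \<Rightarrow> ('a, 'w, 'z) module_scheme) \<Rightarrow> (int \<Rightarrow> int \<Rightarrow> 'w set) \<Rightarrow>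
     (int \<Rightarrow> 'w \<Rightarrow> 'w) \<Rightarrow> 'a set \<Rightarrow> int \<Rightarrow> bool" where
  "exact_cofinally R K X d S i \<longleftrightarrow> (\<forall>m. \<exists>n\<le>m. exact_at R K X d S i n)"

text \<open>The exponent is uniform in \<open>n\<close> and \<open>u\<close>: a power of
  \<open>y\<close> annihilates the whole \<open>i\<close>-th torsion cohomology, for each
  homogeneous \<open>y\<close> of positive degree.\<close>

definition positively_nilpotent ::
  "('a, 'r) ring_scheme \<Rightarrow> (int \<Rightarrow> 'a set) \<Rightarrow> (int \<Rightarrow> ('a, 'w, 'z) module_scheme) \<Rightarrow>
     (int \<Rightarrow> int \<Rightarrow> 'w set) \<Rightarrow> (int \<Rightarrow> 'w \<Rightarrow> 'w) \<Rightarrow> 'a set \<Rightarrow> int \<Rightarrow> bool" where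
  "positively_nilpotent R P K X d S i \<longleftrightarrow> (\<forall>e\<ge>1. \<forall>y\<in>P e. \<exists>k::nat. \<forall>n.
     \<forall>u\<in>tors R (K i) S (X i n). d i u = \<zero>\<^bsub>K (i + 1)\<^esub> \<longrightarrow>
       (y [^]\<^bsub>R\<^esub> k) \<odot>\<^bsub>K i\<^esub> u \<in> d (i - 1) ` tors R (K (i - 1)) S (X (i - 1) (n + int k * e)))"

context graded_complex
begin

text \<open>If the cohomology is confined to degrees between \<open>n0\<close> and
  \<open>n1\<close>, the exponent \<open>n1 - n0\<close> moves every class past them, as
  \<open>y\<close> has degree at least 1.\<close>

lemma positively_nilpotentI:
  assumes S: "S \<subseteq> (\<Union>e. P e)"
    and "exact_below_some R K X d S i" "exact_above_some R K X d S i"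
  shows "positively_nilpotent R P K X d S i"
  unfolding positively_nilpotent_def
proof (intro allI ballI impI)
  fix e :: int and y assume e: "1 \<le> e" and y: "y \<in> P e"
  have Sc: "S \<subseteq> carrier R" using S P_carrier by blast
  obtain n0 n1 where n0: "\<And>n. n \<le> n0 \<Longrightarrow> exact_at R K X d S i n"
    and n1: "\<And>n. n \<ge> n1 \<Longrightarrow> exact_at R K X d S i n"
    using assms(2,3) unfolding exact_below_some_def exact_above_some_def by blast
  define k where "k = nat (n1 - n0)"
  have "(y [^] k) \<odot>\<^bsub>K i\<^esub> u \<in> d (i - 1) ` tors R (K (i - 1)) S (X (i - 1) (n + int k * e))"
    if u: "u \<in> tors R (K i) S (X i n)" "d i u = \<zero>\<^bsub>K (i + 1)\<^esub>" for n u
  proof (cases "n \<le> n0")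
    case True
    then have "u \<in> d (i - 1) ` tors R (K (i - 1)) S (X (i - 1) n)"
      using n0[OF True] u by (simp add: exact_at_def)
    then show ?thesis by (rule pow_boundary[OF _ Sc P_pow[OF y]])
  next
    case False
    have "int k \<le> int k * e" using e by (simp add: mult_le_cancel_left1)
    moreover have "n1 - n0 \<le> int k" by (simp add: k_def)
    ultimately have "n + int k * e \<ge> n1" using False by linarith
    moreover have "(y [^] k) \<odot>\<^bsub>K i\<^esub> u \<in> tors R (K i) S (X i (n + int k * e))"
      by (rule tors_X_smult[OF Sc u(1) P_pow[OF y]])
    moreover have "d i ((y [^] k) \<odot>\<^bsub>K i\<^esub> u) = \<zero>\<^bsub>K (i + 1)\<^esub>"
      using d_smult[OF P_pow[OF y] torsD[OF u(1)]] u(2) P_carrier[OF P_pow[OF y]]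
        module.smult_r_null[OF module_K] by simp
    ultimately show ?thesis using n1 by (simp add: exact_at_def)
  qed
  then show "\<exists>k::nat. \<forall>n. \<forall>u\<in>tors R (K i) S (X i n). d i u = \<zero>\<^bsub>K (i + 1)\<^esub> \<longrightarrow>
       (y [^] k) \<odot>\<^bsub>K i\<^esub> u \<in> d (i - 1) ` tors R (K (i - 1)) S (X (i - 1) (n + int k * e))" by blast
qed

end

context mapping_cone
begin

text \<open>Exponents add along H^i(K2) \<rightarrow> H^i(C) \<rightarrow> H^{i+1}(K1):
  \<open>y^k\<close> moves a class into the image of H^i(K2), and there \<open>y^l\<close> kills
  it.\<close>

lemma positively_nilpotent_cone:
  assumes S: "S \<subseteq> (\<Union>e. P e)"
    and nil: "positively_nilpotent R P K1 X1 d1 S (i + 1)" "positively_nilpotent R P K2 X2 d2 S i"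
  shows "positively_nilpotent R P CK CX Cd S i"
  unfolding positively_nilpotent_def
proof (intro allI ballI impI)
  fix e :: int and y assume e: "1 \<le> e" and y: "y \<in> P e"
  have Sc: "S \<subseteq> carrier R" using S A.P_carrier by blast
  have yc: "y \<in> carrier R" using y A.P_carrier by blast
  interpret C: graded_complex R P CK CX Cd by (rule C_complex)
  obtain k :: nat where k: "\<And>n u. u \<in> tors R (K1 (i + 1)) S (X1 (i + 1) n) \<Longrightarrow>
      d1 (i + 1) u = \<zero>\<^bsub>K1 (i + 1 + 1)\<^esub> \<Longrightarrow>
      (y [^] k) \<odot>\<^bsub>K1 (i + 1)\<^esub> u \<in> d1 i ` tors R (K1 i) S (X1 i (n + int k * e))"
    using nil(1) e y unfolding positively_nilpotent_def by fastforce
  obtain l :: nat where l: "\<And>n u. u \<in> tors R (K2 i) S (X2 i n) \<Longrightarrow> d2 i u = \<zero>\<^bsub>K2 (i + 1)\<^esub> \<Longrightarrow>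
      (y [^] l) \<odot>\<^bsub>K2 i\<^esub> u \<in> d2 (i - 1) ` tors R (K2 (i - 1)) S (X2 (i - 1) (n + int l * e))"
    using nil(2) e y unfolding positively_nilpotent_def by fastforce
  have "(y [^] (l + k)) \<odot>\<^bsub>CK i\<^esub> u \<in> Cd (i - 1) ` tors R (CK (i - 1)) S (CX (i - 1) (n + int (l + k) * e))"
    if u: "u \<in> tors R (CK i) S (CX i n)" "Cd i u = \<zero>\<^bsub>CK (i + 1)\<^esub>" for n u
  proof -
    interpret A': module R "K1 (i + 1)" by (rule A.module_K)
    interpret B': module R "K2 i" by (rule B.module_K)
    interpret CC: module R "CK (i + 1)" by (rule C.module_K)
    from C_torsE[OF Sc u(1)] obtain a b where ab: "u = pr a b"
      "a \<in> tors R (K1 (i + 1)) S (X1 (i + 1) (n - s))" "b \<in> tors R (K2 i) S (X2 i n)" .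
    have "d1 (i + 1) a = \<zero>\<^bsub>K1 (i + 1 + 1)\<^esub>"
      using cone_cocycle_fst u(2) torsD[OF u(1)] unfolding ab(1) by blast
    from k[OF ab(2) this] obtain a' where a': "a' \<in> tors R (K1 i) S (X1 i (n + int k * e - s))"
      "(y [^] k) \<odot>\<^bsub>K1 (i + 1)\<^esub> a = d1 i a'" by (auto simp: algebra_simps)
    have aX: "a \<in> X1 (i + 1) (n - s)" and bX: "b \<in> X2 i n" and a'X: "a' \<in> X1 i (n + int k * e - s)"
      using torsD[OF ab(2)] torsD[OF ab(3)] torsD[OF a'(1)] .
    have c: "a \<in> carrier (K1 (i + 1))" "b \<in> carrier (K2 i)" "a' \<in> carrier (K1 i)" "\<phi> i a' \<in> carrier (K2 i)"
      using A.X_carrier[OF aX] B.X_carrier[OF bX] A.X_carrier[OF a'X]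
        B.X_carrier[OF map_closed'[OF a'X]] .
    have u1: "pr ((y [^] k) \<odot>\<^bsub>K1 (i + 1)\<^esub> a) ((y [^] k) \<odot>\<^bsub>K2 i\<^esub> b) \<in> tors R (CK i) S (CX i (n + int k * e))"
      using C.tors_X_smult[OF Sc u(1) A.P_pow[OF y, of k]] by (simp add: ab(1) CK_simps)
    have u2: "Cd i (pr ((y [^] k) \<odot>\<^bsub>K1 (i + 1)\<^esub> a) ((y [^] k) \<odot>\<^bsub>K2 i\<^esub> b)) = \<zero>\<^bsub>CK (i + 1)\<^esub>"
      using C.d_smult[OF A.P_pow[OF y, of k] torsD[OF u(1)]] u(2) yc CC.smult_r_null[of "y [^] k"]
      by (simp add: ab(1) cone_module_def pair_smult)
    define b1 where "b1 = (y [^] k) \<odot>\<^bsub>K2 i\<^esub> b \<oplus>\<^bsub>K2 i\<^esub> \<phi> i a'"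
    have "b1 \<in> tors R (K2 i) S (X2 i (n + int k * e))" "d2 i b1 = \<zero>\<^bsub>K2 (i + 1)\<^esub>"
      unfolding b1_def using cone_cocycle[OF S u1 u2 a'] .
    from l[OF this] have b1: "(y [^] l) \<odot>\<^bsub>K2 i\<^esub> b1 \<in> d2 (i - 1) ` tors R (K2 (i - 1)) S (X2 (i - 1) (n + int (l + k) * e))"
      by (simp add: algebra_simps)
    have deg: "n + int (l + k) * e - s = n + int k * e - s + int l * e" by (simp add: algebra_simps)
    have "pr ((y [^] (l + k)) \<odot>\<^bsub>K1 (i + 1)\<^esub> a) ((y [^] (l + k)) \<odot>\<^bsub>K2 i\<^esub> b)
       \<in> Cd (i - 1) ` tors R (CK (i - 1)) S (CX (i - 1) (n + int (l + k) * e))"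
    proof (rule cone_boundaryI[OF S, where a' = "(y [^] l) \<odot>\<^bsub>K1 i\<^esub> a'"])
      show "(y [^] (l + k)) \<odot>\<^bsub>K2 i\<^esub> b \<in> carrier (K2 i)" using yc c by simp
      show "(y [^] l) \<odot>\<^bsub>K1 i\<^esub> a' \<in> tors R (K1 i) S (X1 i (n + int (l + k) * e - s))"
        unfolding deg by (rule A.tors_X_smult[OF Sc a'(1) A.P_pow[OF y]])
      have "(y [^] (l + k)) \<odot>\<^bsub>K1 (i + 1)\<^esub> a = (y [^] l) \<odot>\<^bsub>K1 (i + 1)\<^esub> ((y [^] k) \<odot>\<^bsub>K1 (i + 1)\<^esub> a)"
        using yc c by (simp add: A'.smult_assoc1[symmetric] A.nat_pow_mult)
      then show "(y [^] (l + k)) \<odot>\<^bsub>K1 (i + 1)\<^esub> a = d1 i ((y [^] l) \<odot>\<^bsub>K1 i\<^esub> a')"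
        using A.d_smult[OF A.P_pow[OF y] a'X] a'(2) by simp
      have "(y [^] (l + k)) \<odot>\<^bsub>K2 i\<^esub> b = (y [^] l) \<odot>\<^bsub>K2 i\<^esub> ((y [^] k) \<odot>\<^bsub>K2 i\<^esub> b)"
        using yc c by (simp add: B'.smult_assoc1[symmetric] A.nat_pow_mult)
      moreover have "\<phi> i ((y [^] l) \<odot>\<^bsub>K1 i\<^esub> a') = (y [^] l) \<odot>\<^bsub>K2 i\<^esub> \<phi> i a'"
        by (rule map_smult[OF A.P_pow[OF y] a'X])
      ultimately have "(y [^] (l + k)) \<odot>\<^bsub>K2 i\<^esub> b \<oplus>\<^bsub>K2 i\<^esub> \<phi> i ((y [^] l) \<odot>\<^bsub>K1 i\<^esub> a') = (y [^] l) \<odot>\<^bsub>K2 i\<^esub> b1"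
        unfolding b1_def using yc c by (simp add: B'.smult_r_distr)
      then show "(y [^] (l + k)) \<odot>\<^bsub>K2 i\<^esub> b \<oplus>\<^bsub>K2 i\<^esub> \<phi> i ((y [^] l) \<odot>\<^bsub>K1 i\<^esub> a')
          \<in> d2 (i - 1) ` tors R (K2 (i - 1)) S (X2 (i - 1) (n + int (l + k) * e))" using b1 by simp
    qed
    then show ?thesis by (simp add: ab(1) CK_simps)
  qed
  then show "\<exists>k::nat. \<forall>n. \<forall>u\<in>tors R (CK i) S (CX i n). Cd i u = \<zero>\<^bsub>CK (i + 1)\<^esub> \<longrightarrow>
       (y [^] k) \<odot>\<^bsub>CK i\<^esub> u \<in> Cd (i - 1) ` tors R (CK (i - 1)) S (CX (i - 1) (n + int k * e))" by blast
qed

end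

text \<open>Write \<open>q = t s + b\<close> with \<open>b < s \<le> t\<close> and replace
  \<open>b\<close> of the \<open>t\<close> summands \<open>s\<close> by \<open>s + 1\<close>. A
  single step length would reach only one residue class modulo \<open>s\<close>.\<close>

lemma semigroup_consecutive:
  fixes s :: int
  assumes "s \<ge> 1" "q \<ge> s * s"
  shows "\<exists>a b :: nat. q = int a * s + int b * (s + 1)"
proof -
  define t b where "t = q div s" and "b = q mod s"
  have b: "0 \<le> b" "b < s" using assms(1) by (auto simp: b_def)
  have q: "q = t * s + b" by (simp add: t_def b_def)
  have "t \<ge> s" using assms by (simp add: t_def zdiv_mono1[of "s * s" q s, simplified])
  then have "q = int (nat (t - b)) * s + int (nat b) * (s + 1)" using b q by (simp add: algebra_simps)
  then show ?thesis by blast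
qed

section \<open>The induction steps for vanishing in large and in small degrees\<close>

context admissible_complex
begin

lemma multiplication_cone:
  assumes "pairing pr p1 p2"
  obtains s0 where "\<And>s. s \<ge> s0 \<Longrightarrow> \<exists>y\<in>P s.
    mapping_cone pr p1 p2 R P K X d K X d s (\<lambda>i x. y \<odot>\<^bsub>K i\<^esub> x) \<and>
    admissible_complex R P G (cone_module pr p1 p2 K K) (cone_part pr s X X)
      (cone_diff pr p1 p2 K K d d (\<lambda>i x. y \<odot>\<^bsub>K i\<^esub> x))"
proof -
  obtain A s0 where A: "finite A"
    "\<And>s. s \<ge> s0 \<Longrightarrow> \<exists>y\<in>P s. \<forall>n u. n \<notin> A \<longrightarrow> u \<in> X 0 n \<longrightarrow> d 0 u = \<zero>\<^bsub>K 1\<^esub> \<longrightarrow>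
        y \<odot>\<^bsub>K 0\<^esub> u \<in> d (- 1) ` X (- 1) (n + s) \<longrightarrow> u \<in> d (- 1) ` X (- 1) n"
    by (rule almost_regular_elements) blast
  show thesis
  proof (rule that)
    fix s assume "s0 \<le> s"
    from A(2)[OF this] obtain y where y: "y \<in> P s"
      "\<And>n u. n \<notin> A \<Longrightarrow> u \<in> X 0 n \<Longrightarrow> d 0 u = \<zero>\<^bsub>K 1\<^esub> \<Longrightarrow>
        y \<odot>\<^bsub>K 0\<^esub> u \<in> d (- 1) ` X (- 1) (n + s) \<Longrightarrow> u \<in> d (- 1) ` X (- 1) n" by blast
    show "\<exists>y\<in>P s.
      mapping_cone pr p1 p2 R P K X d K X d s (\<lambda>i x. y \<odot>\<^bsub>K i\<^esub> x) \<and>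
      admissible_complex R P G (cone_module pr p1 p2 K K) (cone_part pr s X X)
        (cone_diff pr p1 p2 K K d d (\<lambda>i x. y \<odot>\<^bsub>K i\<^esub> x))"
      by (intro bexI[OF _ y(1)] conjI mapping_cone_smult[OF assms y(1)] cone_admissible[OF assms y(1) A(1) y(2)])
  qed
qed

text \<open>As the cone has no torsion cohomology in position \<open>i\<close> and large degrees,
  \<open>y\<close> acts injectively on the one of \<open>K\<close> in position \<open>i + 1\<close>
  there. But \<open>y\<close> has positive degree, so a power of it kills any given
  \<open>G\<close>-torsion element.\<close>

lemma exact_above_step:
  fixes pr :: "'w \<Rightarrow> 'w \<Rightarrow> 'p"
  assumes pair: "pairing pr p1 p2" and Y: "Y \<subseteq> P 0"
    and IH: "\<And>(K' :: int \<Rightarrow> ('a, 'p) module) X' d'. admissible_complex R P G K' X' d' \<Longrightarrow>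
      exact_above_some R K' X' d' (G \<union> Y) i"
  shows "exact_above_some R K X d (G \<union> Y) (i + 1)"
proof -
  define S where "S = G \<union> Y"
  have S: "S \<subseteq> (\<Union>e. P e)" using G_sub Y by (auto simp: S_def)
  have Sc: "S \<subseteq> carrier R" using S P_carrier by blast
  obtain s0 where s0: "\<And>s. s \<ge> s0 \<Longrightarrow> \<exists>y\<in>P s.
    mapping_cone pr p1 p2 R P K X d K X d s (\<lambda>i x. y \<odot>\<^bsub>K i\<^esub> x) \<and>
    admissible_complex R P G (cone_module pr p1 p2 K K) (cone_part pr s X X)
      (cone_diff pr p1 p2 K K d d (\<lambda>i x. y \<odot>\<^bsub>K i\<^esub> x))"
    using multiplication_cone[OF pair] by blast
  \<comment> \<open>The degree is chosen positive so that multiplication by \<open>y\<close> never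
    leaves the range of large degrees and is nilpotent on each torsion element.\<close>
  define s where "s = max s0 1"
  have s: "s \<ge> s0" "s \<ge> 1" by (auto simp: s_def)
  obtain y where y: "y \<in> P s" and mc: "mapping_cone pr p1 p2 R P K X d K X d s (\<lambda>i x. y \<odot>\<^bsub>K i\<^esub> x)"
    and ac: "admissible_complex R P G (cone_module pr p1 p2 K K) (cone_part pr s X X)
      (cone_diff pr p1 p2 K K d d (\<lambda>i x. y \<odot>\<^bsub>K i\<^esub> x))" using s0[OF s(1)] by blast
  interpret C: mapping_cone pr p1 p2 R P K X d K X d s "\<lambda>i x. y \<odot>\<^bsub>K i\<^esub> x" by (rule mc)
  interpret M: module R "K (i + 1)" by (rule module_K)
  have yc: "y \<in> carrier R" using y P_carrier by blast
  obtain N where N: "\<And>n. n \<ge> N \<Longrightarrow> exact_at R C.CK C.CX C.Cd S i n"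
    using IH[OF ac] unfolding exact_above_some_def S_def by blast
  have inj: "u \<in> d i ` tors R (K i) S (X i m)"
    if u: "u \<in> tors R (K (i + 1)) S (X (i + 1) m)" "d (i + 1) u = \<zero>\<^bsub>K (i + 1 + 1)\<^esub>" "m \<ge> N"
      "(y [^] k) \<odot>\<^bsub>K (i + 1)\<^esub> u = \<zero>\<^bsub>K (i + 1)\<^esub>" for m u and k :: nat
    using u
  proof (induction k arbitrary: m u)
    case 0
    then have "u = \<zero>\<^bsub>K (i + 1)\<^esub>" using X_carrier[OF torsD[OF 0(1)]] by simp
    then show ?case using d_zero[of i] tors_X_zero[OF Sc] by (metis imageI)
  next
    case (Suc k)
    have uX: "u \<in> X (i + 1) m" using Suc.prems(1) by (rule torsD)
    have uc: "u \<in> carrier (K (i + 1))" using uX by (rule X_carrier)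
    have yu: "y \<odot>\<^bsub>K (i + 1)\<^esub> u \<in> tors R (K (i + 1)) S (X (i + 1) (m + s))"
      by (rule tors_X_smult[OF Sc Suc.prems(1) y])
    have "y \<odot>\<^bsub>K (i + 1)\<^esub> u \<in> d i ` tors R (K i) S (X i (m + s))"
    proof (rule Suc.IH[OF yu])
      show "d (i + 1) (y \<odot>\<^bsub>K (i + 1)\<^esub> u) = \<zero>\<^bsub>K (i + 1 + 1)\<^esub>"
        unfolding d_smult[OF y uX] Suc.prems(2) by (rule module.smult_r_null[OF module_K yc])
      show "(y [^] k) \<odot>\<^bsub>K (i + 1)\<^esub> (y \<odot>\<^bsub>K (i + 1)\<^esub> u) = \<zero>\<^bsub>K (i + 1)\<^esub>"
        using Suc.prems(4) yc uc by (simp add: M.smult_assoc1)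
    qed (use Suc.prems s in auto)
    then show ?case
      using C.boundary_of_exact_cone[of S "i + 1" "m + s" u] S N[of "m + s"] Suc.prems s by simp
  qed
  have "exact_at R K X d S (i + 1) m" if m: "m \<ge> N" for m
    unfolding exact_at_def
  proof (intro ballI impI)
    fix u assume u: "u \<in> tors R (K (i + 1)) S (X (i + 1) m)" "d (i + 1) u = \<zero>\<^bsub>K (i + 1 + 1)\<^esub>"
    have "\<exists>k::nat. (y [^] k) \<odot>\<^bsub>K (i + 1)\<^esub> u = \<zero>\<^bsub>K (i + 1)\<^esub>"
    proof (rule positive_nilpotent[OF module_K _ _ s(2) y])
      show "u \<in> carrier (K (i + 1))" using torsD[OF u(1)] by (rule X_carrier)
      show "\<exists>k::nat. (z [^] k) \<odot>\<^bsub>K (i + 1)\<^esub> u = \<zero>\<^bsub>K (i + 1)\<^esub>" if "z \<in> G" for z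
        using u(1) that by (auto simp: tors_def S_def)
    qed
    then show "u \<in> d (i + 1 - 1) ` tors R (K (i + 1 - 1)) S (X (i + 1 - 1) m)"
      using inj[OF u m] by auto
  qed
  then show ?thesis unfolding exact_above_some_def S_def by blast
qed

text \<open>Both alternatives of \<open>cases\<close> pass to position \<open>i\<close> of the cone,
  so \<open>IH\<close> makes the cone exact there in small degrees, and \<open>y\<close> becomes
  injective on H^{i+1} in small degrees. Then either \<open>y^k\<close> is cancelled from the
  nilpotency statement, or one zero component spreads to all sufficiently smaller degrees.\<close>

lemma exact_below_step:
  fixes pr :: "'w \<Rightarrow> 'w \<Rightarrow> 'p"
  assumes pair: "pairing pr p1 p2" and Y: "Y \<subseteq> P 0"
    and IH: "\<And>(K' :: int \<Rightarrow> ('a, 'p) module) X' d'. admissible_complex R P G K' X' d' \<Longrightarrow>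
      (\<And>j. j < i \<Longrightarrow> exact_below_some R K' X' d' (G \<union> Y) j) \<Longrightarrow>
      positively_nilpotent R P K' X' d' (G \<union> Y) i \<or> exact_cofinally R K' X' d' (G \<union> Y) i \<Longrightarrow>
      exact_below_some R K' X' d' (G \<union> Y) i"
    and above: "exact_above_some R K X d (G \<union> Y) i"
    and low: "\<And>j. j < i + 1 \<Longrightarrow> exact_below_some R K X d (G \<union> Y) j"
    and cases: "positively_nilpotent R P K X d (G \<union> Y) (i + 1) \<or> exact_cofinally R K X d (G \<union> Y) (i + 1)"
  shows "exact_below_some R K X d (G \<union> Y) (i + 1)"
proof -
  define S where "S = G \<union> Y"
  note assms' = IH[folded S_def] above[folded S_def] low[folded S_def] cases[folded S_def]
  have S: "S \<subseteq> (\<Union>e. P e)" using G_sub Y by (auto simp: S_def)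
  have Sc: "S \<subseteq> carrier R" using S P_carrier by blast
  \<comment> \<open>H^i vanishes in small degrees by \<open>low\<close> and in large ones by
    \<open>above\<close>; nilpotency of H^i is needed to pass nilpotency of H^{i+1} on to the
    cone.\<close>
  have nil: "positively_nilpotent R P K X d S i"
    by (rule positively_nilpotentI[OF S assms'(3) assms'(2)]) simp
  obtain s0 where s0: "\<And>s. s \<ge> s0 \<Longrightarrow> \<exists>y\<in>P s.
    mapping_cone pr p1 p2 R P K X d K X d s (\<lambda>i x. y \<odot>\<^bsub>K i\<^esub> x) \<and>
    admissible_complex R P G (cone_module pr p1 p2 K K) (cone_part pr s X X)
      (cone_diff pr p1 p2 K K d d (\<lambda>i x. y \<odot>\<^bsub>K i\<^esub> x))"
    using multiplication_cone[OF pair] by blast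
  obtain l0 where l0: "\<And>n. n \<le> l0 \<Longrightarrow> exact_at R K X d S i n"
    using assms'(3)[of i] unfolding exact_below_some_def by auto
  have mono: "\<exists>y\<in>P s. \<exists>n1. \<forall>n\<le>n1. \<forall>u\<in>tors R (K (i + 1)) S (X (i + 1) n).
      d (i + 1) u = \<zero>\<^bsub>K (i + 1 + 1)\<^esub> \<longrightarrow> y \<odot>\<^bsub>K (i + 1)\<^esub> u \<in> d i ` tors R (K i) S (X i (n + s)) \<longrightarrow>
      u \<in> d i ` tors R (K i) S (X i n)" if s: "s \<ge> s0" for s
  proof -
    obtain y where y: "y \<in> P s" and mc: "mapping_cone pr p1 p2 R P K X d K X d s (\<lambda>i x. y \<odot>\<^bsub>K i\<^esub> x)"
      and ac: "admissible_complex R P G (cone_module pr p1 p2 K K) (cone_part pr s X X)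
        (cone_diff pr p1 p2 K K d d (\<lambda>i x. y \<odot>\<^bsub>K i\<^esub> x))" using s0[OF s] by blast
    interpret C: mapping_cone pr p1 p2 R P K X d K X d s "\<lambda>i x. y \<odot>\<^bsub>K i\<^esub> x" by (rule mc)
    have "exact_below_some R C.CK C.CX C.Cd S i"
    proof (rule assms'(1)[OF ac])
      fix j assume "j < i"
      then obtain n1 n2 where n: "\<And>n. n \<le> n1 \<Longrightarrow> exact_at R K X d S (j + 1) n"
        "\<And>n. n \<le> n2 \<Longrightarrow> exact_at R K X d S j n"
        using assms'(3)[of "j + 1"] assms'(3)[of j] unfolding exact_below_some_def by auto
      have "exact_at R C.CK C.CX C.Cd S j n" if "n \<le> min (n1 + s) n2" for n
        using that by (intro C.exact_cone[OF S] n) auto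
      then show "exact_below_some R C.CK C.CX C.Cd S j" unfolding exact_below_some_def by blast
    next
      have "exact_cofinally R C.CK C.CX C.Cd S i" if cof: "exact_cofinally R K X d S (i + 1)"
        unfolding exact_cofinally_def
      proof
        fix m
        \<comment> \<open>The cone in degree \<open>n + s\<close> involves H^i of \<open>K\<close>
          in degree \<open>n + s\<close> and H^{i+1} in degree \<open>n\<close>. The bounds put
          \<open>n + s\<close> below both \<open>m\<close> and \<open>l0\<close>.\<close>
        obtain n where n: "n \<le> min (m - s) (l0 - s)" "exact_at R K X d S (i + 1) n"
          using cof unfolding exact_cofinally_def by blast
        have "exact_at R C.CK C.CX C.Cd S i (n + s)"
          by (rule C.exact_cone[OF S]) (use n l0[of "n + s"] in auto)
        then show "\<exists>n\<le>m. exact_at R C.CK C.CX C.Cd S i n" using n(1) by (intro exI[of _ "n + s"]) auto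
      qed
      then show "positively_nilpotent R P C.CK C.CX C.Cd S i \<or> exact_cofinally R C.CK C.CX C.Cd S i"
        using assms'(4) C.positively_nilpotent_cone[OF S _ nil] by blast
    qed
    then obtain n1 where n1: "\<And>n. n \<le> n1 \<Longrightarrow> exact_at R C.CK C.CX C.Cd S i n"
      unfolding exact_below_some_def by blast
    have "u \<in> d i ` tors R (K i) S (X i n)" if "n \<le> n1 - s" "u \<in> tors R (K (i + 1)) S (X (i + 1) n)"
      "d (i + 1) u = \<zero>\<^bsub>K (i + 1 + 1)\<^esub>" "y \<odot>\<^bsub>K (i + 1)\<^esub> u \<in> d i ` tors R (K i) S (X i (n + s))" for n u
      using C.boundary_of_exact_cone[of S "i + 1" "n + s" u] S n1[of "n + s"] that by simp
    then show ?thesis using y by blast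
  qed
  define s where "s = max s0 1"
  have s: "s \<ge> s0" "s + 1 \<ge> s0" "s \<ge> 1" by (auto simp: s_def)
  obtain y n1 where y: "y \<in> P s" "\<And>n u. n \<le> n1 \<Longrightarrow> u \<in> tors R (K (i + 1)) S (X (i + 1) n) \<Longrightarrow>
      d (i + 1) u = \<zero>\<^bsub>K (i + 1 + 1)\<^esub> \<Longrightarrow> y \<odot>\<^bsub>K (i + 1)\<^esub> u \<in> d i ` tors R (K i) S (X i (n + s)) \<Longrightarrow>
      u \<in> d i ` tors R (K i) S (X i n)" using mono[OF s(1)] by blast
  obtain y' n2 where y': "y' \<in> P (s + 1)" "\<And>n u. n \<le> n2 \<Longrightarrow> u \<in> tors R (K (i + 1)) S (X (i + 1) n) \<Longrightarrow>
      d (i + 1) u = \<zero>\<^bsub>K (i + 1 + 1)\<^esub> \<Longrightarrow> y' \<odot>\<^bsub>K (i + 1)\<^esub> u \<in> d i ` tors R (K i) S (X i (n + (s + 1))) \<Longrightarrow>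
      u \<in> d i ` tors R (K i) S (X i n)" using mono[OF s(2)] by blast
  interpret M: module R "K (i + 1)" by (rule module_K)
  have yc: "y \<in> carrier R" "y' \<in> carrier R" using y y' P_carrier by blast+
  have step: "exact_at R K X d S (i + 1) n" if ex: "exact_at R K X d S (i + 1) (n + e)" and t: "t \<in> P e"
    and can: "\<And>u. u \<in> tors R (K (i + 1)) S (X (i + 1) n) \<Longrightarrow>
      d (i + 1) u = \<zero>\<^bsub>K (i + 1 + 1)\<^esub> \<Longrightarrow> t \<odot>\<^bsub>K (i + 1)\<^esub> u \<in> d i ` tors R (K i) S (X i (n + e)) \<Longrightarrow>
      u \<in> d i ` tors R (K i) S (X i n)" for n t e
    unfolding exact_at_def
  proof (intro ballI impI)
    fix u assume u: "u \<in> tors R (K (i + 1)) S (X (i + 1) n)" "d (i + 1) u = \<zero>\<^bsub>K (i + 1 + 1)\<^esub>"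
    have "t \<odot>\<^bsub>K (i + 1)\<^esub> u \<in> tors R (K (i + 1)) S (X (i + 1) (n + e))"
      by (rule tors_X_smult[OF Sc u(1) t])
    moreover have "d (i + 1) (t \<odot>\<^bsub>K (i + 1)\<^esub> u) = \<zero>\<^bsub>K (i + 1 + 1)\<^esub>"
      unfolding d_smult[OF t torsD[OF u(1)]] u(2) by (rule module.smult_r_null[OF module_K P_carrier[OF t]])
    ultimately have "t \<odot>\<^bsub>K (i + 1)\<^esub> u \<in> d i ` tors R (K i) S (X i (n + e))"
      using ex by (auto simp: exact_at_def)
    then show "u \<in> d (i + 1 - 1) ` tors R (K (i + 1 - 1)) S (X (i + 1 - 1) n)"
      using can[OF u] by simp
  qed
  from assms'(4) show ?thesis
  proof
    assume "positively_nilpotent R P K X d S (i + 1)"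
    then obtain k :: nat where k: "\<And>n u. u \<in> tors R (K (i + 1)) S (X (i + 1) n) \<Longrightarrow>
        d (i + 1) u = \<zero>\<^bsub>K (i + 1 + 1)\<^esub> \<Longrightarrow>
        (y [^] k) \<odot>\<^bsub>K (i + 1)\<^esub> u \<in> d i ` tors R (K i) S (X i (n + int k * s))"
      using s(3) y(1) unfolding positively_nilpotent_def by fastforce
    \<comment> \<open>Multiplication by \<open>y^l\<close> climbs from degree \<open>n\<close> to
      \<open>n + l s\<close>; the bound on the last degree keeps all intermediate ones in the range
      where \<open>y\<close> can be cancelled.\<close>
    have cancel: "u \<in> d i ` tors R (K i) S (X i n)" if "n + int l * s \<le> n1"
      "u \<in> tors R (K (i + 1)) S (X (i + 1) n)" "d (i + 1) u = \<zero>\<^bsub>K (i + 1 + 1)\<^esub>"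
      "(y [^] l) \<odot>\<^bsub>K (i + 1)\<^esub> u \<in> d i ` tors R (K i) S (X i (n + int l * s))" for n u and l :: nat
      using that
    proof (induction l arbitrary: n u)
      case 0
      then show ?case using X_carrier[OF torsD[OF 0(2)]] by simp
    next
      case (Suc l)
      have uX: "u \<in> X (i + 1) n" using Suc.prems(2) by (rule torsD)
      have uc: "u \<in> carrier (K (i + 1))" using uX by (rule X_carrier)
      have deg: "n + s + int l * s = n + int (Suc l) * s" by (simp add: algebra_simps)
      have "y \<odot>\<^bsub>K (i + 1)\<^esub> u \<in> d i ` tors R (K i) S (X i (n + s))"
      proof (rule Suc.IH)
        show "n + s + int l * s \<le> n1" using Suc.prems(1) deg by simp
        show "y \<odot>\<^bsub>K (i + 1)\<^esub> u \<in> tors R (K (i + 1)) S (X (i + 1) (n + s))"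
          by (rule tors_X_smult[OF Sc Suc.prems(2) y(1)])
        show "d (i + 1) (y \<odot>\<^bsub>K (i + 1)\<^esub> u) = \<zero>\<^bsub>K (i + 1 + 1)\<^esub>"
          unfolding d_smult[OF y(1) uX] Suc.prems(3) by (rule module.smult_r_null[OF module_K yc(1)])
        show "(y [^] l) \<odot>\<^bsub>K (i + 1)\<^esub> (y \<odot>\<^bsub>K (i + 1)\<^esub> u) \<in> d i ` tors R (K i) S (X i (n + s + int l * s))"
          using Suc.prems(4) yc uc unfolding deg by (simp add: M.smult_assoc1)
      qed
      moreover have "n \<le> n1"
      proof -
        have "0 \<le> int (Suc l) * s" using s(3) by simp
        then show ?thesis using Suc.prems(1) by linarith
      qed
      ultimately show ?case using y(2) Suc.prems(2,3) by blast
    qed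
    have "exact_at R K X d S (i + 1) n" if n: "n \<le> n1 - int k * s" for n
      unfolding exact_at_def using cancel[OF _ _ _ k] n by auto
    then show ?thesis unfolding exact_below_some_def S_def by blast
  next
    assume cof: "exact_cofinally R K X d S (i + 1)"
    \<comment> \<open>Below both \<open>n1\<close> and \<open>n2\<close>, so that either element can
      be cancelled in all smaller degrees.\<close>
    obtain m where m: "m \<le> min n1 n2" "exact_at R K X d S (i + 1) m"
      using cof unfolding exact_cofinally_def by blast
    have down1: "exact_at R K X d S (i + 1) (n - int a * s)" if "n \<le> n1" "exact_at R K X d S (i + 1) n" for n and a :: nat
    proof (induction a)
      case 0
      then show ?case using that by simp
    next
      case (Suc a)
      have le: "n - int (Suc a) * s \<le> n1"
      proof -
        have "0 \<le> int (Suc a) * s" using s(3) by simp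
        then show ?thesis using that(1) by linarith
      qed
      have deg: "n - int (Suc a) * s + s = n - int a * s" by (simp add: algebra_simps)
      show ?case
      proof (rule step[OF _ y(1)])
        show "exact_at R K X d S (i + 1) (n - int (Suc a) * s + s)" unfolding deg by (rule Suc.IH)
      qed (use y(2)[OF le] in blast)
    qed
    have down2: "exact_at R K X d S (i + 1) (n - int b * (s + 1))" if "n \<le> n2" "exact_at R K X d S (i + 1) n" for n and b :: nat
    proof (induction b)
      case 0
      then show ?case using that by simp
    next
      case (Suc b)
      have le: "n - int (Suc b) * (s + 1) \<le> n2"
      proof -
        have "0 \<le> int (Suc b) * (s + 1)" using s(3) by simp
        then show ?thesis using that(1) by linarith
      qed
      have deg: "n - int (Suc b) * (s + 1) + (s + 1) = n - int b * (s + 1)" by (simp add: algebra_simps)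
      show ?case
      proof (rule step[OF _ y'(1)])
        show "exact_at R K X d S (i + 1) (n - int (Suc b) * (s + 1) + (s + 1))"
          unfolding deg by (rule Suc.IH)
      qed (use y'(2)[OF le] in blast)
    qed
    have "exact_at R K X d S (i + 1) n" if n: "n \<le> m - s * s" for n
    proof -
      have "m - n \<ge> s * s" using n by simp
      then obtain a b :: nat where ab: "m - n = int a * s + int b * (s + 1)"
        using semigroup_consecutive[OF s(3)] by blast
      have "m - int a * s \<le> n2"
      proof -
        have "0 \<le> int a * s" using s(3) by simp
        then show ?thesis using m(1) by linarith
      qed
      then have "exact_at R K X d S (i + 1) (m - int a * s - int b * (s + 1))"
        using down1[of m a] m by (intro down2) auto
      moreover have "m - int a * s - int b * (s + 1) = n" using ab by linarith
      ultimately show ?thesis by simp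
    qed
    then show ?thesis unfolding exact_below_some_def S_def by blast
  qed
qed

end

text \<open>Iterated cones of a complex with elements in \<open>'w\<close> have elements in \<open>'w cone_tree\<close>, which makes
  the induction on the cohomological degree possible within one type.\<close>

datatype 'w cone_tree = Leaf 'w | Node "'w cone_tree" "'w cone_tree"

fun left_branch where
  "left_branch (Node a b) = a"
| "left_branch (Leaf x) = Leaf x"

fun right_branch where
  "right_branch (Node a b) = b"
| "right_branch (Leaf x) = Leaf x"

fun leaf_value where
  "leaf_value (Leaf x) = x"
| "leaf_value (Node a b) = undefined"

lemma pairing_Node: "pairing Node left_branch right_branch"
  by unfold_locales auto

text \<open>The first cone leads from the original type into trees; all further ones use
  \<open>Node\<close> and stay there.\<close>

lemma pairing_Leaf:
  "pairing (\<lambda>a b. Node (Leaf a) (Leaf b)) (\<lambda>t. leaf_value (left_branch t)) (\<lambda>t. leaf_value (right_branch t))"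
  by unfold_locales auto

context admissible_complex
begin

lemma exact_low_some:
  assumes "finite Y" "Y \<subseteq> P 0" "j \<le> 0"
  shows "exact_above_some R K X d (G \<union> Y) j" "exact_below_some R K X d (G \<union> Y) j"
proof -
  obtain N where N: "\<And>n. \<bar>n\<bar> > N \<Longrightarrow> exact_at R K X d (G \<union> Y) j n"
    using exact_low[OF assms(1,2)] assms(3) by blast
  show "exact_above_some R K X d (G \<union> Y) j" unfolding exact_above_some_def
    using N by (intro exI[of _ "\<bar>N\<bar> + 1"]) auto
  show "exact_below_some R K X d (G \<union> Y) j" unfolding exact_below_some_def
    using N by (intro exI[of _ "- \<bar>N\<bar> - 1"]) auto
qed

end

lemma (in graded_noetherian) exact_above_tree:
  fixes K :: "int \<Rightarrow> ('a, 'w cone_tree) module"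
  assumes "finite Y" "Y \<subseteq> P 0" "admissible_complex R P G K X d"
  shows "exact_above_some R K X d (G \<union> Y) (int i)"
  using assms(3)
proof (induction i arbitrary: K X d)
  case 0
  then show ?case using admissible_complex.exact_low_some(1) assms by fastforce
next
  case (Suc i)
  have "exact_above_some R K X d (G \<union> Y) (int i + 1)"
    by (rule admissible_complex.exact_above_step[OF Suc.prems pairing_Node assms(2) Suc.IH])
  then show ?case by (simp add: add.commute)
qed

lemma (in graded_noetherian) exact_below_tree:
  fixes K :: "int \<Rightarrow> ('a, 'w cone_tree) module"
  assumes "finite Y" "Y \<subseteq> P 0" "admissible_complex R P G K X d"
    and "\<And>j. j < int i \<Longrightarrow> exact_below_some R K X d (G \<union> Y) j"
    and "positively_nilpotent R P K X d (G \<union> Y) (int i) \<or> exact_cofinally R K X d (G \<union> Y) (int i)"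
  shows "exact_below_some R K X d (G \<union> Y) (int i)"
  using assms(3-)
proof (induction i arbitrary: K X d)
  case 0
  then show ?case using admissible_complex.exact_low_some(2) assms by fastforce
next
  case (Suc i)
  have eq: "int (Suc i) = int i + 1" by simp
  show ?case unfolding eq
    by (rule admissible_complex.exact_below_step[OF Suc.prems(1) pairing_Node assms(2) Suc.IH
          exact_above_tree[OF assms(1,2) Suc.prems(1)] Suc.prems(2,3)[unfolded eq]])
qed

context admissible_complex
begin

theorem local_cohomology_vanishes_above:
  assumes "finite Y" "Y \<subseteq> P 0"
  shows "exact_above_some R K X d (G \<union> Y) i"
proof (cases "i \<le> 0")
  case True
  then show ?thesis by (rule exact_low_some(1)[OF assms])
next
  case False
  define j where "j = nat (i - 1)"
  have i: "i = int j + 1" using False by (simp add: j_def)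
  show ?thesis unfolding i
    by (rule exact_above_step[OF pairing_Leaf assms(2) exact_above_tree[OF assms]])
qed

text \<open>Read contrapositively: the first position whose components do not all vanish in small
  degrees has nonzero components in all small degrees. The first cone changes the type, hence the
  step from \<open>j\<close> to \<open>j + 1\<close> outside the induction on trees.\<close>

theorem local_cohomology_tame:
  assumes "finite Y" "Y \<subseteq> P 0"
    and "\<And>j. j < i \<Longrightarrow> exact_below_some R K X d (G \<union> Y) j"
    and "positively_nilpotent R P K X d (G \<union> Y) i \<or> exact_cofinally R K X d (G \<union> Y) i"
  shows "exact_below_some R K X d (G \<union> Y) i"
proof (cases "i \<le> 0")
  case True
  then show ?thesis by (rule exact_low_some(2)[OF assms(1,2)])
next
  case False
  define j where "j = nat (i - 1)"
  have i: "i = int j + 1" using False by (simp add: j_def)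
  show ?thesis using assms(3,4) unfolding i
    by (intro exact_below_step[OF pairing_Leaf assms(2) exact_below_tree[OF assms(1,2)]
          local_cohomology_vanishes_above[OF assms(1,2)]])
qed

end


section \<open>Graded groups and rings\<close>

lemma (in abelian_group) additive_subgroup_iff:
  "additive_subgroup H G \<longleftrightarrow> H \<subseteq> carrier G \<and> \<zero> \<in> H \<and> (\<forall>x\<in>H. \<forall>y\<in>H. x \<oplus> y \<in> H) \<and> (\<forall>x\<in>H. \<ominus> x \<in> H)"
proof
  assume "additive_subgroup H G"
  then interpret additive_subgroup H G .
  show "H \<subseteq> carrier G \<and> \<zero> \<in> H \<and> (\<forall>x\<in>H. \<forall>y\<in>H. x \<oplus> y \<in> H) \<and> (\<forall>x\<in>H. \<ominus> x \<in> H)"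
    using a_subset by auto
next
  assume "H \<subseteq> carrier G \<and> \<zero> \<in> H \<and> (\<forall>x\<in>H. \<forall>y\<in>H. x \<oplus> y \<in> H) \<and> (\<forall>x\<in>H. \<ominus> x \<in> H)"
  then show "additive_subgroup H G"
    by (intro additive_subgroup.intro subgroup.intro) (auto simp: a_inv_def)
qed

definition component :: "('m, 'z) ring_scheme \<Rightarrow> ('i \<Rightarrow> 'm set) \<Rightarrow> 'm \<Rightarrow> 'i \<Rightarrow> 'm" where
  "component M C x = (THE c. (\<forall>i. c i \<in> C i) \<and> finite {i. c i \<noteq> \<zero>\<^bsub>M\<^esub>} \<and>
        x = finsum M c {i. c i \<noteq> \<zero>\<^bsub>M\<^esub>})"

text \<open>\<open>finsum\<close> depends on the record in which it is taken; this compares the sum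
  in an ideal, viewed as a module, with the sum in the ring.\<close>

lemma finsum_subcarrier:
  assumes "abelian_group M" "abelian_group N" "carrier N \<subseteq> carrier M"
    "add N = add M" "\<zero>\<^bsub>N\<^esub> = \<zero>\<^bsub>M\<^esub>" "finite F" "c \<in> F \<rightarrow> carrier N"
  shows "finsum N c F = finsum M c F"
  using assms(6,7)
proof (induction F)
  case empty
  interpret M: abelian_group M by fact
  interpret N: abelian_group N by fact
  show ?case using assms by simp
next
  case (insert a F)
  interpret M: abelian_group M by fact
  interpret N: abelian_group N by fact
  have "finsum N c (insert a F) = c a \<oplus>\<^bsub>N\<^esub> finsum N c F"
    using insert by (intro N.finsum_insert) auto
  moreover have "finsum M c (insert a F) = c a \<oplus>\<^bsub>M\<^esub> finsum M c F"
    using insert assms(3) by (intro M.finsum_insert) auto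
  ultimately show ?case using insert assms(4) by simp
qed

locale graded_group = abelian_group M for M :: "('m, 'z) ring_scheme" (structure) +
  fixes C :: "'i \<Rightarrow> 'm set"
  assumes direct_sum: "internal_direct_sum M C"
begin

abbreviation "cmp \<equiv> component M C"

lemma C_subgroup: "additive_subgroup (C i) M"
  using direct_sum by (simp add: internal_direct_sum_def)

lemma C_sub: "C i \<subseteq> carrier M" and C_zero: "\<zero> \<in> C i"
  and C_add: "x \<in> C i \<Longrightarrow> y \<in> C i \<Longrightarrow> x \<oplus> y \<in> C i" and C_neg: "x \<in> C i \<Longrightarrow> \<ominus> x \<in> C i"
  using C_subgroup[of i] additive_subgroup_iff by auto

lemma C_carrier: "x \<in> C i \<Longrightarrow> x \<in> carrier M"
  using C_sub by blast

lemma comp_spec: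
  assumes "x \<in> carrier M"
  shows "cmp x i \<in> C i" "finite {i. cmp x i \<noteq> \<zero>}" "x = finsum M (cmp x) {i. cmp x i \<noteq> \<zero>}"
proof -
  have "\<exists>!c. (\<forall>i. c i \<in> C i) \<and> finite {i. c i \<noteq> \<zero>} \<and> x = finsum M c {i. c i \<noteq> \<zero>}"
    using direct_sum assms by (simp add: internal_direct_sum_def)
  from theI'[OF this] show "cmp x i \<in> C i" "finite {i. cmp x i \<noteq> \<zero>}"
    "x = finsum M (cmp x) {i. cmp x i \<noteq> \<zero>}"
    by (simp_all add: component_def)
qed

lemma comp_carrier: "x \<in> carrier M \<Longrightarrow> cmp x i \<in> carrier M"
  using comp_spec(1) C_carrier by blast

lemma comp_unique:
  assumes "\<And>i. c i \<in> C i" "finite F" "\<And>i. i \<notin> F \<Longrightarrow> c i = \<zero>" "x = finsum M c F"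
  shows "cmp x = c"
proof -
  have c: "c \<in> A \<rightarrow> carrier M" for A using assms(1) C_carrier by blast
  have x: "x \<in> carrier M" using assms(4) c by simp
  have sub: "{i. c i \<noteq> \<zero>} \<subseteq> F" using assms(3) by blast
  then have fin: "finite {i. c i \<noteq> \<zero>}" using assms(2) finite_subset by blast
  have "finsum M c {i. c i \<noteq> \<zero>} = finsum M c F"
    by (rule add.finprod_mono_neutral_cong_left) (use assms(2) sub c in auto)
  then have "x = finsum M c {i. c i \<noteq> \<zero>}" using assms(4) by simp
  moreover have "\<exists>!c. (\<forall>i. c i \<in> C i) \<and> finite {i. c i \<noteq> \<zero>} \<and> x = finsum M c {i. c i \<noteq> \<zero>}"
    using direct_sum x by (simp add: internal_direct_sum_def)
  ultimately show ?thesis unfolding component_def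
    using assms(1) fin by (intro the1_equality) auto
qed

lemma comp_homogeneous:
  assumes "x \<in> C i"
  shows "cmp x j = (if j = i then x else \<zero>)"
proof -
  have "cmp x = (\<lambda>j. if j = i then x else \<zero>)"
  proof (rule comp_unique[of _ "{i}"])
    have "finsum M (\<lambda>j. if j = i then x else \<zero>) {i} = x \<oplus> \<zero>"
      using assms C_carrier by (subst finsum_insert) auto
    then show "x = finsum M (\<lambda>j. if j = i then x else \<zero>) {i}" using assms C_carrier by simp
  qed (use assms C_zero in auto)
  then show ?thesis by simp
qed

lemma comp_zero: "cmp \<zero> j = \<zero>"
  using comp_homogeneous[OF C_zero, of j j] by simp

lemma comp_support_subset:
  assumes "x \<in> carrier M" "finite F" "\<And>i. cmp x i \<noteq> \<zero> \<Longrightarrow> i \<in> F"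
  shows "x = finsum M (cmp x) F"
proof -
  have "finsum M (cmp x) {i. cmp x i \<noteq> \<zero>} = finsum M (cmp x) F"
    by (rule add.finprod_mono_neutral_cong_left) (use assms comp_carrier in auto)
  then show ?thesis using comp_spec(3)[OF assms(1)] by simp
qed

lemma comp_add:
  assumes "x \<in> carrier M" "y \<in> carrier M"
  shows "cmp (x \<oplus> y) i = cmp x i \<oplus> cmp y i"
proof -
  let ?F = "{i. cmp x i \<noteq> \<zero>} \<union> {i. cmp y i \<noteq> \<zero>}"
  have fin: "finite ?F" using comp_spec(2) assms by simp
  have c: "cmp x \<in> A \<rightarrow> carrier M" "cmp y \<in> A \<rightarrow> carrier M" for A
    using comp_carrier assms by auto
  have "cmp (x \<oplus> y) = (\<lambda>i. cmp x i \<oplus> cmp y i)"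
  proof (rule comp_unique[OF _ fin])
    have x: "x = finsum M (cmp x) ?F"
      by (rule comp_support_subset) (use assms fin in auto)
    have y: "y = finsum M (cmp y) ?F"
      by (rule comp_support_subset) (use assms fin in auto)
    have "finsum M (\<lambda>i. cmp x i \<oplus> cmp y i) ?F = finsum M (cmp x) ?F \<oplus> finsum M (cmp y) ?F"
      by (rule finsum_addf) (use c in auto)
    then show "x \<oplus> y = finsum M (\<lambda>i. cmp x i \<oplus> cmp y i) ?F" using x y by simp
  qed (use assms comp_spec(1) C_add in auto)
  then show ?thesis by simp
qed

lemma comp_neg:
  assumes "x \<in> carrier M"
  shows "cmp (\<ominus> x) i = \<ominus> cmp x i"
proof -
  have "cmp (\<ominus> x) i \<oplus> cmp x i = \<zero>"
    using comp_add[of "\<ominus> x" x i] assms by (simp add: l_neg comp_zero)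
  then show ?thesis using assms comp_carrier by (metis a_inv_closed minus_equality)
qed

lemma homogeneous_induct [consumes 1, case_names zero homogeneous add]:
  assumes "x \<in> carrier M" "Q \<zero>" "\<And>i x. x \<in> C i \<Longrightarrow> Q x"
    and add: "\<And>x y. x \<in> carrier M \<Longrightarrow> y \<in> carrier M \<Longrightarrow> Q x \<Longrightarrow> Q y \<Longrightarrow> Q (x \<oplus> y)"
  shows "Q x"
proof -
  have "Q (finsum M c F)" if "finite F" "\<And>i. c i \<in> C i" for c F
    using that(1)
  proof (induction F)
    case empty
    then show ?case using assms(2) by simp
  next
    case (insert a F)
    have c: "c \<in> A \<rightarrow> carrier M" for A using that(2) C_carrier by blast
    have "finsum M c (insert a F) = c a \<oplus> finsum M c F"
      by (rule finsum_insert) (use insert c in auto)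
    then show ?case using insert assms(3)[OF that(2)] add[of "c a" "finsum M c F"] c C_carrier[OF that(2)] by auto
  qed
  then show ?thesis using comp_spec[OF assms(1)] by metis
qed

text \<open>Unlike \<open>homogeneous_induct\<close>, this looks only at the components of the given
  \<open>x\<close>, so it applies to sets that contain few homogeneous elements.\<close>

lemma comp_induct_closed:
  assumes "x \<in> carrier M" "\<zero> \<in> Q" "\<And>x y. x \<in> Q \<Longrightarrow> y \<in> Q \<Longrightarrow> x \<oplus> y \<in> Q" "\<And>i. cmp x i \<in> Q"
  shows "x \<in> Q"
proof -
  have "finsum M (cmp x) F \<in> Q" if "finite F" for F
    using that
  proof (induction F)
    case (insert a F)
    have "finsum M (cmp x) (insert a F) = cmp x a \<oplus> finsum M (cmp x) F"
      by (rule finsum_insert) (use insert comp_carrier assms in auto)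
    then show ?case using insert assms by simp
  qed (use assms in simp)
  then show ?thesis using comp_spec[OF assms(1)] by metis
qed

end

text \<open>Both sides are additive in \<open>x\<close>, so homogeneous \<open>x\<close> suffice.
  The injection \<open>\<sigma>\<close> records a shift of degrees; differentials and multiplication
  by a homogeneous element are both covered. The second part says that degrees missed by the shift
  receive nothing.\<close>

lemma component_map:
  assumes "graded_group M C" "graded_group N C'" "inj \<sigma>"
    and "\<And>x y. x \<in> carrier M \<Longrightarrow> y \<in> carrier M \<Longrightarrow> g (x \<oplus>\<^bsub>M\<^esub> y) = g x \<oplus>\<^bsub>N\<^esub> g y"
    and "\<And>i x. x \<in> C i \<Longrightarrow> g x \<in> C' (\<sigma> i)" and "x \<in> carrier M"
  shows "component N C' (g x) (\<sigma> i) = g (component M C x i)"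
    and "j \<notin> range \<sigma> \<Longrightarrow> component N C' (g x) j = \<zero>\<^bsub>N\<^esub>"
proof -
  interpret M: graded_group M C by fact
  interpret N: graded_group N C' by fact
  have gc: "g x \<in> carrier N" if "x \<in> carrier M" for x
    using that
  proof (induction rule: M.homogeneous_induct)
    case zero
    then show ?case using assms(5)[OF M.C_zero] N.C_carrier by blast
  next
    case (homogeneous i x)
    then show ?case using assms(5) N.C_carrier by blast
  qed (simp add: assms(4))
  have "g \<zero>\<^bsub>M\<^esub> \<oplus>\<^bsub>N\<^esub> g \<zero>\<^bsub>M\<^esub> = g \<zero>\<^bsub>M\<^esub>" using assms(4)[of "\<zero>\<^bsub>M\<^esub>" "\<zero>\<^bsub>M\<^esub>"] by simp
  then have g0: "g \<zero>\<^bsub>M\<^esub> = \<zero>\<^bsub>N\<^esub>" using gc by (metis M.zero_closed N.add.r_cancel_one')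
  have "component N C' (g x) (\<sigma> i) = g (component M C x i) \<and>
      (j \<notin> range \<sigma> \<longrightarrow> component N C' (g x) j = \<zero>\<^bsub>N\<^esub>)"
    using assms(6)
  proof (induction rule: M.homogeneous_induct)
    case zero
    then show ?case by (simp add: g0 M.comp_zero N.comp_zero)
  next
    case (homogeneous k x)
    then show ?case using N.comp_homogeneous[OF assms(5)[OF homogeneous]] assms(3)
      by (auto simp: M.comp_homogeneous g0 inj_eq)
  next
    case (add x y)
    then show ?case by (simp add: assms(4) gc M.comp_add N.comp_add M.comp_carrier)
  qed
  then show "component N C' (g x) (\<sigma> i) = g (component M C x i)"
    "j \<notin> range \<sigma> \<Longrightarrow> component N C' (g x) j = \<zero>\<^bsub>N\<^esub>" by auto
qed

text \<open>Uniqueness comes from the projections: applied to any decomposition of \<open>x\<close>,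
  they return its terms.\<close>

lemma internal_direct_sumI:
  assumes "abelian_group M" "\<And>i. additive_subgroup (C i) M"
    and p: "\<And>i x. x \<in> carrier M \<Longrightarrow> p x i \<in> C i" "\<And>x. x \<in> carrier M \<Longrightarrow> finite {i. p x i \<noteq> \<zero>\<^bsub>M\<^esub>}"
      "\<And>x. x \<in> carrier M \<Longrightarrow> x = finsum M (p x) {i. p x i \<noteq> \<zero>\<^bsub>M\<^esub>}"
      "\<And>x y i. x \<in> carrier M \<Longrightarrow> y \<in> carrier M \<Longrightarrow> p (x \<oplus>\<^bsub>M\<^esub> y) i = p x i \<oplus>\<^bsub>M\<^esub> p y i"
      "\<And>i j x. x \<in> C i \<Longrightarrow> p x j = (if j = i then x else \<zero>\<^bsub>M\<^esub>)"
  shows "internal_direct_sum M C"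
  unfolding internal_direct_sum_def
proof (intro conjI allI ballI assms(2))
  interpret M: abelian_group M by fact
  have sub: "C i \<subseteq> carrier M" for i
    using assms(2)[of i] unfolding M.additive_subgroup_iff by (elim conjE)
  fix x assume x: "x \<in> carrier M"
  show "\<exists>!c. (\<forall>i. c i \<in> C i) \<and> finite {i. c i \<noteq> \<zero>\<^bsub>M\<^esub>} \<and> x = finsum M c {i. c i \<noteq> \<zero>\<^bsub>M\<^esub>}"
  proof (intro ex1I[of _ "p x"] conjI allI p x; (elim conjE)?)
    fix c assume c: "\<forall>i. c i \<in> C i" "finite {i. c i \<noteq> \<zero>\<^bsub>M\<^esub>}" "x = finsum M c {i. c i \<noteq> \<zero>\<^bsub>M\<^esub>}"
    have ci: "c i \<in> carrier M" for i using c(1) sub[of i] by auto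
    then have cc: "c \<in> A \<rightarrow> carrier M" for A by simp
    have pz: "p \<zero>\<^bsub>M\<^esub> j = \<zero>\<^bsub>M\<^esub>" for j
      using p(5)[of "\<zero>\<^bsub>M\<^esub>" j j] assms(2)[of j] unfolding M.additive_subgroup_iff by simp
    have "p (finsum M c F) j = (if j \<in> F then c j else \<zero>\<^bsub>M\<^esub>)" if "finite F" for F j
      using that
    proof (induction F)
      case empty
      then show ?case by (simp add: pz)
    next
      case (insert a F)
      have ca: "c a \<in> carrier M" "c j \<in> carrier M" using ci by simp_all
      have "finsum M c (insert a F) = c a \<oplus>\<^bsub>M\<^esub> finsum M c F"
        by (rule M.finsum_insert) (use insert cc in auto)
      then have "p (finsum M c (insert a F)) j = p (c a) j \<oplus>\<^bsub>M\<^esub> p (finsum M c F) j"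
        using p(4)[OF ca(1) M.finsum_closed[OF cc]] by simp
      also have "p (c a) j = (if j = a then c a else \<zero>\<^bsub>M\<^esub>)" using p(5)[of "c a" a j] c(1) by simp
      finally show ?case using insert ca by auto
    qed
    from this[OF c(2)] c(3) show "c = p x" by force
  qed
qed

section \<open>Noetherian graded rings generated in degree one\<close>

lemma (in noetherian_ring) ideal_chain_stabilizes:
  assumes "\<And>i::nat. ideal (f i) R" "\<And>i. f i \<subseteq> f (Suc i)"
  shows "\<exists>l. f (Suc l) = f l"
proof -
  have mono: "f i \<subseteq> f j" if "i \<le> j" for i j using assms(2) that by (rule lift_Suc_mono_le)
  have "subset.chain {I. ideal I R} (range f)"
    unfolding subset_chain_def using assms(1) mono by (auto) (metis nle_le subsetD)
  from ideal_chain_is_trivial[OF _ this] obtain l where "\<Union> (range f) = f l" by auto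
  then have "f (Suc l) \<subseteq> f l" by auto
  then show ?thesis using assms(2) by blast
qed

text \<open>The grading is extended by zero to negative degrees, since degrees of scalars are
  subtracted from integer degrees.\<close>

definition int_part :: "'a graded_ring \<Rightarrow> int \<Rightarrow> 'a set" where
  "int_part R n = (if n < 0 then {\<zero>\<^bsub>R\<^esub>} else ring_part R (nat n))"

locale graded_ring_locale =
  fixes R :: "'a graded_ring" (structure)
  assumes is_graded: "is_graded_ring R"
begin

sublocale cring R
  using is_graded by (simp add: is_graded_ring_def)

sublocale graded_group R "ring_part R"
  using is_graded by unfold_locales (simp add: is_graded_ring_def)

lemma part_mult: "a \<in> ring_part R i \<Longrightarrow> b \<in> ring_part R j \<Longrightarrow> a \<otimes> b \<in> ring_part R (i + j)"
  using is_graded by (simp add: is_graded_ring_def)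

lemma one_part: "\<one> \<in> ring_part R 0"
  using is_graded by (simp add: is_graded_ring_def)

lemma int_part_nat: "int_part R (int i) = ring_part R i"
  by (simp add: int_part_def)

sublocale graded_scalars R "int_part R"
proof unfold_locales
  show "int_part R e \<subseteq> carrier R" for e using C_sub by (auto simp: int_part_def)
  show "\<one> \<in> int_part R 0" using one_part by (simp add: int_part_def)
  fix r s e e' assume rs: "r \<in> int_part R e" "s \<in> int_part R e'"
  have z: "\<zero> \<in> int_part R e" for e using C_zero by (simp add: int_part_def)
  consider "e < 0" | "e' < 0" | "e \<ge> 0" "e' \<ge> 0" by linarith
  then show "r \<otimes> s \<in> int_part R (e + e')"
  proof cases
    case 1
    then have "r = \<zero>" using rs by (simp add: int_part_def)
    moreover have "s \<in> carrier R" using rs C_carrier by (auto simp: int_part_def split: if_splits)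
    ultimately show ?thesis using z by simp
  next
    case 2
    then have "s = \<zero>" using rs by (simp add: int_part_def)
    moreover have "r \<in> carrier R" using rs C_carrier by (auto simp: int_part_def split: if_splits)
    ultimately show ?thesis using z by simp
  next
    case 3
    then show ?thesis using rs part_mult by (simp add: int_part_def nat_add_distrib)
  qed
qed

lemma int_part_zero: "\<zero> \<in> int_part R e"
  and int_part_add: "a \<in> int_part R e \<Longrightarrow> b \<in> int_part R e \<Longrightarrow> a \<oplus> b \<in> int_part R e"
  and int_part_neg: "a \<in> int_part R e \<Longrightarrow> \<ominus> a \<in> int_part R e"
  by (auto simp: int_part_def C_zero C_add C_neg a_inv_zero split: if_splits)

lemma comp_mult_homogeneous:
  assumes "a \<in> ring_part R i" "b \<in> carrier R"
  shows "cmp (a \<otimes> b) (i + k) = a \<otimes> cmp b k"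
  by (rule component_map(1)[where g = "\<lambda>b. a \<otimes> b" and \<sigma> = "\<lambda>k. i + k", OF graded_group_axioms graded_group_axioms])
    (use assms C_carrier[OF assms(1)] part_mult in \<open>auto simp: r_distr inj_def\<close>)

lemma mult_closed_if_components:
  assumes W: "W \<subseteq> carrier R" "\<zero> \<in> W" "\<And>x y. x \<in> W \<Longrightarrow> y \<in> W \<Longrightarrow> x \<oplus> y \<in> W"
    and ab: "a \<in> carrier R" "b \<in> carrier R" "\<And>i k. cmp a i \<otimes> cmp b k \<in> W"
  shows "a \<otimes> b \<in> W"
proof -
  have 1: "cmp a i \<otimes> b \<in> W" for i
  proof -
    have c: "cmp a i \<in> carrier R" using ab(1) by (rule comp_carrier)
    have "b \<in> {b \<in> carrier R. cmp a i \<otimes> b \<in> W}"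
      by (rule comp_induct_closed) (use c W ab comp_carrier in \<open>auto simp: r_distr\<close>)
    then show ?thesis by simp
  qed
  have "a \<in> {a \<in> carrier R. a \<otimes> b \<in> W}"
    by (rule comp_induct_closed) (use 1 W ab comp_carrier in \<open>auto simp: l_distr\<close>)
  then show ?thesis by simp
qed

text \<open>From a family of graded pieces back to a set of ring elements. By
  \<open>ideal_of_part\<close> the pieces in nonnegative degrees can be recovered, so the chain
  condition of \<open>R\<close> transfers to homogeneous ideals.\<close>

definition ideal_of :: "(int \<Rightarrow> 'a set) \<Rightarrow> 'a set" where
  "ideal_of p = {r \<in> carrier R. \<forall>i. cmp r i \<in> p (int i)}"

lemma ideal_of_ideal:
  assumes "hom_ideal p"
  shows "ideal (ideal_of p) R"
proof -
  have p: "p e \<subseteq> int_part R e" "\<zero> \<in> p e" "a \<in> p e \<Longrightarrow> b \<in> p e \<Longrightarrow> a \<oplus> b \<in> p e"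
    "a \<in> p e \<Longrightarrow> r \<in> int_part R e' \<Longrightarrow> r \<otimes> a \<in> p (e + e')" for a b r e e'
    using assms unfolding hom_ideal_def by blast+
  have z: "\<zero> \<in> ideal_of p" using p(2) by (simp add: ideal_of_def comp_zero)
  have add: "x \<oplus> y \<in> ideal_of p" if "x \<in> ideal_of p" "y \<in> ideal_of p" for x y
    using that p(3) by (simp add: ideal_of_def comp_add)
  have l: "r \<otimes> a \<in> ideal_of p" if a: "a \<in> ideal_of p" and r: "r \<in> carrier R" for a r
  proof (rule mult_closed_if_components[OF _ z add r])
    show "ideal_of p \<subseteq> carrier R" "a \<in> carrier R" using a by (auto simp: ideal_of_def)
    fix i k
    have ri: "cmp r i \<in> ring_part R i" using r by (rule comp_spec)
    have ak: "cmp a k \<in> p (int k)" "cmp a k \<in> ring_part R k"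
      using a comp_spec(1) by (auto simp: ideal_of_def)
    have 1: "cmp r i \<otimes> cmp a k \<in> ring_part R (i + k)" by (rule part_mult[OF ri ak(2)])
    have "cmp r i \<otimes> cmp a k \<in> p (int k + int i)" using p(4)[OF ak(1)] ri by (simp add: int_part_nat)
    then have "cmp (cmp r i \<otimes> cmp a k) j \<in> p (int j)" for j
      using comp_homogeneous[OF 1, of j] p(2) by (auto simp: add.commute)
    then show "cmp r i \<otimes> cmp a k \<in> ideal_of p" using C_carrier[OF 1] by (simp add: ideal_of_def)
  qed
  have neg: "\<ominus> x \<in> ideal_of p" if "x \<in> ideal_of p" for x
    using l[OF that, of "\<ominus> \<one>"] that by (simp add: ideal_of_def l_minus)
  have "additive_subgroup (ideal_of p) R"
    unfolding additive_subgroup_iff using z add neg by (auto simp: ideal_of_def)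
  then show ?thesis
    using l by (intro idealI ring_axioms additive_subgroup.a_subgroup) (auto simp: m_comm ideal_of_def)
qed

lemma ideal_of_part:
  assumes "hom_ideal p"
  shows "p (int i) = ideal_of p \<inter> ring_part R i"
proof -
  have p: "p e \<subseteq> int_part R e" "\<zero> \<in> p e" for e using assms unfolding hom_ideal_def by blast+
  have 1: "p (int i) \<subseteq> ring_part R i" using p(1)[of "int i"] by (simp add: int_part_nat)
  have "r \<in> ideal_of p \<longleftrightarrow> r \<in> p (int i)" if r: "r \<in> ring_part R i" for r
    unfolding ideal_of_def mem_Collect_eq comp_homogeneous[OF r] using C_carrier[OF r] p(2) by auto
  with 1 show ?thesis by blast
qed

end

locale noetherian_graded_ring = graded_ring_locale +
  assumes is_noetherian: "noetherian_ring R"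
    and degree_one: "finitely_generated_in_degree_one R"
begin

lemma wf_hom_ideal: "wf {(q, p). hom_ideal p \<and> hom_ideal q \<and> p \<le> q \<and> p \<noteq> q}"
  unfolding wf_iff_no_infinite_down_chain
proof
  assume "\<exists>f. \<forall>i::nat. (f (Suc i), f i) \<in> {(q, p). hom_ideal p \<and> hom_ideal q \<and> p \<le> q \<and> p \<noteq> q}"
  then obtain f where f: "\<And>i::nat. hom_ideal (f i)" "\<And>i. f i \<le> f (Suc i)" "\<And>i. f i \<noteq> f (Suc i)" by blast
  have "\<exists>l. ideal_of (f (Suc l)) = ideal_of (f l)"
  proof (rule noetherian_ring.ideal_chain_stabilizes[OF is_noetherian])
    show "ideal (ideal_of (f i)) R" for i by (rule ideal_of_ideal[OF f(1)])
    show "ideal_of (f i) \<subseteq> ideal_of (f (Suc i))" for i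
      using f(2)[of i] by (auto simp: ideal_of_def le_fun_def)
  qed
  then obtain l where l: "ideal_of (f (Suc l)) = ideal_of (f l)" by blast
  have "f (Suc l) e = f l e" for e
  proof (cases "e < 0")
    case True
    have "f i e = {\<zero>}" for i
    proof -
      have "f i e \<subseteq> int_part R e" "\<zero> \<in> f i e" using f(1)[of i] unfolding hom_ideal_def by auto
      then show ?thesis using True by (auto simp: int_part_def)
    qed
    then show ?thesis by simp
  next
    case False
    then obtain i where "e = int i" by (metis nonneg_int_cases not_less)
    then show ?thesis using ideal_of_part[OF f(1)] l by simp
  qed
  then show False using f(3) by blast
qed

definition degree_one_generators :: "'a set" where
  "degree_one_generators = (SOME S. finite S \<and> S \<subseteq> ring_part R 1 \<and>
     carrier R = generate_ring R (ring_part R 0 \<union> S))"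

lemma degree_one_generators:
  "finite degree_one_generators" "degree_one_generators \<subseteq> ring_part R 1"
  "carrier R = generate_ring R (ring_part R 0 \<union> degree_one_generators)"
  using someI_ex[OF degree_one[unfolded finitely_generated_in_degree_one_def]]
  by (auto simp: degree_one_generators_def)

text \<open>Generation of \<open>R\<close> as a ring has to be turned into R_{e+1} = G R_e. The
  elements whose component in each degree \<open>j + 1\<close> lies in the span of G R_j form a
  subring that contains R_0 and \<open>G\<close>, hence they are all of \<open>R\<close>.\<close>

lemma generators_span:
  fixes Q :: "'a set"
  assumes r: "r \<in> ring_part R (Suc e)" and Q: "\<zero> \<in> Q" "\<And>a b. a \<in> Q \<Longrightarrow> b \<in> Q \<Longrightarrow> a \<oplus> b \<in> Q"
    "\<And>g t. g \<in> degree_one_generators \<Longrightarrow> t \<in> ring_part R e \<Longrightarrow> g \<otimes> t \<in> Q"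
  shows "r \<in> Q"
proof -
  let ?G = degree_one_generators
  define cl where "cl j Q \<longleftrightarrow> \<zero> \<in> Q \<and> (\<forall>a\<in>Q. \<forall>b\<in>Q. a \<oplus> b \<in> Q) \<and>
    (\<forall>g\<in>?G. \<forall>t\<in>ring_part R j. g \<otimes> t \<in> Q)" for j Q
  \<comment> \<open>The additive span of G R_j, as the smallest set with the closure properties
    \<open>cl\<close>.\<close>
  define Sp where "Sp j = \<Inter> {Q. cl j Q}" for j
  have Sp: "x \<in> Sp j \<Longrightarrow> cl j Q \<Longrightarrow> x \<in> Q" for x j Q by (auto simp: Sp_def)
  have Sp_cl: "cl j (Sp j)" for j unfolding Sp_def cl_def by blast
  have Gc: "g \<in> ring_part R 1" "g \<in> carrier R" if "g \<in> ?G" for g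
    using that degree_one_generators(2) C_carrier by blast+
  have Sp_part: "Sp j \<subseteq> ring_part R (Suc j)" for j
  proof
    fix x assume "x \<in> Sp j"
    moreover have "cl j (ring_part R (Suc j))"
      unfolding cl_def using C_zero C_add part_mult[OF Gc(1)] by auto
    ultimately show "x \<in> ring_part R (Suc j)" by (rule Sp)
  qed
  have Sp_mult: "x \<otimes> a \<in> Sp (i + j)" if x: "x \<in> ring_part R i" and a: "a \<in> Sp j" for x a i j
  proof -
    have xc: "x \<in> carrier R" using x C_carrier by blast
    have "cl j {a \<in> carrier R. x \<otimes> a \<in> Sp (i + j)}"
      unfolding cl_def
    proof (intro conjI ballI)
      show "\<zero> \<in> {a \<in> carrier R. x \<otimes> a \<in> Sp (i + j)}" using Sp_cl xc by (simp add: cl_def)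
      show "a \<oplus> b \<in> {a \<in> carrier R. x \<otimes> a \<in> Sp (i + j)}"
        if "a \<in> {a \<in> carrier R. x \<otimes> a \<in> Sp (i + j)}" "b \<in> {a \<in> carrier R. x \<otimes> a \<in> Sp (i + j)}" for a b
        using that Sp_cl[of "i + j"] xc by (simp add: cl_def r_distr)
      fix g t assume gt: "g \<in> ?G" "t \<in> ring_part R j"
      have tc: "t \<in> carrier R" using gt C_carrier by blast
      have "x \<otimes> (g \<otimes> t) = g \<otimes> (x \<otimes> t)" using xc tc Gc gt by (metis m_assoc m_comm)
      then show "g \<otimes> t \<in> {a \<in> carrier R. x \<otimes> a \<in> Sp (i + j)}"
        using Sp_cl[of "i + j"] part_mult[OF x gt(2)] gt Gc tc by (simp add: cl_def)
    qed
    from Sp[OF a this] show ?thesis by simp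
  qed
  define W where "W = {a \<in> carrier R. \<forall>j. cmp a (Suc j) \<in> Sp j}"
  have W0: "\<zero> \<in> W" using Sp_cl by (simp add: W_def comp_zero cl_def)
  have Wadd: "x \<oplus> y \<in> W" if "x \<in> W" "y \<in> W" for x y
    using that Sp_cl by (simp add: W_def comp_add cl_def)
  have W_part: "x \<in> W" if "x \<in> ring_part R k" "\<And>j. k = Suc j \<Longrightarrow> x \<in> Sp j" for x k
    using that Sp_cl C_carrier by (auto simp: W_def comp_homogeneous[OF that(1)] cl_def)
  have Wmult: "a \<otimes> b \<in> W" if ab: "a \<in> W" "b \<in> W" for a b
  proof (rule mult_closed_if_components[OF _ W0 Wadd])
    show "W \<subseteq> carrier R" "a \<in> carrier R" "b \<in> carrier R" using ab by (auto simp: W_def)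
    fix i k
    have a: "cmp a i \<in> ring_part R i" and b: "cmp b k \<in> ring_part R k"
      using ab comp_spec(1) by (auto simp: W_def)
    have c: "cmp a i \<in> carrier R" "cmp b k \<in> carrier R" using a b C_carrier by blast+
    show "cmp a i \<otimes> cmp b k \<in> W"
    proof (rule W_part[OF part_mult[OF a b]])
      fix j assume j: "i + k = Suc j"
      show "cmp a i \<otimes> cmp b k \<in> Sp j"
      \<comment> \<open>A product of positive degree has a factor of positive degree, and that
        factor already lies in a span.\<close>
      proof (cases k)
        case (Suc k')
        then have "cmp b k \<in> Sp k'" using ab by (simp add: W_def)
        then have "cmp a i \<otimes> cmp b k \<in> Sp (i + k')" by (rule Sp_mult[OF a])
        then show ?thesis using j Suc by simp
      next
        case 0
        then have i: "i = Suc j" using j by simp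
        then have "cmp a i \<in> Sp j" using ab by (simp add: W_def)
        then have "cmp b k \<otimes> cmp a i \<in> Sp (k + j)" by (rule Sp_mult[OF b])
        then show ?thesis using 0 c by (simp add: m_comm)
      qed
    qed
  qed
  have "a \<in> W" if "a \<in> generate_ring R (ring_part R 0 \<union> ?G)" for a
    using that
  proof (induction rule: generate_ring.induct)
    case one
    show ?case by (rule W_part[OF one_part]) simp
  next
    case (incl h)
    show ?case
    proof (cases "h \<in> ring_part R 0")
      case True
      then show ?thesis by (rule W_part) simp
    next
      case False
      then have h: "h \<in> ?G" using incl by simp
      show ?thesis
      proof (rule W_part[OF Gc(1)[OF h]])
        fix j assume "1 = Suc j"
        then have "h \<otimes> \<one> \<in> Sp j" using Sp_cl[of j] h one_part by (simp add: cl_def)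
        then show "h \<in> Sp j" using Gc(2)[OF h] by simp
      qed
    qed
  next
    case (a_inv h)
    have "\<ominus> \<one> \<in> W" by (rule W_part[OF C_neg[OF one_part]]) simp
    then have "\<ominus> \<one> \<otimes> h \<in> W" using a_inv by (intro Wmult)
    then show ?case using a_inv by (simp add: W_def l_minus)
  qed (use Wadd Wmult in auto)
  then have "r \<in> W" using C_carrier[OF r] degree_one_generators(3) by blast
  then have "cmp r (Suc e) \<in> Sp e" by (simp add: W_def)
  then have "r \<in> Sp e" using comp_homogeneous[OF r] by simp
  then show ?thesis by (rule Sp) (use Q in \<open>simp add: cl_def\<close>)
qed

sublocale graded_noetherian R "int_part R" degree_one_generators
proof (unfold_locales, goal_cases)
  case (7 e r Q)
  then show ?case by (intro generators_span[of r "nat e" Q]) (auto simp: int_part_def nat_add_distrib)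
qed (use int_part_zero int_part_add int_part_neg degree_one_generators wf_hom_ideal in \<open>auto simp: int_part_def\<close>)

end


section \<open>Divisibility in injective modules\<close>

lemma ideal_as_module:
  assumes "cring R" "ideal J R" "carrier N = J" "add N = add R" "\<zero>\<^bsub>N\<^esub> = \<zero>\<^bsub>R\<^esub>" "smult N = (\<otimes>\<^bsub>R\<^esub>)"
  shows "module R N"
proof -
  interpret cring R by fact
  interpret J: ideal J R by fact
  have "abelian_group N"
  proof (rule abelian_groupI)
    fix x assume "x \<in> carrier N"
    then have "\<ominus>\<^bsub>R\<^esub> x \<in> carrier N" "\<ominus>\<^bsub>R\<^esub> x \<oplus>\<^bsub>N\<^esub> x = \<zero>\<^bsub>N\<^esub>"
      using assms(3-5) J.Icarr by (auto simp: l_neg)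
    then show "\<exists>y\<in>carrier N. y \<oplus>\<^bsub>N\<^esub> x = \<zero>\<^bsub>N\<^esub>" by blast
  qed (use assms(3-5) J.Icarr in \<open>auto simp: a_ac\<close>)
  then show ?thesis
    by (rule moduleI[OF assms(1)])
      (use assms(3-6) J.Icarr in \<open>auto simp: l_distr r_distr m_assoc J.I_l_closed\<close>)
qed

text \<open>Injectivity for the inclusion of \<open>J\<close> in the ring; \<open>z\<close> is the
  value of the extension at 1.\<close>

lemma injective_extends:
  fixes R :: "('a, 'r) ring_scheme"
  assumes "cring R" "injective_module R E" "ideal J R"
    and "\<And>a. a \<in> J \<Longrightarrow> g a \<in> carrier E"
    and "\<And>a b. a \<in> J \<Longrightarrow> b \<in> J \<Longrightarrow> g (a \<oplus>\<^bsub>R\<^esub> b) = g a \<oplus>\<^bsub>E\<^esub> g b"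
    and "\<And>a r. a \<in> J \<Longrightarrow> r \<in> carrier R \<Longrightarrow> g (r \<otimes>\<^bsub>R\<^esub> a) = r \<odot>\<^bsub>E\<^esub> g a"
  shows "\<exists>z\<in>carrier E. \<forall>a\<in>J. g a = a \<odot>\<^bsub>E\<^esub> z"
proof -
  interpret cring R by fact
  interpret J: ideal J R by fact
  define N :: "'a set \<Rightarrow> ('a, 'a) module" where "N I = \<lparr>carrier = I, monoid.mult = monoid.mult R, one = one R, zero = zero R, add = add R,
      smult = monoid.mult R\<rparr>" for I
  have mJ: "module R (N J)" by (rule ideal_as_module[OF assms(1,3)]) (auto simp: N_def)
  have mR: "module R (N (carrier R))"
    by (rule ideal_as_module[OF assms(1) oneideal]) (auto simp: N_def)
  have j: "is_module_hom R (N J) (N (carrier R)) id" "inj_on id (carrier (N J))"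
    using J.Icarr by (auto simp: is_module_hom_def N_def)
  have g: "is_module_hom R (N J) E g" using assms(4-6) by (auto simp: is_module_hom_def N_def)
  have "\<exists>h. is_module_hom R (N (carrier R)) E h \<and> (\<forall>x\<in>carrier (N J). h (id x) = g x)"
    using assms(2) mJ mR j g unfolding injective_module_def by blast
  then obtain h where h: "is_module_hom R (N (carrier R)) E h" "\<And>x. x \<in> J \<Longrightarrow> h x = g x"
    by (auto simp: N_def)
  have "g a = a \<odot>\<^bsub>E\<^esub> h \<one>\<^bsub>R\<^esub>" if a: "a \<in> J" for a
  proof -
    have "\<forall>r\<in>carrier R. \<forall>x\<in>carrier R. h (r \<otimes>\<^bsub>R\<^esub> x) = r \<odot>\<^bsub>E\<^esub> h x"
      using h(1) by (simp add: is_module_hom_def N_def)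
    then have "h (a \<otimes>\<^bsub>R\<^esub> \<one>\<^bsub>R\<^esub>) = a \<odot>\<^bsub>E\<^esub> h \<one>\<^bsub>R\<^esub>"
      using J.Icarr[OF a] one_closed by blast
    then show ?thesis using h(2)[OF a] J.Icarr[OF a] by simp
  qed
  moreover have "h \<one>\<^bsub>R\<^esub> \<in> carrier E" using h(1) by (auto simp: is_module_hom_def N_def)
  ultimately show ?thesis by blast
qed

text \<open>With \<open>l\<close> such that \<open>y\<^sup>l x\<close> and \<open>y\<^sup>l\<^sup>+\<^sup>1 x\<close> have the same annihilator,
  \<open>y\<^sup>l\<^sup>+\<^sup>1 r + s \<mapsto> y\<^sup>l r x\<close> is well defined on \<open>y\<^sup>l\<^sup>+\<^sup>1 R + ann x\<close>. An extension of it to \<open>R\<close> sends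
  \<open>1\<close> to an element \<open>z\<close> killed by \<open>ann x\<close> with \<open>y\<^sup>l (x - y z) = 0\<close>.\<close>

lemma (in module) divisibility_data:
  assumes noeth: "noetherian_ring R" and x: "x \<in> carrier M" and y: "y \<in> carrier R"
  obtains l :: nat and J and g where "ideal J R"
    "J = {y [^] Suc l \<otimes> r \<oplus> s | r s. r \<in> carrier R \<and> s \<in> carrier R \<and> s \<odot>\<^bsub>M\<^esub> x = \<zero>\<^bsub>M\<^esub>}"
    "\<And>r s. r \<in> carrier R \<Longrightarrow> s \<in> carrier R \<Longrightarrow> s \<odot>\<^bsub>M\<^esub> x = \<zero>\<^bsub>M\<^esub> \<Longrightarrow>
      g (y [^] Suc l \<otimes> r \<oplus> s) = (y [^] l \<otimes> r) \<odot>\<^bsub>M\<^esub> x"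
    "\<And>a. a \<in> J \<Longrightarrow> g a \<in> carrier M"
    "\<And>a b. a \<in> J \<Longrightarrow> b \<in> J \<Longrightarrow> g (a \<oplus> b) = g a \<oplus>\<^bsub>M\<^esub> g b"
    "\<And>a r. a \<in> J \<Longrightarrow> r \<in> carrier R \<Longrightarrow> g (r \<otimes> a) = r \<odot>\<^bsub>M\<^esub> g a"
proof -
  define f where "f l = {r \<in> carrier R. (y [^] (l::nat) \<otimes> r) \<odot>\<^bsub>M\<^esub> x = \<zero>\<^bsub>M\<^esub>}" for l
  have "ideal (f l) R" for l
  proof -
    have "additive_subgroup (f l) R"
      unfolding R.additive_subgroup_iff using x y
      by (auto simp: f_def R.r_distr smult_l_distr R.r_minus smult_l_minus M.a_inv_zero)
    moreover have "r \<otimes> a \<in> f l" if "a \<in> f l" "r \<in> carrier R" for a r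
    proof -
      have "y [^] l \<otimes> (r \<otimes> a) = r \<otimes> (y [^] l \<otimes> a)"
        using that y by (simp add: f_def R.m_lcomm)
      then show ?thesis using that x y by (simp add: f_def smult_assoc1)
    qed
    ultimately show ?thesis
      by (intro idealI R.ring_axioms additive_subgroup.a_subgroup) (auto simp: f_def R.m_comm)
  qed
  moreover have "f l \<subseteq> f (Suc l)" for l
  proof
    fix r assume r: "r \<in> f l"
    then have "y [^] Suc l \<otimes> r = y \<otimes> (y [^] l \<otimes> r)" using y by (simp add: f_def R.m_ac)
    then show "r \<in> f (Suc l)" using r x y by (simp add: f_def smult_assoc1)
  qed
  ultimately obtain l where l: "f (Suc l) = f l"
    using noetherian_ring.ideal_chain_stabilizes[OF noeth] by blast
  define J where "J = {y [^] Suc l \<otimes> r \<oplus> s | r s. r \<in> carrier R \<and> s \<in> carrier R \<and> s \<odot>\<^bsub>M\<^esub> x = \<zero>\<^bsub>M\<^esub>}"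
  define g where "g a = (THE v. \<exists>r s. r \<in> carrier R \<and> s \<in> carrier R \<and> s \<odot>\<^bsub>M\<^esub> x = \<zero>\<^bsub>M\<^esub> \<and>
    a = y [^] Suc l \<otimes> r \<oplus> s \<and> v = (y [^] l \<otimes> r) \<odot>\<^bsub>M\<^esub> x)" for a
  have yl: "y [^] Suc l \<in> carrier R" "y [^] l \<in> carrier R" using y by auto
  have wd: "(y [^] l \<otimes> r) \<odot>\<^bsub>M\<^esub> x = (y [^] l \<otimes> r') \<odot>\<^bsub>M\<^esub> x"
    if "r \<in> carrier R" "s \<in> carrier R" "s \<odot>\<^bsub>M\<^esub> x = \<zero>\<^bsub>M\<^esub>" "r' \<in> carrier R" "s' \<in> carrier R" "s' \<odot>\<^bsub>M\<^esub> x = \<zero>\<^bsub>M\<^esub>"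
      "y [^] Suc l \<otimes> r \<oplus> s = y [^] Suc l \<otimes> r' \<oplus> s'" for r s r' s'
  proof -
    have *: "(y [^] Suc l \<otimes> r \<oplus> s) \<odot>\<^bsub>M\<^esub> x = (y [^] Suc l \<otimes> r) \<odot>\<^bsub>M\<^esub> x"
      "(y [^] Suc l \<otimes> r' \<oplus> s') \<odot>\<^bsub>M\<^esub> x = (y [^] Suc l \<otimes> r') \<odot>\<^bsub>M\<^esub> x"
      using that(1-6) yl x by (simp_all add: smult_l_distr del: R.nat_pow_Suc)
    have "(y [^] Suc l \<otimes> r) \<odot>\<^bsub>M\<^esub> x = (y [^] Suc l \<otimes> r') \<odot>\<^bsub>M\<^esub> x"
      unfolding *[symmetric] that(7) ..
    then have "(y [^] Suc l \<otimes> (r \<ominus> r')) \<odot>\<^bsub>M\<^esub> x = \<zero>\<^bsub>M\<^esub>"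
      using that(1-6) yl x by (simp add: a_minus_def R.r_distr R.r_minus smult_l_distr smult_l_minus M.r_neg del: R.nat_pow_Suc)
    then have "r \<ominus> r' \<in> f (Suc l)" using that(1-6) by (simp add: f_def)
    then have "(y [^] l \<otimes> (r \<ominus> r')) \<odot>\<^bsub>M\<^esub> x = \<zero>\<^bsub>M\<^esub>" unfolding l by (simp add: f_def)
    then have d: "(y [^] l \<otimes> r) \<odot>\<^bsub>M\<^esub> x \<ominus>\<^bsub>M\<^esub> (y [^] l \<otimes> r') \<odot>\<^bsub>M\<^esub> x = \<zero>\<^bsub>M\<^esub>"
      using that(1-6) yl x by (simp add: a_minus_def R.r_distr R.r_minus smult_l_distr smult_l_minus)
    show ?thesis by (rule minus_eq_zero_imp_eq[OF _ _ d]) (use that(1-6) yl x in simp_all)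
  qed
  have g: "g (y [^] Suc l \<otimes> r \<oplus> s) = (y [^] l \<otimes> r) \<odot>\<^bsub>M\<^esub> x"
    if "r \<in> carrier R" "s \<in> carrier R" "s \<odot>\<^bsub>M\<^esub> x = \<zero>\<^bsub>M\<^esub>" for r s
    unfolding g_def
  proof (rule the_equality)
    show "\<exists>r' s'. r' \<in> carrier R \<and> s' \<in> carrier R \<and> s' \<odot>\<^bsub>M\<^esub> x = \<zero>\<^bsub>M\<^esub> \<and>
      y [^] Suc l \<otimes> r \<oplus> s = y [^] Suc l \<otimes> r' \<oplus> s' \<and> (y [^] l \<otimes> r) \<odot>\<^bsub>M\<^esub> x = (y [^] l \<otimes> r') \<odot>\<^bsub>M\<^esub> x"
      using that by blast
  next
    fix v assume "\<exists>r' s'. r' \<in> carrier R \<and> s' \<in> carrier R \<and> s' \<odot>\<^bsub>M\<^esub> x = \<zero>\<^bsub>M\<^esub> \<and>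
      y [^] Suc l \<otimes> r \<oplus> s = y [^] Suc l \<otimes> r' \<oplus> s' \<and> v = (y [^] l \<otimes> r') \<odot>\<^bsub>M\<^esub> x"
    then obtain r' s' where "r' \<in> carrier R" "s' \<in> carrier R" "s' \<odot>\<^bsub>M\<^esub> x = \<zero>\<^bsub>M\<^esub>"
      "y [^] Suc l \<otimes> r \<oplus> s = y [^] Suc l \<otimes> r' \<oplus> s'" "v = (y [^] l \<otimes> r') \<odot>\<^bsub>M\<^esub> x" by blast
    then show "v = (y [^] l \<otimes> r) \<odot>\<^bsub>M\<^esub> x" using wd[OF that] by metis
  qed
  have JE: "\<exists>r s. r \<in> carrier R \<and> s \<in> carrier R \<and> s \<odot>\<^bsub>M\<^esub> x = \<zero>\<^bsub>M\<^esub> \<and> a = y [^] Suc l \<otimes> r \<oplus> s"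
    if "a \<in> J" for a using that by (auto simp: J_def)
  have JI: "y [^] Suc l \<otimes> r \<oplus> s \<in> J" if "r \<in> carrier R" "s \<in> carrier R" "s \<odot>\<^bsub>M\<^esub> x = \<zero>\<^bsub>M\<^esub>" for r s
    using that by (auto simp: J_def)
  have sum: "a \<oplus> b \<in> J \<and> g (a \<oplus> b) = g a \<oplus>\<^bsub>M\<^esub> g b" if ab: "a \<in> J" "b \<in> J" for a b
  proof -
    obtain r s r' s' where *: "r \<in> carrier R" "s \<in> carrier R" "s \<odot>\<^bsub>M\<^esub> x = \<zero>\<^bsub>M\<^esub>" "a = y [^] Suc l \<otimes> r \<oplus> s"
      "r' \<in> carrier R" "s' \<in> carrier R" "s' \<odot>\<^bsub>M\<^esub> x = \<zero>\<^bsub>M\<^esub>" "b = y [^] Suc l \<otimes> r' \<oplus> s'" using JE ab by metis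
    have ss: "(s \<oplus> s') \<odot>\<^bsub>M\<^esub> x = \<zero>\<^bsub>M\<^esub>" "r \<oplus> r' \<in> carrier R" "s \<oplus> s' \<in> carrier R"
      using * x by (simp_all add: smult_l_distr)
    have "a \<oplus> b = y [^] Suc l \<otimes> (r \<oplus> r') \<oplus> (s \<oplus> s')"
      using * yl by (simp add: R.r_distr R.a_ac del: R.nat_pow_Suc)
    moreover have "g a \<oplus>\<^bsub>M\<^esub> g b = (y [^] l \<otimes> (r \<oplus> r')) \<odot>\<^bsub>M\<^esub> x"
      unfolding *(4) *(8) g[OF *(1-3)] g[OF *(5-7)]
      using *(1,5) yl x by (simp add: R.r_distr smult_l_distr)
    ultimately show ?thesis using g[OF ss(2,3,1)] JI[OF ss(2,3,1)] by simp
  qed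
  have mult: "t \<otimes> a \<in> J \<and> g (t \<otimes> a) = t \<odot>\<^bsub>M\<^esub> g a" if a: "a \<in> J" and t: "t \<in> carrier R" for a t
  proof -
    obtain r s where *: "r \<in> carrier R" "s \<in> carrier R" "s \<odot>\<^bsub>M\<^esub> x = \<zero>\<^bsub>M\<^esub>" "a = y [^] Suc l \<otimes> r \<oplus> s"
      using JE a by metis
    have ss: "(t \<otimes> s) \<odot>\<^bsub>M\<^esub> x = \<zero>\<^bsub>M\<^esub>" "t \<otimes> r \<in> carrier R" "t \<otimes> s \<in> carrier R"
      using * x t by (simp_all add: smult_assoc1)
    have "t \<otimes> a = y [^] Suc l \<otimes> (t \<otimes> r) \<oplus> (t \<otimes> s)"
      using * yl t by (simp add: R.r_distr R.m_lcomm del: R.nat_pow_Suc)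
    moreover have "t \<odot>\<^bsub>M\<^esub> g a = (y [^] l \<otimes> (t \<otimes> r)) \<odot>\<^bsub>M\<^esub> x"
    proof -
      have "y [^] l \<otimes> (t \<otimes> r) = t \<otimes> (y [^] l \<otimes> r)" using * yl t by (simp add: R.m_lcomm)
      then show ?thesis unfolding *(4) g[OF *(1-3)] using *(1) yl x t by (simp add: smult_assoc1)
    qed
    ultimately show ?thesis using g[OF ss(2,3,1)] JI[OF ss(2,3,1)] by simp
  qed
  have Jc: "J \<subseteq> carrier R" using yl by (auto simp: J_def)
  have z: "\<zero> \<in> J" using JI[of \<zero> \<zero>] x yl by simp
  have neg: "\<ominus> a \<in> J" if "a \<in> J" for a
    using mult[OF that, of "\<ominus> \<one>"] that Jc by (auto simp: R.l_minus)
  have "additive_subgroup J R" unfolding R.additive_subgroup_iff using Jc z sum neg by blast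
  then have J: "ideal J R"
    using mult Jc by (intro idealI R.ring_axioms additive_subgroup.a_subgroup) (auto simp: R.m_comm subset_iff)
  show thesis
  proof (rule that[OF J J_def g])
    show "g a \<in> carrier M" if "a \<in> J" for a
      using JE[OF that] g yl x by auto
  qed (use sum mult in auto)
qed

text \<open>The choice \<open>r = 1\<close>, \<open>s = 0\<close> gives
  \<open>y^l x = y^(l+1) z\<close>, and \<open>r = 0\<close> gives \<open>s z = 0\<close>.\<close>

lemma (in module) divisor_from_extension:
  assumes "x \<in> carrier M" "y \<in> carrier R" "z \<in> carrier M"
    and ext: "\<And>r s. r \<in> carrier R \<Longrightarrow> s \<in> carrier R \<Longrightarrow> s \<odot>\<^bsub>M\<^esub> x = \<zero>\<^bsub>M\<^esub> \<Longrightarrow>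
      (y [^] l \<otimes> r) \<odot>\<^bsub>M\<^esub> x = (y [^] Suc l \<otimes> r \<oplus> s) \<odot>\<^bsub>M\<^esub> z"
  shows "(y [^] (l::nat)) \<odot>\<^bsub>M\<^esub> (x \<ominus>\<^bsub>M\<^esub> y \<odot>\<^bsub>M\<^esub> z) = \<zero>\<^bsub>M\<^esub>"
    and "\<And>s. s \<in> carrier R \<Longrightarrow> s \<odot>\<^bsub>M\<^esub> x = \<zero>\<^bsub>M\<^esub> \<Longrightarrow> s \<odot>\<^bsub>M\<^esub> z = \<zero>\<^bsub>M\<^esub>"
proof -
  have "(y [^] l) \<odot>\<^bsub>M\<^esub> x = (y [^] l) \<odot>\<^bsub>M\<^esub> (y \<odot>\<^bsub>M\<^esub> z)"
    using ext[of \<one> \<zero>] assms by (simp add: smult_assoc1)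
  then show "(y [^] l) \<odot>\<^bsub>M\<^esub> (x \<ominus>\<^bsub>M\<^esub> y \<odot>\<^bsub>M\<^esub> z) = \<zero>\<^bsub>M\<^esub>"
    using assms(1-3) by (simp add: smult_minus_distr) (simp add: a_minus_def M.r_neg)
  show "s \<odot>\<^bsub>M\<^esub> z = \<zero>\<^bsub>M\<^esub>" if "s \<in> carrier R" "s \<odot>\<^bsub>M\<^esub> x = \<zero>\<^bsub>M\<^esub>" for s
    using ext[of \<zero> s] that assms by simp
qed

lemma injective_good:
  fixes R :: "('a, 'r) ring_scheme"
  assumes "noetherian_ring R" "injective_module R E" "x \<in> carrier E" "y \<in> carrier R"
  shows "\<exists>z\<in>carrier E. (\<exists>l::nat. (y [^]\<^bsub>R\<^esub> l) \<odot>\<^bsub>E\<^esub> (x \<ominus>\<^bsub>E\<^esub> y \<odot>\<^bsub>E\<^esub> z) = \<zero>\<^bsub>E\<^esub>) \<and>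
    (\<forall>s\<in>carrier R. s \<odot>\<^bsub>E\<^esub> x = \<zero>\<^bsub>E\<^esub> \<longrightarrow> s \<odot>\<^bsub>E\<^esub> z = \<zero>\<^bsub>E\<^esub>)"
proof -
  interpret E: module R E using assms(2) by (simp add: injective_module_def)
  obtain l J g where J: "ideal J R"
    "J = {y [^]\<^bsub>R\<^esub> Suc l \<otimes>\<^bsub>R\<^esub> r \<oplus>\<^bsub>R\<^esub> s | r s. r \<in> carrier R \<and> s \<in> carrier R \<and> s \<odot>\<^bsub>E\<^esub> x = \<zero>\<^bsub>E\<^esub>}"
    and g: "\<And>r s. r \<in> carrier R \<Longrightarrow> s \<in> carrier R \<Longrightarrow> s \<odot>\<^bsub>E\<^esub> x = \<zero>\<^bsub>E\<^esub> \<Longrightarrow>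
      g (y [^]\<^bsub>R\<^esub> Suc l \<otimes>\<^bsub>R\<^esub> r \<oplus>\<^bsub>R\<^esub> s) = (y [^]\<^bsub>R\<^esub> l \<otimes>\<^bsub>R\<^esub> r) \<odot>\<^bsub>E\<^esub> x"
    "\<And>a. a \<in> J \<Longrightarrow> g a \<in> carrier E"
    "\<And>a b. a \<in> J \<Longrightarrow> b \<in> J \<Longrightarrow> g (a \<oplus>\<^bsub>R\<^esub> b) = g a \<oplus>\<^bsub>E\<^esub> g b"
    "\<And>a r. a \<in> J \<Longrightarrow> r \<in> carrier R \<Longrightarrow> g (r \<otimes>\<^bsub>R\<^esub> a) = r \<odot>\<^bsub>E\<^esub> g a"
    by (rule E.divisibility_data[OF assms(1,3,4)]) (rule that; assumption)
  obtain z where z: "z \<in> carrier E" "\<And>a. a \<in> J \<Longrightarrow> g a = a \<odot>\<^bsub>E\<^esub> z"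
    using injective_extends[OF E.R.is_cring assms(2) J(1) g(2-4)] by blast
  have "(y [^]\<^bsub>R\<^esub> l \<otimes>\<^bsub>R\<^esub> r) \<odot>\<^bsub>E\<^esub> x = (y [^]\<^bsub>R\<^esub> Suc l \<otimes>\<^bsub>R\<^esub> r \<oplus>\<^bsub>R\<^esub> s) \<odot>\<^bsub>E\<^esub> z"
    if "r \<in> carrier R" "s \<in> carrier R" "s \<odot>\<^bsub>E\<^esub> x = \<zero>\<^bsub>E\<^esub>" for r s
    using g(1)[OF that] z(2)[of "y [^]\<^bsub>R\<^esub> Suc l \<otimes>\<^bsub>R\<^esub> r \<oplus>\<^bsub>R\<^esub> s"] that unfolding J(2) by auto
  from E.divisor_from_extension[OF assms(3,4) z(1) this] show ?thesis using z(1) by blast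
qed

section \<open>Division in graded injective modules\<close>

context graded_ring_locale
begin

text \<open>The graded module J(-q): the unit of the ring has degree \<open>q\<close>, so the value
  at 1 of a graded map on R(-q) has degree \<open>q\<close>.\<close>

definition shifted_ideal :: "'a set \<Rightarrow> int \<Rightarrow> ('a, 'a) graded_module" where
  "shifted_ideal J q = \<lparr>carrier = J, monoid.mult = monoid.mult R, one = one R, zero = zero R,
     add = add R, smult = monoid.mult R, module_part = (\<lambda>m. J \<inter> int_part R (m - q))\<rparr>"

lemma shifted_ideal_graded:
  assumes J: "ideal J R" and hom: "\<And>a k. a \<in> J \<Longrightarrow> cmp a k \<in> J"
  shows "is_graded_module R (shifted_ideal J q)"
proof -
  let ?N = "shifted_ideal J q"
  interpret J: ideal J R by fact
  have N: "carrier ?N = J" "add ?N = add R" "\<zero>\<^bsub>?N\<^esub> = \<zero>" "smult ?N = (\<otimes>)"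
    "module_part ?N = (\<lambda>m. J \<inter> int_part R (m - q))"
    by (simp_all add: shifted_ideal_def)
  have mod: "module R ?N" by (rule ideal_as_module[OF is_cring J N(1-4)])
  interpret N: module R ?N by (rule mod)
  have neg: "\<ominus>\<^bsub>?N\<^esub> x = \<ominus> x" if "x \<in> J" for x
    by (rule N.M.minus_equality) (use that N J.Icarr in \<open>auto simp: l_neg\<close>)
  \<comment> \<open>Component \<open>m\<close> of the shifted module is component
    \<open>m - q\<close> in the ring, and zero if \<open>m - q\<close> is negative.\<close>
  define p where "p x m = (if m < q then \<zero> else cmp x (nat (m - q)))" for x and m :: int
  have supp: "{m. p x m \<noteq> \<zero>} = (\<lambda>i. int i + q) ` {i. cmp x i \<noteq> \<zero>}" for x
  proof safe
    fix m assume m: "p x m \<noteq> \<zero>"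
    then have "m = int (nat (m - q)) + q" "cmp x (nat (m - q)) \<noteq> \<zero>" by (auto simp: p_def split: if_splits)
    then show "m \<in> (\<lambda>i. int i + q) ` {i. cmp x i \<noteq> \<zero>}" by blast
  qed (auto simp: p_def)
  have "internal_direct_sum ?N (module_part ?N)"
  proof (rule internal_direct_sumI[of _ _ p])
    show "abelian_group ?N" by (rule N.abelian_group_axioms)
    show "additive_subgroup (module_part ?N i) ?N" for i
      unfolding N.M.additive_subgroup_iff
      using int_part_zero int_part_add int_part_neg by (auto simp: N neg)
    fix x assume x: "x \<in> carrier ?N"
    then have xJ: "x \<in> J" and xc: "x \<in> carrier R" using N J.Icarr by auto
    show "p x i \<in> module_part ?N i" for i
      using hom[OF xJ] int_part_zero comp_spec(1)[OF xc] by (auto simp: p_def N int_part_def)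
    show fin: "finite {i. p x i \<noteq> \<zero>\<^bsub>?N\<^esub>}" using comp_spec(2)[OF xc] by (simp add: N supp)
    have pJ: "p x i \<in> J" for i using hom[OF xJ] by (simp add: p_def)
    have "finsum ?N (p x) {i. p x i \<noteq> \<zero>\<^bsub>?N\<^esub>} = finsum R (p x) {i. p x i \<noteq> \<zero>\<^bsub>?N\<^esub>}"
      by (rule finsum_subcarrier) (use N J.Icarr pJ fin abelian_group_axioms N.abelian_group_axioms in auto)
    also have "\<dots> = finsum R (\<lambda>i. p x (int i + q)) {i. cmp x i \<noteq> \<zero>}"
      unfolding N(3) supp by (rule finsum_reindex) (use pJ J.Icarr in \<open>auto simp: inj_on_def\<close>)
    also have "\<dots> = finsum R (cmp x) {i. cmp x i \<noteq> \<zero>}" by (simp add: p_def)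
    also have "\<dots> = x" using comp_spec(3)[OF xc] by simp
    finally show "x = finsum ?N (p x) {i. p x i \<noteq> \<zero>\<^bsub>?N\<^esub>}" by simp
    fix y i assume "y \<in> carrier ?N"
    then have "y \<in> carrier R" using N J.Icarr by auto
    then show "p (x \<oplus>\<^bsub>?N\<^esub> y) i = p x i \<oplus>\<^bsub>?N\<^esub> p y i" using xc by (simp add: N p_def comp_add)
  next
    fix i j x assume "x \<in> module_part ?N i"
    then have x: "x \<in> int_part R (i - q)" by (simp add: N)
    show "p x j = (if j = i then x else \<zero>\<^bsub>?N\<^esub>)"
    proof (cases "i < q")
      case True
      then have "x = \<zero>" using x by (simp add: int_part_def)
      then show ?thesis by (simp add: p_def comp_zero N)
    next
      case False
      then have "x \<in> ring_part R (nat (i - q))" using x by (simp add: int_part_def)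
      from comp_homogeneous[OF this] show ?thesis using False by (auto simp: p_def N nat_eq_iff)
    qed
  qed
  moreover have "a \<odot>\<^bsub>?N\<^esub> x \<in> module_part ?N (int i + j)"
    if a: "a \<in> ring_part R i" and x: "x \<in> module_part ?N j" for a x i j
  proof -
    have "a \<otimes> x \<in> int_part R (int i + (j - q))"
      using a x by (intro P_mult) (auto simp: N int_part_nat)
    moreover have "a \<otimes> x \<in> J" using x C_carrier[OF a] J.I_l_closed by (simp add: N)
    ultimately show ?thesis by (simp add: N algebra_simps)
  qed
  ultimately show ?thesis using mod unfolding is_graded_module_def by blast
qed

lemma graded_moduleD:
  assumes "is_graded_module R E"
  shows "module R E" "graded_group E (module_part E)"
    "\<And>r x e n. r \<in> int_part R e \<Longrightarrow> x \<in> module_part E n \<Longrightarrow> r \<odot>\<^bsub>E\<^esub> x \<in> module_part E (n + e)"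
proof -
  show mod: "module R E" using assms by (simp add: is_graded_module_def)
  then interpret E: module R E .
  show gr: "graded_group E (module_part E)"
    using assms by (intro graded_group.intro graded_group_axioms.intro E.abelian_group_axioms)
      (simp add: is_graded_module_def)
  interpret E': graded_group E "module_part E" by (rule gr)
  fix r x e n assume rx: "r \<in> int_part R e" "x \<in> module_part E n"
  show "r \<odot>\<^bsub>E\<^esub> x \<in> module_part E (n + e)"
  proof (cases "e < 0")
    case True
    then show ?thesis using rx E'.C_zero E'.C_carrier[OF rx(2)] by (simp add: int_part_def)
  next
    case False
    then have "r \<odot>\<^bsub>E\<^esub> x \<in> module_part E (int (nat e) + n)"
      using assms rx unfolding is_graded_module_def int_part_def by (metis not_less)
    then show ?thesis using False by (simp add: add.commute)
  qed
qed

text \<open>The component of \<open>s x\<close> in degree \<open>k + n\<close> is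
  \<open>cmp s k\<close> times \<open>x\<close>; hence annihilators of homogeneous elements are
  homogeneous.\<close>

lemma annihilator_homogeneous:
  assumes E: "is_graded_module R E" and x: "x \<in> module_part E n" and s: "s \<in> carrier R" "s \<odot>\<^bsub>E\<^esub> x = \<zero>\<^bsub>E\<^esub>"
  shows "cmp s k \<odot>\<^bsub>E\<^esub> x = \<zero>\<^bsub>E\<^esub>"
proof -
  interpret M: module R E by (rule graded_moduleD(1)[OF E])
  interpret E': graded_group E "module_part E" by (rule graded_moduleD(2)[OF E])
  have xc: "x \<in> carrier E" using x by (rule E'.C_carrier)
  have "component E (module_part E) (s \<odot>\<^bsub>E\<^esub> x) (int k + n) = cmp s k \<odot>\<^bsub>E\<^esub> x"
  proof (rule component_map(1)[where g = "\<lambda>s. s \<odot>\<^bsub>E\<^esub> x" and \<sigma> = "\<lambda>k. int k + n", OF graded_group_axioms E'.graded_group_axioms])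
    show "r \<odot>\<^bsub>E\<^esub> x \<in> module_part E (int i + n)" if "r \<in> ring_part R i" for r i
      using graded_moduleD(3)[OF E _ x, of r "int i"] that by (simp add: int_part_nat add.commute)
  qed (use xc s in \<open>auto simp: inj_def M.smult_l_distr\<close>)
  then show ?thesis using s(2) E'.comp_zero by simp
qed

text \<open>For homogeneous \<open>x\<close> and \<open>y\<close> the data of
  \<open>divisibility_data\<close> are homogeneous: \<open>J\<close> contains the components of its
  elements, and \<open>g\<close> has degree 0 on J(-q) for \<open>q = n - e\<close>. A graded
  extension therefore yields a \<open>z\<close> of degree \<open>n - e\<close>.\<close>

lemma graded_injective_good:
  fixes E :: "('a, 'e) graded_module"
  assumes noeth: "noetherian_ring R" and inj: "graded_injective_module R E"
    and x: "x \<in> module_part E n" and y: "y \<in> int_part R e"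
  shows "\<exists>z\<in>module_part E (n - e). (\<exists>l::nat. (y [^] l) \<odot>\<^bsub>E\<^esub> (x \<ominus>\<^bsub>E\<^esub> y \<odot>\<^bsub>E\<^esub> z) = \<zero>\<^bsub>E\<^esub>) \<and>
    (\<forall>s\<in>carrier R. s \<odot>\<^bsub>E\<^esub> x = \<zero>\<^bsub>E\<^esub> \<longrightarrow> s \<odot>\<^bsub>E\<^esub> z = \<zero>\<^bsub>E\<^esub>)"
proof -
  have E: "is_graded_module R E" using inj by (simp add: graded_injective_module_def)
  interpret M: module R E by (rule graded_moduleD(1)[OF E])
  interpret E': graded_group E "module_part E" by (rule graded_moduleD(2)[OF E])
  note E_smult = graded_moduleD(3)[OF E]
  have xc: "x \<in> carrier E" using x by (rule E'.C_carrier)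
  have yc: "y \<in> carrier R" using y by (rule P_carrier)
  show ?thesis
  proof (cases "e < 0")
    \<comment> \<open>There are no nonzero scalars of negative degree; for \<open>y = 0\<close> the
      divisor 0 works with exponent 1.\<close>
    case True
    then have "y = \<zero>" using y by (simp add: int_part_def)
    then have "(y [^] (1::nat)) \<odot>\<^bsub>E\<^esub> (x \<ominus>\<^bsub>E\<^esub> y \<odot>\<^bsub>E\<^esub> \<zero>\<^bsub>E\<^esub>) = \<zero>\<^bsub>E\<^esub>" using xc by simp
    then show ?thesis using E'.C_zero by (intro bexI[of _ "\<zero>\<^bsub>E\<^esub>"] conjI exI[of _ 1]) auto
  next
    case False
    define q where "q = n - e"
    obtain l J g where J: "ideal J R"
      "J = {y [^] Suc l \<otimes> r \<oplus> s | r s. r \<in> carrier R \<and> s \<in> carrier R \<and> s \<odot>\<^bsub>E\<^esub> x = \<zero>\<^bsub>E\<^esub>}"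
      and g: "\<And>r s. r \<in> carrier R \<Longrightarrow> s \<in> carrier R \<Longrightarrow> s \<odot>\<^bsub>E\<^esub> x = \<zero>\<^bsub>E\<^esub> \<Longrightarrow>
        g (y [^] Suc l \<otimes> r \<oplus> s) = (y [^] l \<otimes> r) \<odot>\<^bsub>E\<^esub> x"
      "\<And>a. a \<in> J \<Longrightarrow> g a \<in> carrier E"
      "\<And>a b. a \<in> J \<Longrightarrow> b \<in> J \<Longrightarrow> g (a \<oplus> b) = g a \<oplus>\<^bsub>E\<^esub> g b"
      "\<And>a r. a \<in> J \<Longrightarrow> r \<in> carrier R \<Longrightarrow> g (r \<otimes> a) = r \<odot>\<^bsub>E\<^esub> g a"
      by (rule M.divisibility_data[OF noeth xc yc]) (rule that; assumption)
    have ylc: "y [^] Suc l \<in> carrier R" "y [^] l \<in> carrier R" using yc by auto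
    have ylP: "y [^] Suc l \<in> int_part R (int (Suc l) * e)" "y [^] l \<in> int_part R (int l * e)"
      using P_pow[OF y] by blast+
    define w where "w = Suc l * nat e"
    have we: "int w = int (Suc l) * e" using False by (simp add: w_def algebra_simps)
    have yw: "y [^] Suc l \<in> ring_part R w" using ylP(1) unfolding we[symmetric] int_part_nat .
    \<comment> \<open>The part of degree \<open>k\<close> of \<open>y^(l+1) r + s\<close> has the
      same form: \<open>r\<close> is replaced by its part of degree \<open>k - w\<close>, or by 0 if
      \<open>k < w\<close>, and the part of \<open>s\<close> still annihilates
      \<open>x\<close>.\<close>
    have comp_J: "\<exists>r s. cmp a k = y [^] Suc l \<otimes> r \<oplus> s \<and> r \<in> int_part R (int k - int w) \<and>
        s \<in> carrier R \<and> s \<odot>\<^bsub>E\<^esub> x = \<zero>\<^bsub>E\<^esub>" if a: "a \<in> J" for a k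
    proof -
      obtain r s where rs: "a = y [^] Suc l \<otimes> r \<oplus> s" "r \<in> carrier R" "s \<in> carrier R" "s \<odot>\<^bsub>E\<^esub> x = \<zero>\<^bsub>E\<^esub>"
        using a unfolding J(2) by blast
      have "cmp a k = cmp (y [^] Suc l \<otimes> r) k \<oplus> cmp s k"
        unfolding rs(1) using rs(2,3) ylc by (intro comp_add m_closed)
      moreover have "cmp s k \<odot>\<^bsub>E\<^esub> x = \<zero>\<^bsub>E\<^esub>" by (rule annihilator_homogeneous[OF E x rs(3,4)])
      moreover have "cmp s k \<in> carrier R" using rs(3) by (rule comp_carrier)
      moreover have "\<exists>r'. cmp (y [^] Suc l \<otimes> r) k = y [^] Suc l \<otimes> r' \<and> r' \<in> int_part R (int k - int w)"
      proof (cases "w \<le> k")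
        case True
        then have "cmp (y [^] Suc l \<otimes> r) k = y [^] Suc l \<otimes> cmp r (k - w)"
          using comp_mult_homogeneous[OF yw rs(2), of "k - w"] by simp
        moreover have "cmp r (k - w) \<in> int_part R (int k - int w)"
          using comp_spec(1)[OF rs(2)] True int_part_nat[of "k - w"] by (simp add: of_nat_diff)
        ultimately show ?thesis by blast
      next
        case False
        have "cmp (y [^] Suc l \<otimes> r) k = \<zero>"
        proof (rule component_map(2)[where g = "\<lambda>b. y [^] Suc l \<otimes> b" and \<sigma> = "\<lambda>k. w + k", OF graded_group_axioms graded_group_axioms])
          show "k \<notin> range ((+) w)" using False by auto
        qed (use rs ylc part_mult[OF yw] in \<open>auto simp: inj_def r_distr simp del: nat_pow_Suc\<close>)
        then show ?thesis using int_part_zero ylc(1) by (intro exI[of _ \<zero>]) simp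
      qed
      ultimately show ?thesis by metis
    qed
    have Jc: "a \<in> carrier R" if "a \<in> J" for a using that J(1) ideal.Icarr by metis
    have JJ: "cmp a k \<in> J" if "a \<in> J" for a k
      using comp_J[OF that, of k] P_carrier unfolding J(2) by blast
    have g_hom: "g a \<in> module_part E m" if a: "a \<in> J" "a \<in> int_part R (m - q)" for a m
    proof (cases "m - q < 0")
      case True
      then have "a = \<zero>" using a by (simp add: int_part_def)
      then have "a = \<zero> \<otimes> a" by simp
      then have "g a = \<zero> \<odot>\<^bsub>E\<^esub> g a" using g(4)[OF a(1), of \<zero>] by simp
      then show ?thesis using g(2)[OF a(1)] E'.C_zero by simp
    next
      case False
      define k where "k = nat (m - q)"
      have k: "int k = m - q" "a \<in> ring_part R k" using False a by (auto simp: k_def int_part_def)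
      have "cmp a k = a" using comp_homogeneous[OF k(2)] by simp
      with comp_J[OF a(1), of k] obtain r s where rs: "a = y [^] Suc l \<otimes> r \<oplus> s" "r \<in> int_part R (int k - int w)"
        "s \<in> carrier R" "s \<odot>\<^bsub>E\<^esub> x = \<zero>\<^bsub>E\<^esub>" by metis
      have "y [^] l \<otimes> r \<in> int_part R (int l * e + (int k - int w))" by (rule P_mult[OF ylP(2) rs(2)])
      from E_smult[OF this x] have "(y [^] l \<otimes> r) \<odot>\<^bsub>E\<^esub> x \<in> module_part E (n + (int l * e + (int k - int w)))" .
      \<comment> \<open>The shift \<open>q = n - e\<close> accounts for the one factor
        \<open>y\<close> by which \<open>y^(l+1)\<close> exceeds \<open>y^l\<close>.\<close>
      moreover have "n + (int l * e + (int k - int w)) = m"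
        unfolding we k(1) by (simp add: q_def algebra_simps)
      ultimately show ?thesis unfolding rs(1) g(1)[OF P_carrier[OF rs(2)] rs(3,4)] by simp
    qed
    let ?A = "shifted_ideal J q" and ?B = "shifted_ideal (carrier R) q"
    have A: "is_graded_module R ?A" by (rule shifted_ideal_graded[OF J(1) JJ])
    have B: "is_graded_module R ?B" by (rule shifted_ideal_graded[OF oneideal comp_carrier])
    have j: "is_graded_hom R ?A ?B id" "inj_on id (carrier ?A)"
      using Jc by (auto simp: is_graded_hom_def is_module_hom_def shifted_ideal_def)
    have gh: "is_graded_hom R ?A E g"
      using g(2-4) g_hom by (auto simp: is_graded_hom_def is_module_hom_def shifted_ideal_def)
    have "\<exists>h. is_graded_hom R ?B E h \<and> (\<forall>x\<in>carrier ?A. h (id x) = g x)"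
      using inj A B j gh unfolding graded_injective_module_def by blast
    then obtain h where h: "is_graded_hom R ?B E h" "\<And>x. x \<in> J \<Longrightarrow> h x = g x"
      by (auto simp: shifted_ideal_def)
    define z where "z = h \<one>"
    have "\<one> \<in> module_part ?B (n - e)" using P_one by (simp add: shifted_ideal_def q_def)
    then have zE: "z \<in> module_part E (n - e)" using h(1) unfolding is_graded_hom_def z_def by blast
    have h_lin: "\<forall>r\<in>carrier R. \<forall>x\<in>carrier R. h (r \<otimes> x) = r \<odot>\<^bsub>E\<^esub> h x"
      using h(1) by (simp add: is_graded_hom_def is_module_hom_def shifted_ideal_def)
    have gz: "g a = a \<odot>\<^bsub>E\<^esub> z" if a: "a \<in> J" for a
    proof -
      have "h (a \<otimes> \<one>) = a \<odot>\<^bsub>E\<^esub> z" using h_lin Jc[OF a] one_closed unfolding z_def by blast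
      then show ?thesis using h(2)[OF a] Jc[OF a] by simp
    qed
    have "(y [^] l \<otimes> r) \<odot>\<^bsub>E\<^esub> x = (y [^] Suc l \<otimes> r \<oplus> s) \<odot>\<^bsub>E\<^esub> z"
      if "r \<in> carrier R" "s \<in> carrier R" "s \<odot>\<^bsub>E\<^esub> x = \<zero>\<^bsub>E\<^esub>" for r s
    proof -
      have "y [^] Suc l \<otimes> r \<oplus> s \<in> J" using that unfolding J(2) by blast
      then show ?thesis using g(1)[OF that] gz by metis
    qed
    from M.divisor_from_extension[OF xc yc E'.C_carrier[OF zE] this] show ?thesis using zE by blast
  qed
qed

end


section \<open>Baer's criterion\<close>

text \<open>Submodules as mere sets; closure under negation comes from the scalar -1.\<close>

definition submodule_set :: "('a, 'r) ring_scheme \<Rightarrow> ('a, 'm, 'y) module_scheme \<Rightarrow> 'm set \<Rightarrow> bool" where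
  "submodule_set R M N \<longleftrightarrow> N \<subseteq> carrier M \<and> \<zero>\<^bsub>M\<^esub> \<in> N \<and> (\<forall>x\<in>N. \<forall>y\<in>N. x \<oplus>\<^bsub>M\<^esub> y \<in> N) \<and>
     (\<forall>r\<in>carrier R. \<forall>x\<in>N. r \<odot>\<^bsub>M\<^esub> x \<in> N)"

definition linear_map_on ::
  "('a, 'r) ring_scheme \<Rightarrow> ('a, 'm, 'y) module_scheme \<Rightarrow> ('a, 'n, 'z) module_scheme \<Rightarrow> 'm set \<Rightarrow>
     ('m \<Rightarrow> 'n) \<Rightarrow> bool" where
  "linear_map_on R M D N h \<longleftrightarrow> (\<forall>x\<in>N. h x \<in> carrier D) \<and>
     (\<forall>x\<in>N. \<forall>y\<in>N. h (x \<oplus>\<^bsub>M\<^esub> y) = h x \<oplus>\<^bsub>D\<^esub> h y) \<and>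
     (\<forall>r\<in>carrier R. \<forall>x\<in>N. h (r \<odot>\<^bsub>M\<^esub> x) = r \<odot>\<^bsub>D\<^esub> h x)"

text \<open>Baer's criterion. The definition of injectivity only provides extensions to the ring itself
  from its ideals, while the domain needed here lies in another type.\<close>

lemma injective_extend_submodule:
  fixes R :: "('a, 'r) ring_scheme" and M :: "('a, 'm, 'y) module_scheme"
  assumes M: "module R M" and inj: "injective_module R D"
    and N0: "submodule_set R M N0" and N1: "submodule_set R M N1" "N0 \<subseteq> N1"
    and h0: "linear_map_on R M D N0 h0"
  shows "\<exists>h. linear_map_on R M D N1 h \<and> (\<forall>x\<in>N0. h x = h0 x)"
proof -
  interpret M: module R M by fact
  interpret D: module R D using inj by (simp add: injective_module_def)
  \<comment> \<open>Graphs of linear maps that extend \<open>h0\<close> to submodules of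
    \<open>N1\<close>; for an additive relation the last condition amounts to being single-valued.
    As relations, the partial maps are ordered by inclusion and Zorn's lemma applies
    directly.\<close>
  define ok where "ok G \<longleftrightarrow> G \<subseteq> N1 \<times> carrier D \<and> (\<forall>x\<in>N0. (x, h0 x) \<in> G) \<and>
    (\<forall>a v b w. (a, v) \<in> G \<longrightarrow> (b, w) \<in> G \<longrightarrow> (a \<oplus>\<^bsub>M\<^esub> b, v \<oplus>\<^bsub>D\<^esub> w) \<in> G) \<and>
    (\<forall>r\<in>carrier R. \<forall>a v. (a, v) \<in> G \<longrightarrow> (r \<odot>\<^bsub>M\<^esub> a, r \<odot>\<^bsub>D\<^esub> v) \<in> G) \<and>
    (\<forall>v. (\<zero>\<^bsub>M\<^esub>, v) \<in> G \<longrightarrow> v = \<zero>\<^bsub>D\<^esub>)" for G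
  have N1c: "x \<in> carrier M" if "x \<in> N1" for x using N1(1) that unfolding submodule_set_def by blast
  have h00: "h0 \<zero>\<^bsub>M\<^esub> = \<zero>\<^bsub>D\<^esub>"
  proof -
    have z: "\<zero>\<^bsub>M\<^esub> \<in> N0" using N0 by (simp add: submodule_set_def)
    then have "h0 (\<zero>\<^bsub>R\<^esub> \<odot>\<^bsub>M\<^esub> \<zero>\<^bsub>M\<^esub>) = \<zero>\<^bsub>R\<^esub> \<odot>\<^bsub>D\<^esub> h0 \<zero>\<^bsub>M\<^esub>" and "h0 \<zero>\<^bsub>M\<^esub> \<in> carrier D"
      using h0 M.R.zero_closed unfolding linear_map_on_def by blast+
    then show ?thesis by simp
  qed
  have "ok {(x, h0 x) | x. x \<in> N0}"
    using N0 N1(2) h0 h00 unfolding ok_def submodule_set_def linear_map_on_def by auto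
  then have ne: "Collect ok \<noteq> {}" by blast
  have "\<exists>G\<in>Collect ok. \<forall>G'\<in>Collect ok. G \<subseteq> G' \<longrightarrow> G' = G"
  proof (rule subset_Zorn_nonempty[OF ne])
    fix C assume C: "C \<noteq> {}" "subset.chain (Collect ok) C"
    then have okC: "\<And>G. G \<in> C \<Longrightarrow> ok G" and ch: "\<And>G G'. G \<in> C \<Longrightarrow> G' \<in> C \<Longrightarrow> G \<subseteq> G' \<or> G' \<subseteq> G"
      by (auto simp: subset_chain_def)
    have "(a \<oplus>\<^bsub>M\<^esub> b, v \<oplus>\<^bsub>D\<^esub> w) \<in> \<Union>C" if ab: "(a, v) \<in> \<Union>C" "(b, w) \<in> \<Union>C" for a v b w
    proof -
      obtain G G' where G: "G \<in> C" "(a, v) \<in> G" "G' \<in> C" "(b, w) \<in> G'" using ab by blast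
      then obtain H where "H \<in> C" "(a, v) \<in> H" "(b, w) \<in> H" using ch[OF G(1,3)] by blast
      then show ?thesis using okC unfolding ok_def by blast
    qed
    moreover have "\<Union>C \<subseteq> N1 \<times> carrier D" using okC unfolding ok_def by blast
    moreover have "\<forall>x\<in>N0. (x, h0 x) \<in> \<Union>C" using C(1) okC unfolding ok_def by blast
    moreover have "\<forall>r\<in>carrier R. \<forall>a v. (a, v) \<in> \<Union>C \<longrightarrow> (r \<odot>\<^bsub>M\<^esub> a, r \<odot>\<^bsub>D\<^esub> v) \<in> \<Union>C"
      using okC unfolding ok_def by blast
    moreover have "\<forall>v. (\<zero>\<^bsub>M\<^esub>, v) \<in> \<Union>C \<longrightarrow> v = \<zero>\<^bsub>D\<^esub>" using okC unfolding ok_def by blast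
    ultimately show "\<Union>C \<in> Collect ok" unfolding ok_def mem_Collect_eq by blast
  qed
  then obtain G where G: "ok G" and max: "\<And>G'. ok G' \<Longrightarrow> G \<subseteq> G' \<Longrightarrow> G' = G" by blast
  have Gc: "a \<in> N1 \<and> a \<in> carrier M \<and> v \<in> carrier D" if "(a, v) \<in> G" for a v
    using G that N1c unfolding ok_def by blast
  have Gadd: "(a \<oplus>\<^bsub>M\<^esub> b, v \<oplus>\<^bsub>D\<^esub> w) \<in> G" if "(a, v) \<in> G" "(b, w) \<in> G" for a v b w
    using G that unfolding ok_def by blast
  have Gsm: "(r \<odot>\<^bsub>M\<^esub> a, r \<odot>\<^bsub>D\<^esub> v) \<in> G" if "r \<in> carrier R" "(a, v) \<in> G" for a v r
    using G that unfolding ok_def by blast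
  have G0: "v = \<zero>\<^bsub>D\<^esub>" if "(\<zero>\<^bsub>M\<^esub>, v) \<in> G" for v using G that unfolding ok_def by blast
  have GN0: "(x, h0 x) \<in> G" if "x \<in> N0" for x using G that unfolding ok_def by blast
  have Gneg: "(\<ominus>\<^bsub>M\<^esub> a, \<ominus>\<^bsub>D\<^esub> v) \<in> G" if "(a, v) \<in> G" for a v
    using Gsm[of "\<ominus>\<^bsub>R\<^esub> \<one>\<^bsub>R\<^esub>", OF _ that] Gc[OF that] by (simp add: M.smult_l_minus D.smult_l_minus)
  have Guniq: "v = w" if "(a, v) \<in> G" "(a, w) \<in> G" for a v w
  proof -
    have "(a \<oplus>\<^bsub>M\<^esub> \<ominus>\<^bsub>M\<^esub> a, v \<oplus>\<^bsub>D\<^esub> \<ominus>\<^bsub>D\<^esub> w) \<in> G" using Gadd[OF that(1) Gneg[OF that(2)]] .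
    then have "v \<oplus>\<^bsub>D\<^esub> \<ominus>\<^bsub>D\<^esub> w = \<zero>\<^bsub>D\<^esub>" using G0 Gc[OF that(1)] by (simp add: M.M.r_neg)
    then show ?thesis using D.minus_eq_zero_imp_eq Gc that unfolding a_minus_def by blast
  qed
  have total: "\<exists>v. (u, v) \<in> G" if u: "u \<in> N1" for u
  proof -
    have uc: "u \<in> carrier M" using u by (rule N1c)
    \<comment> \<open>The scalars that move \<open>u\<close> into the domain form an ideal, on which
      the values already assigned define a linear map. Its extension to the ring provides the value
      \<open>z\<close> to assign to \<open>u\<close>.\<close>
    define J where "J = {r \<in> carrier R. \<exists>v. (r \<odot>\<^bsub>M\<^esub> u, v) \<in> G}"
    define g where "g r = (THE v. (r \<odot>\<^bsub>M\<^esub> u, v) \<in> G)" for r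
    have gI: "g r = v" if "(r \<odot>\<^bsub>M\<^esub> u, v) \<in> G" for r v
      unfolding g_def using that Guniq by (intro the_equality) auto
    have gG: "(r \<odot>\<^bsub>M\<^esub> u, g r) \<in> G" if "r \<in> J" for r
      using that gI unfolding J_def by auto
    have sum: "a \<oplus>\<^bsub>R\<^esub> b \<in> J \<and> g (a \<oplus>\<^bsub>R\<^esub> b) = g a \<oplus>\<^bsub>D\<^esub> g b" if ab: "a \<in> J" "b \<in> J" for a b
    proof -
      have c: "a \<in> carrier R" "b \<in> carrier R" using ab by (auto simp: J_def)
      have "((a \<oplus>\<^bsub>R\<^esub> b) \<odot>\<^bsub>M\<^esub> u, g a \<oplus>\<^bsub>D\<^esub> g b) \<in> G"
        using Gadd[OF gG[OF ab(1)] gG[OF ab(2)]] c uc by (simp add: M.smult_l_distr)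
      then show ?thesis using gI c by (auto simp: J_def)
    qed
    have mult: "t \<otimes>\<^bsub>R\<^esub> a \<in> J \<and> g (t \<otimes>\<^bsub>R\<^esub> a) = t \<odot>\<^bsub>D\<^esub> g a" if a: "a \<in> J" and t: "t \<in> carrier R" for a t
    proof -
      have c: "a \<in> carrier R" using a by (auto simp: J_def)
      have "((t \<otimes>\<^bsub>R\<^esub> a) \<odot>\<^bsub>M\<^esub> u, t \<odot>\<^bsub>D\<^esub> g a) \<in> G"
        using Gsm[OF t gG[OF a]] c t uc by (simp add: M.smult_assoc1)
      then show ?thesis using gI c t by (auto simp: J_def)
    qed
    have zN0: "\<zero>\<^bsub>M\<^esub> \<in> N0" using N0 by (simp add: submodule_set_def)
    have z: "\<zero>\<^bsub>R\<^esub> \<in> J" using GN0[OF zN0] uc by (auto simp: J_def)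
    have neg: "\<ominus>\<^bsub>R\<^esub> a \<in> J" if "a \<in> J" for a
      using mult[OF that, of "\<ominus>\<^bsub>R\<^esub> \<one>\<^bsub>R\<^esub>"] that by (simp add: J_def M.R.l_minus)
    have Jc: "J \<subseteq> carrier R" by (auto simp: J_def)
    have "additive_subgroup J R" unfolding M.R.additive_subgroup_iff
      by (intro conjI ballI Jc z neg conjunct1[OF sum])
    then have J: "ideal J R"
      using mult Jc by (intro idealI M.R.ring_axioms additive_subgroup.a_subgroup) (auto simp: M.R.m_comm subset_iff)
    have gD: "g a \<in> carrier D" if "a \<in> J" for a using gG[OF that] Gc by blast
    have "\<exists>z\<in>carrier D. \<forall>a\<in>J. g a = a \<odot>\<^bsub>D\<^esub> z"
      by (rule injective_extends[OF M.R.is_cring inj J gD conjunct2[OF sum] conjunct2[OF mult]])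
    then obtain z where zD: "z \<in> carrier D" "\<And>a. a \<in> J \<Longrightarrow> g a = a \<odot>\<^bsub>D\<^esub> z" by blast
    define G' where "G' = {(w \<oplus>\<^bsub>M\<^esub> r \<odot>\<^bsub>M\<^esub> u, v \<oplus>\<^bsub>D\<^esub> r \<odot>\<^bsub>D\<^esub> z) | w v r. (w, v) \<in> G \<and> r \<in> carrier R}"
    have G'I: "(w \<oplus>\<^bsub>M\<^esub> r \<odot>\<^bsub>M\<^esub> u, v \<oplus>\<^bsub>D\<^esub> r \<odot>\<^bsub>D\<^esub> z) \<in> G'" if "(w, v) \<in> G" "r \<in> carrier R" for w v r
      using that unfolding G'_def by blast
    have GG': "G \<subseteq> G'"
    proof
      fix p assume "p \<in> G"
      moreover obtain w v where p: "p = (w, v)" by force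
      ultimately have "(w \<oplus>\<^bsub>M\<^esub> \<zero>\<^bsub>R\<^esub> \<odot>\<^bsub>M\<^esub> u, v \<oplus>\<^bsub>D\<^esub> \<zero>\<^bsub>R\<^esub> \<odot>\<^bsub>D\<^esub> z) \<in> G'" using G'I by blast
      then show "p \<in> G'" using Gc[of w v] \<open>p \<in> G\<close> p uc zD(1) by simp
    qed
    have "ok G'" unfolding ok_def
    proof (intro conjI allI impI ballI)
      show "G' \<subseteq> N1 \<times> carrier D"
      proof
        fix p assume "p \<in> G'"
        then obtain w v r where p: "p = (w \<oplus>\<^bsub>M\<^esub> r \<odot>\<^bsub>M\<^esub> u, v \<oplus>\<^bsub>D\<^esub> r \<odot>\<^bsub>D\<^esub> z)" "(w, v) \<in> G" "r \<in> carrier R"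
          unfolding G'_def by blast
        have "w \<oplus>\<^bsub>M\<^esub> r \<odot>\<^bsub>M\<^esub> u \<in> N1" using N1(1) u p Gc[OF p(2)] unfolding submodule_set_def by blast
        then show "p \<in> N1 \<times> carrier D" using p Gc[OF p(2)] zD(1) by simp
      qed
      show "(x, h0 x) \<in> G'" if "x \<in> N0" for x using GN0[OF that] GG' by blast
    next
      fix a v b w assume "(a, v) \<in> G'" "(b, w) \<in> G'"
      then obtain a1 v1 r b1 w1 s where *: "a = a1 \<oplus>\<^bsub>M\<^esub> r \<odot>\<^bsub>M\<^esub> u" "v = v1 \<oplus>\<^bsub>D\<^esub> r \<odot>\<^bsub>D\<^esub> z" "(a1, v1) \<in> G" "r \<in> carrier R"
        "b = b1 \<oplus>\<^bsub>M\<^esub> s \<odot>\<^bsub>M\<^esub> u" "w = w1 \<oplus>\<^bsub>D\<^esub> s \<odot>\<^bsub>D\<^esub> z" "(b1, w1) \<in> G" "s \<in> carrier R"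
        unfolding G'_def by blast
      have "((a1 \<oplus>\<^bsub>M\<^esub> b1) \<oplus>\<^bsub>M\<^esub> (r \<oplus>\<^bsub>R\<^esub> s) \<odot>\<^bsub>M\<^esub> u, (v1 \<oplus>\<^bsub>D\<^esub> w1) \<oplus>\<^bsub>D\<^esub> (r \<oplus>\<^bsub>R\<^esub> s) \<odot>\<^bsub>D\<^esub> z) \<in> G'"
        using Gadd[OF *(3,7)] * by (intro G'I) auto
      moreover have "(a1 \<oplus>\<^bsub>M\<^esub> b1) \<oplus>\<^bsub>M\<^esub> (r \<oplus>\<^bsub>R\<^esub> s) \<odot>\<^bsub>M\<^esub> u = a \<oplus>\<^bsub>M\<^esub> b"
        using *(1,4,5,8) Gc[OF *(3)] Gc[OF *(7)] uc by (simp add: M.smult_l_distr M.M.a_ac)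
      moreover have "(v1 \<oplus>\<^bsub>D\<^esub> w1) \<oplus>\<^bsub>D\<^esub> (r \<oplus>\<^bsub>R\<^esub> s) \<odot>\<^bsub>D\<^esub> z = v \<oplus>\<^bsub>D\<^esub> w"
        using *(2,4,6,8) Gc[OF *(3)] Gc[OF *(7)] zD(1) by (simp add: D.smult_l_distr D.M.a_ac)
      ultimately show "(a \<oplus>\<^bsub>M\<^esub> b, v \<oplus>\<^bsub>D\<^esub> w) \<in> G'" by simp
    next
      fix t a v assume t: "t \<in> carrier R" and "(a, v) \<in> G'"
      then obtain a1 v1 r where *: "a = a1 \<oplus>\<^bsub>M\<^esub> r \<odot>\<^bsub>M\<^esub> u" "v = v1 \<oplus>\<^bsub>D\<^esub> r \<odot>\<^bsub>D\<^esub> z" "(a1, v1) \<in> G" "r \<in> carrier R"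
        unfolding G'_def by blast
      have "(t \<odot>\<^bsub>M\<^esub> a1 \<oplus>\<^bsub>M\<^esub> (t \<otimes>\<^bsub>R\<^esub> r) \<odot>\<^bsub>M\<^esub> u, t \<odot>\<^bsub>D\<^esub> v1 \<oplus>\<^bsub>D\<^esub> (t \<otimes>\<^bsub>R\<^esub> r) \<odot>\<^bsub>D\<^esub> z) \<in> G'"
        using Gsm[OF t *(3)] * t by (intro G'I) auto
      then show "(t \<odot>\<^bsub>M\<^esub> a, t \<odot>\<^bsub>D\<^esub> v) \<in> G'"
        using *(1,2,4) Gc[OF *(3)] uc zD(1) t
        by (simp add: M.smult_r_distr M.smult_assoc1 D.smult_r_distr D.smult_assoc1)
    next
      fix v assume "(\<zero>\<^bsub>M\<^esub>, v) \<in> G'"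
      then obtain a1 v1 r where *: "\<zero>\<^bsub>M\<^esub> = a1 \<oplus>\<^bsub>M\<^esub> r \<odot>\<^bsub>M\<^esub> u" "v = v1 \<oplus>\<^bsub>D\<^esub> r \<odot>\<^bsub>D\<^esub> z" "(a1, v1) \<in> G" "r \<in> carrier R"
        unfolding G'_def by blast
      have c: "a1 \<in> carrier M" "v1 \<in> carrier D" using Gc[OF *(3)] by auto
      \<comment> \<open>If \<open>a1 + r u = 0\<close>, then \<open>r\<close> lies in
        \<open>J\<close>, and the value at \<open>r u\<close> is both \<open>- v1\<close> and
        \<open>r z\<close>.\<close>
      have "\<ominus>\<^bsub>M\<^esub> a1 = r \<odot>\<^bsub>M\<^esub> u"
        using *(1,4) c uc M.M.a_comm M.M.minus_equality by (metis M.smult_closed)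
      then have ru: "(r \<odot>\<^bsub>M\<^esub> u, \<ominus>\<^bsub>D\<^esub> v1) \<in> G" using Gneg[OF *(3)] by simp
      then have "r \<in> J" using *(4) by (auto simp: J_def)
      then have "r \<odot>\<^bsub>D\<^esub> z = \<ominus>\<^bsub>D\<^esub> v1" using zD(2) gI[OF ru] by simp
      then show "v = \<zero>\<^bsub>D\<^esub>" using *(2) c by (simp add: D.M.r_neg)
    qed
    then have "G' = G" using max GG' by blast
    moreover have "(\<zero>\<^bsub>M\<^esub> \<oplus>\<^bsub>M\<^esub> \<one>\<^bsub>R\<^esub> \<odot>\<^bsub>M\<^esub> u, h0 \<zero>\<^bsub>M\<^esub> \<oplus>\<^bsub>D\<^esub> \<one>\<^bsub>R\<^esub> \<odot>\<^bsub>D\<^esub> z) \<in> G'"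
      by (rule G'I[OF GN0[OF zN0]]) simp
    ultimately show ?thesis using uc by auto
  qed
  define h where "h x = (THE v. (x, v) \<in> G)" for x
  have hI: "h x = v" if "(x, v) \<in> G" for x v
    unfolding h_def using that Guniq by (intro the_equality) auto
  have hG: "(x, h x) \<in> G" if "x \<in> N1" for x using total[OF that] hI by auto
  have "linear_map_on R M D N1 h" unfolding linear_map_on_def
  proof (intro conjI ballI)
    show "h x \<in> carrier D" if "x \<in> N1" for x using Gc[OF hG[OF that]] by simp
    show "h (x \<oplus>\<^bsub>M\<^esub> y) = h x \<oplus>\<^bsub>D\<^esub> h y" if "x \<in> N1" "y \<in> N1" for x y
      by (rule hI[OF Gadd[OF hG[OF that(1)] hG[OF that(2)]]])
    show "h (r \<odot>\<^bsub>M\<^esub> x) = r \<odot>\<^bsub>D\<^esub> h x" if "r \<in> carrier R" "x \<in> N1" for r x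
      by (rule hI[OF Gsm[OF that(1) hG[OF that(2)]]])
  qed
  moreover have "\<forall>x\<in>N0. h x = h0 x" using hI GN0 by blast
  ultimately show ?thesis by blast
qed


section \<open>Torsion submodules and subquotients\<close>

lemma (in cring) ideal_power_ideal:
  assumes "ideal J R"
  shows "ideal (ideal_power R J k) R"
  by (induction k) (use assms oneideal ideal_prod_is_ideal in \<open>auto simp: ideal_power_def\<close>)

lemma ideal_power_Suc: "ideal_power R J (Suc k) = ideal_prod R J (ideal_power R J k)"
  by (simp add: ideal_power_def)

lemma ideal_power_0: "ideal_power R J 0 = carrier R"
  by (simp add: ideal_power_def)

lemma (in cring) pow_in_ideal_power:
  assumes "w \<in> J" "w \<in> carrier R"
  shows "w [^] (k::nat) \<in> ideal_power R J k"
proof (induction k)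
  case (Suc k)
  have "w \<otimes> w [^] k \<in> ideal_power R J (Suc k)"
    unfolding ideal_power_Suc by (rule ideal_prod.prod[OF assms(1) Suc])
  then show ?case using assms(2) by (simp add: m_comm)
qed (simp add: ideal_power_0)

context module
begin

text \<open>The pigeonhole argument on products of generators as an induction on \<open>N\<close>:
  one factor \<open>w\<close> is split off, \<open>x\<close> is replaced by \<open>w x\<close>, and
  the exponent of \<open>w\<close> drops by one. If that exponent is already 0, then
  \<open>x\<close> is zero.\<close>

lemma ideal_power_annihilates:
  assumes I: "ideal I R" and W: "finite W" "W \<subseteq> I" "\<And>J. ideal J R \<Longrightarrow> W \<subseteq> J \<Longrightarrow> I \<subseteq> J"
    and "x \<in> carrier M" "\<And>w. w \<in> W \<Longrightarrow> (w [^] (\<kappa> w :: nat)) \<odot>\<^bsub>M\<^esub> x = \<zero>\<^bsub>M\<^esub>" "sum \<kappa> W \<le> N"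
    and "c \<in> ideal_power R I (Suc N)"
  shows "c \<odot>\<^bsub>M\<^esub> x = \<zero>\<^bsub>M\<^esub>"
  using assms(5-)
proof (induction N arbitrary: \<kappa> x c rule: less_induct)
  case (less N)
  have Wc: "w \<in> carrier R" if "w \<in> W" for w using W(2) that ideal.Icarr[OF I] by blast
  have pow_c: "c \<in> carrier R" if "c \<in> ideal_power R I k" for c k
    using that ideal.Icarr[OF R.ideal_power_ideal[OF I]] by blast
  have gen: "(w \<otimes> c') \<odot>\<^bsub>M\<^esub> x = \<zero>\<^bsub>M\<^esub>" if w: "w \<in> W" and c': "c' \<in> ideal_power R I N" for w c'
  proof (cases "\<kappa> w")
    case 0
    then have "x = \<zero>\<^bsub>M\<^esub>" using less.prems(1) less.prems(2)[OF w] by simp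
    then show ?thesis using Wc[OF w] pow_c[OF c'] by simp
  next
    case (Suc k)
    define \<kappa>' where "\<kappa>' = \<kappa>(w := k)"
    have "sum \<kappa> W = \<kappa> w + sum \<kappa> (W - {w})" "sum \<kappa>' W = \<kappa>' w + sum \<kappa>' (W - {w})"
      using W(1) w by (simp_all add: sum.remove)
    moreover have "sum \<kappa>' (W - {w}) = sum \<kappa> (W - {w})" by (rule sum.cong) (auto simp: \<kappa>'_def)
    ultimately have "sum \<kappa>' W < N" using Suc less.prems(3) by (simp add: \<kappa>'_def)
    then obtain N' where N': "N = Suc N'" "sum \<kappa>' W \<le> N'" by (cases N) auto
    have wx: "w \<odot>\<^bsub>M\<^esub> x \<in> carrier M" using Wc[OF w] less.prems(1) by simp
    have "(v [^] \<kappa>' v) \<odot>\<^bsub>M\<^esub> (w \<odot>\<^bsub>M\<^esub> x) = \<zero>\<^bsub>M\<^esub>" if v: "v \<in> W" for v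
    proof (cases "v = w")
      case True
      have "(w [^] Suc k) \<odot>\<^bsub>M\<^esub> x = \<zero>\<^bsub>M\<^esub>" using less.prems(2)[OF w] Suc by simp
      then show ?thesis using True Wc[OF w] less.prems(1) by (simp add: \<kappa>'_def smult_assoc1)
    next
      case False
      have "(v [^] \<kappa> v) \<odot>\<^bsub>M\<^esub> (w \<odot>\<^bsub>M\<^esub> x) = w \<odot>\<^bsub>M\<^esub> ((v [^] \<kappa> v) \<odot>\<^bsub>M\<^esub> x)"
        using Wc[OF w] Wc[OF v] less.prems(1) by (intro smult_commute) auto
      then show ?thesis using False less.prems(2)[OF v] Wc[OF w] by (simp add: \<kappa>'_def)
    qed
    then have "c' \<odot>\<^bsub>M\<^esub> (w \<odot>\<^bsub>M\<^esub> x) = \<zero>\<^bsub>M\<^esub>"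
      using less.IH[of N' "w \<odot>\<^bsub>M\<^esub> x" \<kappa>' c'] N' wx c' by simp
    then show ?thesis
      using Wc[OF w] pow_c[OF c'] less.prems(1) by (simp add: smult_assoc1 smult_commute[of w c' x])
  qed
  \<comment> \<open>The first factors for which the claim holds form an ideal, so it is enough that
    they include the generators.\<close>
  define Q where "Q = {a \<in> carrier R. \<forall>c'\<in>ideal_power R I N. (a \<otimes> c') \<odot>\<^bsub>M\<^esub> x = \<zero>\<^bsub>M\<^esub>}"
  have "additive_subgroup Q R" unfolding R.additive_subgroup_iff
    using pow_c less.prems(1)
    by (auto simp: Q_def R.l_distr smult_l_distr R.l_minus smult_l_minus M.a_inv_zero)
  moreover have "r \<otimes> a \<in> Q" if "a \<in> Q" "r \<in> carrier R" for a r
    using that pow_c less.prems(1) by (auto simp: Q_def R.m_assoc smult_assoc1[of r])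
  ultimately have "ideal Q R"
    by (intro idealI R.ring_axioms additive_subgroup.a_subgroup) (auto simp: Q_def R.m_comm)
  moreover have "W \<subseteq> Q" using gen Wc by (auto simp: Q_def)
  ultimately have IQ: "I \<subseteq> Q" using W(3) by blast
  have "c \<in> ideal_prod R I (ideal_power R I N)" using less.prems(4) by (simp add: ideal_power_Suc)
  then have "c \<in> carrier R \<and> c \<odot>\<^bsub>M\<^esub> x = \<zero>\<^bsub>M\<^esub>"
  proof (induction rule: ideal_prod.induct)
    case (prod i j)
    then show ?case using IQ pow_c by (auto simp: Q_def subset_iff)
  next
    case (sum s1 s2)
    then show ?case using less.prems(1) by (simp add: smult_l_distr)
  qed
  then show ?case by simp
qed

text \<open>Torsion by powers of an ideal is replaced by torsion by powers of finitely many
  generators, the form in which generators can be added one at a time.\<close>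

lemma torsion_part_eq_tors:
  assumes I: "ideal I R" and W: "finite W" "W \<subseteq> I" "\<And>J. ideal J R \<Longrightarrow> W \<subseteq> J \<Longrightarrow> I \<subseteq> J"
  shows "torsion_part R I M = tors R M W (carrier M)"
proof
  show "torsion_part R I M \<subseteq> tors R M W (carrier M)"
  proof
    fix x assume "x \<in> torsion_part R I M"
    then obtain k where x: "x \<in> carrier M" "\<And>a. a \<in> ideal_power R I k \<Longrightarrow> a \<odot>\<^bsub>M\<^esub> x = \<zero>\<^bsub>M\<^esub>"
      by (auto simp: torsion_part_def)
    have "(w [^] k) \<odot>\<^bsub>M\<^esub> x = \<zero>\<^bsub>M\<^esub>" if "w \<in> W" for w
      using that W(2) ideal.Icarr[OF I] by (intro x(2) R.pow_in_ideal_power) auto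
    then show "x \<in> tors R M W (carrier M)" using x(1) by (auto simp: tors_def)
  qed
  show "tors R M W (carrier M) \<subseteq> torsion_part R I M"
  proof
    fix x assume x: "x \<in> tors R M W (carrier M)"
    then have "\<forall>w\<in>W. \<exists>k::nat. (w [^] k) \<odot>\<^bsub>M\<^esub> x = \<zero>\<^bsub>M\<^esub>" by (simp add: tors_def)
    then obtain \<kappa> :: "'a \<Rightarrow> nat" where k: "\<And>w. w \<in> W \<Longrightarrow> (w [^] \<kappa> w) \<odot>\<^bsub>M\<^esub> x = \<zero>\<^bsub>M\<^esub>" by metis
    have xc: "x \<in> carrier M" using x by (rule torsD)
    have "\<forall>a\<in>ideal_power R I (Suc (sum \<kappa> W)). a \<odot>\<^bsub>M\<^esub> x = \<zero>\<^bsub>M\<^esub>"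
      using ideal_power_annihilates[OF I W xc k] by blast
    then show "x \<in> torsion_part R I M" using xc by (auto simp: torsion_part_def)
  qed
qed

lemma submodule_setD:
  assumes "submodule_set R M N"
  shows "N \<subseteq> carrier M" "\<zero>\<^bsub>M\<^esub> \<in> N" "x \<in> N \<Longrightarrow> y \<in> N \<Longrightarrow> x \<oplus>\<^bsub>M\<^esub> y \<in> N"
    "r \<in> carrier R \<Longrightarrow> x \<in> N \<Longrightarrow> r \<odot>\<^bsub>M\<^esub> x \<in> N" "x \<in> N \<Longrightarrow> \<ominus>\<^bsub>M\<^esub> x \<in> N" "x \<in> N \<Longrightarrow> x \<in> carrier M"
proof -
  show 1: "N \<subseteq> carrier M" "\<zero>\<^bsub>M\<^esub> \<in> N" "x \<in> N \<Longrightarrow> y \<in> N \<Longrightarrow> x \<oplus>\<^bsub>M\<^esub> y \<in> N"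
    "\<And>r x. r \<in> carrier R \<Longrightarrow> x \<in> N \<Longrightarrow> r \<odot>\<^bsub>M\<^esub> x \<in> N"
    using assms unfolding submodule_set_def by blast+
  then show c: "x \<in> N \<Longrightarrow> x \<in> carrier M" for x by blast
  show "x \<in> N \<Longrightarrow> \<ominus>\<^bsub>M\<^esub> x \<in> N"
    using 1(4)[of "\<ominus> \<one>" x] c[of x] by (simp add: smult_l_minus)
qed

lemma submodule_set_abelian_subgroup: "submodule_set R M N \<Longrightarrow> abelian_subgroup N M"
proof -
  assume N: "submodule_set R M N"
  have "additive_subgroup N M"
    unfolding M.additive_subgroup_iff using submodule_setD[OF N] by simp
  then show ?thesis by (rule abelian_subgroupI3) (rule M.abelian_group_axioms)
qed

lemma coset_eq_iff:
  assumes B: "submodule_set R M B" and "x \<in> carrier M" "y \<in> carrier M"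
  shows "B +>\<^bsub>M\<^esub> x = B +>\<^bsub>M\<^esub> y \<longleftrightarrow> x \<ominus>\<^bsub>M\<^esub> y \<in> B"
proof
  interpret B: abelian_subgroup B M by (rule submodule_set_abelian_subgroup[OF B])
  show "x \<ominus>\<^bsub>M\<^esub> y \<in> B" if "B +>\<^bsub>M\<^esub> x = B +>\<^bsub>M\<^esub> y"
  proof -
    have "x \<in> B +>\<^bsub>M\<^esub> y" using B.a_rcos_self[OF assms(2)] that by simp
    then show ?thesis using B.a_rcos_module_imp[OF assms(3)] by (simp add: a_minus_def)
  qed
  show "B +>\<^bsub>M\<^esub> x = B +>\<^bsub>M\<^esub> y" if "x \<ominus>\<^bsub>M\<^esub> y \<in> B"
  proof -
    have "x \<in> B +>\<^bsub>M\<^esub> y"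
      using that by (intro B.a_rcos_module_rev assms) (simp add: a_minus_def)
    from M.a_repr_independence[OF this assms(3) B.a_subgroup] show ?thesis by simp
  qed
qed

lemma coset_zero: "submodule_set R M B \<Longrightarrow> B +>\<^bsub>M\<^esub> \<zero>\<^bsub>M\<^esub> = B"
  by (rule abelian_subgroup.a_rcos_const[OF submodule_set_abelian_subgroup submodule_setD(2)])

lemma coset_eq_zero_iff:
  assumes "submodule_set R M B" "x \<in> carrier M"
  shows "B +>\<^bsub>M\<^esub> x = B \<longleftrightarrow> x \<in> B"
  using coset_eq_iff[OF assms M.zero_closed] assms coset_zero by (simp add: a_minus_def M.a_inv_zero)

text \<open>All members of the union coincide, because differences of representatives stay in
  \<open>B\<close> under multiplication.\<close>

lemma coset_smult:
  assumes B: "submodule_set R M B" and a: "a \<in> carrier R" and x: "x \<in> carrier M"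
  shows "(\<Union>x'\<in>B +>\<^bsub>M\<^esub> x. B +>\<^bsub>M\<^esub> (a \<odot>\<^bsub>M\<^esub> x')) = B +>\<^bsub>M\<^esub> (a \<odot>\<^bsub>M\<^esub> x)"
proof -
  interpret B: abelian_subgroup B M by (rule submodule_set_abelian_subgroup[OF B])
  have "B +>\<^bsub>M\<^esub> (a \<odot>\<^bsub>M\<^esub> x') = B +>\<^bsub>M\<^esub> (a \<odot>\<^bsub>M\<^esub> x)" if x': "x' \<in> B +>\<^bsub>M\<^esub> x" for x'
  proof -
    have x'c: "x' \<in> carrier M"
      using x' x submodule_setD(6)[OF B] by (auto simp: a_r_coset_def')
    have "x' \<ominus>\<^bsub>M\<^esub> x \<in> B" using B.a_rcos_module_imp[OF x x'] by (simp add: a_minus_def)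
    then have "a \<odot>\<^bsub>M\<^esub> (x' \<ominus>\<^bsub>M\<^esub> x) \<in> B" by (rule submodule_setD(4)[OF B a])
    then have "a \<odot>\<^bsub>M\<^esub> x' \<ominus>\<^bsub>M\<^esub> a \<odot>\<^bsub>M\<^esub> x \<in> B" using smult_minus_distr[OF a x'c x] by simp
    then show ?thesis using coset_eq_iff[OF B] a x x'c by simp
  qed
  then show ?thesis using B.a_rcos_self[OF x] by blast
qed

lemma zero_subquotient_iff:
  assumes "submodule_set R M B" "submodule_set R M Z"
  shows "zero_module (subquotient_module M Z B) \<longleftrightarrow> Z \<subseteq> B"
proof -
  have "zero_module (subquotient_module M Z B) \<longleftrightarrow> (\<lambda>x. B +>\<^bsub>M\<^esub> x) ` Z = {B}"
    by (simp add: zero_module_def subquotient_module_def)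
  also have "\<dots> \<longleftrightarrow> (\<forall>x\<in>Z. B +>\<^bsub>M\<^esub> x = B)" using submodule_setD(2)[OF assms(2)] by auto
  also have "\<dots> \<longleftrightarrow> Z \<subseteq> B"
    using coset_eq_zero_iff[OF assms(1) submodule_setD(6)[OF assms(2)]] by auto
  finally show ?thesis .
qed

lemma annihilator_subquotient_iff:
  assumes "submodule_set R M B" "submodule_set R M Z"
  shows "a \<in> annihilator R (subquotient_module M Z B) \<longleftrightarrow> a \<in> carrier R \<and> (\<forall>x\<in>Z. a \<odot>\<^bsub>M\<^esub> x \<in> B)"
proof -
  have "(\<forall>x\<in>Z. (\<Union>x'\<in>B +>\<^bsub>M\<^esub> x. B +>\<^bsub>M\<^esub> (a \<odot>\<^bsub>M\<^esub> x')) = B) \<longleftrightarrow> (\<forall>x\<in>Z. a \<odot>\<^bsub>M\<^esub> x \<in> B)" if a: "a \<in> carrier R"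
  proof (rule ball_cong[OF refl])
    fix x assume "x \<in> Z"
    then have x: "x \<in> carrier M" using submodule_setD(6)[OF assms(2)] by simp
    show "(\<Union>x'\<in>B +>\<^bsub>M\<^esub> x. B +>\<^bsub>M\<^esub> (a \<odot>\<^bsub>M\<^esub> x')) = B \<longleftrightarrow> a \<odot>\<^bsub>M\<^esub> x \<in> B"
      unfolding coset_smult[OF assms(1) a x] by (rule coset_eq_zero_iff[OF assms(1)]) (use a x in simp)
  qed
  then show ?thesis by (auto simp: annihilator_def subquotient_module_def)
qed

text \<open>Restates finite generation of the coset module in terms of submodules between
  \<open>B\<close> and \<open>Z\<close>, so that later arguments can work with
  representatives.\<close>

lemma finitely_generated_subquotient:
  assumes B: "submodule_set R M B" and Z: "submodule_set R M Z" and "B \<subseteq> Z"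
    and fg: "finitely_generated_module R (subquotient_module M Z B)"
  obtains S where "finite S" "S \<subseteq> Z"
    "\<And>N. submodule_set R M N \<Longrightarrow> B \<subseteq> N \<Longrightarrow> N \<subseteq> Z \<Longrightarrow> S \<subseteq> N \<Longrightarrow> N = Z"
proof -
  let ?Q = "subquotient_module M Z B"
  interpret B: abelian_subgroup B M by (rule submodule_set_abelian_subgroup[OF B])
  define q where "q x = B +>\<^bsub>M\<^esub> x" for x
  have Q: "carrier ?Q = q ` Z" "\<zero>\<^bsub>?Q\<^esub> = B" "add ?Q = set_add M"
    "smult ?Q = (\<lambda>a c. \<Union>x\<in>c. B +>\<^bsub>M\<^esub> (a \<odot>\<^bsub>M\<^esub> x))"
    by (simp_all add: subquotient_module_def q_def[abs_def])
  note ZD = submodule_setD[OF Z]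
  have qadd: "q x <+>\<^bsub>M\<^esub> q y = q (x \<oplus>\<^bsub>M\<^esub> y)" if "x \<in> carrier M" "y \<in> carrier M" for x y
    unfolding q_def by (rule B.a_rcos_sum[OF that])
  have q0: "q \<zero>\<^bsub>M\<^esub> = B" unfolding q_def by (rule coset_zero[OF B])
  have ab: "abelian_group ?Q"
  proof (rule abelian_groupI)
    show "\<zero>\<^bsub>?Q\<^esub> \<in> carrier ?Q" unfolding Q using q0 ZD(2) by (metis imageI)
    show "x \<oplus>\<^bsub>?Q\<^esub> y \<in> carrier ?Q" if "x \<in> carrier ?Q" "y \<in> carrier ?Q" for x y
      using that ZD by (auto simp: Q qadd)
    show "x \<oplus>\<^bsub>?Q\<^esub> y \<oplus>\<^bsub>?Q\<^esub> z = x \<oplus>\<^bsub>?Q\<^esub> (y \<oplus>\<^bsub>?Q\<^esub> z)"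
      if "x \<in> carrier ?Q" "y \<in> carrier ?Q" "z \<in> carrier ?Q" for x y z
      using that ZD(6) by (auto simp: Q qadd M.a_assoc)
    show "x \<oplus>\<^bsub>?Q\<^esub> y = y \<oplus>\<^bsub>?Q\<^esub> x" if "x \<in> carrier ?Q" "y \<in> carrier ?Q" for x y
      using that ZD(6) by (auto simp: Q qadd M.a_comm)
    show "\<zero>\<^bsub>?Q\<^esub> \<oplus>\<^bsub>?Q\<^esub> x = x" if x: "x \<in> carrier ?Q" for x
    proof -
      obtain z where z: "z \<in> Z" "x = q z" using x by (auto simp: Q)
      have "q \<zero>\<^bsub>M\<^esub> <+>\<^bsub>M\<^esub> q z = q z" using ZD(6)[OF z(1)] by (simp add: qadd)
      then show ?thesis by (simp add: Q z(2) q0)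
    qed
    show "\<exists>y\<in>carrier ?Q. y \<oplus>\<^bsub>?Q\<^esub> x = \<zero>\<^bsub>?Q\<^esub>" if x: "x \<in> carrier ?Q" for x
    proof -
      obtain z where z: "z \<in> Z" "x = q z" using x by (auto simp: Q)
      have "q (\<ominus>\<^bsub>M\<^esub> z) <+>\<^bsub>M\<^esub> q z = B" using ZD(6)[OF z(1)] by (simp add: qadd M.l_neg q0)
      then show ?thesis using ZD(5)[OF z(1)] z(2) unfolding Q by blast
    qed
  qed
  interpret Q: abelian_group ?Q by (rule ab)
  obtain S' where S': "finite S'" "S' \<subseteq> q ` Z"
    "\<And>N. submodule N R ?Q \<Longrightarrow> S' \<subseteq> N \<Longrightarrow> N = q ` Z"
    using fg unfolding finitely_generated_module_def Q by (elim exE conjE) simp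
  obtain S where S: "S \<subseteq> Z" "finite S" "S' = q ` S"
    using finite_subset_image[OF S'(1,2)] by (elim exE conjE) simp
  show thesis
  proof (rule that[OF S(2,1)])
    fix N assume N: "submodule_set R M N" "B \<subseteq> N" "N \<subseteq> Z" "S \<subseteq> N"
    note ND = submodule_setD[OF N(1)]
    have "additive_subgroup (q ` N) ?Q"
      unfolding Q.additive_subgroup_iff
    proof (intro conjI ballI)
      show "q ` N \<subseteq> carrier ?Q" using N(3) by (auto simp: Q)
      show "\<zero>\<^bsub>?Q\<^esub> \<in> q ` N" unfolding Q using q0 ND(2) by (metis imageI)
      show "x \<oplus>\<^bsub>?Q\<^esub> y \<in> q ` N" if "x \<in> q ` N" "y \<in> q ` N" for x y
        using that ND(3,6) by (auto simp: Q qadd)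
      show "\<ominus>\<^bsub>?Q\<^esub> x \<in> q ` N" if x: "x \<in> q ` N" for x
      proof -
        obtain z where z: "z \<in> N" "x = q z" using x by blast
        have "\<ominus>\<^bsub>?Q\<^esub> x = q (\<ominus>\<^bsub>M\<^esub> z)"
        proof (rule Q.minus_equality)
          show "q (\<ominus>\<^bsub>M\<^esub> z) \<oplus>\<^bsub>?Q\<^esub> x = \<zero>\<^bsub>?Q\<^esub>"
            using ND(6)[OF z(1)] by (simp add: Q z(2) qadd M.l_neg q0)
        qed (use z ND(5) N(3) in \<open>auto simp: Q\<close>)
        then show ?thesis using ND(5)[OF z(1)] by simp
      qed
    qed
    moreover have "a \<odot>\<^bsub>?Q\<^esub> x \<in> q ` N" if a: "a \<in> carrier R" and x: "x \<in> q ` N" for a x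
    proof -
      obtain z where z: "z \<in> N" "x = q z" using x by blast
      have "a \<odot>\<^bsub>?Q\<^esub> x = q (a \<odot>\<^bsub>M\<^esub> z)"
        unfolding Q z(2) q_def by (rule coset_smult[OF B a ND(6)[OF z(1)]])
      then show ?thesis using ND(4)[OF a z(1)] by simp
    qed
    ultimately have "submodule (q ` N) R ?Q"
      by (intro submodule.intro submodule_axioms.intro additive_subgroup.a_subgroup)
    moreover have "S' \<subseteq> q ` N" using N(4) S(3) by blast
    ultimately have eq: "q ` N = q ` Z" by (rule S'(3))
    \<comment> \<open>Equal images force equality since \<open>N\<close> contains
      \<open>B\<close>.\<close>
    have "z \<in> N" if z: "z \<in> Z" for z
    proof -
      obtain n where n: "n \<in> N" "q z = q n" using eq z by blast
      have "z \<ominus>\<^bsub>M\<^esub> n \<in> B" using n(2) coset_eq_iff[OF B ZD(6)[OF z] ND(6)[OF n(1)]] by (simp add: q_def)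
      then have "(z \<ominus>\<^bsub>M\<^esub> n) \<oplus>\<^bsub>M\<^esub> n \<in> N" using N(2) n(1) ND(3) by blast
      moreover have "(z \<ominus>\<^bsub>M\<^esub> n) \<oplus>\<^bsub>M\<^esub> n = z"
        using ZD(6)[OF z] ND(6)[OF n(1)] by (simp add: a_minus_def M.a_assoc M.l_neg)
      ultimately show ?thesis by simp
    qed
    then show "N = Z" using N(3) by blast
  qed
qed

end


section \<open>Graded injective resolutions\<close>

text \<open>At negative positions \<open>nat i\<close> is 0, so the module there is
  \<open>E 0\<close>; with only its zero element as graded part, the complex is extended by
  zero.\<close>

definition int_parts where
  "int_parts E Q i n = (if i < 0 then {\<zero>\<^bsub>E (nat i)\<^esub>} else Q (nat i) n)" for i :: int and n :: int

definition int_diff where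
  "int_diff E d i x = (if i < 0 then \<zero>\<^bsub>E (nat (i + 1))\<^esub> else d (nat i) x)" for i :: int

lemma extend_by_zero:
  fixes E :: "nat \<Rightarrow> ('a, 'e, 'z) module_scheme"
  assumes "graded_scalars R P" and md: "\<And>i. module R (E i)"
    and Q: "\<And>i n. Q i n \<subseteq> carrier (E i)" "\<And>i n. \<zero>\<^bsub>E i\<^esub> \<in> Q i n"
      "\<And>i n x y. x \<in> Q i n \<Longrightarrow> y \<in> Q i n \<Longrightarrow> x \<oplus>\<^bsub>E i\<^esub> y \<in> Q i n"
      "\<And>i n x. x \<in> Q i n \<Longrightarrow> \<ominus>\<^bsub>E i\<^esub> x \<in> Q i n"
      "\<And>i n e r x. r \<in> P e \<Longrightarrow> x \<in> Q i n \<Longrightarrow> r \<odot>\<^bsub>E i\<^esub> x \<in> Q i (n + e)"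
    and d: "\<And>i n x. x \<in> Q i n \<Longrightarrow> d i x \<in> Q (Suc i) n"
      "\<And>i x y. x \<in> carrier (E i) \<Longrightarrow> y \<in> carrier (E i) \<Longrightarrow> d i (x \<oplus>\<^bsub>E i\<^esub> y) = d i x \<oplus>\<^bsub>E (Suc i)\<^esub> d i y"
      "\<And>i r x. r \<in> carrier R \<Longrightarrow> x \<in> carrier (E i) \<Longrightarrow> d i (r \<odot>\<^bsub>E i\<^esub> x) = r \<odot>\<^bsub>E (Suc i)\<^esub> d i x"
      "\<And>i x. x \<in> carrier (E i) \<Longrightarrow> d (Suc i) (d i x) = \<zero>\<^bsub>E (Suc (Suc i))\<^esub>"
    and good: "\<And>i n e r x. x \<in> Q i n \<Longrightarrow> r \<in> P e \<Longrightarrow>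
      \<exists>z\<in>Q i (n - e). (\<exists>l::nat. (r [^]\<^bsub>R\<^esub> l) \<odot>\<^bsub>E i\<^esub> (x \<ominus>\<^bsub>E i\<^esub> r \<odot>\<^bsub>E i\<^esub> z) = \<zero>\<^bsub>E i\<^esub>) \<and>
        (\<forall>s\<in>carrier R. s \<odot>\<^bsub>E i\<^esub> x = \<zero>\<^bsub>E i\<^esub> \<longrightarrow> s \<odot>\<^bsub>E i\<^esub> z = \<zero>\<^bsub>E i\<^esub>)"
  shows "graded_complex R P (\<lambda>i. E (nat i)) (int_parts E Q) (int_diff E d)"
proof -
  interpret graded_scalars R P by fact
  interpret E0: module R "E 0" by (rule md)
  have zero_d: "d i \<zero>\<^bsub>E i\<^esub> = \<zero>\<^bsub>E (Suc i)\<^esub>" for i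
  proof -
    interpret A: module R "E i" by (rule md)
    interpret B: module R "E (Suc i)" by (rule md)
    have "d i \<zero>\<^bsub>E i\<^esub> \<in> carrier (E (Suc i))" using d(1)[OF Q(2), of i 0] Q(1) by blast
    moreover have "d i (\<zero>\<^bsub>R\<^esub> \<odot>\<^bsub>E i\<^esub> \<zero>\<^bsub>E i\<^esub>) = \<zero>\<^bsub>R\<^esub> \<odot>\<^bsub>E (Suc i)\<^esub> d i \<zero>\<^bsub>E i\<^esub>" by (rule d(3)) auto
    ultimately show ?thesis by simp
  qed
  have Qc: "x \<in> carrier (E i)" if "x \<in> Q i n" for x i n using Q(1) that by blast
  have nat1: "nat (i + 1) = Suc (nat i)" if "\<not> i < 0" for i using that by (simp add: nat_add_distrib)
  have pos: "\<not> i + 1 < 0" if "\<not> i < 0" for i :: int using that by simp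
  show ?thesis
  proof (intro graded_complex.intro graded_complex_axioms.intro md graded_scalars_axioms, goal_cases)
    case (1 i n)
    interpret A: module R "E (nat i)" by (rule md)
    show ?case using Q(1) subsetD[OF Q(1) Q(2)[of 0 n]] by (auto simp: int_parts_def)
  next
    case (2 i n)
    show ?case using Q(2) by (simp add: int_parts_def)
  next
    case (3 x i n y)
    interpret A: module R "E (nat i)" by (rule md)
    show ?case using 3 Q(3) by (auto simp: int_parts_def split: if_splits)
  next
    case (4 x i n)
    interpret A: module R "E (nat i)" by (rule md)
    show ?case using 4 Q(4) by (auto simp: int_parts_def A.M.a_inv_zero E0.M.a_inv_zero split: if_splits)
  next
    case (5 r e x i n)
    interpret A: module R "E (nat i)" by (rule md)
    show ?case using 5 Q(5) P_carrier[OF 5(1)] by (auto simp: int_parts_def split: if_splits)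
  next
    case (6 x i n)
    show ?case
    proof (cases "i < 0")
      case True
      then show ?thesis using Q(2) by (simp add: int_parts_def int_diff_def)
    next
      case False
      have "x \<in> Q (nat i) n" using 6 False by (simp add: int_parts_def)
      from d(1)[OF this] show ?thesis
        unfolding int_parts_def int_diff_def using False pos[OF False] nat1[OF False] by simp
    qed
  next
    case (7 x i n y)
    interpret A: module R "E (nat (i + 1))" by (rule md)
    show ?case
    proof (cases "i < 0")
      case True
      then show ?thesis by (simp add: int_diff_def)
    next
      case False
      have "x \<in> Q (nat i) n" "y \<in> Q (nat i) n" using 7 False by (simp_all add: int_parts_def)
      from d(2)[OF Qc[OF this(1)] Qc[OF this(2)]] show ?thesis
        unfolding int_diff_def using False nat1[OF False] by simp
    qed
  next
    case (8 r e x i n)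
    interpret A: module R "E (nat (i + 1))" by (rule md)
    show ?case
    proof (cases "i < 0")
      case True
      then show ?thesis using P_carrier[OF 8(1)] by (simp add: int_diff_def)
    next
      case False
      have "x \<in> Q (nat i) n" using 8 False by (simp_all add: int_parts_def)
      from d(3)[OF P_carrier[OF 8(1)] Qc[OF this]] show ?thesis
        unfolding int_diff_def using False nat1[OF False] by simp
    qed
  next
    case (9 x i n)
    show ?case
    proof (cases "i < 0")
      case True
      show ?thesis
      proof (cases "i + 1 < 0")
        case False
        then have "i = -1" using True by simp
        then show ?thesis using zero_d[of 0] by (simp add: int_diff_def)
      qed (simp add: int_diff_def)
    next
      case False
      have "x \<in> Q (nat i) n" using 9 False by (simp_all add: int_parts_def)
      from d(4)[OF Qc[OF this]] show ?thesis
        unfolding int_diff_def using False pos[OF False] nat1[OF False] nat1[OF pos[OF False]] by simp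
    qed
  next
    case (10 x i n r e)
    interpret A: module R "E (nat i)" by (rule md)
    show ?case
    proof (cases "i < 0")
      case True
      then have "x = \<zero>\<^bsub>E (nat i)\<^esub>" using 10 by (simp add: int_parts_def)
      then have "(r [^]\<^bsub>R\<^esub> (0::nat)) \<odot>\<^bsub>E (nat i)\<^esub> (x \<ominus>\<^bsub>E (nat i)\<^esub> r \<odot>\<^bsub>E (nat i)\<^esub> \<zero>\<^bsub>E (nat i)\<^esub>) = \<zero>\<^bsub>E (nat i)\<^esub>"
        using P_carrier[OF 10(2)] by (simp add: a_minus_def A.M.a_inv_zero E0.M.a_inv_zero)
      then have "\<exists>l::nat. (r [^]\<^bsub>R\<^esub> l) \<odot>\<^bsub>E (nat i)\<^esub> (x \<ominus>\<^bsub>E (nat i)\<^esub> r \<odot>\<^bsub>E (nat i)\<^esub> \<zero>\<^bsub>E (nat i)\<^esub>) = \<zero>\<^bsub>E (nat i)\<^esub>"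
        by blast
      then show ?thesis using True P_carrier by (auto simp: int_parts_def)
    next
      case False
      then have "x \<in> Q (nat i) n" using 10 by (simp add: int_parts_def)
      from good[OF this 10(2)] show ?thesis using False P_carrier by (auto simp: int_parts_def)
    qed
  qed
qed

lemma (in graded_noetherian_module) foldl_adjoin_member:
  assumes "hom_submodule N" "\<And>m u. (m, u) \<in> set us \<Longrightarrow> u \<in> X m" "(m, u) \<in> set us"
  shows "u \<in> foldl adjoin N us m"
  using assms
proof (induction us arbitrary: N)
  case (Cons mu us)
  obtain m' u' where mu: "mu = (m', u')" by force
  have u': "u' \<in> X m'" using Cons.prems(2)[of m' u'] mu by simp
  have N': "hom_submodule (adjoin N mu)" unfolding mu by (rule hom_submodule_adjoin(1)[OF Cons.prems(1) u'])
  show ?case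
  proof (cases "(m, u) \<in> set us")
    case True
    then show ?thesis using Cons.IH[OF N'] Cons.prems(2) by simp
  next
    case False
    then have eq: "m' = m" "u' = u" using Cons.prems(3) mu by auto
    have "\<zero>\<^bsub>V\<^esub> \<oplus>\<^bsub>V\<^esub> \<one> \<odot>\<^bsub>V\<^esub> u \<in> adjoin N (m, u) m"
      by (rule adjoinI) (use hom_submoduleD(2)[OF Cons.prems(1)] P_one in auto)
    moreover have "u \<in> carrier V" using u' X_sub eq by blast
    ultimately have "u \<in> adjoin N mu m" by (simp add: mu eq)
    then show ?thesis using hom_submodule_foldl[OF N', of us] Cons.prems(2) by auto
  qed
qed simp

locale graded_resolution = noetherian_graded_ring R for R :: "'a graded_ring" (structure) +
  fixes M :: "('a, 'm) graded_module" and \<epsilon> :: "'m \<Rightarrow> 'e" and E :: "nat \<Rightarrow> ('a, 'e) graded_module"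
    and d :: "nat \<Rightarrow> 'e \<Rightarrow> 'e"
  assumes resolution: "graded_injective_resolution R M \<epsilon> E d"
    and M_fg: "finitely_generated_module R M"
begin

lemma M_graded: "is_graded_module R M"
  and E_injective: "graded_injective_module R (E i)"
  and \<epsilon>_hom: "is_graded_hom R M (E 0) \<epsilon>"
  and d_hom: "is_graded_hom R (E i) (E (Suc i)) (d i)"
  and coresolution: "exact_coresolution M \<epsilon> E d"
  using resolution by (simp_all add: graded_injective_resolution_def)

lemma E_graded: "is_graded_module R (E i)"
  using E_injective by (simp add: graded_injective_module_def)

lemmas E_module = graded_moduleD(1)[OF E_graded]
lemmas E_group = graded_moduleD(2)[OF E_graded]
lemmas E_smult = graded_moduleD(3)[OF E_graded]

lemma d_closed: "x \<in> carrier (E i) \<Longrightarrow> d i x \<in> carrier (E (Suc i))"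
  and d_add: "x \<in> carrier (E i) \<Longrightarrow> y \<in> carrier (E i) \<Longrightarrow> d i (x \<oplus>\<^bsub>E i\<^esub> y) = d i x \<oplus>\<^bsub>E (Suc i)\<^esub> d i y"
  and d_smult: "r \<in> carrier R \<Longrightarrow> x \<in> carrier (E i) \<Longrightarrow> d i (r \<odot>\<^bsub>E i\<^esub> x) = r \<odot>\<^bsub>E (Suc i)\<^esub> d i x"
  using d_hom[of i] by (auto simp: is_graded_hom_def is_module_hom_def)

lemma d_part: "x \<in> module_part (E i) n \<Longrightarrow> d i x \<in> module_part (E (Suc i)) n"
  using d_hom[of i] unfolding is_graded_hom_def by blast

lemma d_image: "d i ` carrier (E i) = {x \<in> carrier (E (Suc i)). d (Suc i) x = \<zero>\<^bsub>E (Suc (Suc i))\<^esub>}"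
  using coresolution by (simp add: exact_coresolution_def)

lemma d_d: "x \<in> carrier (E i) \<Longrightarrow> d (Suc i) (d i x) = \<zero>\<^bsub>E (Suc (Suc i))\<^esub>"
  using d_image[of i] by blast

lemma E_part_carrier: "x \<in> module_part (E i) n \<Longrightarrow> x \<in> carrier (E i)"
  using graded_group.C_carrier[OF E_group] by blast

abbreviation "ecomp i \<equiv> component (E i) (module_part (E i))"

lemmas ecomp_part = graded_group.comp_spec(1)[OF E_group]
lemmas ecomp_add = graded_group.comp_add[OF E_group]
lemmas ecomp_carrier = graded_group.comp_carrier[OF E_group]
lemmas ecomp_homogeneous = graded_group.comp_homogeneous[OF E_group]
lemmas ecomp_zero = graded_group.comp_zero[OF E_group]

lemma ecomp_d: "x \<in> carrier (E i) \<Longrightarrow> ecomp (Suc i) (d i x) n = d i (ecomp i x n)"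
  using component_map(1)[OF E_group E_group inj_on_id, of i "d i" "Suc i" x n] d_add d_part by simp

lemma ecomp_smult:
  assumes "r \<in> int_part R e" "x \<in> carrier (E i)"
  shows "ecomp i (r \<odot>\<^bsub>E i\<^esub> x) (n + e) = r \<odot>\<^bsub>E i\<^esub> ecomp i x n"
proof (rule component_map(1)[OF E_group E_group, where \<sigma> = "\<lambda>n. n + e" and g = "\<lambda>x. r \<odot>\<^bsub>E i\<^esub> x"])
  interpret A: module R "E i" by (rule E_module)
  show "r \<odot>\<^bsub>E i\<^esub> (x \<oplus>\<^bsub>E i\<^esub> y) = r \<odot>\<^bsub>E i\<^esub> x \<oplus>\<^bsub>E i\<^esub> r \<odot>\<^bsub>E i\<^esub> y" if "x \<in> carrier (E i)" "y \<in> carrier (E i)" for x y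
    using that P_carrier[OF assms(1)] by (simp add: A.smult_r_distr)
qed (use assms E_smult in \<open>auto simp: inj_def\<close>)

abbreviation "KE \<equiv> \<lambda>i. E (nat i)"
abbreviation "XE \<equiv> int_parts E (\<lambda>i. module_part (E i))"
abbreviation "dE \<equiv> int_diff E d"

lemma E_complex: "graded_complex R (int_part R) KE XE dE"
proof (rule extend_by_zero[OF graded_scalars_axioms E_module])
  fix i n
  interpret G: graded_group "E i" "module_part (E i)" by (rule E_group)
  show "module_part (E i) n \<subseteq> carrier (E i)" by (rule G.C_sub)
  show "\<zero>\<^bsub>E i\<^esub> \<in> module_part (E i) n" by (rule G.C_zero)
  show "x \<oplus>\<^bsub>E i\<^esub> y \<in> module_part (E i) n" if "x \<in> module_part (E i) n" "y \<in> module_part (E i) n" for x y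
    using that by (rule G.C_add)
  show "\<ominus>\<^bsub>E i\<^esub> x \<in> module_part (E i) n" if "x \<in> module_part (E i) n" for x
    using that by (rule G.C_neg)
  show "\<exists>z\<in>module_part (E i) (n - e). (\<exists>l::nat. (r [^] l) \<odot>\<^bsub>E i\<^esub> (x \<ominus>\<^bsub>E i\<^esub> r \<odot>\<^bsub>E i\<^esub> z) = \<zero>\<^bsub>E i\<^esub>) \<and>
        (\<forall>s\<in>carrier R. s \<odot>\<^bsub>E i\<^esub> x = \<zero>\<^bsub>E i\<^esub> \<longrightarrow> s \<odot>\<^bsub>E i\<^esub> z = \<zero>\<^bsub>E i\<^esub>)"
    if "x \<in> module_part (E i) n" "r \<in> int_part R e" for r x e
    by (rule graded_injective_good[OF is_noetherian E_injective that])
qed (use E_smult d_part d_add d_smult d_d in auto)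

text \<open>The degree \<open>n\<close> component of any preimage is again a preimage, so exactness
  holds degree by degree.\<close>

lemma homogeneous_preimage:
  assumes "x \<in> module_part (E (Suc i)) n" "d (Suc i) x = \<zero>\<^bsub>E (Suc (Suc i))\<^esub>"
  shows "x \<in> d i ` module_part (E i) n"
proof -
  obtain w where w: "w \<in> carrier (E i)" "x = d i w"
    using d_image[of i] assms E_part_carrier by blast
  have "x = ecomp (Suc i) x n" using ecomp_homogeneous[OF assms(1)] by simp
  also have "\<dots> = d i (ecomp i w n)" unfolding w(2) by (rule ecomp_d[OF w(1)])
  finally show ?thesis using ecomp_part[OF w(1)] by blast
qed

text \<open>The kernel of \<open>d 0\<close> is the image of \<open>M\<close>. The components of
  finitely many generators of \<open>M\<close>, mapped by \<open>\<epsilon>\<close>, generate it in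
  each degree: the elements of \<open>M\<close> all of whose components map into the span
  \<open>L\<close> form a submodule that contains the generators.\<close>

lemma E_finitely_generated:
  "\<exists>us. (\<forall>(m, u)\<in>set us. u \<in> module_part (E 0) m \<and> d 0 u = \<zero>\<^bsub>E 1\<^esub>) \<and>
      (\<forall>n. {u \<in> module_part (E 0) n. d 0 u = \<zero>\<^bsub>E 1\<^esub>} \<subseteq>
        foldl (adjoin_element (int_part R) (E 0)) (\<lambda>n. {\<zero>\<^bsub>E 0\<^esub>}) us n)"
proof -
  interpret M: module R M by (rule graded_moduleD(1)[OF M_graded])
  interpret Mg: graded_group M "module_part M" by (rule graded_moduleD(2)[OF M_graded])
  interpret E0: module R "E 0" by (rule E_module)
  interpret Eg: graded_group "E 0" "module_part (E 0)" by (rule E_group)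
  interpret V: graded_noetherian_module R "int_part R" degree_one_generators "E 0" "module_part (E 0)"
    by (intro graded_noetherian_module.intro graded_noetherian_module_axioms.intro
        graded_noetherian_axioms E_module Eg.C_sub Eg.C_zero Eg.C_add E_smult)
  have \<epsilon>: "\<epsilon> x \<in> carrier (E 0)" "\<epsilon> (x \<oplus>\<^bsub>M\<^esub> y) = \<epsilon> x \<oplus>\<^bsub>E 0\<^esub> \<epsilon> y" "\<epsilon> (r \<odot>\<^bsub>M\<^esub> x) = r \<odot>\<^bsub>E 0\<^esub> \<epsilon> x"
    if "x \<in> carrier M" "y \<in> carrier M" "r \<in> carrier R" for x y r
    using \<epsilon>_hom that by (auto simp: is_graded_hom_def is_module_hom_def)
  have \<epsilon>_part: "\<epsilon> x \<in> module_part (E 0) n" if "x \<in> module_part M n" for x n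
    using \<epsilon>_hom that by (auto simp: is_graded_hom_def)
  have \<epsilon>_image: "\<epsilon> ` carrier M = {x \<in> carrier (E 0). d 0 x = \<zero>\<^bsub>E 1\<^esub>}"
    using coresolution by (simp add: exact_coresolution_def)
  have \<epsilon>_comp: "ecomp 0 (\<epsilon> x) n = \<epsilon> (Mg.cmp x n)" if "x \<in> carrier M" for x n
    using component_map(1)[OF Mg.graded_group_axioms E_group inj_on_id, of \<epsilon> 0 x n] that \<epsilon>(2)[OF _ _ zero_closed] \<epsilon>_part
    by simp
  have \<epsilon>0: "\<epsilon> \<zero>\<^bsub>M\<^esub> = \<zero>\<^bsub>E 0\<^esub>"
    using \<epsilon>(3)[of "\<zero>\<^bsub>M\<^esub>" "\<zero>\<^bsub>M\<^esub>" \<zero>] \<epsilon>(1)[of "\<zero>\<^bsub>M\<^esub>" "\<zero>\<^bsub>M\<^esub>" \<zero>] by simp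
  obtain S where S: "finite S" "S \<subseteq> carrier M" "\<And>N. submodule N R M \<Longrightarrow> S \<subseteq> N \<Longrightarrow> N = carrier M"
    using M_fg unfolding finitely_generated_module_def by (elim exE conjE) simp
  define T where "T = (\<Union>s\<in>S. (\<lambda>n. (n, \<epsilon> (Mg.cmp s n))) ` {n. Mg.cmp s n \<noteq> \<zero>\<^bsub>M\<^esub>})"
  have "finite T" unfolding T_def using S(1,2) Mg.comp_spec(2) by (intro finite_UN_I finite_imageI) auto
  then obtain us where us: "set us = T" using finite_list by blast
  have usD: "u \<in> module_part (E 0) m" "d 0 u = \<zero>\<^bsub>E 1\<^esub>" if mu: "(m, u) \<in> set us" for m u
  proof -
    obtain s where s: "s \<in> S" "u = \<epsilon> (Mg.cmp s m)" using mu by (auto simp: us T_def)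
    then have "Mg.cmp s m \<in> module_part M m" using S(2) Mg.comp_spec(1) by blast
    then show "u \<in> module_part (E 0) m" "d 0 u = \<zero>\<^bsub>E 1\<^esub>"
      using \<epsilon>_part \<epsilon>_image Mg.C_carrier s(2) by blast+
  qed
  have B: "V.hom_submodule (\<lambda>n. {\<zero>\<^bsub>E 0\<^esub>})"
    unfolding V.hom_submodule_def using Eg.C_zero P_carrier by auto
  define L where "L = foldl V.adjoin (\<lambda>n. {\<zero>\<^bsub>E 0\<^esub>}) us"
  have L: "V.hom_submodule L" unfolding L_def using V.hom_submodule_foldl[OF B usD(1)] by blast
  note LD = V.hom_submoduleD[OF L]
  define N where "N = {x \<in> carrier M. \<forall>n. \<epsilon> (Mg.cmp x n) \<in> L n}"
  have N0: "\<zero>\<^bsub>M\<^esub> \<in> N" using LD(2) by (simp add: N_def Mg.comp_zero \<epsilon>0)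
  have Nadd: "x \<oplus>\<^bsub>M\<^esub> y \<in> N" if "x \<in> N" "y \<in> N" for x y
    using that LD(3) Mg.comp_carrier by (simp add: N_def Mg.comp_add \<epsilon>(2)[OF _ _ zero_closed])
  have Nsm: "r \<odot>\<^bsub>M\<^esub> x \<in> N" if x: "x \<in> N" and r: "r \<in> carrier R" for x r
    using r
  proof (induction rule: homogeneous_induct)
    case zero
    then show ?case using x N0 by (simp add: N_def)
  next
    case (homogeneous i r)
    have xc: "x \<in> carrier M" and rc: "r \<in> carrier R" using x C_carrier[OF homogeneous] by (auto simp: N_def)
    have rP: "r \<in> int_part R (int i)" using homogeneous by (simp add: int_part_nat)
    have "\<epsilon> (Mg.cmp (r \<odot>\<^bsub>M\<^esub> x) (n + int i)) \<in> L (n + int i)" for n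
    proof -
      have "Mg.cmp (r \<odot>\<^bsub>M\<^esub> x) (n + int i) = r \<odot>\<^bsub>M\<^esub> Mg.cmp x n"
        by (rule component_map(1)[OF Mg.graded_group_axioms Mg.graded_group_axioms, where \<sigma> = "\<lambda>n. n + int i" and g = "\<lambda>x. r \<odot>\<^bsub>M\<^esub> x"])
          (use xc rc graded_moduleD(3)[OF M_graded rP] in \<open>auto simp: inj_def M.smult_r_distr\<close>)
      moreover have "\<epsilon> (Mg.cmp x n) \<in> L n" using x by (simp add: N_def)
      ultimately show ?thesis
        using LD(4)[OF _ rP] \<epsilon>(3)[OF Mg.comp_carrier[OF xc] xc rc] by simp
    qed
    then have "\<epsilon> (Mg.cmp (r \<odot>\<^bsub>M\<^esub> x) n) \<in> L n" for n by (metis diff_add_cancel)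
    then show ?case using xc rc by (simp add: N_def)
  next
    case (add r s)
    have xc: "x \<in> carrier M" using x by (simp add: N_def)
    show ?case using add Nadd[OF add(3,4)] xc by (simp add: M.smult_l_distr)
  qed
  have "submodule N R M"
  proof (rule M.submoduleI)
    show "\<ominus>\<^bsub>M\<^esub> a \<in> N" if "a \<in> N" for a
      using Nsm[OF that, of "\<ominus> \<one>"] that by (simp add: N_def M.smult_l_minus)
  qed (use N0 Nadd Nsm in \<open>auto simp: N_def\<close>)
  moreover have "S \<subseteq> N"
  proof
    fix s assume s: "s \<in> S"
    have "\<epsilon> (Mg.cmp s n) \<in> L n" for n
    proof (cases "Mg.cmp s n = \<zero>\<^bsub>M\<^esub>")
      case True
      then show ?thesis using \<epsilon>0 LD(2) by simp
    next
      case False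
      then have "(n, \<epsilon> (Mg.cmp s n)) \<in> set us" using s by (auto simp: us T_def)
      then show ?thesis unfolding L_def by (intro V.foldl_adjoin_member[OF B usD(1)])
    qed
    then show "s \<in> N" using s S(2) by (auto simp: N_def)
  qed
  ultimately have NM: "N = carrier M" by (rule S(3))
  have "u \<in> L n" if u: "u \<in> module_part (E 0) n" "d 0 u = \<zero>\<^bsub>E 1\<^esub>" for u n
  proof -
    obtain x where x: "x \<in> carrier M" "u = \<epsilon> x" using \<epsilon>_image u E_part_carrier by blast
    have "u = ecomp 0 u n" using ecomp_homogeneous[OF u(1)] by simp
    then have "u = \<epsilon> (Mg.cmp x n)" using \<epsilon>_comp[OF x(1)] x(2) by simp
    then show ?thesis using x(1) NM by (auto simp: N_def)
  qed
  then show ?thesis using usD unfolding L_def by (intro exI[of _ us]) auto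
qed

lemma E_admissible: "admissible_complex R (int_part R) degree_one_generators KE XE dE"
proof (intro admissible_complex.intro graded_noetherian_complex.intro admissible_complex_axioms.intro
    graded_noetherian_axioms E_complex)
  fix j n :: int assume j: "j > 0"
  define i where "i = nat (j - 1)"
  have ji: "nat j = Suc i" "nat (j - 1) = i" "nat (j + 1) = Suc (Suc i)" using j by (auto simp: i_def)
  show "exact_at R KE XE dE {} j n"
    unfolding exact_at_def int_parts_def int_diff_def ji using j homogeneous_preimage[of _ i n]
    by (simp add: ji)
next
  have "exact_at R KE XE dE {} j n" if "j < 0" for j n
    unfolding exact_at_def int_parts_def int_diff_def using that by (auto simp: image_iff)
  then show "\<exists>N. \<forall>j<0. \<forall>n. N < \<bar>n\<bar> \<longrightarrow> exact_at R KE XE dE {} j n" by blast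
next
  have "dE (- 1) ` XE (- 1) n = {\<zero>\<^bsub>E 0\<^esub>}" for n by (simp add: int_diff_def int_parts_def)
  moreover have "XE 0 n = module_part (E 0) n" for n by (simp add: int_parts_def)
  moreover have "dE 0 = d 0" by (rule ext) (simp add: int_diff_def)
  ultimately show "\<exists>us. (\<forall>(m, u)\<in>set us. u \<in> XE 0 m \<and> dE 0 u = \<zero>\<^bsub>E (nat 1)\<^esub>) \<and>
      (\<forall>n. {u \<in> XE 0 n. dE 0 u = \<zero>\<^bsub>E (nat 1)\<^esub>} \<subseteq>
        foldl (adjoin_element (int_part R) (E (nat 0))) (\<lambda>n. dE (- 1) ` XE (- 1) n) us n)"
    using E_finitely_generated by simp
qed

end


section \<open>Local cohomology of a graded resolution\<close>

context noetherian_graded_ring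
begin

lemma irrelevant_ideal_iff: "irrelevant_ideal R = {r \<in> carrier R. cmp r 0 = \<zero>}"
proof
  show "irrelevant_ideal R \<subseteq> {r \<in> carrier R. cmp r 0 = \<zero>}"
  proof
    fix r assume "r \<in> irrelevant_ideal R"
    then obtain c F where r: "r = finsum R c F" "finite F" "F \<subseteq> {0<..}" "\<forall>n\<in>F. c n \<in> ring_part R n"
      by (auto simp: irrelevant_ideal_def)
    have "finsum R c F \<in> {r \<in> carrier R. cmp r 0 = \<zero>}"
      using r(2-4)
    proof (induction F)
      case empty
      then show ?case by (simp add: comp_zero)
    next
      case (insert a F)
      have c: "c a \<in> ring_part R a" "c a \<in> carrier R" "a \<noteq> 0" "c \<in> F \<rightarrow> carrier R"
        using insert C_carrier by auto
      have "cmp (c a) 0 = \<zero>" using comp_homogeneous[OF c(1)] c(3) by simp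
      then show ?case using insert c by (simp add: comp_add)
    qed
    then show "r \<in> {r \<in> carrier R. cmp r 0 = \<zero>}" by (simp add: r(1))
  qed
  show "{r \<in> carrier R. cmp r 0 = \<zero>} \<subseteq> irrelevant_ideal R"
  proof safe
    fix r assume r: "r \<in> carrier R" "cmp r 0 = \<zero>"
    have "{i. cmp r i \<noteq> \<zero>} \<subseteq> {0<..}" using r(2) by (auto intro: ccontr)
    then show "r \<in> irrelevant_ideal R"
      unfolding irrelevant_ideal_def using comp_spec[OF r(1)] by blast
  qed
qed

lemma irrelevant_ideal_closed:
  "\<zero> \<in> irrelevant_ideal R" "x \<in> irrelevant_ideal R \<Longrightarrow> y \<in> irrelevant_ideal R \<Longrightarrow> x \<oplus> y \<in> irrelevant_ideal R"
  by (simp_all add: irrelevant_ideal_iff comp_zero comp_add)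

lemma positive_part_irrelevant: "r \<in> ring_part R i \<Longrightarrow> i \<noteq> 0 \<Longrightarrow> r \<in> irrelevant_ideal R"
  using comp_homogeneous[of r i 0] C_carrier by (simp add: irrelevant_ideal_iff)

lemma irrelevant_ideal_ideal: "ideal (irrelevant_ideal R) R"
proof -
  have l: "r \<otimes> a \<in> irrelevant_ideal R" if a: "a \<in> irrelevant_ideal R" and r: "r \<in> carrier R" for a r
  proof (rule mult_closed_if_components[OF _ irrelevant_ideal_closed r])
    show "irrelevant_ideal R \<subseteq> carrier R" "a \<in> carrier R" using a by (auto simp: irrelevant_ideal_iff)
    fix i k
    show "cmp r i \<otimes> cmp a k \<in> irrelevant_ideal R"
    proof (cases "k = 0")
      case True
      then show ?thesis using a comp_carrier[OF r] irrelevant_ideal_closed(1) by (simp add: irrelevant_ideal_iff)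
    next
      case False
      have "a \<in> carrier R" using a by (simp add: irrelevant_ideal_iff)
      then show ?thesis
        using False comp_spec(1) r by (intro positive_part_irrelevant[OF part_mult]) auto
    qed
  qed
  have "\<ominus> x \<in> irrelevant_ideal R" if "x \<in> irrelevant_ideal R" for x
    using that by (simp add: irrelevant_ideal_iff comp_neg a_inv_zero)
  then have "additive_subgroup (irrelevant_ideal R) R"
    unfolding additive_subgroup_iff using irrelevant_ideal_closed by (auto simp: irrelevant_ideal_iff)
  then show ?thesis
    using l by (intro idealI ring_axioms additive_subgroup.a_subgroup) (auto simp: m_comm irrelevant_ideal_iff)
qed

lemma irrelevant_ideal_minimal:
  assumes J: "ideal J R" and G: "degree_one_generators \<subseteq> J"
  shows "irrelevant_ideal R \<subseteq> J"
proof
  interpret J: ideal J R by fact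
  have part: "r \<in> J" if r: "r \<in> ring_part R (Suc e)" for r e
    by (rule generators_span[OF r]) (use G C_carrier J.I_r_closed in auto)
  fix r assume r: "r \<in> irrelevant_ideal R"
  have "cmp r i \<in> J" for i
  proof (cases i)
    case 0
    then show ?thesis using r by (simp add: irrelevant_ideal_iff)
  next
    case (Suc k)
    then show ?thesis using part comp_spec(1)[of r i] r by (simp add: irrelevant_ideal_iff)
  qed
  moreover have "r \<in> carrier R" using r by (simp add: irrelevant_ideal_iff)
  ultimately show "r \<in> J" by (intro comp_induct_closed[of r J] J.zero_closed J.a_closed)
qed

definition homogeneously_generated :: "'a set \<Rightarrow> 'a set \<Rightarrow> bool" where
  "homogeneously_generated I W \<longleftrightarrow> ideal I R \<and> finite W \<and> W \<subseteq> I \<and> W \<subseteq> (\<Union>e. int_part R e) \<and>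
     (\<forall>J. ideal J R \<longrightarrow> W \<subseteq> J \<longrightarrow> I \<subseteq> J)"

lemma irrelevant_ideal_generated: "homogeneously_generated (irrelevant_ideal R) degree_one_generators"
  unfolding homogeneously_generated_def
  using irrelevant_ideal_ideal irrelevant_ideal_minimal degree_one_generators(1,2) G_sub positive_part_irrelevant
  by auto

text \<open>\<open>Y\<close> generates \<open>a0\<close> over the degree zero ring. To see that it
  generates the extension of \<open>a0\<close> as well, an ideal \<open>J\<close> of
  \<open>R\<close> is intersected with R_0, which gives an ideal of the degree zero ring.\<close>

lemma sum_ideal_generated:
  assumes R0: "noetherian_ring (degree_zero_ring R)" and a0: "ideal a0 (degree_zero_ring R)"
  obtains Y where "finite Y" "Y \<subseteq> ring_part R 0" "Y \<subseteq> a0"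
    "\<And>J. ideal J (degree_zero_ring R) \<Longrightarrow> Y \<subseteq> J \<Longrightarrow> a0 \<subseteq> J"
    "homogeneously_generated ((Idl\<^bsub>R\<^esub> a0) <+>\<^bsub>R\<^esub> irrelevant_ideal R) (degree_one_generators \<union> Y)"
proof -
  let ?R0 = "degree_zero_ring R"
  have R0c: "carrier ?R0 = ring_part R 0" "add ?R0 = add R" "monoid.mult ?R0 = monoid.mult R"
    "\<zero>\<^bsub>?R0\<^esub> = \<zero>" by (simp_all add: degree_zero_ring_def)
  interpret N: noetherian_ring ?R0 by fact
  obtain Y where Y: "Y \<subseteq> carrier ?R0" "finite Y" "a0 = Idl\<^bsub>?R0\<^esub> Y"
    using N.finetely_gen[OF a0] by (elim exE conjE) simp
  have YP: "Y \<subseteq> ring_part R 0" using Y(1) R0c by simp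
  have Ya0: "Y \<subseteq> a0" unfolding Y(3) by (rule N.genideal_self[OF Y(1)])
  have min0: "a0 \<subseteq> J" if "ideal J ?R0" "Y \<subseteq> J" for J
    unfolding Y(3) by (rule N.genideal_minimal[OF that])
  have a0c: "a0 \<subseteq> carrier R"
  proof
    fix x assume "x \<in> a0"
    then have "x \<in> ring_part R 0" using ideal.Icarr[OF a0] R0c(1) by simp
    then show "x \<in> carrier R" by (rule C_carrier)
  qed
  have Ia0: "ideal (Idl\<^bsub>R\<^esub> a0) R" by (rule genideal_ideal[OF a0c])
  have Iplus: "ideal (irrelevant_ideal R) R" by (rule irrelevant_ideal_ideal)
  have ideal_sum: "ideal ((Idl\<^bsub>R\<^esub> a0) <+>\<^bsub>R\<^esub> irrelevant_ideal R) R" by (rule add_ideals[OF Ia0 Iplus])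
  have sub: "Idl\<^bsub>R\<^esub> a0 \<subseteq> (Idl\<^bsub>R\<^esub> a0) <+>\<^bsub>R\<^esub> irrelevant_ideal R"
    "irrelevant_ideal R \<subseteq> (Idl\<^bsub>R\<^esub> a0) <+>\<^bsub>R\<^esub> irrelevant_ideal R"
  proof -
    have z: "\<zero> \<in> Idl\<^bsub>R\<^esub> a0" using Ia0 additive_subgroup.zero_closed ideal.axioms(1) by blast
    show "Idl\<^bsub>R\<^esub> a0 \<subseteq> (Idl\<^bsub>R\<^esub> a0) <+>\<^bsub>R\<^esub> irrelevant_ideal R"
    proof
      fix x assume x: "x \<in> Idl\<^bsub>R\<^esub> a0"
      then have "x = x \<oplus> \<zero>" using ideal.Icarr[OF Ia0] by simp
      then show "x \<in> (Idl\<^bsub>R\<^esub> a0) <+>\<^bsub>R\<^esub> irrelevant_ideal R"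
        unfolding set_add_def' using x irrelevant_ideal_closed(1) by blast
    qed
    show "irrelevant_ideal R \<subseteq> (Idl\<^bsub>R\<^esub> a0) <+>\<^bsub>R\<^esub> irrelevant_ideal R"
    proof
      fix x assume x: "x \<in> irrelevant_ideal R"
      then have "x = \<zero> \<oplus> x" using ideal.Icarr[OF Iplus] by simp
      then show "x \<in> (Idl\<^bsub>R\<^esub> a0) <+>\<^bsub>R\<^esub> irrelevant_ideal R"
        unfolding set_add_def' using x z by blast
    qed
  qed
  have min: "(Idl\<^bsub>R\<^esub> a0) <+>\<^bsub>R\<^esub> irrelevant_ideal R \<subseteq> J"
    if J: "ideal J R" and W: "degree_one_generators \<union> Y \<subseteq> J" for J
  proof -
    interpret J: ideal J R by fact
    have neg: "\<ominus>\<^bsub>?R0\<^esub> x = \<ominus> x" if "x \<in> ring_part R 0" for x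
      by (rule N.minus_equality) (use that C_neg C_carrier in \<open>auto simp: R0c l_neg\<close>)
    have "additive_subgroup (J \<inter> ring_part R 0) ?R0"
      unfolding N.additive_subgroup_iff using C_zero C_add C_neg neg by (auto simp: R0c)
    moreover have "x \<otimes> a \<in> J \<inter> ring_part R 0 \<and> a \<otimes> x \<in> J \<inter> ring_part R 0"
      if "a \<in> J \<inter> ring_part R 0" "x \<in> ring_part R 0" for a x
      using that part_mult[of x 0 a 0] part_mult[of a 0 x 0] C_carrier J.I_l_closed J.I_r_closed by auto
    ultimately have "ideal (J \<inter> ring_part R 0) ?R0"
      by (intro idealI N.ring_axioms additive_subgroup.a_subgroup) (auto simp: R0c)
    then have "a0 \<subseteq> J \<inter> ring_part R 0" by (rule min0) (use W YP in auto)
    then have "Idl\<^bsub>R\<^esub> a0 \<subseteq> J" by (intro genideal_minimal[OF J]) simp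
    moreover have "irrelevant_ideal R \<subseteq> J" by (rule irrelevant_ideal_minimal[OF J]) (use W in simp)
    ultimately show ?thesis unfolding set_add_def' by blast
  qed
  have "Y \<subseteq> (Idl\<^bsub>R\<^esub> a0) <+>\<^bsub>R\<^esub> irrelevant_ideal R" using Ya0 genideal_self[OF a0c] sub(1) by blast
  moreover have "degree_one_generators \<subseteq> (Idl\<^bsub>R\<^esub> a0) <+>\<^bsub>R\<^esub> irrelevant_ideal R"
    using irrelevant_ideal_generated sub(2) unfolding homogeneously_generated_def by blast
  moreover have "Y \<subseteq> int_part R 0" using YP int_part_nat[of 0] by simp
  ultimately have "homogeneously_generated ((Idl\<^bsub>R\<^esub> a0) <+>\<^bsub>R\<^esub> irrelevant_ideal R) (degree_one_generators \<union> Y)"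
    unfolding homogeneously_generated_def using ideal_sum min Y(2) degree_one_generators(1) G_sub by blast
  from that[OF Y(2) YP Ya0 min0 this] show thesis .
qed

end

context graded_resolution
begin

lemma exact_negative: "j < 0 \<Longrightarrow> exact_at R KE XE dE S j n"
proof -
  assume j: "j < 0"
  interpret graded_complex R "int_part R" KE XE dE by (rule E_complex)
  interpret E0: module R "E 0" by (rule E_module)
  have "\<zero>\<^bsub>E 0\<^esub> \<in> tors R (E 0) S {\<zero>\<^bsub>E 0\<^esub>}" if "u \<in> tors R (E 0) S {\<zero>\<^bsub>E 0\<^esub>}" for u
    using that torsD[OF that] by simp
  then show ?thesis unfolding exact_at_def int_parts_def int_diff_def
    using j by (auto simp: image_iff dest: torsD)
qed

section \<open>Torsion cocycles and coboundaries of a graded resolution\<close>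

context
  fixes I W
  assumes IW: "homogeneously_generated I W"
begin

lemma W_hom: "W \<subseteq> (\<Union>e. int_part R e)" and W_carrier: "W \<subseteq> carrier R"
  using IW P_carrier unfolding homogeneously_generated_def by blast+

abbreviation "TE i \<equiv> tors R (E i) W (carrier (E i))"
abbreviation "TC \<equiv> torsion_cocycles R I E d"
abbreviation "TB \<equiv> torsion_coboundaries R I E d"

lemma torsion_part_E: "torsion_part R I (E i) = TE i"
  by (rule module.torsion_part_eq_tors[OF E_module]) (use IW in \<open>auto simp: homogeneously_generated_def\<close>)

lemma TC_iff: "x \<in> TC i \<longleftrightarrow> x \<in> TE i \<and> d i x = \<zero>\<^bsub>E (Suc i)\<^esub>"
  by (simp add: torsion_cocycles_def torsion_part_E)

lemma TB_0: "TB 0 = {\<zero>\<^bsub>E 0\<^esub>}" and TB_Suc: "TB (Suc i) = d i ` TE i"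
  by (simp_all add: torsion_coboundaries_def torsion_part_E)

lemma TE_submodule: "submodule_set R (E i) (TE i)"
proof -
  interpret A: module R "E i" by (rule E_module)
  show ?thesis unfolding submodule_set_def
  proof (intro conjI ballI)
    show "TE i \<subseteq> carrier (E i)" by (auto dest: torsD)
    show "\<zero>\<^bsub>E i\<^esub> \<in> TE i" by (rule A.tors_zero[OF W_carrier]) simp
    show "x \<oplus>\<^bsub>E i\<^esub> y \<in> TE i" if "x \<in> TE i" "y \<in> TE i" for x y
      using torsD[OF that(1)] torsD[OF that(2)] by (intro A.tors_add[OF W_carrier _ that]) auto
    show "r \<odot>\<^bsub>E i\<^esub> x \<in> TE i" if "r \<in> carrier R" "x \<in> TE i" for r x
      using torsD[OF that(2)] that(1) by (intro A.tors_smult[OF W_carrier _ that(2,1)]) auto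
  qed
qed

lemma TE_homogeneous: "u \<in> tors R (E i) W (module_part (E i) n) \<longleftrightarrow> u \<in> TE i \<and> u \<in> module_part (E i) n"
  using E_part_carrier by (auto simp: tors_def)

lemma d_zero: "d i \<zero>\<^bsub>E i\<^esub> = \<zero>\<^bsub>E (Suc i)\<^esub>"
proof -
  interpret A: module R "E i" by (rule E_module)
  interpret B: module R "E (Suc i)" by (rule E_module)
  have "d i (\<zero> \<odot>\<^bsub>E i\<^esub> \<zero>\<^bsub>E i\<^esub>) = \<zero> \<odot>\<^bsub>E (Suc i)\<^esub> d i \<zero>\<^bsub>E i\<^esub>" by (rule d_smult) auto
  then show ?thesis using d_closed[of "\<zero>\<^bsub>E i\<^esub>" i] by simp
qed

lemma TE_comp:
  assumes "x \<in> TE i"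
  shows "ecomp i x n \<in> TE i"
  unfolding tors_def
proof (intro CollectI conjI ballI)
  have xc: "x \<in> carrier (E i)" using assms by (rule torsD)
  then show "ecomp i x n \<in> carrier (E i)" by (rule ecomp_carrier)
  fix w assume w: "w \<in> W"
  then obtain e where e: "w \<in> int_part R e" using W_hom by blast
  obtain k :: nat where k: "(w [^] k) \<odot>\<^bsub>E i\<^esub> x = \<zero>\<^bsub>E i\<^esub>" using assms w by (rule torsE)
  have "(w [^] k) \<odot>\<^bsub>E i\<^esub> ecomp i x n = ecomp i ((w [^] k) \<odot>\<^bsub>E i\<^esub> x) (n + int k * e)"
    using ecomp_smult[OF P_pow[OF e] xc] by simp
  then show "\<exists>k::nat. (w [^] k) \<odot>\<^bsub>E i\<^esub> ecomp i x n = \<zero>\<^bsub>E i\<^esub>" using k ecomp_zero by metis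
qed

lemma d_TE:
  assumes "x \<in> TE i"
  shows "d i x \<in> TE (Suc i)"
  unfolding tors_def
proof (intro CollectI conjI ballI)
  have xc: "x \<in> carrier (E i)" using assms by (rule torsD)
  then show "d i x \<in> carrier (E (Suc i))" by (rule d_closed)
  fix w assume w: "w \<in> W"
  then have wc: "w \<in> carrier R" using W_carrier by blast
  obtain k :: nat where k: "(w [^] k) \<odot>\<^bsub>E i\<^esub> x = \<zero>\<^bsub>E i\<^esub>" using assms w by (rule torsE)
  have "(w [^] k) \<odot>\<^bsub>E (Suc i)\<^esub> d i x = \<zero>\<^bsub>E (Suc i)\<^esub>"
    using d_smult[of "w [^] k" x i] wc xc k d_zero by simp
  then show "\<exists>k::nat. (w [^] k) \<odot>\<^bsub>E (Suc i)\<^esub> d i x = \<zero>\<^bsub>E (Suc i)\<^esub>" by blast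
qed

lemma TC_submodule: "submodule_set R (E i) (TC i)"
proof -
  interpret A: module R "E i" by (rule E_module)
  interpret B: module R "E (Suc i)" by (rule E_module)
  note T = A.submodule_setD[OF TE_submodule]
  show ?thesis unfolding submodule_set_def
  proof (intro conjI ballI)
    show "TC i \<subseteq> carrier (E i)" using T(1) TC_iff by blast
    show "\<zero>\<^bsub>E i\<^esub> \<in> TC i" using T(2) d_zero by (simp add: TC_iff)
    show "x \<oplus>\<^bsub>E i\<^esub> y \<in> TC i" if "x \<in> TC i" "y \<in> TC i" for x y
      using that T(3,6) d_add by (simp add: TC_iff)
    show "r \<odot>\<^bsub>E i\<^esub> x \<in> TC i" if "r \<in> carrier R" "x \<in> TC i" for r x
      using that T(4,6) d_smult by (simp add: TC_iff)
  qed
qed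

lemma TB_submodule: "submodule_set R (E i) (TB i)"
proof (cases i)
  case 0
  interpret A: module R "E 0" by (rule E_module)
  show ?thesis unfolding 0 submodule_set_def TB_0 by simp
next
  case (Suc j)
  interpret A: module R "E j" by (rule E_module)
  interpret B: module R "E (Suc j)" by (rule E_module)
  note T = A.submodule_setD[OF TE_submodule]
  show ?thesis unfolding Suc submodule_set_def TB_Suc
  proof (intro conjI ballI)
    show "d j ` TE j \<subseteq> carrier (E (Suc j))" using T(6) d_closed by blast
    show "\<zero>\<^bsub>E (Suc j)\<^esub> \<in> d j ` TE j" using T(2) d_zero by (metis imageI)
    show "x \<oplus>\<^bsub>E (Suc j)\<^esub> y \<in> d j ` TE j" if xy: "x \<in> d j ` TE j" "y \<in> d j ` TE j" for x y
    proof -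
      obtain v w where "v \<in> TE j" "w \<in> TE j" "x = d j v" "y = d j w" using xy by blast
      then show ?thesis using T(3)[of v w] T(6) d_add[of v j w] by (metis imageI)
    qed
    show "r \<odot>\<^bsub>E (Suc j)\<^esub> x \<in> d j ` TE j" if r: "r \<in> carrier R" and x: "x \<in> d j ` TE j" for r x
    proof -
      obtain v where "v \<in> TE j" "x = d j v" using x by blast
      then show ?thesis using T(4)[OF r, of v] T(6) d_smult[OF r, of v j] by (metis imageI)
    qed
  qed
qed

lemma TB_TC: "TB i \<subseteq> TC i"
proof (cases i)
  case 0
  interpret A: module R "E 0" by (rule E_module)
  show ?thesis unfolding 0 TB_0 using A.submodule_setD(2)[OF TC_submodule] by simp
next
  case (Suc j)
  have "d j x \<in> TC (Suc j)" if "x \<in> TE j" for x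
    using d_TE[OF that] d_d[OF torsD[OF that]] by (simp add: TC_iff)
  then show ?thesis by (auto simp: Suc TB_Suc)
qed

lemma TC_comp: "x \<in> TC i \<Longrightarrow> ecomp i x n \<in> TC i"
  using TE_comp[of x i n] ecomp_d[of x i n] ecomp_zero[of "Suc i" n] by (auto simp: TC_iff dest: torsD)

lemma TB_comp: "x \<in> TB i \<Longrightarrow> ecomp i x n \<in> TB i"
proof (cases i)
  case (Suc j)
  assume "x \<in> TB i"
  then obtain w where w: "w \<in> TE j" "x = d j w" by (auto simp: Suc TB_Suc)
  have "ecomp (Suc j) x n = d j (ecomp j w n)" unfolding w(2) by (rule ecomp_d[OF torsD[OF w(1)]])
  then show ?thesis using TE_comp[OF w(1)] by (auto simp: Suc TB_Suc)
qed (simp add: TB_0 ecomp_zero)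

text \<open>A torsion preimage of a homogeneous element may be replaced by its component of the same
  degree, which is torsion again.\<close>

lemma homogeneous_boundary_iff:
  assumes u: "u \<in> module_part (E i) n"
  shows "u \<in> dE (int i - 1) ` tors R (KE (int i - 1)) W (XE (int i - 1) n) \<longleftrightarrow> u \<in> TB i"
proof (cases i)
  case 0
  interpret A: module R "E 0" by (rule E_module)
  have "tors R (E 0) W {\<zero>\<^bsub>E 0\<^esub>} = {\<zero>\<^bsub>E 0\<^esub>}"
    using A.tors_zero[OF W_carrier, of "{\<zero>\<^bsub>E 0\<^esub>}"] by (auto dest: torsD)
  then show ?thesis by (simp add: 0 TB_0 int_parts_def int_diff_def)
next
  case (Suc j)
  have n: "nat (int (Suc j) - 1) = j" "\<not> int (Suc j) - 1 < 0" by simp_all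
  have "u \<in> d j ` tors R (E j) W (module_part (E j) n) \<longleftrightarrow> u \<in> TB (Suc j)"
  proof
    assume "u \<in> d j ` tors R (E j) W (module_part (E j) n)"
    then show "u \<in> TB (Suc j)" by (auto simp: TB_Suc TE_homogeneous)
  next
    assume "u \<in> TB (Suc j)"
    then obtain w where w: "w \<in> TE j" "u = d j w" by (auto simp: TB_Suc)
    have "u = ecomp (Suc j) u n" using ecomp_homogeneous[OF u[unfolded Suc]] by simp
    also have "\<dots> = d j (ecomp j w n)" unfolding w(2) by (rule ecomp_d[OF torsD[OF w(1)]])
    finally show "u \<in> d j ` tors R (E j) W (module_part (E j) n)"
      using TE_comp[OF w(1)] ecomp_part[OF torsD[OF w(1)]] by (auto simp: TE_homogeneous)
  qed
  then show ?thesis unfolding Suc int_parts_def int_diff_def n using n(2) by simp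
qed

lemma XE_nat [simp]: "XE (int i) n = module_part (E i) n" and dE_nat [simp]: "dE (int i) x = d i x"
  and KE_Suc [simp]: "nat (int i + 1) = Suc i"
  by (simp_all add: int_parts_def int_diff_def nat_add_distrib)

lemma homogeneous_cocycles:
  "{u \<in> tors R (KE (int i)) W (XE (int i) n). dE (int i) u = \<zero>\<^bsub>KE (int i + 1)\<^esub>} = TC i \<inter> module_part (E i) n"
  by (auto simp: TC_iff TE_homogeneous)

lemma exact_iff: "exact_at R KE XE dE W (int i) n \<longleftrightarrow> TC i \<inter> module_part (E i) n \<subseteq> TB i"
proof -
  have "exact_at R KE XE dE W (int i) n \<longleftrightarrow> (\<forall>u\<in>TC i \<inter> module_part (E i) n.
      u \<in> dE (int i - 1) ` tors R (KE (int i - 1)) W (XE (int i - 1) n))"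
    unfolding exact_at_def homogeneous_cocycles[symmetric]
    by (simp only: Ball_def mem_Collect_eq imp_conjL)
  then show ?thesis using homogeneous_boundary_iff by auto
qed

lemma zero_local_cohomology_iff:
  "zero_module (local_cohomology R I E d i) \<longleftrightarrow> TC i \<subseteq> TB i"
  unfolding local_cohomology_def
  by (rule module.zero_subquotient_iff[OF E_module TB_submodule TC_submodule])

lemma annihilator_local_cohomology_iff:
  "a \<in> annihilator R (local_cohomology R I E d i) \<longleftrightarrow> a \<in> carrier R \<and> (\<forall>x\<in>TC i. a \<odot>\<^bsub>E i\<^esub> x \<in> TB i)"
  unfolding local_cohomology_def
  by (rule module.annihilator_subquotient_iff[OF E_module TB_submodule TC_submodule])

text \<open>The cocycles whose class has no component below degree \<open>m\<close>: a decreasing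
  filtration that R_+ raises by one, suited to scalars that are not homogeneous.\<close>

definition TC_from where
  "TC_from i m = {z \<in> TC i. \<forall>n<m. ecomp i z n \<in> TB i}"

lemma TC_from_add: "x \<in> TC_from i m \<Longrightarrow> y \<in> TC_from i m \<Longrightarrow> x \<oplus>\<^bsub>E i\<^esub> y \<in> TC_from i m"
  using module.submodule_setD(3,6)[OF E_module TC_submodule] module.submodule_setD(3)[OF E_module TB_submodule]
  by (simp add: TC_from_def ecomp_add)

lemma TC_from_zero: "\<zero>\<^bsub>E i\<^esub> \<in> TC_from i m"
  using module.submodule_setD(2)[OF E_module TC_submodule] module.submodule_setD(2)[OF E_module TB_submodule]
  by (simp add: TC_from_def ecomp_zero)

lemma TC_from_homogeneous_smult:
  assumes "x \<in> TC_from i m" "r \<in> ring_part R k"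
  shows "r \<odot>\<^bsub>E i\<^esub> x \<in> TC_from i (m + int k)"
proof -
  have x: "x \<in> TC i" "\<And>n. n < m \<Longrightarrow> ecomp i x n \<in> TB i" using assms(1) by (auto simp: TC_from_def)
  have xc: "x \<in> carrier (E i)" using module.submodule_setD(6)[OF E_module TC_submodule x(1)] .
  have rc: "r \<in> carrier R" using assms(2) by (rule C_carrier)
  have rP: "r \<in> int_part R (int k)" using assms(2) by (simp add: int_part_nat)
  have "ecomp i (r \<odot>\<^bsub>E i\<^esub> x) n \<in> TB i" if "n < m + int k" for n
  proof -
    have "ecomp i (r \<odot>\<^bsub>E i\<^esub> x) n = r \<odot>\<^bsub>E i\<^esub> ecomp i x (n - int k)"
      using ecomp_smult[OF rP xc, of "n - int k"] by simp
    then show ?thesis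
      using module.submodule_setD(4)[OF E_module TB_submodule rc x(2)[of "n - int k"]] that by simp
  qed
  then show ?thesis
    using module.submodule_setD(4)[OF E_module TC_submodule rc x(1)] by (simp add: TC_from_def)
qed

lemma TC_from_mono: "m' \<le> m \<Longrightarrow> TC_from i m \<subseteq> TC_from i m'"
  by (auto simp: TC_from_def)

lemma TC_from_smult:
  assumes x: "x \<in> TC_from i m" and r: "r \<in> carrier R"
  shows "r \<odot>\<^bsub>E i\<^esub> x \<in> TC_from i m" "r \<in> irrelevant_ideal R \<Longrightarrow> r \<odot>\<^bsub>E i\<^esub> x \<in> TC_from i (m + 1)"
proof -
  interpret A: module R "E i" by (rule E_module)
  have xc: "x \<in> carrier (E i)"
    using x A.submodule_setD(6)[OF TC_submodule] by (simp add: TC_from_def)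
  have closed: "r \<in> {r \<in> carrier R. r \<odot>\<^bsub>E i\<^esub> x \<in> TC_from i m'}"
    if "\<And>k. cmp r k \<odot>\<^bsub>E i\<^esub> x \<in> TC_from i m'" for m'
    by (rule comp_induct_closed[OF r])
      (use that r xc TC_from_zero TC_from_add comp_carrier in \<open>auto simp: A.smult_l_distr\<close>)
  have hom: "cmp r k \<odot>\<^bsub>E i\<^esub> x \<in> TC_from i (m + int k)" for k
    by (rule TC_from_homogeneous_smult[OF x comp_spec(1)[OF r]])
  then show "r \<odot>\<^bsub>E i\<^esub> x \<in> TC_from i m" using closed[of m] TC_from_mono[of m "m + int _" i] by force
  show "r \<odot>\<^bsub>E i\<^esub> x \<in> TC_from i (m + 1)" if "r \<in> irrelevant_ideal R"
  proof -
    have "cmp r k \<odot>\<^bsub>E i\<^esub> x \<in> TC_from i (m + 1)" for k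
    proof (cases k)
      case 0
      then have "cmp r k = \<zero>" using that by (simp add: irrelevant_ideal_iff)
      then show ?thesis using xc TC_from_zero by simp
    next
      case (Suc j)
      then show ?thesis using hom[of k] TC_from_mono[of "m + 1" "m + int k" i] by auto
    qed
    then show ?thesis using closed[of "m + 1"] by simp
  qed
qed

text \<open>Finitely many generators have finitely many nonzero components, hence a common lower
  bound \<open>m\<close> for their degrees; the classes without components below \<open>m\<close>
  form a submodule that contains them.\<close>

lemma finitely_generated_exact_below:
  assumes "finitely_generated_module R (local_cohomology R I E d i)"
  shows "exact_below_some R KE XE dE W (int i)"
proof -
  interpret A: module R "E i" by (rule E_module)
  obtain S where S: "finite S" "S \<subseteq> TC i"
    "\<And>N. submodule_set R (E i) N \<Longrightarrow> TB i \<subseteq> N \<Longrightarrow> N \<subseteq> TC i \<Longrightarrow> S \<subseteq> N \<Longrightarrow> N = TC i"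
    using A.finitely_generated_subquotient[OF TB_submodule TC_submodule TB_TC assms[unfolded local_cohomology_def]]
    by (metis (no_types, lifting))
  have Sc: "s \<in> carrier (E i)" if "s \<in> S" for s
    using S(2) that A.submodule_setD(6)[OF TC_submodule] by blast
  have "finite (\<Union>s\<in>S. {n. ecomp i s n \<noteq> \<zero>\<^bsub>E i\<^esub>})"
    using S(1) Sc graded_group.comp_spec(2)[OF E_group] by blast
  then have "\<exists>m. \<forall>n\<in>(\<Union>s\<in>S. {n. ecomp i s n \<noteq> \<zero>\<^bsub>E i\<^esub>}). m \<le> n"
    using Min_le by blast
  then obtain m where m: "\<And>s n. s \<in> S \<Longrightarrow> ecomp i s n \<noteq> \<zero>\<^bsub>E i\<^esub> \<Longrightarrow> m \<le> n" by blast
  have "TC_from i m = TC i"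
  proof (rule S(3))
    show "submodule_set R (E i) (TC_from i m)"
      unfolding submodule_set_def
      using TC_from_zero TC_from_add TC_from_smult(1) A.submodule_setD(6)[OF TC_submodule]
      by (auto simp: TC_from_def)
    show "TB i \<subseteq> TC_from i m" using TB_TC TB_comp by (auto simp: TC_from_def)
    show "TC_from i m \<subseteq> TC i" by (auto simp: TC_from_def)
    show "S \<subseteq> TC_from i m"
    proof
      fix s assume s: "s \<in> S"
      have "ecomp i s n = \<zero>\<^bsub>E i\<^esub>" if "n < m" for n using m[OF s, of n] that by fastforce
      then show "s \<in> TC_from i m"
        using S(2) s A.submodule_setD(2)[OF TB_submodule] by (auto simp: TC_from_def)
    qed
  qed
  then have "exact_at R KE XE dE W (int i) n" if "n \<le> m - 1" for n
    unfolding exact_iff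
  proof (intro subsetI)
    fix u assume u: "u \<in> TC i \<inter> module_part (E i) n"
    then have "u \<in> TC_from i m" using \<open>TC_from i m = TC i\<close> by simp
    then show "u \<in> TB i" using that u ecomp_homogeneous[of u i n n] by (auto simp: TC_from_def)
  qed
  then show ?thesis unfolding exact_below_some_def by blast
qed

text \<open>Membership of a power of \<open>y\<close> in the annihilator is uniform in all classes;
  for a homogeneous class the preimage is made homogeneous by passing to a component.\<close>

lemma nilpotent_if_radical:
  assumes "irrelevant_ideal R \<subseteq> radical_of R (annihilator R (local_cohomology R I E d i))"
  shows "positively_nilpotent R (int_part R) KE XE dE W (int i)"
  unfolding positively_nilpotent_def
proof (intro allI ballI impI)
  fix e :: int and y assume e: "1 \<le> e" and y: "y \<in> int_part R e"
  interpret C: graded_complex R "int_part R" KE XE dE by (rule E_complex)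
  have "y \<in> irrelevant_ideal R"
    using e y by (intro positive_part_irrelevant[of y "nat e"]) (auto simp: int_part_def)
  then obtain k :: nat where k: "y [^] k \<in> annihilator R (local_cohomology R I E d i)"
    using assms by (auto simp: radical_of_def)
  have "(y [^] k) \<odot>\<^bsub>KE (int i)\<^esub> u \<in> dE (int i - 1) ` tors R (KE (int i - 1)) W (XE (int i - 1) (n + int k * e))"
    if u: "u \<in> tors R (KE (int i)) W (XE (int i) n)" "dE (int i) u = \<zero>\<^bsub>KE (int i + 1)\<^esub>" for n u
  proof -
    have uX: "u \<in> module_part (E i) n" using torsD[OF u(1)] by (simp add: int_parts_def)
    have "u \<in> TC i" using u by (simp add: TC_iff int_parts_def int_diff_def TE_homogeneous nat_add_distrib)
    then have B: "(y [^] k) \<odot>\<^bsub>E i\<^esub> u \<in> TB i" using k by (simp add: annihilator_local_cohomology_iff)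
    define v where "v = (y [^] k) \<odot>\<^bsub>E i\<^esub> u"
    have vB: "v \<in> TB i" unfolding v_def by (rule B)
    have "v \<in> module_part (E i) (n + int k * e)" unfolding v_def by (rule E_smult[OF P_pow[OF y] uX])
    then have v: "ecomp i v (n + int k * e) = v" using ecomp_homogeneous by simp
    show ?thesis
    proof (cases i)
      case 0
      interpret A: module R "E 0" by (rule E_module)
      have "v = \<zero>\<^bsub>E 0\<^esub>" using B 0 by (simp add: v_def TB_0)
      moreover have "\<zero>\<^bsub>E 0\<^esub> \<in> tors R (E 0) W {\<zero>\<^bsub>E 0\<^esub>}" by (rule A.tors_zero[OF W_carrier]) simp
      ultimately show ?thesis using 0 by (auto simp: v_def int_parts_def int_diff_def)
    next
      case (Suc j)
      obtain w where w: "w \<in> TE j" "v = d j w" using vB unfolding Suc TB_Suc by (elim imageE) simp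
      have "v = ecomp i v (n + int k * e)" using v by (rule sym)
      also have "\<dots> = d j (ecomp j w (n + int k * e))"
        unfolding Suc w(2) by (rule ecomp_d[OF torsD[OF w(1)]])
      finally have vd: "v = d j (ecomp j w (n + int k * e))" .
      have "ecomp j w (n + int k * e) \<in> tors R (E j) W (module_part (E j) (n + int k * e))"
        using TE_comp[OF w(1)] ecomp_part[OF torsD[OF w(1)]] by (simp add: TE_homogeneous)
      then have "v \<in> d j ` tors R (E j) W (module_part (E j) (n + int k * e))" unfolding vd by (rule imageI)
      then show ?thesis unfolding v_def Suc nat_int by (simp add: int_parts_def int_diff_def)
    qed
  qed
  then show "\<exists>k::nat. \<forall>n. \<forall>u\<in>tors R (KE (int i)) W (XE (int i) n). dE (int i) u = \<zero>\<^bsub>KE (int i + 1)\<^esub> \<longrightarrow>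
       (y [^] k) \<odot>\<^bsub>KE (int i)\<^esub> u \<in> dE (int i - 1) ` tors R (KE (int i - 1)) W (XE (int i - 1) (n + int k * e))"
    by blast
qed

text \<open>Each factor from R_+ raises the filtration \<open>TC_from\<close> by one. From
  \<open>n0\<close> on, \<open>n1 - n0\<close> factors suffice to leave the range of nonzero
  components, also when \<open>r\<close> is not homogeneous.\<close>

lemma radical_if_exact:
  assumes "exact_below_some R KE XE dE W (int i)" "exact_above_some R KE XE dE W (int i)"
  shows "irrelevant_ideal R \<subseteq> radical_of R (annihilator R (local_cohomology R I E d i))"
proof
  interpret A: module R "E i" by (rule E_module)
  obtain n0 n1 where n0: "\<And>n. n \<le> n0 \<Longrightarrow> TC i \<inter> module_part (E i) n \<subseteq> TB i"
    and n1: "\<And>n. n \<ge> n1 \<Longrightarrow> TC i \<inter> module_part (E i) n \<subseteq> TB i"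
    using assms unfolding exact_below_some_def exact_above_some_def exact_iff by blast
  have comp: "ecomp i z n \<in> TC i \<inter> module_part (E i) n" if "z \<in> TC i" for z n
    using TC_comp[OF that] ecomp_part[OF A.submodule_setD(6)[OF TC_submodule that]] by simp
  fix r assume r: "r \<in> irrelevant_ideal R"
  then have rc: "r \<in> carrier R" by (simp add: irrelevant_ideal_iff)
  define k where "k = nat (n1 - n0)"
  have pow: "(r [^] l) \<odot>\<^bsub>E i\<^esub> z \<in> TC_from i (n0 + int l)" if z: "z \<in> TC i" for z and l :: nat
  proof (induction l)
    case 0
    have "ecomp i z n \<in> TB i" if "n < n0" for n
      by (rule subsetD[OF n0 comp[OF z]]) (use that in simp)
    then have "z \<in> TC_from i n0" using z by (simp add: TC_from_def)
    then show ?case using A.submodule_setD(6)[OF TC_submodule z] by simp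
  next
    case (Suc l)
    have "r \<odot>\<^bsub>E i\<^esub> ((r [^] l) \<odot>\<^bsub>E i\<^esub> z) \<in> TC_from i (n0 + int l + 1)"
      by (rule TC_from_smult(2)[OF Suc rc r])
    moreover have "r \<odot>\<^bsub>E i\<^esub> ((r [^] l) \<odot>\<^bsub>E i\<^esub> z) = (r [^] Suc l) \<odot>\<^bsub>E i\<^esub> z"
      using rc A.submodule_setD(6)[OF TC_submodule z] by (simp add: A.smult_assoc1[symmetric] m_comm)
    ultimately show ?case by (simp add: algebra_simps)
  qed
  have "(r [^] k) \<odot>\<^bsub>E i\<^esub> z \<in> TB i" if z: "z \<in> TC i" for z
  proof -
    have w: "(r [^] k) \<odot>\<^bsub>E i\<^esub> z \<in> TC_from i (n0 + int k)" by (rule pow[OF z])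
    have wC: "(r [^] k) \<odot>\<^bsub>E i\<^esub> z \<in> TC i" using w by (simp add: TC_from_def)
    have "ecomp i ((r [^] k) \<odot>\<^bsub>E i\<^esub> z) n \<in> TB i" for n
    proof (cases "n < n0 + int k")
      case True
      then show ?thesis using w by (simp add: TC_from_def)
    next
      case False
      moreover have "n1 - n0 \<le> int k" by (simp add: k_def)
      ultimately have "n \<ge> n1" by linarith
      then show ?thesis using n1 comp[OF wC] by blast
    qed
    then show ?thesis
      using graded_group.comp_induct_closed[OF E_group A.submodule_setD(6)[OF TC_submodule wC], of "TB i"]
        A.submodule_setD(2,3)[OF TB_submodule] by blast
  qed
  then have "r [^] k \<in> annihilator R (local_cohomology R I E d i)"
    using rc by (simp add: annihilator_local_cohomology_iff)
  then show "r \<in> radical_of R (annihilator R (local_cohomology R I E d i))"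
    using rc by (auto simp: radical_of_def)
qed

end

end

section \<open>Shifts of position and change of scalars\<close>

context graded_complex
begin

lemma shift:
  "graded_complex R P (\<lambda>i. K (i + s)) (\<lambda>i. X (i + s)) (\<lambda>i. d (i + s))"
proof (intro graded_complex.intro graded_complex_axioms.intro graded_scalars_axioms module_K, goal_cases)
  have eq: "i + 1 + s = i + s + 1" for i by simp
  {
    case (6 x i n)
    then show ?case unfolding eq by (rule d_closed)
  next
    case (7 x i n y)
    then show ?case unfolding eq by (rule d_add)
  next
    case (8 r e x i n)
    then show ?case unfolding eq by (rule d_smult)
  next
    case (9 x i n)
    then show ?case unfolding eq by (rule d_d)
  next
    case (10 x i n r e)
    then show ?case by (rule good)
  }
qed (simp_all add: X_sub X_zero X_add X_neg X_smult)

lemma restrict_scalars: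
  assumes "cring R'" "carrier R' \<subseteq> carrier R" "monoid.mult R' = monoid.mult R" "\<one>\<^bsub>R'\<^esub> = \<one>" "add R' = add R"
    and "\<And>e. P e \<subseteq> carrier R'"
  shows "graded_complex R' P K X d"
proof -
  interpret R': cring R' by fact
  have pow: "r [^]\<^bsub>R'\<^esub> k = r [^] k" for r and k :: nat
    using assms(3,4) by (simp add: nat_pow_def)
  have md: "module R' (K i)" for i
  proof -
    interpret A: module R "K i" by (rule module_K)
    show ?thesis
      by (rule moduleI[OF assms(1) ab_K])
        (use assms(2-5) in \<open>auto simp: subset_iff A.smult_l_distr A.smult_r_distr A.smult_assoc1\<close>)
  qed
  have "graded_scalars R' P"
    by unfold_locales (use assms P_mult P_one in auto)
  then show ?thesis
    by (intro graded_complex.intro graded_complex_axioms.intro md X_sub X_zero X_add X_neg X_smult d_closed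
        d_add d_smult d_d) (use good in \<open>simp_all add: pow\<close>)
qed

text \<open>With \<open>P 0\<close> the whole ring, the cocycles and coboundaries in a fixed degree
  are submodules, so the coset criterion for a zero quotient applies.\<close>

lemma zero_subquotient_exact_iff:
  assumes P0: "P 0 = carrier R" and S: "S \<subseteq> (\<Union>e. P e)"
  shows "zero_module (subquotient_module (K i) {u \<in> tors R (K i) S (X i n). d i u = \<zero>\<^bsub>K (i + 1)\<^esub>}
      (d (i - 1) ` tors R (K (i - 1)) S (X (i - 1) n))) \<longleftrightarrow> exact_at R K X d S i n"
proof -
  interpret A: module R "K i" by (rule module_K)
  interpret B: module R "K (i + 1)" by (rule module_K)
  have Sc: "S \<subseteq> carrier R" using S P_carrier by blast
  have sm: "r \<odot>\<^bsub>K j\<^esub> x \<in> tors R (K j) S (X j n) \<and> d j (r \<odot>\<^bsub>K j\<^esub> x) = r \<odot>\<^bsub>K (j + 1)\<^esub> d j x"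
    if "r \<in> carrier R" "x \<in> tors R (K j) S (X j n)" for r x j
    using tors_X_smult[OF Sc that(2), of r 0] d_smult[OF _ torsD[OF that(2)], of r 0] that(1) P0 by simp
  have Z: "submodule_set R (K i) {u \<in> tors R (K i) S (X i n). d i u = \<zero>\<^bsub>K (i + 1)\<^esub>}"
    unfolding submodule_set_def
  proof (intro conjI ballI)
    show "{u \<in> tors R (K i) S (X i n). d i u = \<zero>\<^bsub>K (i + 1)\<^esub>} \<subseteq> carrier (K i)"
      by (auto dest!: torsD X_carrier)
    show "\<zero>\<^bsub>K i\<^esub> \<in> {u \<in> tors R (K i) S (X i n). d i u = \<zero>\<^bsub>K (i + 1)\<^esub>}"
      using tors_X_zero[OF Sc] d_zero by simp
    show "x \<oplus>\<^bsub>K i\<^esub> y \<in> {u \<in> tors R (K i) S (X i n). d i u = \<zero>\<^bsub>K (i + 1)\<^esub>}"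
      if "x \<in> {u \<in> tors R (K i) S (X i n). d i u = \<zero>\<^bsub>K (i + 1)\<^esub>}"
        "y \<in> {u \<in> tors R (K i) S (X i n). d i u = \<zero>\<^bsub>K (i + 1)\<^esub>}" for x y
      using that tors_X_add[OF Sc] d_add[OF torsD torsD, of x R "K i" S i n y R "K i" S] by simp
    show "r \<odot>\<^bsub>K i\<^esub> x \<in> {u \<in> tors R (K i) S (X i n). d i u = \<zero>\<^bsub>K (i + 1)\<^esub>}"
      if "r \<in> carrier R" "x \<in> {u \<in> tors R (K i) S (X i n). d i u = \<zero>\<^bsub>K (i + 1)\<^esub>}" for r x
      using sm[OF that(1), of x i] that by simp
  qed
  have B: "submodule_set R (K i) (d (i - 1) ` tors R (K (i - 1)) S (X (i - 1) n))"
    unfolding submodule_set_def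
  proof (intro conjI ballI)
    show "d (i - 1) ` tors R (K (i - 1)) S (X (i - 1) n) \<subseteq> carrier (K i)"
      using d_closed[of _ "i - 1" n] X_carrier[of _ i n] by (auto dest!: torsD)
    have "d (i - 1) \<zero>\<^bsub>K (i - 1)\<^esub> = \<zero>\<^bsub>K i\<^esub>" using d_zero[of "i - 1"] by simp
    then show "\<zero>\<^bsub>K i\<^esub> \<in> d (i - 1) ` tors R (K (i - 1)) S (X (i - 1) n)"
      using tors_X_zero[OF Sc] by (metis imageI)
    show "x \<oplus>\<^bsub>K i\<^esub> y \<in> d (i - 1) ` tors R (K (i - 1)) S (X (i - 1) n)"
      if xy: "x \<in> d (i - 1) ` tors R (K (i - 1)) S (X (i - 1) n)" "y \<in> d (i - 1) ` tors R (K (i - 1)) S (X (i - 1) n)" for x y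
    proof -
      obtain v w where vw: "v \<in> tors R (K (i - 1)) S (X (i - 1) n)" "w \<in> tors R (K (i - 1)) S (X (i - 1) n)"
        "x = d (i - 1) v" "y = d (i - 1) w" using xy by blast
      have "x \<oplus>\<^bsub>K i\<^esub> y = d (i - 1) (v \<oplus>\<^bsub>K (i - 1)\<^esub> w)"
        using d_add[OF torsD[OF vw(1)] torsD[OF vw(2)]] vw(3,4) by simp
      then show ?thesis using tors_X_add[OF Sc vw(1,2)] by blast
    qed
    show "r \<odot>\<^bsub>K i\<^esub> x \<in> d (i - 1) ` tors R (K (i - 1)) S (X (i - 1) n)"
      if r: "r \<in> carrier R" and x: "x \<in> d (i - 1) ` tors R (K (i - 1)) S (X (i - 1) n)" for r x
    proof -
      obtain v where v: "v \<in> tors R (K (i - 1)) S (X (i - 1) n)" "x = d (i - 1) v" using x by blast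
      have "r \<odot>\<^bsub>K i\<^esub> x = d (i - 1) (r \<odot>\<^bsub>K (i - 1)\<^esub> v)" using sm[OF r v(1)] v(2) by simp
      then show ?thesis using sm[OF r v(1)] by blast
    qed
  qed
  show ?thesis unfolding A.zero_subquotient_iff[OF B Z] exact_at_def by (simp only: subset_iff mem_Collect_eq Ball_def imp_conjL)
qed

end

context graded_resolution
begin

text \<open>Below \<open>t\<close>, nilpotency feeds \<open>local_cohomology_tame\<close> position
  by position, so everything vanishes in small degrees. At \<open>t\<close> this fails, since
  vanishing at both ends would put R_+ into the radical of the annihilator; by tameness it can fail
  only if all components of small degree are nonzero.\<close>

lemma first_nonvanishing_stable:
  assumes I: "homogeneously_generated I (degree_one_generators \<union> Y)" and Y: "finite Y" "Y \<subseteq> int_part R 0"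
    and t: "\<not> irrelevant_ideal R \<subseteq> radical_of R (annihilator R (local_cohomology R I E d t))"
    and low: "\<And>j. j < t \<Longrightarrow> irrelevant_ideal R \<subseteq> radical_of R (annihilator R (local_cohomology R I E d j))"
  shows "\<exists>m. \<forall>n\<le>m. (\<forall>j<t. exact_at R KE XE dE (degree_one_generators \<union> Y) (int j) n) \<and>
    \<not> exact_at R KE XE dE (degree_one_generators \<union> Y) (int t) n"
proof -
  let ?W = "degree_one_generators \<union> Y"
  interpret A: admissible_complex R "int_part R" degree_one_generators KE XE dE by (rule E_admissible)
  have below: "exact_below_some R KE XE dE ?W (int j)" if "j < t" for j
    using that
  proof (induction j rule: less_induct)
    case (less j)
    have "exact_below_some R KE XE dE ?W j'" if that': "j' < int j" for j'
    proof (cases "j' < 0")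
      case True
      then show ?thesis using exact_negative by (simp add: exact_below_some_def)
    next
      case False
      then have "exact_below_some R KE XE dE ?W (int (nat j'))"
        using that' less.prems by (intro less.IH) auto
      then show ?thesis using False by simp
    qed
    moreover have "positively_nilpotent R (int_part R) KE XE dE ?W (int j)"
      by (rule nilpotent_if_radical[OF I low[OF less.prems]])
    ultimately show ?case by (rule A.local_cohomology_tame[OF Y _ disjI1])
  qed
  have "\<not> exact_below_some R KE XE dE ?W (int t)"
    using radical_if_exact[OF I _ A.local_cohomology_vanishes_above[OF Y]] t by metis
  moreover have "exact_below_some R KE XE dE ?W j'" if "j' < int t" for j'
  proof (cases "j' < 0")
    case True
    then show ?thesis using exact_negative by (simp add: exact_below_some_def)
  next
    case False
    then show ?thesis using below[of "nat j'"] that by simp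
  qed
  ultimately have "\<not> exact_cofinally R KE XE dE ?W (int t)"
    using A.local_cohomology_tame[OF Y _ disjI2, of "int t"] by metis
  then obtain m where m: "\<And>n. n \<le> m \<Longrightarrow> \<not> exact_at R KE XE dE ?W (int t) n"
    unfolding exact_cofinally_def by blast
  have "\<exists>m. \<forall>n\<le>m. \<forall>j<t'. exact_at R KE XE dE ?W (int j) n" if "t' \<le> t" for t' :: nat
    using that
  proof (induction t')
    case (Suc t')
    then obtain m1 where m1: "\<forall>n\<le>m1. \<forall>j<t'. exact_at R KE XE dE ?W (int j) n" by auto
    obtain m2 where m2: "\<forall>n\<le>m2. exact_at R KE XE dE ?W (int t') n"
      using below[of t'] Suc.prems unfolding exact_below_some_def by auto
    show ?case using m1 m2 by (intro exI[of _ "min m1 m2"]) (auto simp: less_Suc_eq)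
  qed simp
  then obtain m' where "\<forall>n\<le>m'. \<forall>j<t. exact_at R KE XE dE ?W (int j) n" by blast
  then show ?thesis using m by (intro exI[of _ "min m m'"]) auto
qed

end


section \<open>Comparison with an injective resolution\<close>

abbreviation scalars_in_degree_zero :: "('a, 'r) ring_scheme \<Rightarrow> int \<Rightarrow> 'a set" where
  "scalars_in_degree_zero R \<equiv> \<lambda>e. if e = 0 then carrier R else {}"

text \<open>\<open>C\<close> may have terms in negative positions, so it is not a resolution of its
  H^0; it merely has no other cohomology. The conditions on the image and the zeros of
  \<open>g\<close> identify that H^0 with the kernel of \<open>d' 0\<close>.\<close>

locale injective_comparison = A: graded_complex R "scalars_in_degree_zero R" K "\<lambda>i n. C i" d
  for R :: "('a, 'r) ring_scheme" (structure) and K :: "int \<Rightarrow> ('a, 'v, 'y) module_scheme" and C d +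
  fixes D :: "nat \<Rightarrow> ('a, 'w, 'z) module_scheme" and d' :: "nat \<Rightarrow> 'w \<Rightarrow> 'w" and g :: "'v \<Rightarrow> 'w"
  assumes noetherian: "noetherian_ring R"
    and D_injective: "injective_module R (D j)"
    and D_hom: "is_module_hom R (D j) (D (Suc j)) (d' j)"
    and D_exact: "d' j ` carrier (D j) = {x \<in> carrier (D (Suc j)). d' (Suc j) x = \<zero>\<^bsub>D (Suc (Suc j))\<^esub>}"
    and C_exact: "i \<noteq> 0 \<Longrightarrow> exact_at R K (\<lambda>i n. C i) d {} i n"
    and g_linear: "linear_map_on R (K 0) (D 0) {x \<in> C 0. d 0 x = \<zero>\<^bsub>K 1\<^esub>} g"
    and g_image: "g ` {x \<in> C 0. d 0 x = \<zero>\<^bsub>K 1\<^esub>} = {x \<in> carrier (D 0). d' 0 x = \<zero>\<^bsub>D 1\<^esub>}"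
    and g_zero: "x \<in> C 0 \<Longrightarrow> d 0 x = \<zero>\<^bsub>K 1\<^esub> \<Longrightarrow> g x = \<zero>\<^bsub>D 0\<^esub> \<longleftrightarrow> x \<in> d (- 1) ` C (- 1)"
begin

lemma D_module: "module R (D j)"
  using D_injective by (simp add: injective_module_def)

lemma D_closed: "x \<in> carrier (D j) \<Longrightarrow> d' j x \<in> carrier (D (Suc j))"
  and D_add: "x \<in> carrier (D j) \<Longrightarrow> y \<in> carrier (D j) \<Longrightarrow> d' j (x \<oplus>\<^bsub>D j\<^esub> y) = d' j x \<oplus>\<^bsub>D (Suc j)\<^esub> d' j y"
  and D_smult: "r \<in> carrier R \<Longrightarrow> x \<in> carrier (D j) \<Longrightarrow> d' j (r \<odot>\<^bsub>D j\<^esub> x) = r \<odot>\<^bsub>D (Suc j)\<^esub> d' j x"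
  using D_hom[of j] by (auto simp: is_module_hom_def)

lemma D_D: "x \<in> carrier (D j) \<Longrightarrow> d' (Suc j) (d' j x) = \<zero>\<^bsub>D (Suc (Suc j))\<^esub>"
  using D_exact[of j] by blast

lemma D_zero: "d' j \<zero>\<^bsub>D j\<^esub> = \<zero>\<^bsub>D (Suc j)\<^esub>"
proof -
  interpret U: module R "D j" by (rule D_module)
  interpret V: module R "D (Suc j)" by (rule D_module)
  have "d' j (\<zero> \<odot>\<^bsub>D j\<^esub> \<zero>\<^bsub>D j\<^esub>) = \<zero> \<odot>\<^bsub>D (Suc j)\<^esub> d' j \<zero>\<^bsub>D j\<^esub>" by (rule D_smult) auto
  then show ?thesis using D_closed[of "\<zero>\<^bsub>D j\<^esub>" j] by simp
qed

abbreviation "KD \<equiv> \<lambda>i. D (nat i)"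
abbreviation "XD \<equiv> int_parts D (\<lambda>i n. carrier (D i))"
abbreviation "dD \<equiv> int_diff D d'"

lemma D_complex: "graded_complex R (scalars_in_degree_zero R) KD XD dD"
proof (rule extend_by_zero[OF A.graded_scalars_axioms D_module])
  fix i and n :: int
  interpret U: module R "D i" by (rule D_module)
  show "\<zero>\<^bsub>D i\<^esub> \<in> carrier (D i)" by simp
  show "x \<oplus>\<^bsub>D i\<^esub> y \<in> carrier (D i)" if "x \<in> carrier (D i)" "y \<in> carrier (D i)" for x y using that by simp
  show "\<ominus>\<^bsub>D i\<^esub> x \<in> carrier (D i)" if "x \<in> carrier (D i)" for x using that by simp
  show "r \<odot>\<^bsub>D i\<^esub> x \<in> carrier (D i)" if "r \<in> scalars_in_degree_zero R e" "x \<in> carrier (D i)" for r e x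
    using that by (simp split: if_splits)
  show "\<exists>z\<in>carrier (D i). (\<exists>l::nat. (r [^] l) \<odot>\<^bsub>D i\<^esub> (x \<ominus>\<^bsub>D i\<^esub> r \<odot>\<^bsub>D i\<^esub> z) = \<zero>\<^bsub>D i\<^esub>) \<and>
        (\<forall>s\<in>carrier R. s \<odot>\<^bsub>D i\<^esub> x = \<zero>\<^bsub>D i\<^esub> \<longrightarrow> s \<odot>\<^bsub>D i\<^esub> z = \<zero>\<^bsub>D i\<^esub>)"
    if "x \<in> carrier (D i)" "r \<in> scalars_in_degree_zero R e" for x r e
    using that by (intro injective_good[OF noetherian D_injective]) (simp_all split: if_splits)
qed (use D_closed D_add D_smult D_D in auto)

sublocale D: graded_complex R "scalars_in_degree_zero R" KD XD dD
  by (rule D_complex)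

lemma scalar: "r \<in> carrier R \<Longrightarrow> r \<in> scalars_in_degree_zero R 0"
  by simp

lemma C_smult: "r \<in> carrier R \<Longrightarrow> x \<in> C i \<Longrightarrow> r \<odot>\<^bsub>K i\<^esub> x \<in> C i"
  by (rule A.X_smult[OF scalar])

lemma C_d_smult: "r \<in> carrier R \<Longrightarrow> x \<in> C i \<Longrightarrow> d i (r \<odot>\<^bsub>K i\<^esub> x) = r \<odot>\<^bsub>K (i + 1)\<^esub> d i x"
  by (rule A.d_smult[OF scalar])

lemma C_submodule: "submodule_set R (K i) (C i)"
  unfolding submodule_set_def using A.X_sub A.X_zero A.X_add C_smult by blast

lemma cocycles_submodule: "submodule_set R (K i) {x \<in> C i. d i x = \<zero>\<^bsub>K (i + 1)\<^esub>}"
proof -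
  interpret U: module R "K (i + 1)" by (rule A.module_K)
  show ?thesis unfolding submodule_set_def
    by (auto simp: A.X_carrier A.X_zero A.X_add C_smult A.d_zero A.d_add C_d_smult)
qed

lemma C_cocycle:
  assumes "i \<noteq> 0" "y \<in> C i" "d i y = \<zero>\<^bsub>K (i + 1)\<^esub>"
  shows "\<exists>x\<in>C (i - 1). d (i - 1) x = y"
  using C_exact[OF assms(1)] assms(2,3) by (auto simp: exact_at_def)

text \<open>The second condition is the invariant of the construction: it ensures that
  \<open>d' j\<close> after \<open>h\<close> depends only on \<open>d x\<close>, before a map in the
  next position exists.\<close>

definition lifts_at :: "nat \<Rightarrow> ('v \<Rightarrow> 'w) \<Rightarrow> bool" where
  "lifts_at j h \<longleftrightarrow> linear_map_on R (K (int j)) (D j) (C (int j)) h \<and>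
     (\<forall>x\<in>C (int j). d (int j) x = \<zero>\<^bsub>K (int j + 1)\<^esub> \<longrightarrow> d' j (h x) = \<zero>\<^bsub>D (Suc j)\<^esub>)"

text \<open>Cocycles in the next position are all of the form \<open>d x\<close>, and on them the
  map is forced to be \<open>d x \<mapsto> d' (h x)\<close>, well defined by the invariant.
  Injectivity of \<open>D (Suc j)\<close> extends it to all of \<open>C\<close>.\<close>

lemma lift_step:
  assumes h: "lifts_at j h"
  shows "\<exists>h'. lifts_at (Suc j) h' \<and> (\<forall>x\<in>C (int j). h' (d (int j) x) = d' j (h x))"
proof -
  let ?i = "int j"
  let ?Z = "{y \<in> C (?i + 1). d (?i + 1) y = \<zero>\<^bsub>K (?i + 1 + 1)\<^esub>}"
  interpret U: module R "K ?i" by (rule A.module_K)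
  interpret U': module R "K (?i + 1)" by (rule A.module_K)
  interpret V: module R "D j" by (rule D_module)
  interpret V': module R "D (Suc j)" by (rule D_module)
  have hc: "h x \<in> carrier (D j)" if "x \<in> C ?i" for x
    using h that by (auto simp: lifts_at_def linear_map_on_def)
  have hadd: "h (x \<oplus>\<^bsub>K ?i\<^esub> y) = h x \<oplus>\<^bsub>D j\<^esub> h y" if "x \<in> C ?i" "y \<in> C ?i" for x y
    using h that by (auto simp: lifts_at_def linear_map_on_def)
  have hsmult: "h (r \<odot>\<^bsub>K ?i\<^esub> x) = r \<odot>\<^bsub>D j\<^esub> h x" if "r \<in> carrier R" "x \<in> C ?i" for r x
    using h that by (auto simp: lifts_at_def linear_map_on_def)
  have dhc: "d' j (h x) \<in> carrier (D (Suc j))" if "x \<in> C ?i" for x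
    by (rule D_closed[OF hc[OF that]])
  define lift where "lift y = (SOME x. x \<in> C ?i \<and> d ?i x = y)" for y
  have lift: "lift y \<in> C ?i" "d ?i (lift y) = y" if "y \<in> ?Z" for y
  proof -
    have "\<exists>x. x \<in> C ?i \<and> d ?i x = y" using C_cocycle[of "?i + 1" y] that by auto
    then show "lift y \<in> C ?i" "d ?i (lift y) = y" unfolding lift_def by (metis (mono_tags, lifting) someI)+
  qed
  have dZ: "d ?i x \<in> ?Z" if "x \<in> C ?i" for x using A.d_closed[OF that] A.d_d[OF that] by simp
  have welldef: "d' j (h (lift (d ?i x))) = d' j (h x)" if x: "x \<in> C ?i" for x
  proof -
    let ?x' = "lift (d ?i x)"
    have x': "?x' \<in> C ?i" "d ?i ?x' = d ?i x" using lift[OF dZ[OF x]] by auto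
    \<comment> \<open>The difference of two preimages, written with the scalar -1 so that linearity
      of \<open>h\<close> applies.\<close>
    let ?w = "?x' \<oplus>\<^bsub>K ?i\<^esub> (\<ominus> \<one>) \<odot>\<^bsub>K ?i\<^esub> x"
    have m: "(\<ominus> \<one>) \<odot>\<^bsub>K ?i\<^esub> x \<in> C ?i" using C_smult x by simp
    have "d ?i ?w = d ?i x \<oplus>\<^bsub>K (?i + 1)\<^esub> (\<ominus> \<one>) \<odot>\<^bsub>K (?i + 1)\<^esub> d ?i x"
      using A.d_add[OF x'(1) m] C_d_smult x x'(2) by simp
    also have "\<dots> = \<zero>\<^bsub>K (?i + 1)\<^esub>"
      using A.X_carrier[OF A.d_closed[OF x]] by (simp add: U'.smult_l_minus U'.M.r_neg)
    finally have "d' j (h ?w) = \<zero>\<^bsub>D (Suc j)\<^esub>"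
      using h A.X_add[OF x'(1) m] by (simp add: lifts_at_def)
    moreover have "h ?w = h ?x' \<oplus>\<^bsub>D j\<^esub> (\<ominus> \<one>) \<odot>\<^bsub>D j\<^esub> h x"
      using hadd[OF x'(1) m] hsmult[of "\<ominus> \<one>" x] x by simp
    ultimately have "d' j (h ?x') \<oplus>\<^bsub>D (Suc j)\<^esub> (\<ominus> \<one>) \<odot>\<^bsub>D (Suc j)\<^esub> d' j (h x) = \<zero>\<^bsub>D (Suc j)\<^esub>"
      using hc x' x D_add D_smult by simp
    then have "d' j (h ?x') \<ominus>\<^bsub>D (Suc j)\<^esub> d' j (h x) = \<zero>\<^bsub>D (Suc j)\<^esub>"
      using dhc[OF x] by (simp add: V'.smult_l_minus a_minus_def)
    then show ?thesis using V'.minus_eq_zero_imp_eq dhc x x'(1) by blast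
  qed
  define h0 where "h0 y = d' j (h (lift y))" for y
  have h0: "h0 (d ?i x) = d' j (h x)" if "x \<in> C ?i" for x using welldef[OF that] by (simp add: h0_def)
  have lin: "linear_map_on R (K (?i + 1)) (D (Suc j)) ?Z h0"
    unfolding linear_map_on_def
  proof (intro conjI ballI)
    show "h0 x \<in> carrier (D (Suc j))" if "x \<in> ?Z" for x using dhc lift(1)[OF that] by (simp add: h0_def)
    show "h0 (x \<oplus>\<^bsub>K (?i + 1)\<^esub> y) = h0 x \<oplus>\<^bsub>D (Suc j)\<^esub> h0 y" if xy: "x \<in> ?Z" "y \<in> ?Z" for x y
    proof -
      note l = lift[OF xy(1)] lift[OF xy(2)]
      have "x \<oplus>\<^bsub>K (?i + 1)\<^esub> y = d ?i (lift x \<oplus>\<^bsub>K ?i\<^esub> lift y)" using A.d_add l by simp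
      then have "h0 (x \<oplus>\<^bsub>K (?i + 1)\<^esub> y) = d' j (h (lift x \<oplus>\<^bsub>K ?i\<^esub> lift y))"
        using h0 A.X_add l by simp
      also have "\<dots> = d' j (h (lift x)) \<oplus>\<^bsub>D (Suc j)\<^esub> d' j (h (lift y))"
        using hadd[OF l(1,3)] hc l(1,3) D_add by simp
      finally show ?thesis by (simp add: h0_def)
    qed
    show "h0 (r \<odot>\<^bsub>K (?i + 1)\<^esub> x) = r \<odot>\<^bsub>D (Suc j)\<^esub> h0 x" if r: "r \<in> carrier R" and x: "x \<in> ?Z" for r x
    proof -
      note l = lift[OF x]
      have "r \<odot>\<^bsub>K (?i + 1)\<^esub> x = d ?i (r \<odot>\<^bsub>K ?i\<^esub> lift x)" using C_d_smult[OF r l(1)] l(2) by simp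
      then have "h0 (r \<odot>\<^bsub>K (?i + 1)\<^esub> x) = d' j (h (r \<odot>\<^bsub>K ?i\<^esub> lift x))" using h0[OF C_smult[OF r l(1)]] by simp
      also have "\<dots> = r \<odot>\<^bsub>D (Suc j)\<^esub> d' j (h (lift x))" using hsmult[OF r l(1)] hc l(1) D_smult r by simp
      finally show ?thesis by (simp add: h0_def)
    qed
  qed
  obtain h' where h': "linear_map_on R (K (?i + 1)) (D (Suc j)) (C (?i + 1)) h'" "\<And>x. x \<in> ?Z \<Longrightarrow> h' x = h0 x"
    using injective_extend_submodule[OF A.module_K D_injective cocycles_submodule C_submodule _ lin] by blast
  have eq: "int (Suc j) = ?i + 1" by simp
  have dh': "h' (d ?i x) = d' j (h x)" if "x \<in> C ?i" for x using h'(2)[OF dZ[OF that]] h0[OF that] by simp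
  have "d' (Suc j) (h' y) = \<zero>\<^bsub>D (Suc (Suc j))\<^esub>" if y: "y \<in> ?Z" for y
  proof -
    have "h' y = d' j (h (lift y))" using dh' lift[OF y] by metis
    then show ?thesis using D_D hc lift(1)[OF y] by simp
  qed
  then have "lifts_at (Suc j) h'" unfolding lifts_at_def eq using h'(1) by simp
  then show ?thesis using dh' by blast
qed

lemma lift_exists:
  obtains \<psi> where "\<And>j. lifts_at j (\<psi> j)" "\<And>j x. x \<in> C (int j) \<Longrightarrow> \<psi> (Suc j) (d (int j) x) = d' j (\<psi> j x)"
    "\<And>x. x \<in> C 0 \<Longrightarrow> d 0 x = \<zero>\<^bsub>K 1\<^esub> \<Longrightarrow> \<psi> 0 x = g x"
proof -
  have "\<exists>h. linear_map_on R (K 0) (D 0) (C 0) h \<and> (\<forall>x\<in>{x \<in> C 0. d 0 x = \<zero>\<^bsub>K 1\<^esub>}. h x = g x)"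
    by (rule injective_extend_submodule[OF A.module_K D_injective _ C_submodule _ g_linear])
      (use cocycles_submodule[of 0] in auto)
  then obtain h where h: "linear_map_on R (K 0) (D 0) (C 0) h" "\<And>x. x \<in> C 0 \<Longrightarrow> d 0 x = \<zero>\<^bsub>K 1\<^esub> \<Longrightarrow> h x = g x"
    by blast
  have "d' 0 (h x) = \<zero>\<^bsub>D 1\<^esub>" if "x \<in> C 0" "d 0 x = \<zero>\<^bsub>K 1\<^esub>" for x
    using g_image h(2)[OF that] that by blast
  then have h0: "lifts_at 0 h" using h(1) by (simp add: lifts_at_def)
  \<comment> \<open>The clause for \<open>j = 0\<close> keeps the chosen start through the dependent
    choice.\<close>
  have "\<exists>\<psi>. \<forall>j. (lifts_at j (\<psi> j) \<and> (j = 0 \<longrightarrow> \<psi> j = h)) \<and> (\<forall>x\<in>C (int j). \<psi> (Suc j) (d (int j) x) = d' j (\<psi> j x))"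
  proof (rule dependent_nat_choice)
    show "\<exists>x. lifts_at 0 x \<and> (0 = 0 \<longrightarrow> x = h)" using h0 by simp
    show "\<exists>y. (lifts_at (Suc j) y \<and> (Suc j = 0 \<longrightarrow> y = h)) \<and> (\<forall>xa\<in>C (int j). y (d (int j) xa) = d' j (x xa))"
      if "lifts_at j x \<and> (j = 0 \<longrightarrow> x = h)" for x j using lift_step[of j x] that by auto
  qed
  then obtain \<psi> where "\<And>j. lifts_at j (\<psi> j)" "\<psi> 0 = h"
    "\<And>j x. x \<in> C (int j) \<Longrightarrow> \<psi> (Suc j) (d (int j) x) = d' j (\<psi> j x)" by blast
  then show thesis using h(2) by (intro that[of \<psi>]) auto
qed

lemma D_int_exact: "i \<noteq> 0 \<Longrightarrow> exact_at R KD XD dD {} i n"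
proof (cases "i < 0")
  case True
  then show ?thesis by (auto simp: exact_at_def int_parts_def int_diff_def)
next
  case False
  assume "i \<noteq> 0"
  then obtain j where j: "i = int (Suc j)" using False by (metis not0_implies_Suc nonneg_int_cases not_less of_nat_0)
  have n: "nat (int (Suc j) - 1) = j" "nat (int (Suc j) + 1) = Suc (Suc j)" by (simp_all add: nat_add_distrib)
  show ?thesis unfolding exact_at_def j using D_exact[of j] n
    by (auto simp: int_parts_def int_diff_def simp del: of_nat_Suc)
qed

text \<open>The cone of the lift is exact everywhere: away from positions 0 and -1 because both
  complexes are, in position 0 because \<open>g\<close> is onto the kernel, and in position -1
  because \<open>g\<close> vanishes only on boundaries. As the cone satisfies \<open>good\<close>,
  its torsion is exact too, and the long exact sequence compares the torsion of both
  complexes.\<close>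

theorem exact_comparison:
  assumes Y: "finite Y" "Y \<subseteq> carrier R"
  shows "exact_at R K (\<lambda>i n. C i) d Y i n \<longleftrightarrow> exact_at R KD XD dD Y i n"
proof -
  obtain \<psi> where \<psi>: "\<And>j. lifts_at j (\<psi> j)"
    "\<And>j x. x \<in> C (int j) \<Longrightarrow> \<psi> (Suc j) (d (int j) x) = d' j (\<psi> j x)"
    "\<And>x. x \<in> C 0 \<Longrightarrow> d 0 x = \<zero>\<^bsub>K 1\<^esub> \<Longrightarrow> \<psi> 0 x = g x"
    using lift_exists by blast
  define \<Phi> where "\<Phi> i x = (if i < 0 then \<zero>\<^bsub>D (nat i)\<^esub> else \<psi> (nat i) x)" for i x
  have lin: "linear_map_on R (K i) (D (nat i)) (C i) (\<psi> (nat i))" if "\<not> i < 0" for i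
    using \<psi>(1)[of "nat i"] that by (simp add: lifts_at_def)
  interpret D0: module R "D 0" by (rule D_module)
  interpret mapping_cone Pair fst snd R "scalars_in_degree_zero R" K "\<lambda>i n. C i" d KD XD dD 0 \<Phi>
  proof (intro mapping_cone.intro mapping_cone_axioms.intro A.graded_complex_axioms D_complex, goal_cases)
    case 1
    show ?case by unfold_locales auto
  next
    case (2 a i n)
    then show ?case using lin[of i] by (auto simp: \<Phi>_def int_parts_def linear_map_on_def)
  next
    case (3 a i n a')
    then show ?case using lin[of i] by (auto simp: \<Phi>_def linear_map_on_def)
  next
    case (4 r e a i n)
    then show ?case using lin[of i] by (auto simp: \<Phi>_def linear_map_on_def split: if_splits)
  next
    case (5 a i n)
    consider "i < - 1" | "i = - 1" | "i \<ge> 0" by linarith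
    then show ?case
    proof cases
      \<comment> \<open>At the left end of \<open>D\<close> compatibility requires that
        \<open>\<psi> 0\<close> kills boundaries, which it does because \<open>g\<close>
        does.\<close>
      case 2
      have da: "d (- 1) a \<in> C 0" "d 0 (d (- 1) a) = \<zero>\<^bsub>K 1\<^esub>"
        using A.d_closed[of a "- 1"] A.d_d[of a "- 1"] 5 2 by auto
      then have "\<psi> 0 (d (- 1) a) = \<zero>\<^bsub>D 0\<^esub>" using g_zero[OF da] \<psi>(3)[OF da] 5 2 by auto
      then show ?thesis using 2 by (simp add: \<Phi>_def int_diff_def)
    next
      case 3
      then have "nat (i + 1) = Suc (nat i)" "int (nat i) = i" by auto
      then show ?thesis using \<psi>(2)[of a "nat i"] 5 3 by (simp add: \<Phi>_def int_diff_def)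
    qed (simp add: \<Phi>_def int_diff_def)
  qed
  interpret Co: graded_complex R "scalars_in_degree_zero R" CK CX Cd by (rule C_complex)
  have \<Phi>0: "\<Phi> 0 x = g x" if "x \<in> C 0" "d 0 x = \<zero>\<^bsub>K 1\<^esub>" for x using \<psi>(3) that by (simp add: \<Phi>_def)
  have cone0: "exact_at R CK CX Cd {} 0 n" for n
    unfolding exact_at_def
  proof (intro ballI impI)
    fix u assume u: "u \<in> tors R (CK 0) {} (CX 0 n)" "Cd 0 u = \<zero>\<^bsub>CK (0 + 1)\<^esub>"
    then obtain a b where ab: "u = (a, b)" "a \<in> C (0 + 1)" "b \<in> XD 0 n" by (auto elim: CXE)
    have u': "(a, b) \<in> CX 0 n" "Cd 0 (a, b) = \<zero>\<^bsub>CK (0 + 1)\<^esub>" using u ab(1) by auto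
    obtain a' where a': "a' \<in> C 0" "a = d 0 a'"
      using C_cocycle[of 1 a] ab(2) cone_cocycle_fst[OF u'] by auto
    have bc: "b \<in> carrier (D 0)" using ab(3) by (simp add: int_parts_def)
    have fc: "\<Phi> 0 a' \<in> carrier (D 0)" using map_closed[OF a'(1), of 0] by (simp add: int_parts_def)
    have "d' 0 (b \<oplus>\<^bsub>D 0\<^esub> \<Phi> 0 a') = \<zero>\<^bsub>D 1\<^esub>"
      using cone_cocycle(2)[of "{}" a b 0 n a'] u' a' by (simp add: int_diff_def)
    then have "b \<oplus>\<^bsub>D 0\<^esub> \<Phi> 0 a' \<in> g ` {x \<in> C 0. d 0 x = \<zero>\<^bsub>K 1\<^esub>}"
      unfolding g_image using bc fc by simp
    \<comment> \<open>\<open>D\<close> has no nonzero coboundary in position 0, so the correction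
      has to vanish exactly: replacing \<open>a'\<close> by \<open>a' - z\<close> achieves this
      without changing \<open>d a'\<close>.\<close>
    then obtain z where z: "z \<in> C 0" "d 0 z = \<zero>\<^bsub>K 1\<^esub>" "g z = b \<oplus>\<^bsub>D 0\<^esub> \<Phi> 0 a'" by auto
    interpret K1: module R "K 1" by (rule A.module_K)
    let ?a = "a' \<ominus>\<^bsub>K 0\<^esub> z"
    have aC: "?a \<in> C 0" by (rule A.X_minus[OF a'(1) z(1)])
    have "a = d 0 ?a"
      using A.d_minus[OF a'(1) z(1)] z(2) a'(2) A.X_carrier[OF A.d_closed[OF a'(1)]]
      by (simp add: a_minus_def K1.M.a_inv_zero)
    moreover have "\<Phi> 0 ?a = \<Phi> 0 a' \<ominus>\<^bsub>D 0\<^esub> (b \<oplus>\<^bsub>D 0\<^esub> \<Phi> 0 a')"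
      using map_add[OF a'(1) A.X_neg[OF z(1)]] map_neg[OF z(1)] \<Phi>0[OF z(1,2)] z(3) by (simp add: a_minus_def)
    then have "b \<oplus>\<^bsub>D 0\<^esub> \<Phi> 0 ?a = \<zero>\<^bsub>D 0\<^esub>"
      using bc fc by (simp add: a_minus_def D0.M.a_assoc[symmetric] D0.M.r_neg)
    then have "b \<oplus>\<^bsub>D 0\<^esub> \<Phi> 0 ?a \<in> dD (0 - 1) ` tors R (KD (0 - 1)) {} (XD (0 - 1) n)"
      by (simp add: int_diff_def int_parts_def)
    ultimately show "u \<in> Cd (0 - 1) ` tors R (CK (0 - 1)) {} (CX (0 - 1) n)"
      unfolding ab(1) using bc aC by (intro cone_boundaryI[where a' = ?a]) auto
  qed
  have cone_minus: "exact_at R CK CX Cd {} (- 1) n" for n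
    unfolding exact_at_def
  proof (intro ballI impI)
    fix u assume u: "u \<in> tors R (CK (- 1)) {} (CX (- 1) n)" "Cd (- 1) u = \<zero>\<^bsub>CK (- 1 + 1)\<^esub>"
    then obtain a b where ab: "u = (a, b)" "a \<in> C (- 1 + 1)" by (auto elim: CXE)
    have u': "(a, b) \<in> CX (- 1) n" "Cd (- 1) (a, b) = \<zero>\<^bsub>CK (- 1 + 1)\<^esub>" using u ab(1) by auto
    have a: "a \<in> C 0" "d 0 a = \<zero>\<^bsub>K 1\<^esub>" using ab(2) cone_cocycle_fst[OF u'] by auto
    have fc: "\<Phi> 0 a \<in> carrier (D 0)" using map_closed[OF a(1), of 0] by (simp add: int_parts_def)
    have "g a = \<zero>\<^bsub>D 0\<^esub>"
      using u'(2) fc \<Phi>0[OF a] by (simp add: Cd_pr CK_simps int_diff_def)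
    then obtain a' where a': "a' \<in> C (- 1)" "a = d (- 1) a'" using g_zero[OF a] by auto
    show "u \<in> Cd (- 1 - 1) ` tors R (CK (- 1 - 1)) {} (CX (- 1 - 1) n)"
      unfolding ab(1) using u' a' by (intro cone_boundary[OF _ D_int_exact, where a' = a']) auto
  qed
  have cone: "exact_at R CK CX Cd {} j n" for j n
  proof (cases "j = 0 \<or> j = - 1")
    case True
    then show ?thesis using cone0 cone_minus by blast
  next
    case False
    then show ?thesis by (intro exact_cone C_exact D_int_exact) auto
  qed
  have Yh: "Y \<subseteq> (\<Union>e. scalars_in_degree_zero R e)" using Y(2) by auto
  have coneY: "exact_at R CK CX Cd Y j n" for j n
    unfolding exact_at_def
  proof (intro ballI impI)
    fix u assume u: "u \<in> tors R (CK j) Y (CX j n)" "Cd j u = \<zero>\<^bsub>CK (j + 1)\<^esub>"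
    have "u \<in> Cd (j - 1) ` CX (j - 1) n" using cone[of j n] u(2) torsD[OF u(1)] by (simp add: exact_at_def)
    from order_refl u(1) this show "u \<in> Cd (j - 1) ` tors R (CK (j - 1)) Y (CX (j - 1) n)"
    \<comment> \<open>The cone is exact in every position, so exponent 0 meets the assumption of the
      lifting lemma.\<close>
    proof (rule Co.tors_boundary_lift[where g = "\<lambda>_. 0", OF Y(1), rotated 2])
      show "s \<in> scalars_in_degree_zero R 0" if "s \<in> Y" for s using that Y by auto
      fix j' n' u' s assume *: "u' \<in> CX j' n'" "Cd j' u' = \<zero>\<^bsub>CK (j' + 1)\<^esub>"
      have "\<one> \<odot>\<^bsub>CK j'\<^esub> u' = u'" using module.smult_one[OF Co.module_K Co.X_carrier[OF *(1)]] .
      then show "\<exists>k::nat. (s [^] k) \<odot>\<^bsub>CK j'\<^esub> u' \<in> Cd (j' - 1) ` CX (j' - 1) (n' + int k * 0)"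
        using * cone[of j' n'] by (intro exI[of _ 0]) (simp add: exact_at_def)
    qed
  qed
  show ?thesis
    using exact_source[OF Yh coneY, of i n] exact_target[OF Yh coneY, of i n] by auto
qed

end


section \<open>The components of local cohomology\<close>

lemma tors_degree_zero_ring: "tors (degree_zero_ring R) M S A = tors R M S A"
  by (simp add: tors_def nat_pow_def degree_zero_ring_def)

text \<open>The local cohomology computed from \<open>D\<close> is the torsion cohomology of its
  extension by zero, to which \<open>exact_comparison\<close> applies. With all scalars in degree 0,
  the index \<open>n\<close> is a dummy.\<close>

lemma zero_local_cohomology_iff_exact:
  assumes "injective_comparison R K C d D d' g"
    and Y: "finite Y" "Y \<subseteq> a" "ideal a R" "\<And>J. ideal J R \<Longrightarrow> Y \<subseteq> J \<Longrightarrow> a \<subseteq> J"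
  shows "zero_module (local_cohomology R a D d' j) \<longleftrightarrow> exact_at R K (\<lambda>i n. C i) d Y (int j) n"
proof -
  interpret injective_comparison R K C d D d' g by fact
  have Yc: "Y \<subseteq> carrier R" using Y(2) ideal.Icarr[OF Y(3)] by blast
  have T: "torsion_part R a (D j) = tors R (D j) Y (carrier (D j))" for j
    by (rule module.torsion_part_eq_tors[OF D_module Y(3,1,2,4)])
  have "torsion_cocycles R a D d' j =
      {u \<in> tors R (KD (int j)) Y (XD (int j) n). dD (int j) u = \<zero>\<^bsub>KD (int j + 1)\<^esub>}"
    by (auto simp: torsion_cocycles_def T int_parts_def int_diff_def nat_add_distrib)
  moreover have "torsion_coboundaries R a D d' j = dD (int j - 1) ` tors R (KD (int j - 1)) Y (XD (int j - 1) n)"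
  proof (cases j)
    case 0
    interpret D0: module R "D 0" by (rule D_module)
    have "tors R (D 0) Y {\<zero>\<^bsub>D 0\<^esub>} = {\<zero>\<^bsub>D 0\<^esub>}"
      using D0.tors_zero[OF Yc, of "{\<zero>\<^bsub>D 0\<^esub>}"] by (auto dest: torsD)
    then show ?thesis by (simp add: 0 torsion_coboundaries_def int_parts_def int_diff_def)
  qed (simp add: torsion_coboundaries_def T int_parts_def int_diff_def)
  ultimately have "zero_module (local_cohomology R a D d' j) \<longleftrightarrow> exact_at R KD XD dD Y (int j) n"
    using D.zero_subquotient_exact_iff[of Y "int j" n] Yc by (auto simp: local_cohomology_def)
  then show ?thesis using exact_comparison[OF Y(1) Yc] by simp
qed

context graded_resolution
begin

text \<open>In degree \<open>n\<close> the complex of \<open>R\<^sub>+\<close>-torsion has cohomology only in position \<open>f\<close>. Hence from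
  there on it can replace an injective resolution of that cohomology.\<close>

lemma component_comparison:
  fixes D :: "nat \<Rightarrow> ('a, 'd) module"
  assumes R0: "noetherian_ring (degree_zero_ring R)"
    and exact: "\<And>j. j \<noteq> f \<Longrightarrow> exact_at R KE XE dE degree_one_generators (int j) n"
    and res: "injective_resolution (degree_zero_ring R)
      (local_cohomology_component R (irrelevant_ideal R) E d f n) \<epsilon>' D d'"
  shows "injective_comparison (degree_zero_ring R) (\<lambda>i. KE (i + int f))
    (\<lambda>i. tors R (KE (i + int f)) degree_one_generators (XE (i + int f) n)) (\<lambda>i. dE (i + int f)) D d'
    (\<lambda>x. \<epsilon>' (torsion_coboundaries R (irrelevant_ideal R) E d f +>\<^bsub>E f\<^esub> x))"
proof -
  let ?I = "irrelevant_ideal R" and ?G = degree_one_generators and ?R0 = "degree_zero_ring R"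
  let ?H = "local_cohomology_component R ?I E d f n"
  note I = irrelevant_ideal_generated
  let ?B = "torsion_coboundaries R ?I E d f"
  let ?Z = "torsion_cocycles R ?I E d f \<inter> module_part (E f) n"
  define q where "q x = ?B +>\<^bsub>E f\<^esub> x" for x
  interpret F: module R "E f" by (rule E_module)
  interpret Eg: graded_group "E f" "module_part (E f)" by (rule E_group)
  note B = TB_submodule[OF I, of f] and Z = F.submodule_setD[OF TC_submodule[OF I, of f]]
  interpret B: abelian_subgroup ?B "E f" by (rule F.submodule_set_abelian_subgroup[OF B])
  have R0c: "carrier ?R0 = ring_part R 0" "monoid.mult ?R0 = monoid.mult R" "\<one>\<^bsub>?R0\<^esub> = \<one>" "add ?R0 = add R"
    by (simp_all add: degree_zero_ring_def)
  have P0: "(\<lambda>e. if e = 0 then int_part R 0 else {}) = scalars_in_degree_zero ?R0"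
    by (simp add: fun_eq_iff R0c int_part_def)
  have P0c: "(if e = 0 then int_part R 0 else {}) \<subseteq> carrier ?R0" for e :: int
    by (simp add: R0c int_part_def)
  have H: "carrier ?H = q ` ?Z" "add ?H = set_add (E f)" "smult ?H = (\<lambda>a c. \<Union>x\<in>c. ?B +>\<^bsub>E f\<^esub> (a \<odot>\<^bsub>E f\<^esub> x))"
    "\<zero>\<^bsub>?H\<^esub> = ?B"
    by (simp_all add: local_cohomology_component_def local_cohomology_def subquotient_module_def q_def)
  have modH: "module ?R0 ?H" and D: "injective_module ?R0 (D j)" "is_module_hom ?R0 (D j) (D (Suc j)) (d' j)"
    and \<epsilon>': "is_module_hom ?R0 ?H (D 0) \<epsilon>'" and cores: "exact_coresolution ?H \<epsilon>' D d'" for j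
    using res by (simp_all add: injective_resolution_def)
  have cringR0: "cring ?R0" using modH by (rule module.axioms)
  interpret H: module ?R0 ?H by (rule modH)
  have modD: "module ?R0 (D j)" for j using D(1) by (simp add: injective_module_def)
  interpret D0: module ?R0 "D 0" by (rule modD)
  have G: "?G \<subseteq> (\<Union>e. int_part R e)" using W_hom[OF I] .
  interpret T: graded_complex R "\<lambda>e. if e = 0 then int_part R 0 else {}" KE "\<lambda>i m. tors R (KE i) ?G (XE i n)" dE
    by (rule graded_complex.restrict_torsion[OF E_complex G])
  \<comment> \<open>Position \<open>f\<close> is moved to 0, and the scalars are restricted to the
    ring over which the component and its resolution are modules.\<close>
  have cx: "graded_complex ?R0 (scalars_in_degree_zero ?R0) (\<lambda>i. KE (i + int f))
      (\<lambda>i m. tors R (KE (i + int f)) ?G (XE (i + int f) n)) (\<lambda>i. dE (i + int f))"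
    using graded_complex.restrict_scalars[OF T.shift[of "int f"] cringR0 _ R0c(2-4) P0c, unfolded P0] R0c(1) C_sub
    by simp
  have Z0: "{x \<in> tors R (KE (0 + int f)) ?G (XE (0 + int f) n). dE (0 + int f) x = \<zero>\<^bsub>KE (1 + int f)\<^esub>} = ?Z"
    using homogeneous_cocycles[OF I, of f n] by (simp add: add.commute)
  have Zc: "x \<in> carrier (E f)" if "x \<in> ?Z" for x using that Z(6) by blast
  have qH: "q x \<in> carrier ?H" if "x \<in> ?Z" for x using that by (simp only: H imageI)
  have \<epsilon>'_zero: "\<epsilon>' h = \<zero>\<^bsub>D 0\<^esub> \<longleftrightarrow> h = ?B" if h: "h \<in> carrier ?H" for h
  proof -
    have 0: "\<epsilon>' ?B = \<zero>\<^bsub>D 0\<^esub>"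
    proof -
      have "\<epsilon>' (\<zero>\<^bsub>?R0\<^esub> \<odot>\<^bsub>?H\<^esub> \<zero>\<^bsub>?H\<^esub>) = \<zero>\<^bsub>?R0\<^esub> \<odot>\<^bsub>D 0\<^esub> \<epsilon>' \<zero>\<^bsub>?H\<^esub>" "\<epsilon>' \<zero>\<^bsub>?H\<^esub> \<in> carrier (D 0)"
        using \<epsilon>' H.M.zero_closed cring.cring_simprules(2)[OF cringR0] unfolding is_module_hom_def by blast+
      then show ?thesis using H.smult_l_null[OF H.M.zero_closed] D0.smult_l_null by (simp add: H(4))
    qed
    have "inj_on \<epsilon>' (carrier ?H)" "?B \<in> carrier ?H"
      using cores H.M.zero_closed by (simp_all only: exact_coresolution_def H(4))
    then show ?thesis using 0 h by (metis inj_onD)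
  qed
  show ?thesis
  proof (intro injective_comparison.intro injective_comparison_axioms.intro cx R0 D, unfold Z0 q_def[symmetric])
    show "d' j ` carrier (D j) = {x \<in> carrier (D (Suc j)). d' (Suc j) x = \<zero>\<^bsub>D (Suc (Suc j))\<^esub>}" for j
      using cores by (simp add: exact_coresolution_def)
    fix i m :: int assume "i \<noteq> 0"
    have ex: "exact_at R KE XE dE ?G (i + int f) n"
    proof (cases "i + int f < 0")
      case True
      then show ?thesis by (rule exact_negative)
    next
      case False
      then show ?thesis using exact[of "nat (i + int f)"] \<open>i \<noteq> 0\<close> by simp
    qed
    have eq: "i - 1 + int f = i + int f - 1" "i + 1 + int f = i + int f + 1" by simp_all
    show "exact_at ?R0 (\<lambda>i. KE (i + int f)) (\<lambda>i m. tors R (KE (i + int f)) ?G (XE (i + int f) n))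
        (\<lambda>i. dE (i + int f)) {} i m"
      using ex unfolding exact_at_def tors_empty eq .
  next
    have lin: "linear_map_on ?R0 (E f) (D 0) ?Z (\<lambda>x. \<epsilon>' (q x))"
      unfolding linear_map_on_def
    proof (intro conjI ballI)
      show "\<epsilon>' (q x) \<in> carrier (D 0)" if "x \<in> ?Z" for x
        using qH[OF that] \<epsilon>' by (auto simp: is_module_hom_def)
      show "\<epsilon>' (q (x \<oplus>\<^bsub>E f\<^esub> y)) = \<epsilon>' (q x) \<oplus>\<^bsub>D 0\<^esub> \<epsilon>' (q y)" if xy: "x \<in> ?Z" "y \<in> ?Z" for x y
      proof -
        have "\<epsilon>' (q x \<oplus>\<^bsub>?H\<^esub> q y) = \<epsilon>' (q x) \<oplus>\<^bsub>D 0\<^esub> \<epsilon>' (q y)"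
          using \<epsilon>' qH[OF xy(1)] qH[OF xy(2)] by (simp add: is_module_hom_def)
        moreover have "q x \<oplus>\<^bsub>?H\<^esub> q y = q (x \<oplus>\<^bsub>E f\<^esub> y)"
          unfolding H(2) q_def by (rule B.a_rcos_sum[OF Zc[OF xy(1)] Zc[OF xy(2)]])
        ultimately show ?thesis by simp
      qed
      show "\<epsilon>' (q (r \<odot>\<^bsub>E f\<^esub> x)) = r \<odot>\<^bsub>D 0\<^esub> \<epsilon>' (q x)" if r: "r \<in> carrier ?R0" and x: "x \<in> ?Z" for r x
      proof -
        have "r \<in> carrier R" using r R0c C_carrier by simp
        then have "q (r \<odot>\<^bsub>E f\<^esub> x) = r \<odot>\<^bsub>?H\<^esub> q x"
          unfolding H(3) q_def using F.coset_smult[OF B _ Zc[OF x]] by simp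
        then show ?thesis using \<epsilon>' qH[OF x] r by (simp add: is_module_hom_def)
      qed
    qed
    then show "linear_map_on ?R0 (KE (0 + int f)) (D 0) ?Z (\<lambda>x. \<epsilon>' (q x))" by simp
    have "(\<lambda>x. \<epsilon>' (q x)) ` ?Z = \<epsilon>' ` carrier ?H" by (simp only: H(1) image_image)
    then show "(\<lambda>x. \<epsilon>' (q x)) ` ?Z = {x \<in> carrier (D 0). d' 0 x = \<zero>\<^bsub>D 1\<^esub>}"
      using cores by (simp add: exact_coresolution_def)
    fix x assume "x \<in> tors R (KE (0 + int f)) ?G (XE (0 + int f) n)" "dE (0 + int f) x = \<zero>\<^bsub>KE (1 + int f)\<^esub>"
    then have x: "x \<in> ?Z" using Z0 by blast
    have "\<epsilon>' (q x) = \<zero>\<^bsub>D 0\<^esub> \<longleftrightarrow> x \<in> ?B"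
      unfolding \<epsilon>'_zero[OF qH[OF x]] unfolding q_def by (rule F.coset_eq_zero_iff[OF B Zc[OF x]])
    then show "\<epsilon>' (q x) = \<zero>\<^bsub>D 0\<^esub> \<longleftrightarrow>
        x \<in> dE (- 1 + int f) ` tors R (KE (- 1 + int f)) ?G (XE (- 1 + int f) n)"
      using homogeneous_boundary_iff[OF I, of x f n] x by simp
  qed
qed

text \<open>By \<open>tors_tors\<close>, torsion by \<open>Y\<close> inside the R_+-torsion is
  torsion by all generators of the sum ideal. Positions below \<open>f\<close> correspond to
  negative positions of \<open>D\<close>, where that complex is zero; this is the second
  claim.\<close>

lemma component_cohomology:
  fixes D :: "nat \<Rightarrow> ('a, 'd) module"
  assumes R0: "noetherian_ring (degree_zero_ring R)" and a0: "ideal a0 (degree_zero_ring R)"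
    and Y: "finite Y" "Y \<subseteq> a0" "\<And>J. ideal J (degree_zero_ring R) \<Longrightarrow> Y \<subseteq> J \<Longrightarrow> a0 \<subseteq> J"
    and exact: "\<And>j. j \<noteq> f \<Longrightarrow> exact_at R KE XE dE degree_one_generators (int j) n"
    and res: "injective_resolution (degree_zero_ring R)
      (local_cohomology_component R (irrelevant_ideal R) E d f n) \<epsilon>' D d'"
  shows "zero_module (local_cohomology (degree_zero_ring R) a0 D d' j) \<longleftrightarrow>
      exact_at R KE XE dE (degree_one_generators \<union> Y) (int (f + j)) n" (is ?zero)
    and "j < f \<Longrightarrow> exact_at R KE XE dE (degree_one_generators \<union> Y) (int j) n"
proof -
  let ?R0 = "degree_zero_ring R" and ?G = degree_one_generators
  let ?K = "\<lambda>i. KE (i + int f)" and ?d = "\<lambda>i. dE (i + int f)"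
  let ?C = "\<lambda>i. tors R (KE (i + int f)) ?G (XE (i + int f) n)"
  note comparison = component_comparison[OF R0 exact res]
  interpret injective_comparison ?R0 ?K ?C ?d D d'
    "\<lambda>x. \<epsilon>' (torsion_coboundaries R (irrelevant_ideal R) E d f +>\<^bsub>E f\<^esub> x)"
    by (rule comparison)
  have translate: "exact_at ?R0 ?K (\<lambda>i n. ?C i) ?d Y i n \<longleftrightarrow> exact_at R KE XE dE (?G \<union> Y) (i + int f) n" for i
  proof -
    have eq: "i - 1 + int f = i + int f - 1" "i + 1 + int f = i + int f + 1" by simp_all
    show ?thesis unfolding exact_at_def tors_degree_zero_ring tors_tors eq ..
  qed
  show ?zero
    using zero_local_cohomology_iff_exact[OF comparison Y(1,2) a0 Y(3), of j n] translate[of "int j"]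
    by (simp add: add.commute)
  assume j: "j < f"
  have "exact_at ?R0 KD XD dD Y (int j - int f) n"
    using j D_zero by (auto simp: exact_at_def int_parts_def int_diff_def dest: torsD)
  then have "exact_at ?R0 ?K (\<lambda>i n. ?C i) ?d Y (int j - int f) n"
    using exact_comparison[OF Y(1)] Y(2) ideal.Icarr[OF a0] by blast
  then show "exact_at R KE XE dE (?G \<union> Y) (int j) n" using translate by simp
qed

end

theorem theorem2p3:
  fixes R :: "'a graded_ring"
    and R0 :: "'a graded_ring"
    and M :: "('a, 'm) graded_module"
    and E :: "nat \<Rightarrow> ('a, 'e) graded_module"
    and m0 a0 Rplus \<aa> :: "'a set"
    and f :: nat
  defines "R0 \<equiv> degree_zero_ring R"
    and "Rplus \<equiv> irrelevant_ideal R"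
    and "\<aa> \<equiv> (Idl\<^bsub>R\<^esub> a0) <+>\<^bsub>R\<^esub> Rplus"
  assumes "is_graded_ring R" and "noetherian_ring R"
    and "noetherian_ring R0" and "local_ring R0 m0"
    and "finitely_generated_in_degree_one R"
    and "ideal a0 R0" and "a0 \<noteq> carrier R0"
    and "is_graded_module R M" and "finitely_generated_module R M" and "\<not> zero_module M"
    and "graded_injective_resolution R M \<epsilon> E d"
    and "relative_finiteness_dimension R \<aa> Rplus E d < \<infinity>"
    and "finiteness_dimension R Rplus E d = ereal (real f)"
    and "cohomological_dimension R Rplus E d = ereal (real f)"
  shows "\<exists>n0::int. \<forall>n\<le>n0. \<forall>\<epsilon>' (D :: nat \<Rightarrow> ('a, 'd) module) d'.
           injective_resolution R0 (local_cohomology_component R Rplus E d f n) \<epsilon>' D d' \<longrightarrow>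
           grade R0 a0 D d' = relative_finiteness_dimension R \<aa> Rplus E d - ereal (real f)"
proof -
  interpret noetherian_graded_ring R
    by (intro noetherian_graded_ring.intro graded_ring_locale.intro noetherian_graded_ring_axioms.intro) fact+
  interpret graded_resolution R M \<epsilon> E d
    by (intro graded_resolution.intro graded_resolution_axioms.intro noetherian_graded_ring_axioms) fact+
  let ?G = degree_one_generators
  have R0: "noetherian_ring (degree_zero_ring R)" and a0: "ideal a0 (degree_zero_ring R)"
    using \<open>noetherian_ring R0\<close> \<open>ideal a0 R0\<close> by (simp_all add: R0_def)
  obtain Y where Y: "finite Y" "Y \<subseteq> ring_part R 0" "Y \<subseteq> a0"
    "\<And>J. ideal J (degree_zero_ring R) \<Longrightarrow> Y \<subseteq> J \<Longrightarrow> a0 \<subseteq> J"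
    and I: "homogeneously_generated \<aa> (?G \<union> Y)"
    by (rule sum_ideal_generated[OF R0 a0]) (simp add: \<aa>_def Rplus_def)
  have YP: "Y \<subseteq> int_part R 0" using Y(2) by (simp add: int_part_def)
  note G = irrelevant_ideal_generated
  \<comment> \<open>The index set of the infimum. It is nonempty because the infimum is finite, so
    its least element \<open>t\<close> is the relative finiteness dimension.\<close>
  define N where "N = {i. \<not> Rplus \<subseteq> radical_of R (annihilator R (local_cohomology R \<aa> E d i))}"
  define t where "t = (LEAST i. i \<in> N)"
  have rel: "relative_finiteness_dimension R \<aa> Rplus E d = (INF i\<in>N. ereal (real i))"
    by (simp add: relative_finiteness_dimension_def N_def)
  have "N \<noteq> {}" using \<open>relative_finiteness_dimension R \<aa> Rplus E d < \<infinity>\<close> unfolding rel by (auto simp: top_ereal_def)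
  then have tN: "t \<in> N" and tmin: "\<And>j. j < t \<Longrightarrow> j \<notin> N"
    unfolding t_def by (auto intro: LeastI dest: not_less_Least)
  have INF_least: "(INF i\<in>S. ereal (real i)) = ereal (real s)" if "s \<in> S" "\<And>j. j \<in> S \<Longrightarrow> s \<le> j" for S s
    using that by (intro antisym INF_lower INF_greatest) auto
  have rel_t: "relative_finiteness_dimension R \<aa> Rplus E d = ereal (real t)"
    unfolding rel using tN tmin by (intro INF_least) (auto simp: not_less[symmetric])
  obtain m1 where m1: "\<And>n j. n \<le> m1 \<Longrightarrow> j < t \<Longrightarrow> exact_at R KE XE dE (?G \<union> Y) (int j) n"
    "\<And>n. n \<le> m1 \<Longrightarrow> \<not> exact_at R KE XE dE (?G \<union> Y) (int t) n"
    using first_nonvanishing_stable[OF I Y(1) YP, of t] tN tmin by (auto simp: N_def Rplus_def)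
  \<comment> \<open>Above \<open>f\<close> the cohomology is zero, hence zero in every degree
    \<open>n\<close>. Below \<open>f\<close> it is only finitely generated and vanishes for small
    \<open>n\<close>, with a bound that depends on the position.\<close>
  have above: "exact_at R KE XE dE ?G (int j) n" if "j > f" for j n
  proof -
    have "zero_module (local_cohomology R Rplus E d j)"
    proof (rule ccontr)
      assume "\<not> zero_module (local_cohomology R Rplus E d j)"
      then have "ereal (real j) \<le> cohomological_dimension R Rplus E d"
        unfolding cohomological_dimension_def by (intro SUP_upper) simp
      then show False using that \<open>cohomological_dimension R Rplus E d = ereal (real f)\<close> by simp
    qed
    then show ?thesis
      unfolding exact_iff[OF G] Rplus_def zero_local_cohomology_iff[OF G] by blast
  qed
  have "\<exists>m. \<forall>n\<le>m. exact_at R KE XE dE ?G (int j) n" if "j < f" for j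
  proof -
    have "finitely_generated_module R (local_cohomology R Rplus E d j)"
    proof (rule ccontr)
      assume "\<not> finitely_generated_module R (local_cohomology R Rplus E d j)"
      then have "finiteness_dimension R Rplus E d \<le> ereal (real j)"
        unfolding finiteness_dimension_def by (intro INF_lower) simp
      then show False using that \<open>finiteness_dimension R Rplus E d = ereal (real f)\<close> by simp
    qed
    then show ?thesis
      using finitely_generated_exact_below[OF G] unfolding Rplus_def exact_below_some_def by blast
  qed
  then obtain b where b: "\<And>j n. j < f \<Longrightarrow> n \<le> b j \<Longrightarrow> exact_at R KE XE dE ?G (int j) n" by metis
  \<comment> \<open>Only finitely many positions lie below \<open>f\<close>, so their bounds have a
    minimum.\<close>
  define n0 where "n0 = Min (insert m1 (b ` {..<f}))"
  have n0: "n0 \<le> m1" "\<And>j. j < f \<Longrightarrow> n0 \<le> b j" by (auto simp: n0_def)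
  have "grade R0 a0 D d' = relative_finiteness_dimension R \<aa> Rplus E d - ereal (real f)"
    if n: "n \<le> n0" and res: "injective_resolution R0 (local_cohomology_component R Rplus E d f n) \<epsilon>' D d'"
    for n \<epsilon>' d' and D :: "nat \<Rightarrow> ('a, 'd) module"
  proof -
    have exact: "exact_at R KE XE dE ?G (int j) n" if "j \<noteq> f" for j
    proof (cases "j < f")
      case True
      then show ?thesis using b[OF True] n0(2)[OF True] n by simp
    next
      case False
      then show ?thesis using above that by simp
    qed
    note cmp = component_cohomology[OF R0 a0 Y(1,3,4) exact res[unfolded R0_def Rplus_def], folded R0_def]
    have n': "n \<le> m1" using n n0(1) by simp
    \<comment> \<open>If \<open>t < f\<close>, the second part of the comparison would give
      exactness in position \<open>t\<close>, against the choice of \<open>m1\<close>. Hence the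
      natural number \<open>t - f\<close> is the true difference.\<close>
    have "f \<le> t" using cmp(2)[of t] m1(2)[OF n'] by (simp only: not_less[symmetric]) blast
    have "grade R0 a0 D d' = ereal (real (t - f))"
      unfolding grade_def
    proof (rule INF_least)
      show "t - f \<in> {i. \<not> zero_module (local_cohomology R0 a0 D d' i)}"
        using cmp(1)[of "t - f"] m1(2)[OF n'] \<open>f \<le> t\<close> by simp
      show "t - f \<le> j" if j: "j \<in> {i. \<not> zero_module (local_cohomology R0 a0 D d' i)}" for j
      proof (rule ccontr)
        assume "\<not> t - f \<le> j"
        then have "exact_at R KE XE dE (?G \<union> Y) (int (f + j)) n" by (intro m1(1)[OF n']) simp
        then show False using j cmp(1)[of j] by simp
      qed
    qed
    then show ?thesis using \<open>f \<le> t\<close> by (simp add: rel_t of_nat_diff)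
  qed
  then show ?thesis by blast
qed

end
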